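(* Let $\mathfrak g$ be a simply laced semisimple Lie algebra and let $\sigma$ be an admissible diagram automorphism of $\mathfrak g$ of order $2$. Then for any reduced decompositions $\mathbf i,\mathbf i'$ of the longest element $w_\circ$ of $W({\mathfrak g^\sigma}^\vee)$, the subalgebras of $U_q^+(\mathfrak g)$ generated by the images of $\iota_{\mathbf i}$ and $\iota_{\mathbf i'}$ are isomorphic.
   Context: Let $A=(a_{ij})_{i,j\in I}$ be the Cartan matrix of $\mathfrak g$. A bijection $\sigma:I\to I$ is a diagram automorphism if $a_{\sigma(i)\sigma(j)}=a_{ij}$; it is admissible if $a_{i,\sigma^k(i)}=0$ whenever $\sigma^k(i)\ne i$. $I/\sigma$ indexes the $\sigma$-orbits $\mathcal O_r$. $U_q(\mathfrak g)$ over $\mathbb C(q)$ has generators $E_i,F_i,K_i^{\pm1}$ and the standard relations with $q_i=q^{d_i}$ ($[E_i,F_j]=\delta_{ij}\frac{K_i-K_i^{-1}}{q_i-q_i^{-1}}$, $K_iE_jK_i^{-1}=q_i^{a_{ij}}E_j$, $K_iF_jK_i^{-1}=q_i^{-a_{ij}}F_j$, quantum Serre); for $\mathfrak g$ simply laced $d_i=1$. $U_q^+$ is the subalgebra generated by the $E_i$; $\sigma$ acts by $E_i\mapsto E_{\sigma(i)}$. $U_q({\mathfrak g^\sigma}^\vee)$ is defined with index set $I/\sigma$, symmetrizers $d_r=|\mathcal O_r|$ and Cartan matrix $a_{rs}=|\mathcal O_r|^{-1}\sum_{i\in\mathcal O_r,j\in\mathcal O_s}a_{ij}$. For any semisimple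 Lie algebra, the braid group acts on $U_q$ by Lusztig's automorphisms: $T_i(K_j^{\pm1})=K_j^{\pm1}K_i^{\mp a_{ij}}$, $T_i(E_i)=-K_i^{-1}F_i$, $T_i(F_i)=-E_iK_i$, and for $i\ne j$, $T_i(E_j)=\sum_{s+r=-a_{ij}}(-1)^rq_i^{-r}E_i^{(r)}E_jE_i^{(s)}$, $T_i(F_j)=\sum_{s+r=-a_{ij}}(-1)^rq_i^{r}F_i^{(s)}F_jF_i^{(r)}$, with $Y_i^{(k)}=Y_i^k/[k]_{q_i}!$. For a reduced word $\mathbf i=(r_1,\dots,r_m)$ of $w_\circ\in W({\mathfrak g^\sigma}^\vee)$ put $X_k=c_k^{-1}T_{r_1}\cdots T_{r_{k-1}}(E_{r_k})\in U_q^+({\mathfrak g^\sigma}^\vee)$, where $c_k=\gamma(s_{r_1}\cdots s_{r_{k-1}}(\alpha_{r_k})-\alpha_{r_k})$ and $\gamma:Q\to\mathbb C(q)^\times$ is the group homomorphism on the root lattice with $\gamma(\alpha_r)=q_r-q_r^{-1}$; the monomials $X_1^{a_1}\cdots X_m^{a_m}$ form a basis of $U_q^+({\mathfrak g^\sigma}^\vee)$. In $U_q^+(\mathfrak g)$ put $\hat s_r=\prod_{i\in\mathcal O_r}s_i$, $\hat T_r=\prod_{i\in\mathcal O_r}T_i$, $\hat E_r=\prod_{i\in\mathcal O_r}E_i$ and $\hat X_k=\hat c_k^{-1}\hat T_{r_1}\cdots\hat T_{r_{k-1}}(\hat E_{r_k})$, $\hat c_k=\prod_{i\in\mathcal O_{r_k}}\gamma(\hat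 s_{r_1}\cdots\hat s_{r_{k-1}}(\alpha_i)-\alpha_i)$ (with $\gamma(\alpha_i)=q-q^{-1}$ for $i\in I$). The $\mathbf i$-th quantum folding $\iota_{\mathbf i}:U_q^+({\mathfrak g^\sigma}^\vee)\hookrightarrow U_q^+(\mathfrak g)^\sigma\subset U_q^+(\mathfrak g)$ is the injective $\mathbb C(q)$-linear map with $\iota_{\mathbf i}(X_1^{a_1}\cdots X_m^{a_m})=\hat X_1^{a_1}\cdots\hat X_m^{a_m}$. *)

theory Defs
  imports
    "HOL-Algebra.Generated_Rings"
    "HOL-Combinatorics.Orbits"
    "HOL-Library.Poly_Mapping"
    "HOL-Computational_Algebra.Polynomial"
    "HOL-Computational_Algebra.Fraction_Field"
begin

section \<open>The base field\<close>

type_synonym qfield = "complex poly fract"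

definition qvar :: qfield where
  "qvar = Fract [:0, 1:] 1"

definition qint :: "qfield \<Rightarrow> nat \<Rightarrow> qfield" where
  "qint v k = (v ^ k - inverse v ^ k) / (v - inverse v)"

definition qfact :: "qfield \<Rightarrow> nat \<Rightarrow> qfield" where
  "qfact v n = (\<Prod>k = 1..n. qint v k)"


section \<open>Cartan data, diagram automorphisms and folding\<close>

record 'i cartan_datum =
  index :: "'i set"
  cartan :: "'i \<Rightarrow> 'i \<Rightarrow> int"
  symm :: "'i \<Rightarrow> nat"

definition qi :: "'i cartan_datum \<Rightarrow> 'i \<Rightarrow> qfield" where
  "qi C i = qvar ^ symm C i"

text \<open>By Serre's theorem, the matrices described here are exactly the Cartan matrices of
  finite-dimensional complex semisimple Lie algebras.\<close>

definition semisimple_cartan_matrix :: "'i set \<Rightarrow> ('i \<Rightarrow> 'i \<Rightarrow> int) \<Rightarrow> bool" where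
  "semisimple_cartan_matrix I a \<longleftrightarrow>
     finite I \<and>
     (\<forall>i\<in>I. a i i = 2) \<and>
     (\<forall>i\<in>I. \<forall>j\<in>I. i \<noteq> j \<longrightarrow> a i j \<le> 0) \<and>
     (\<forall>i\<in>I. \<forall>j\<in>I. a i j = 0 \<longrightarrow> a j i = 0) \<and>
     (\<exists>d :: 'i \<Rightarrow> nat.
        (\<forall>i\<in>I. 0 < d i) \<and>
        (\<forall>i\<in>I. \<forall>j\<in>I. int (d i) * a i j = int (d j) * a j i) \<and>
        (\<forall>x :: 'i \<Rightarrow> real. (\<exists>i\<in>I. x i \<noteq> 0) \<longrightarrow>
            0 < (\<Sum>i\<in>I. \<Sum>j\<in>I. real (d i) * of_int (a i j) * x i * x j)))"

definition simply_laced :: "'i set \<Rightarrow> ('i \<Rightarrow> 'i \<Rightarrow> int) \<Rightarrow> bool" where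
  "simply_laced I a \<longleftrightarrow> (\<forall>i\<in>I. \<forall>j\<in>I. i \<noteq> j \<longrightarrow> a i j \<in> {0, - 1})"

definition simply_laced_datum :: "'i set \<Rightarrow> ('i \<Rightarrow> 'i \<Rightarrow> int) \<Rightarrow> 'i cartan_datum" where
  "simply_laced_datum I a = \<lparr>index = I, cartan = a, symm = (\<lambda>_. 1)\<rparr>"

definition diagram_automorphism :: "'i set \<Rightarrow> ('i \<Rightarrow> 'i \<Rightarrow> int) \<Rightarrow> ('i \<Rightarrow> 'i) \<Rightarrow> bool" where
  "diagram_automorphism I a \<sigma> \<longleftrightarrow>
     bij_betw \<sigma> I I \<and> (\<forall>i\<in>I. \<forall>j\<in>I. a (\<sigma> i) (\<sigma> j) = a i j)"

definition admissible_automorphism :: "'i set \<Rightarrow> ('i \<Rightarrow> 'i \<Rightarrow> int) \<Rightarrow> ('i \<Rightarrow> 'i) \<Rightarrow> bool" where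
  "admissible_automorphism I a \<sigma> \<longleftrightarrow>
     (\<forall>i\<in>I. \<forall>k. (\<sigma> ^^ k) i \<noteq> i \<longrightarrow> a i ((\<sigma> ^^ k) i) = 0)"

definition has_order_on :: "'i set \<Rightarrow> ('i \<Rightarrow> 'i) \<Rightarrow> nat \<Rightarrow> bool" where
  "has_order_on I \<sigma> n \<longleftrightarrow>
     0 < n \<and> (\<forall>i\<in>I. (\<sigma> ^^ n) i = i) \<and>
     (\<forall>m. 0 < m \<and> m < n \<longrightarrow> (\<exists>i\<in>I. (\<sigma> ^^ m) i \<noteq> i))"

text \<open>The index set of the folded datum is the set of \<open>\<sigma>\<close>-orbits, an orbit being the set of
  its points. For a diagram automorphism the inner sum does not depend on \<open>i\<close>, so the integer
  division below is exact.\<close>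

definition folded_datum ::
  "'i set \<Rightarrow> ('i \<Rightarrow> 'i \<Rightarrow> int) \<Rightarrow> ('i \<Rightarrow> 'i) \<Rightarrow> 'i set cartan_datum" where
  "folded_datum I a \<sigma> =
     \<lparr>index = orbit \<sigma> ` I,
      cartan = (\<lambda>r s. (\<Sum>i\<in>r. \<Sum>j\<in>s. a i j) div int (card r)),
      symm = card\<rparr>"


section \<open>Root lattice and Weyl group\<close>

text \<open>A root lattice element \<open>\<Sum>\<^sub>i v\<^sub>i \<alpha>\<^sub>i\<close> is its coefficient function.
  Coefficients outside the index set are never changed by a reflection, so the Weyl group
  may be realised by maps on all integer-valued functions.\<close>

definition simple_root :: "'i \<Rightarrow> 'i \<Rightarrow> int" where
  "simple_root i = (\<lambda>j. if j = i then 1 else 0)"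

definition reflection :: "'i cartan_datum \<Rightarrow> 'i \<Rightarrow> ('i \<Rightarrow> int) \<Rightarrow> ('i \<Rightarrow> int)" where
  "reflection C i v = (\<lambda>k. v k - (\<Sum>j\<in>index C. cartan C i j * v j) * simple_root i k)"

definition weyl_word :: "'i cartan_datum \<Rightarrow> 'i list \<Rightarrow> ('i \<Rightarrow> int) \<Rightarrow> ('i \<Rightarrow> int)" where
  "weyl_word C rs = foldr (reflection C) rs"

definition weyl_group :: "'i cartan_datum \<Rightarrow> (('i \<Rightarrow> int) \<Rightarrow> ('i \<Rightarrow> int)) set" where
  "weyl_group C = weyl_word C ` lists (index C)"

definition weyl_length :: "'i cartan_datum \<Rightarrow> (('i \<Rightarrow> int) \<Rightarrow> ('i \<Rightarrow> int)) \<Rightarrow> nat" where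
  "weyl_length C w = (LEAST n. \<exists>rs\<in>lists (index C). length rs = n \<and> weyl_word C rs = w)"

definition longest_element :: "'i cartan_datum \<Rightarrow> (('i \<Rightarrow> int) \<Rightarrow> ('i \<Rightarrow> int)) \<Rightarrow> bool" where
  "longest_element C w \<longleftrightarrow>
     w \<in> weyl_group C \<and> (\<forall>v\<in>weyl_group C. weyl_length C v \<le> weyl_length C w)"

definition reduced_decomposition ::
  "'i cartan_datum \<Rightarrow> 'i list \<Rightarrow> (('i \<Rightarrow> int) \<Rightarrow> ('i \<Rightarrow> int)) \<Rightarrow> bool" where
  "reduced_decomposition C rs w \<longleftrightarrow>
     rs \<in> lists (index C) \<and> weyl_word C rs = w \<and> length rs = weyl_length C w"

definition gamma :: "'i cartan_datum \<Rightarrow> ('i \<Rightarrow> int) \<Rightarrow> qfield" where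
  "gamma C v = (\<Prod>i\<in>index C. (qi C i - inverse (qi C i)) powi v i)"


section \<open>Free associative algebras\<close>

datatype 'g word = Word (letters: "'g list")

instantiation word :: (type) monoid_add
begin

definition zero_word :: "'a word" where
  "0 = Word []"

definition plus_word :: "'a word \<Rightarrow> 'a word \<Rightarrow> 'a word" where
  "u + v = Word (letters u @ letters v)"

instance
  by standard (simp_all add: zero_word_def plus_word_def)

end

datatype 'i qgen = Egen 'i | Fgen 'i | Kgen 'i | Kinv 'i

text \<open>Finitely supported functions on words, with the convolution product.\<close>

type_synonym 'i falg = "'i qgen word \<Rightarrow>\<^sub>0 qfield"

definition fconst :: "qfield \<Rightarrow> 'i falg" where
  "fconst c = Poly_Mapping.single 0 c"

definition fgen :: "'i qgen \<Rightarrow> 'i falg" where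
  "fgen g = Poly_Mapping.single (Word [g]) 1"

definition fE :: "'i \<Rightarrow> 'i falg" where "fE i = fgen (Egen i)"
definition fF :: "'i \<Rightarrow> 'i falg" where "fF i = fgen (Fgen i)"
definition fK :: "'i \<Rightarrow> 'i falg" where "fK i = fgen (Kgen i)"
definition fKinv :: "'i \<Rightarrow> 'i falg" where "fKinv i = fgen (Kinv i)"

definition fKpow :: "'i \<Rightarrow> int \<Rightarrow> 'i falg" where
  "fKpow i n = (if 0 \<le> n then fK i ^ nat n else fKinv i ^ nat (- n))"

definition qgens :: "'i cartan_datum \<Rightarrow> 'i qgen set" where
  "qgens C = Egen ` index C \<union> Fgen ` index C \<union> Kgen ` index C \<union> Kinv ` index C"

definition free_alg :: "'i cartan_datum \<Rightarrow> 'i falg ring" where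
  "free_alg C =
     \<lparr>carrier = {x. \<forall>w\<in>Poly_Mapping.keys x. set (letters w) \<subseteq> qgens C},
      monoid.mult = (*), one = 1, zero = 0, add = (+)\<rparr>"

text \<open>The algebra endomorphism determined by the images of the generators.\<close>

definition free_hom :: "('i qgen \<Rightarrow> 'i falg) \<Rightarrow> 'i falg \<Rightarrow> 'i falg" where
  "free_hom f x =
     (\<Sum>w\<in>Poly_Mapping.keys x.
        fconst (Poly_Mapping.lookup x w) * prod_list (map f (letters w)))"

definition divpow :: "'i cartan_datum \<Rightarrow> 'i \<Rightarrow> 'i falg \<Rightarrow> nat \<Rightarrow> 'i falg" where
  "divpow C i y k = fconst (inverse (qfact (qi C i) k)) * y ^ k"


section \<open>The quantized enveloping algebra\<close>

definition serre :: "'i cartan_datum \<Rightarrow> ('i \<Rightarrow> 'i falg) \<Rightarrow> 'i \<Rightarrow> 'i \<Rightarrow> 'i falg" where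
  "serre C Y i j =
     (let n = nat (1 - cartan C i j) in
        \<Sum>r\<le>n. fconst ((- 1) ^ r) * divpow C i (Y i) r * Y j * divpow C i (Y i) (n - r))"

text \<open>A relation \<open>x = y\<close> is encoded by the element \<open>x - y\<close>.\<close>

definition uq_relators :: "'i cartan_datum \<Rightarrow> 'i falg set" where
  "uq_relators C =
     {fK i * fKinv i - 1 | i. i \<in> index C} \<union>
     {fKinv i * fK i - 1 | i. i \<in> index C} \<union>
     {fK i * fK j - fK j * fK i | i j. i \<in> index C \<and> j \<in> index C} \<union>
     {fK i * fE j * fKinv i - fconst (qi C i powi cartan C i j) * fE j
        | i j. i \<in> index C \<and> j \<in> index C} \<union>
     {fK i * fF j * fKinv i - fconst (qi C i powi (- cartan C i j)) * fF j
        | i j. i \<in> index C \<and> j \<in> index C} \<union>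
     {fE i * fF j - fF j * fE i
        - (if i = j then fconst (inverse (qi C i - inverse (qi C i))) * (fK i - fKinv i) else 0)
        | i j. i \<in> index C \<and> j \<in> index C} \<union>
     {serre C fE i j | i j. i \<in> index C \<and> j \<in> index C \<and> i \<noteq> j} \<union>
     {serre C fF i j | i j. i \<in> index C \<and> j \<in> index C \<and> i \<noteq> j}"

definition uq_ideal :: "'i cartan_datum \<Rightarrow> 'i falg set" where
  "uq_ideal C = genideal (free_alg C) (uq_relators C)"

definition uq :: "'i cartan_datum \<Rightarrow> 'i falg set ring" where
  "uq C = free_alg C Quot uq_ideal C"

definition uq_proj :: "'i cartan_datum \<Rightarrow> 'i falg \<Rightarrow> 'i falg set" where
  "uq_proj C x = uq_ideal C +>\<^bsub>free_alg C\<^esub> x"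

definition uq_E :: "'i cartan_datum \<Rightarrow> 'i \<Rightarrow> 'i falg set" where
  "uq_E C i = uq_proj C (fE i)"

definition uq_scale :: "'i cartan_datum \<Rightarrow> qfield \<Rightarrow> 'i falg set \<Rightarrow> 'i falg set" where
  "uq_scale C c x = uq_proj C (fconst c) \<otimes>\<^bsub>uq C\<^esub> x"

definition uq_subalgebra :: "'i cartan_datum \<Rightarrow> 'i falg set set \<Rightarrow> 'i falg set set" where
  "uq_subalgebra C S = generate_ring (uq C) (range (\<lambda>c. uq_proj C (fconst c)) \<union> S)"

definition uq_plus :: "'i cartan_datum \<Rightarrow> 'i falg set set" where
  "uq_plus C = uq_subalgebra C (uq_E C ` index C)"

definition uq_linear_on ::
  "'i cartan_datum \<Rightarrow> 'j cartan_datum \<Rightarrow> 'i falg set set \<Rightarrow> ('i falg set \<Rightarrow> 'j falg set) \<Rightarrow> bool"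
  where
  "uq_linear_on C D S f \<longleftrightarrow>
     (\<forall>x\<in>S. \<forall>y\<in>S. f (x \<oplus>\<^bsub>uq C\<^esub> y) = f x \<oplus>\<^bsub>uq D\<^esub> f y) \<and>
     (\<forall>c. \<forall>x\<in>S. f (uq_scale C c x) = uq_scale D c (f x))"

text \<open>Isomorphism, as \<open>\<complex>(q)\<close>-algebras, of two subalgebras of \<open>uq C\<close>.\<close>

definition uq_subalgebras_iso :: "'i cartan_datum \<Rightarrow> 'i falg set set \<Rightarrow> 'i falg set set \<Rightarrow> bool" where
  "uq_subalgebras_iso C A B \<longleftrightarrow>
     (\<exists>h \<in> ring_iso ((uq C)\<lparr>carrier := A\<rparr>) ((uq C)\<lparr>carrier := B\<rparr>). uq_linear_on C C A h)"


section \<open>The braid group action\<close>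

definition braid_gen :: "'i cartan_datum \<Rightarrow> 'i \<Rightarrow> 'i qgen \<Rightarrow> 'i falg" where
  "braid_gen C i g =
     (case g of
        Kgen j \<Rightarrow> fK j * fKpow i (- cartan C i j)
      | Kinv j \<Rightarrow> fKinv j * fKpow i (cartan C i j)
      | Egen j \<Rightarrow>
          (if j = i then - (fKinv i * fF i)
           else (let n = nat (- cartan C i j) in
                  \<Sum>r\<le>n. fconst ((- 1) ^ r * inverse (qi C i) ^ r)
                         * divpow C i (fE i) r * fE j * divpow C i (fE i) (n - r)))
      | Fgen j \<Rightarrow>
          (if j = i then - (fE i * fK i)
           else (let n = nat (- cartan C i j) in
                  \<Sum>r\<le>n. fconst ((- 1) ^ r * qi C i ^ r)
                         * divpow C i (fF i) (n - r) * fF j * divpow C i (fF i) r)))"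

text \<open>The map induced on the quotient by the endomorphism of the free algebra; by Lusztig's
  theorem that endomorphism preserves \<open>uq_ideal C\<close>, so the image below is a singleton for
  every coset \<open>X\<close>.\<close>

definition braid_T :: "'i cartan_datum \<Rightarrow> 'i \<Rightarrow> 'i falg set \<Rightarrow> 'i falg set" where
  "braid_T C i X = the_elem ((\<lambda>x. uq_proj C (free_hom (braid_gen C i) x)) ` X)"


section \<open>Quantum folding\<close>

definition ordered_monomial :: "('a, 'm) ring_scheme \<Rightarrow> 'a list \<Rightarrow> nat list \<Rightarrow> 'a" where
  "ordered_monomial R xs as =
     foldr (\<lambda>(x, n) y. x [^]\<^bsub>R\<^esub> n \<otimes>\<^bsub>R\<^esub> y) (zip xs as) \<one>\<^bsub>R\<^esub>"

definition pbw_gen :: "'i cartan_datum \<Rightarrow> 'i list \<Rightarrow> nat \<Rightarrow> 'i falg set" where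
  "pbw_gen C rs k =
     uq_scale C
       (inverse (gamma C (weyl_word C (take k rs) (simple_root (rs ! k)) - simple_root (rs ! k))))
       (foldr (braid_T C) (take k rs) (uq_E C (rs ! k)))"

text \<open>The products over an orbit occurring below have pairwise commuting factors when the
  automorphism is admissible, so the chosen enumeration of the orbit is immaterial.\<close>

definition orbit_list :: "'i set \<Rightarrow> 'i list" where
  "orbit_list r = (SOME xs. distinct xs \<and> set xs = r)"

definition hat_reflection :: "'i cartan_datum \<Rightarrow> 'i set \<Rightarrow> ('i \<Rightarrow> int) \<Rightarrow> ('i \<Rightarrow> int)" where
  "hat_reflection C r = foldr (reflection C) (orbit_list r)"

definition hat_T :: "'i cartan_datum \<Rightarrow> 'i set \<Rightarrow> 'i falg set \<Rightarrow> 'i falg set" where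
  "hat_T C r = foldr (braid_T C) (orbit_list r)"

definition hat_E :: "'i cartan_datum \<Rightarrow> 'i set \<Rightarrow> 'i falg set" where
  "hat_E C r = foldr (\<lambda>i y. uq_E C i \<otimes>\<^bsub>uq C\<^esub> y) (orbit_list r) \<one>\<^bsub>uq C\<^esub>"

definition hat_pbw_gen :: "'i cartan_datum \<Rightarrow> 'i set list \<Rightarrow> nat \<Rightarrow> 'i falg set" where
  "hat_pbw_gen C rs k =
     uq_scale C
       (inverse (\<Prod>i\<in>rs ! k.
          gamma C (foldr (hat_reflection C) (take k rs) (simple_root i) - simple_root i)))
       (foldr (hat_T C) (take k rs) (hat_E C (rs ! k)))"

text \<open>\<open>D\<close> is the folded datum, \<open>C\<close> the unfolded one. The conditions determine the map since
  the ordered monomials in the \<open>pbw_gen D rs k\<close> form a basis of \<open>uq_plus D\<close> whenever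
  \<open>rs\<close> is a reduced decomposition of the longest element.\<close>

definition quantum_folding ::
  "'i cartan_datum \<Rightarrow> 'i set cartan_datum \<Rightarrow> 'i set list \<Rightarrow> 'i set falg set \<Rightarrow> 'i falg set" where
  "quantum_folding C D rs =
     (THE f. f \<in> uq_plus D \<rightarrow>\<^sub>E uq_plus C \<and> uq_linear_on D C (uq_plus D) f \<and>
        (\<forall>as. length as = length rs \<longrightarrow>
           f (ordered_monomial (uq D) (map (pbw_gen D rs) [0..<length rs]) as) =
           ordered_monomial (uq C) (map (hat_pbw_gen C rs) [0..<length rs]) as))"


section \<open>Well-formedness of the presentation\<close>

lemma ring_free_alg: "ring (free_alg C)"
proof -
  define S where "S = {x :: 'a falg. \<forall>w\<in>Poly_Mapping.keys x. set (letters w) \<subseteq> qgens C}"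
  have free_alg: "free_alg C = \<lparr>carrier = S, monoid.mult = (*), one = 1, zero = 0, add = (+)\<rparr>"
    by (simp add: free_alg_def S_def)
  have add: "x + y \<in> S" if "x \<in> S" "y \<in> S" for x y
    using that Poly_Mapping.keys_add[of x y] unfolding S_def by blast
  have mult: "x * y \<in> S" if "x \<in> S" "y \<in> S" for x y
    unfolding S_def
  proof (intro CollectI ballI)
    fix w assume "w \<in> Poly_Mapping.keys (x * y)"
    then obtain u v where "w = u + v" "u \<in> Poly_Mapping.keys x" "v \<in> Poly_Mapping.keys y"
      using keys_mult[of x y] by blast
    with that show "set (letters w) \<subseteq> qgens C"
      by (auto simp: plus_word_def S_def)
  qed
  have uminus: "- x \<in> S" if "x \<in> S" for x
    using that by (simp add: S_def)
  have zero: "0 \<in> S" and one: "1 \<in> S"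
    by (simp_all add: S_def zero_word_def)
  show ?thesis
  proof (rule ringI)
    show "abelian_group (free_alg C)"
    proof (rule abelian_groupI)
      fix x assume "x \<in> carrier (free_alg C)"
      then show "\<exists>y\<in>carrier (free_alg C). y \<oplus>\<^bsub>free_alg C\<^esub> x = \<zero>\<^bsub>free_alg C\<^esub>"
        by (intro bexI[of _ "- x"]) (simp_all add: free_alg uminus)
    qed (simp_all add: free_alg add zero add_ac)
    show "monoid (free_alg C)"
      by (rule monoidI) (simp_all add: free_alg mult one mult.assoc)
  qed (simp_all add: free_alg distrib_left distrib_right)
qed

lemma uq_relators_subset: "uq_relators C \<subseteq> carrier (free_alg C)"
proof -
  interpret ring "free_alg C" by (rule ring_free_alg)
  let ?R = "carrier (free_alg C)"
  have mult: "x * y \<in> ?R" and add: "x + y \<in> ?R" if "x \<in> ?R" "y \<in> ?R" for x y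
    using m_closed[OF that] a_closed[OF that] by (simp_all add: free_alg_def)
  have uminus: "- x \<in> ?R" if "x \<in> ?R" for x
    using that by (simp add: free_alg_def)
  have diff: "x - y \<in> ?R" if "x \<in> ?R" "y \<in> ?R" for x y
    using add[OF that(1) uminus[OF that(2)]] by simp
  have zero: "0 \<in> ?R" and one: "1 \<in> ?R"
    using zero_closed one_closed by (simp_all add: free_alg_def)
  have const: "fconst c \<in> ?R" for c
    by (auto simp: fconst_def free_alg_def zero_word_def)
  have power: "x ^ k \<in> ?R" if "x \<in> ?R" for x k
    by (induction k) (use that one mult in auto)
  have sum: "(\<Sum>r\<in>S. f r) \<in> ?R" if "\<And>r. r \<in> S \<Longrightarrow> f r \<in> ?R" for S :: "nat set" and f
    using that by (induction S rule: infinite_finite_induct) (auto simp: zero add)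
  have gens: "fE i \<in> ?R" "fF i \<in> ?R" "fK i \<in> ?R" "fKinv i \<in> ?R" if "i \<in> index C" for i
    using that by (auto simp: fE_def fF_def fK_def fKinv_def fgen_def free_alg_def qgens_def)
  have serre: "serre C Y i j \<in> ?R" if "Y i \<in> ?R" "Y j \<in> ?R" for Y i j
    unfolding serre_def Let_def divpow_def
    by (intro sum mult const power that)
  show ?thesis
    unfolding uq_relators_def
    by (auto intro!: diff mult const gens serre one zero)
qed

lemma ideal_uq_ideal: "ideal (uq_ideal C) (free_alg C)"
  unfolding uq_ideal_def
  by (rule ring.genideal_ideal[OF ring_free_alg uq_relators_subset])

lemma ring_uq: "ring (uq C)"
  unfolding uq_def by (rule ideal.quotient_is_ring[OF ideal_uq_ideal])

end

theory Submission
  imports Defs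
begin

text \<open>The two subalgebras are equal. By the PBW theorem for the folded algebra, the image of
  \<open>\<iota>\<^sub>\<i>\<close> is spanned by the ordered monomials in the \<open>X\<^sub>k\<close> with hats, so the subalgebra that it generates is
  generated by the elements obtained from the products of the \<open>E\<^sub>i\<close> over an orbit by applying the
  products of the \<open>T\<^sub>i\<close> over orbits; the scalars in front of them are nonzero and play no role. By
  Matsumoto's theorem two reduced words of the longest element are connected by braid moves. The products of the
  \<open>T\<^sub>i\<close> over orbits satisfy the braid relations of the folded Weyl group, so a braid move changes only the
  generators that it creates, up to a common automorphism. This reduces the claim to two orbits,
  where each of the two generating sets is seen to lie in the algebra generated by the other one.

  The PBW theorem is proved in the form needed here. A straightening of \<open>E\<^sub>i\<close> against the elements
  of \<open>U\<^sup>+\<close> mapped to \<open>U\<^sup>+\<close> by the inverse of \<open>T\<^sub>i\<close> shows that the ordered monomials times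
  \<open>T\<^sub>w U\<^sup>+\<close> span \<open>U\<^sup>+\<close>, where \<open>w\<close> is the longest element. Since \<open>T\<^sub>w\<close> sends the \<open>E\<^sub>j\<close> into the left
  ideal generated by the \<open>F\<^sub>k\<close>, which meets \<open>U\<^sup>+\<close> trivially, the monomials alone span. They are
  independent because the inverse of \<open>T\<^sub>r\<close> turns powers of \<open>E\<^sub>r\<close> into powers of \<open>F\<^sub>r K\<^sub>r\<close>, which
  are independent over \<open>U\<^sup>+\<close> by the triangular decomposition.\<close>

section \<open>Algebras over a field and quantum integers\<close>

text \<open>The decisive pair of orbits is one point joined to two points. Each of the two words of
  length four gives, besides the two products of the \<open>E\<close> over the orbits, two further
  elements. The first ones, \<open>A\<close> and \<open>B\<close>, differ by a polynomial in the
  common elements. The second ones, \<open>P\<close> and \<open>Q\<close>, are products of two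
  commuting root vectors exchanged by the automorphism; twice such a product is a symmetric
  expression and hence a polynomial in the other generators, and 2 is invertible in the base field.
  So the algebras agree although the root vectors differ. Order 2 means that orbits have at most two
  points, so the folded datum has no triple bond. With bonds at most 2, one locale
  \<open>cartan_type\<close> serves both data, and the relations between the \<open>T i\<close>
  become finitely many polynomial identities in at most three of the \<open>E\<close>. They are
  computed in type class rings, where the simplifier can normalise noncommutative polynomials. Where
  three indices would make this too large, multiplicativity of strings replaces the
  computation.\<close>

locale scaled_ring =
  fixes sc :: "'k::field \<Rightarrow> 'r::ring_1 \<Rightarrow> 'r"
  assumes sc_add_right: "sc c (x + y) = sc c x + sc c y"
    and sc_add_left: "sc (c + d) x = sc c x + sc d x"
    and sc_sc [simp]: "sc c (sc d x) = sc (c * d) x"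
    and sc_1 [simp]: "sc 1 x = x"
    and sc_mult_left [simp]: "sc c x * y = sc c (x * y)"
    and sc_mult_right [simp]: "x * sc c y = sc c (x * y)"
begin

lemma sc_0_right [simp]: "sc c 0 = 0"
  using sc_add_right[of c 0 0] by simp

lemma sc_0_left [simp]: "sc 0 x = 0"
  using sc_add_left[of 0 0 x] by simp

lemma sc_minus_right: "sc c (- x) = - sc c x"
  using sc_add_right[of c x "- x"] by (simp add: minus_unique)

lemma sc_minus_left: "sc (- c) x = - sc c x"
  using sc_add_left[of c "- c" x] by (simp add: minus_unique)

lemma sc_diff_right: "sc c (x - y) = sc c x - sc c y"
  using sc_add_right[of c x "- y"] by (simp add: sc_minus_right)

lemma sc_diff_left: "sc (c - d) x = sc c x - sc d x"
  using sc_add_left[of c "- d" x] by (simp add: sc_minus_left)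

lemma sc_sum_right: "sc c (sum f A) = (\<Sum>x\<in>A. sc c (f x))"
  by (induction A rule: infinite_finite_induct) (auto simp: sc_add_right)

lemma sc_cancel:
  assumes "c \<noteq> 0" "sc c x = sc c y" shows "x = y"
proof -
  have "sc (inverse c) (sc c x) = sc (inverse c) (sc c y)" using assms(2) by simp
  thus ?thesis using assms(1) by simp
qed

lemma sc_eq_0_iff: "c \<noteq> 0 ==> sc c x = 0 \<longleftrightarrow> x = 0"
  using sc_cancel[of c x 0] by auto

lemmas sc_distribs = sc_add_right sc_add_left sc_diff_right sc_diff_left sc_minus_right sc_minus_left

end

text \<open>Exchanging \<open>E\<close> and \<open>F\<close> together with \<open>q\<close> and its inverse is an anti-automorphism compatible with the
  \<open>T\<^sub>i\<close>. Interpreting a locale in the opposite ring turns statements about \<open>E\<close> into statements about \<open>F\<close>.\<close>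

typedef 'a opposite = "UNIV :: 'a set" morphisms unop op
  by simp

instantiation opposite :: (ring_1) ring_1
begin
definition "0 = op 0"
definition "1 = op 1"
definition "x + y = op (unop x + unop y)"
definition "x - y = op (unop x - unop y)"
definition "- x = op (- unop x)"
definition "x * y = op (unop y * unop x)"
instance
  by standard
    (simp_all add: zero_opposite_def one_opposite_def plus_opposite_def minus_opposite_def
      uminus_opposite_def times_opposite_def op_inverse unop_inverse op_inject
      mult.assoc distrib_left distrib_right)
end

definition op_scale :: "('k \<Rightarrow> 'r \<Rightarrow> 'r) \<Rightarrow> 'k \<Rightarrow> 'r opposite \<Rightarrow> 'r opposite" where
  "op_scale f c x = op (f c (unop x))"

lemma unop_simps [simp]:
  "unop 0 = 0" "unop 1 = 1" "unop (x + y) = unop x + unop y" "unop (x - y) = unop x - unop y"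
  "unop (- x) = - unop x" "unop (x * y) = unop y * unop x" "unop (op_scale f c z) = f c (unop z)"
  "unop (op w) = w" "op (unop z) = z"
  by (simp_all add: zero_opposite_def one_opposite_def plus_opposite_def minus_opposite_def
      uminus_opposite_def times_opposite_def op_scale_def op_inverse unop_inverse)

lemma op_eq_iff: "x = y \<longleftrightarrow> unop x = unop y"
  by (simp add: unop_inject)

lemma (in scaled_ring) scaled_ring_opposite: "scaled_ring (op_scale sc)"
  by standard (simp_all add: op_eq_iff sc_add_right sc_add_left)

section \<open>Quantum integers at a scalar that is not a root of unity\<close>

definition not_root_of_unity :: "'k::field \<Rightarrow> bool" where
  "not_root_of_unity v \<longleftrightarrow> v \<noteq> 0 \<and> (\<forall>n>0. v ^ n \<noteq> 1)"

definition qnum :: "'k::field \<Rightarrow> nat \<Rightarrow> 'k" where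
  "qnum v k = (v ^ k - inverse v ^ k) / (v - inverse v)"

lemma not_root_of_unity_inverse: "not_root_of_unity v ==> not_root_of_unity (inverse v)"
  by (auto simp: not_root_of_unity_def power_inverse)

lemma not_root_of_unity_power: "not_root_of_unity v ==> n > 0 ==> not_root_of_unity (v ^ n)"
  by (auto simp: not_root_of_unity_def simp flip: power_mult)

lemma pow_neq_inverse:
  assumes "not_root_of_unity v" "k > 0" shows "v ^ k \<noteq> inverse v ^ k"
proof
  assume "v ^ k = inverse v ^ k"
  hence "v ^ k * v ^ k = v ^ k * inverse (v ^ k)" by (simp add: power_inverse)
  also have "\<dots> = 1" using assms by (simp add: not_root_of_unity_def)
  finally have "v ^ (k + k) = 1" by (simp add: power_add)
  with assms show False by (auto simp: not_root_of_unity_def)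
qed

lemma diff_inverse_neq_0: "not_root_of_unity v ==> v - inverse v \<noteq> 0"
  using pow_neq_inverse[of v 1] by simp

lemma qnum_neq_0: "not_root_of_unity v ==> k > 0 ==> qnum v k \<noteq> 0"
  using pow_neq_inverse[of v k] diff_inverse_neq_0[of v] by (simp add: qnum_def)

lemma qnum_0 [simp]: "qnum v 0 = 0"
  by (simp add: qnum_def)

lemma qnum_1: "not_root_of_unity v ==> qnum v (Suc 0) = 1"
  using diff_inverse_neq_0[of v] by (simp add: qnum_def)

lemma qnum_eqI:
  assumes "not_root_of_unity v" and "\<And>u. v * u = 1 ==> v ^ k - u ^ k = x * (v - u)"
  shows "qnum v k = x"
  using assms(2)[of "inverse v"] diff_inverse_neq_0[OF assms(1)] assms(1)
  by (simp add: qnum_def not_root_of_unity_def)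

lemma qnum_2:
  assumes "not_root_of_unity v" shows "qnum v 2 = v + inverse v"
proof (rule qnum_eqI[OF assms])
  fix u assume "v * u = 1"
  hence "inverse v = u" by (rule inverse_unique)
  thus "v ^ 2 - u ^ 2 = (v + inverse v) * (v - u)"
    by (simp add: algebra_simps power2_eq_square)
qed

lemma qnum_3:
  assumes "not_root_of_unity v" shows "qnum v 3 = v ^ 2 + 1 + inverse v ^ 2"
proof (rule qnum_eqI[OF assms])
  fix u assume vu: "v * u = 1"
  hence 1: "inverse v = u" by (rule inverse_unique)
  have 2: "v * (v * u) = v" "u * (u * v) = u"
    using vu by (simp_all add: mult.commute)
  have "(v\<^sup>2 + 1 + u\<^sup>2) * (v - u) = v ^ 3 - v * (v * u) + v - u + u * (u * v) - u ^ 3"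
    by (simp add: algebra_simps power2_eq_square power3_eq_cube)
  thus "v ^ 3 - u ^ 3 = (v\<^sup>2 + 1 + (inverse v)\<^sup>2) * (v - u)"
    by (simp add: 1 2)
qed

text \<open>An asymmetric splitting of the quantum integer. Its two summands are matched in
  \<open>string_mult\<close> with the contributions of the left and of the right factor to one step
  of the product string.\<close>

lemma qnum_add:
  assumes "not_root_of_unity v"
  shows "qnum v (a + b) = v powi int b * qnum v a + v powi (- int a) * qnum v b"
proof -
  have q: "qnum v k * (v - inverse v) = v ^ k - inverse v ^ k" for k
    using diff_inverse_neq_0[OF assms] by (simp add: qnum_def)
  have "(v powi int b * qnum v a + v powi (- int a) * qnum v b) * (v - inverse v)
    = v ^ b * (qnum v a * (v - inverse v)) + inverse v ^ a * (qnum v b * (v - inverse v))"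
    by (simp only: power_int_minus power_int_of_nat power_inverse distrib_right mult.assoc)
  also have "\<dots> = qnum v (a + b) * (v - inverse v)"
    unfolding q by (simp add: power_add algebra_simps)
  finally show ?thesis
    using diff_inverse_neq_0[OF assms] mult_right_cancel by metis
qed

section \<open>Strings\<close>

context scaled_ring
begin

text \<open>\<open>f k\<close> is the \<open>k\<close>-th divided power of the \<open>q\<close>-adjoint action of \<open>E\<close> on \<open>f 0\<close>. When \<open>f 0\<close> has
  weight \<open>- N\<close> and commutes with \<open>F\<close>, the last nonzero term \<open>f N\<close> is the value of Lusztig's
  automorphism at \<open>f 0\<close>; multiplicativity of strings is what makes this useful.\<close>

definition string :: "'k \<Rightarrow> 'r \<Rightarrow> nat \<Rightarrow> (nat \<Rightarrow> 'r) \<Rightarrow> bool" where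
  "string v E N f \<longleftrightarrow>
     (\<forall>k. f k * E = sc (v powi (2 * int k - int N)) (E * f k) + sc (qnum v (Suc k)) (f (Suc k))) \<and>
     (\<forall>k>N. f k = 0)"

text \<open>A q-Leibniz rule: the q-adjoint action of \<open>E\<close> is a twisted derivation, so
  its divided powers act on a product by a sum over \<open>a + b = k\<close>. The ends of the
  product string are the products of the ends, which makes the passage from bottom to top
  multiplicative.\<close>

lemma string_mult:
  assumes v: "not_root_of_unity v" and f: "string v E N f" and g: "string v E M g"
  shows "\<exists>h. string v E (N + M) h \<and> h 0 = f 0 * g 0 \<and> h (N + M) = f N * g M"
proof -
  have v0: "v \<noteq> 0" using v by (simp add: not_root_of_unity_def)
  \<comment> \<open>The exponent is forced by comparing the coefficients of \<open>f a * g b\<close>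
    in \<open>h k * E\<close>. The resulting recursion is \<open>crec\<close>, and
    \<open>qnum_add\<close> shows that this power of \<open>v\<close> solves it.\<close>
  define c where "c a b = v powi (- (int a * (int M - int b)))" for a b :: nat
  define h where "h k = (\<Sum>a\<le>k. sc (c a (k - a)) (f a * g (k - a)))" for k
  have fE: "f k * E = sc (v powi (2 * int k - int N)) (E * f k) + sc (qnum v (Suc k)) (f (Suc k))" for k
    using f by (simp add: string_def)
  have gE: "g k * E = sc (v powi (2 * int k - int M)) (E * g k) + sc (qnum v (Suc k)) (g (Suc k))" for k
    using g by (simp add: string_def)
  have step: "f a * g b * E = sc (v powi (2 * int (a + b) - int (N + M))) (E * (f a * g b))
      + sc (v powi (2 * int b - int M) * qnum v (Suc a)) (f (Suc a) * g b)
      + sc (qnum v (Suc b)) (f a * g (Suc b))" for a b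
  proof -
    have "f a * g b * E = f a * (g b * E)" by (simp add: mult.assoc)
    also have "\<dots> = sc (v powi (2 * int b - int M)) ((f a * E) * g b) + sc (qnum v (Suc b)) (f a * g (Suc b))"
      unfolding gE by (simp add: distrib_left mult.assoc)
    also have "(f a * E) * g b = sc (v powi (2 * int a - int N)) (E * (f a * g b)) + sc (qnum v (Suc a)) (f (Suc a) * g b)"
      unfolding fE by (simp add: distrib_right mult.assoc)
    finally have "f a * g b * E = sc (v powi (2 * int b - int M) * v powi (2 * int a - int N)) (E * (f a * g b))
      + sc (v powi (2 * int b - int M) * qnum v (Suc a)) (f (Suc a) * g b)
      + sc (qnum v (Suc b)) (f a * g (Suc b))"
      by (simp add: sc_add_right)
    moreover have "v powi (2 * int b - int M) * v powi (2 * int a - int N) = v powi (2 * int (a + b) - int (N + M))"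
      using v0 by (subst power_int_add[symmetric]) (auto intro: arg_cong[where f="\<lambda>e. v powi e"])
    ultimately show ?thesis by simp
  qed
  have crec: "qnum v (a + b) * c a b
      = v powi (2 * int b - int M) * qnum v a * c (a - 1) b + qnum v b * c a (b - 1)" for a b
  proof -
    have 1: "c a b * v powi int b * qnum v a = v powi (2 * int b - int M) * qnum v a * c (a - 1) b"
    proof (cases a)
      case (Suc a')
      have "v powi (- (int a * (int M - int b)) + int b) = v powi (2 * int b - int M + - (int a' * (int M - int b)))"
        by (rule arg_cong[where f="\<lambda>e. v powi e"]) (simp add: Suc algebra_simps)
      hence "c a b * v powi int b = v powi (2 * int b - int M) * c (a - 1) b"
        unfolding c_def using v0 Suc by (simp only: power_int_add simp_thms diff_Suc_1)
      thus ?thesis by (simp only: mult_ac)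
    qed simp
    have 2: "c a b * v powi (- int a) * qnum v b = qnum v b * c a (b - 1)"
    proof (cases b)
      case (Suc b')
      have "v powi (- (int a * (int M - int b)) + - int a) = v powi (- (int a * (int M - int b')))"
        by (rule arg_cong[where f="\<lambda>e. v powi e"]) (simp add: Suc algebra_simps)
      hence "c a b * v powi (- int a) = c a (b - 1)"
        unfolding c_def using v0 Suc by (simp only: power_int_add simp_thms diff_Suc_1)
      thus ?thesis by (simp only: mult_ac)
    qed simp
    show ?thesis
      unfolding qnum_add[OF v] distrib_right 1[symmetric] 2[symmetric] by (simp only: mult_ac)
  qed
  have "h k * E = sc (v powi (2 * int k - int (N + M))) (E * h k) + sc (qnum v (Suc k)) (h (Suc k))" for k
  proof -
    have hE: "h k * E = (\<Sum>a\<le>k. sc (c a (k - a) * v powi (2 * int k - int (N + M))) (E * (f a * g (k - a))))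
       + (\<Sum>a\<le>k. sc (c a (k - a) * (v powi (2 * int (k - a) - int M) * qnum v (Suc a))) (f (Suc a) * g (k - a)))
       + (\<Sum>a\<le>k. sc (c a (k - a) * qnum v (Suc (k - a))) (f a * g (Suc (k - a))))"
      unfolding h_def sum_distrib_right sum.distrib[symmetric]
      by (rule sum.cong) (auto simp: step sc_add_right)
    have S1: "(\<Sum>a\<le>k. sc (c a (k - a) * v powi (2 * int k - int (N + M))) (E * (f a * g (k - a))))
       = sc (v powi (2 * int k - int (N + M))) (E * h k)"
      by (simp add: h_def sc_sum_right sum_distrib_left mult.commute)
    have S2: "(\<Sum>a\<le>k. sc (c a (k - a) * (v powi (2 * int (k - a) - int M) * qnum v (Suc a))) (f (Suc a) * g (k - a)))
       = (\<Sum>a\<le>Suc k. sc (v powi (2 * int (Suc k - a) - int M) * qnum v a * c (a - 1) (Suc k - a)) (f a * g (Suc k - a)))"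
      by (subst sum.atMost_Suc_shift) (simp add: mult_ac)
    have S3: "(\<Sum>a\<le>k. sc (c a (k - a) * qnum v (Suc (k - a))) (f a * g (Suc (k - a))))
       = (\<Sum>a\<le>Suc k. sc (qnum v (Suc k - a) * c a (Suc k - a - 1)) (f a * g (Suc k - a)))"
      by (simp add: Suc_diff_le mult.commute)
    have S4: "sc (qnum v (Suc k)) (h (Suc k)) =
      (\<Sum>a\<le>Suc k. sc (v powi (2 * int (Suc k - a) - int M) * qnum v a * c (a - 1) (Suc k - a)) (f a * g (Suc k - a))) +
      (\<Sum>a\<le>Suc k. sc (qnum v (Suc k - a) * c a (Suc k - a - 1)) (f a * g (Suc k - a)))"
    proof -
      have "sc (qnum v (Suc k)) (h (Suc k)) =
        (\<Sum>a\<le>Suc k. sc (qnum v (a + (Suc k - a)) * c a (Suc k - a)) (f a * g (Suc k - a)))"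
        unfolding h_def sc_sum_right by (rule sum.cong) simp_all
      thus ?thesis
        by (simp only: crec sc_add_left sum.distrib)
    qed
    show ?thesis
      unfolding hE S1 S2 S3 S4 by (simp only: add.assoc)
  qed
  moreover have "h k = 0" if "k > N + M" for k
  proof -
    have "f a * g (k - a) = 0" if "a \<le> k" for a
      using f g \<open>k > N + M\<close> that by (cases "a > N") (auto simp: string_def)
    thus ?thesis by (simp add: h_def)
  qed
  \<comment> \<open>Only \<open>a = N\<close> survives, the other terms lying beyond the end of one
    of the strings, and \<open>c N M\<close> has exponent 0.\<close>
  moreover have "h (N + M) = f N * g M"
  proof -
    have "h (N + M) = (\<Sum>a\<le>N + M. if a = N then f N * g M else 0)"
      unfolding h_def
    proof (rule sum.cong)
      fix a assume "a \<in> {..N + M}"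
      show "sc (c a (N + M - a)) (f a * g (N + M - a)) = (if a = N then f N * g M else 0)"
        using f g by (cases a N rule: linorder_cases) (auto simp: string_def c_def)
    qed simp
    thus ?thesis by simp
  qed
  moreover have "h 0 = f 0 * g 0"
    by (simp add: h_def c_def)
  ultimately show ?thesis
    unfolding string_def by (intro exI[of _ h] conjI allI impI)
qed

definition top_of :: "'k \<Rightarrow> 'r \<Rightarrow> nat \<Rightarrow> 'r \<Rightarrow> 'r \<Rightarrow> bool" where
  "top_of v E N x y \<longleftrightarrow> (\<exists>f. string v E N f \<and> f 0 = x \<and> f N = y)"

lemma top_of_mult:
  assumes v: "not_root_of_unity v" and "top_of v E N x y" "top_of v E M x' y'"
  shows "top_of v E (N + M) (x * x') (y * y')"
proof -
  from assms obtain f g where f: "string v E N f" "f 0 = x" "f N = y" and g: "string v E M g" "g 0 = x'" "g M = y'"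
    unfolding top_of_def by (elim exE conjE)
  from string_mult[OF v f(1) g(1)] f(2,3) g(2,3) show ?thesis
    unfolding top_of_def by simp
qed

lemma top_of_add:
  assumes "top_of v E N x y" "top_of v E N x' y'"
  shows "top_of v E N (x + x') (y + y')"
proof -
  from assms obtain f g where "string v E N f" "f 0 = x" "f N = y" "string v E N g" "g 0 = x'" "g N = y'"
    unfolding top_of_def by blast
  thus ?thesis
    unfolding top_of_def
    by (intro exI[of _ "\<lambda>k. f k + g k"]) (auto simp: string_def distrib_left distrib_right sc_add_right)
qed

lemma top_of_sc:
  assumes "top_of v E N x y"
  shows "top_of v E N (sc c x) (sc c y)"
proof -
  from assms obtain f where "string v E N f" "f 0 = x" "f N = y"
    unfolding top_of_def by blast
  thus ?thesis
    unfolding top_of_def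
    by (intro exI[of _ "\<lambda>k. sc c (f k)"]) (auto simp: string_def sc_add_right mult.commute)
qed

lemma top_of_minus:
  assumes "top_of v E N x y"
  shows "top_of v E N (- x) (- y)"
  using top_of_sc[OF assms, of "- 1"] by (simp add: sc_minus_left)

lemma top_of_diff:
  assumes "top_of v E N x y" "top_of v E N x' y'"
  shows "top_of v E N (x - x') (y - y')"
  using top_of_add[OF assms(1) top_of_minus[OF assms(2)]] by simp

text \<open>Quantum integers are invertible here, so each term of a string determines the next.
  Together with multiplicativity this transports polynomial identities from bottoms to tops; see
  \<open>serre_top\<close>.\<close>

lemma top_of_0:
  assumes v: "not_root_of_unity v" and "top_of v E N 0 y"
  shows "y = 0"
proof -
  from assms obtain f where f: "string v E N f" "f 0 = 0" "f N = y"
    unfolding top_of_def by blast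
  have "f k = 0" for k
  proof (induction k)
    case 0
    show ?case by (fact f(2))
  next
    case (Suc k)
    have "f k * E = sc (v powi (2 * int k - int N)) (E * f k) + sc (qnum v (Suc k)) (f (Suc k))"
      using f(1) by (simp add: string_def)
    with Suc show ?case using sc_eq_0_iff[OF qnum_neq_0[OF v, of "Suc k"]] by simp
  qed
  thus ?thesis using f(3) by simp
qed

end

section \<open>Rank one computations\<close>

lemma assoc_rule: "a * b = c ==> a * (b * x) = c * x" for a b c x :: "'a::semigroup_mult"
  by (simp add: mult.assoc[symmetric])

context scaled_ring
begin

text \<open>\<open>tw\<close> and \<open>twr\<close> are the sums in Lusztig's formulas for \<open>T\<^sub>i E\<^sub>j\<close> and for the inverse of \<open>T\<^sub>i\<close> at
  \<open>E\<^sub>j\<close>, with \<open>m = - a\<^sub>i\<^sub>j \<le> 2\<close>.\<close>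

definition tw :: "'k \<Rightarrow> nat \<Rightarrow> 'r \<Rightarrow> 'r \<Rightarrow> 'r" where
  "tw v m x y =
     (if m = 0 then y else if m = 1 then y * x - sc (inverse v) (x * y)
      else sc (inverse (v + inverse v)) (y * x * x) - sc (inverse v) (x * y * x)
         + sc (inverse (v + inverse v) * inverse v ^ 2) (x * x * y))"

definition twr :: "'k \<Rightarrow> nat \<Rightarrow> 'r \<Rightarrow> 'r \<Rightarrow> 'r" where
  "twr v m x y =
     (if m = 0 then y else if m = 1 then x * y - sc (inverse v) (y * x)
      else sc (inverse (v + inverse v)) (x * x * y) - sc (inverse v) (x * y * x)
         + sc (inverse (v + inverse v) * inverse v ^ 2) (y * x * x))"

text \<open>The quantum Serre element with denominators cleared; it agrees with the one in divided
  powers up to a nonzero scalar (\<open>lift_serre_eq\<close>).\<close>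

definition serre_rel :: "'k \<Rightarrow> nat \<Rightarrow> 'r \<Rightarrow> 'r \<Rightarrow> 'r" where
  "serre_rel v m x y =
     (if m = 0 then x * y - y * x
      else if m = 1 then x * x * y - sc (v + inverse v) (x * y * x) + y * x * x
      else x * x * x * y - sc (v ^ 2 + 1 + inverse v ^ 2) (x * x * y * x)
         + sc (v ^ 2 + 1 + inverse v ^ 2) (x * y * x * x) - y * x * x * x)"

text \<open>The middle one of the three terms of the string of \<open>y\<close> for
  \<open>m = 2\<close>. In type B2 it has the weight of the sum of the two simple roots.\<close>

definition mid :: "'k \<Rightarrow> 'r \<Rightarrow> 'r \<Rightarrow> 'r" where
  "mid v x y = y * x - sc (inverse v ^ 2) (x * y)"

end

lemma tw_opposite:
  "scaled_ring sc ==> scaled_ring.tw (op_scale sc) v m (op x) (op y) = op (scaled_ring.twr sc v m x y)"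
  "scaled_ring sc ==> scaled_ring.twr (op_scale sc) v m (op x) (op y) = op (scaled_ring.tw sc v m x y)"
  by (simp_all add: scaled_ring.tw_def scaled_ring.twr_def scaled_ring.scaled_ring_opposite op_eq_iff mult.assoc)

text \<open>The inverses get names so that coefficients become polynomials in \<open>v\<close>,
  \<open>u\<close>, \<open>t\<close>, which the oriented rules \<open>scalars\<close> bring into a
  normal form. With \<open>expand\<close> the simplifier can then verify identities between
  noncommutative polynomials.\<close>

locale unit_scalar = scaled_ring sc for sc :: "'k::field \<Rightarrow> 'r::ring_1 \<Rightarrow> 'r" +
  fixes v u t :: 'k
  assumes v: "not_root_of_unity v" and u: "u = inverse v" and t: "t = inverse (v + inverse v)"
begin

lemma vu: "v * u = 1" "u * v = 1" "v * (u * c) = c" "u * (v * c) = c"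
  using v by (simp_all add: u not_root_of_unity_def)

lemma tv: "t * v = 1 - t * u" "t * (v * c) = c - t * (u * c)" "v * t = 1 - t * u" "v * (t * c) = c - t * (u * c)"
proof -
  have "v + u \<noteq> 0" using qnum_neq_0[OF v, of 2] qnum_2[OF v] by (simp add: u)
  hence "t * (v + u) = 1" by (simp add: t u)
  hence 1: "t * v = 1 - t * u" by (simp add: distrib_left eq_diff_eq)
  thus "t * v = 1 - t * u" "t * (v * c) = c - t * (u * c)"
    by (simp_all add: mult.assoc[symmetric] left_diff_distrib)
  thus "v * t = 1 - t * u" "v * (t * c) = c - t * (u * c)"
    by (simp_all add: mult.commute mult.left_commute)
qed

lemma tuu: "t * (u * u) = u - t" "t * (u * (u * c)) = u * c - t * c"
proof -
  have "u = u * (t * v + t * u)" by (simp add: tv)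
  also have "\<dots> = t + t * (u * u)" using vu(3)[of t] by (simp add: algebra_simps)
  finally show 1: "t * (u * u) = u - t" by (metis add_diff_cancel_left')
  have "t * (u * (u * c)) = (t * (u * u)) * c" by (simp add: mult.assoc)
  thus "t * (u * (u * c)) = u * c - t * c" by (simp add: 1 left_diff_distrib)
qed

lemmas scalars = vu tv tuu

lemmas expand = sc_distribs scalars algebra_simps

lemma v0: "v \<noteq> 0" "u \<noteq> 0"
  using v by (simp_all add: u not_root_of_unity_def)

lemma powi_simps: "v powi 1 = v" "v powi (- 1) = u" "v powi 2 = v * v" "v powi (- 2) = u * u"
  by (simp_all add: u power_int_minus power2_eq_square)

lemma tw_eqs: "tw v 0 x y = y" "tw v 1 x y = y * x - sc u (x * y)" "tw v (Suc 0) x y = y * x - sc u (x * y)"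
  "tw v 2 x y = sc t (y * (x * x)) - sc u (x * (y * x)) + sc (t * (u * u)) (x * (x * y))"
  by (simp_all add: tw_def u t power2_eq_square mult.assoc)

lemma twr_eqs: "twr v 0 x y = y" "twr v 1 x y = x * y - sc u (y * x)" "twr v (Suc 0) x y = x * y - sc u (y * x)"
  "twr v 2 x y = sc t (x * (x * y)) - sc u (x * (y * x)) + sc (t * (u * u)) (y * (x * x))"
  by (simp_all add: twr_def u t power2_eq_square mult.assoc)

lemma serre_rel_eqs: "serre_rel v 0 x y = x * y - y * x"
  "serre_rel v 1 x y = x * (x * y) - sc (v + u) (x * (y * x)) + y * (x * x)"
  "serre_rel v (Suc 0) x y = x * (x * y) - sc (v + u) (x * (y * x)) + y * (x * x)"
  "serre_rel v 2 x y = x * (x * (x * y)) - sc (v * v + 1 + u * u) (x * (x * (y * x)))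
     + sc (v * v + 1 + u * u) (x * (y * (x * x))) - y * (x * (x * x))"
  by (simp_all add: serre_rel_def u power2_eq_square mult.assoc)

lemma mid_eq: "mid v x y = y * x - sc (u * u) (x * y)"
  by (simp add: mid_def u power2_eq_square)

lemma qnums: "qnum v (Suc 0) = 1" "qnum v 2 = v + u" "qnum v (Suc (Suc 0)) = v + u" "qnum v 3 = v * v + 1 + u * u"
  "qnum v (Suc (Suc (Suc 0))) = v * v + 1 + u * u"
  using qnum_1[OF v] qnum_2[OF v] qnum_3[OF v] by (simp_all add: u power2_eq_square numeral_2_eq_2 numeral_3_eq_3)

lemma tw2_mid: "mid v x y * x = x * mid v x y + sc (v + u) (tw v 2 x y)"
proof -
  have "t * (v + u) = 1" by (simp add: distrib_left tv)
  hence 1: "(v + u) * t = 1" "(v + u) * (t * (u * u)) = u * u" by (simp_all add: mult.commute[of _ t] mult.assoc[symmetric])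
  have 2: "(v + u) * u = 1 + u * u" by (simp add: distrib_right vu)
  show ?thesis
    unfolding tw_eqs mid_eq
    by (simp add: sc_add_right sc_diff_right 1 2 sc_add_left left_diff_distrib right_diff_distrib mult.assoc)
qed

lemma top_of_tw0:
  assumes "E * y = y * E" shows "top_of v E 0 y y"
  unfolding top_of_def
  by (rule exI[of _ "\<lambda>k. if k = 0 then y else 0"]) (simp add: string_def assms)

text \<open>The Serre relation says precisely that the string of \<open>y\<close> breaks off after
  \<open>m\<close> steps.\<close>

lemma top_of_tw:
  assumes "m \<le> 2" "serre_rel v m E y = 0" shows "top_of v E m y (tw v m E y)"
proof -
  consider "m = 0" | "m = 1" | "m = 2" using assms(1) by linarith
  thus ?thesis
  proof cases
    case 1
    thus ?thesis using assms(2) top_of_tw0[of E y] by (simp add: tw_eqs serre_rel_eqs)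
  next
    case 2
    have "tw v 1 E y * E = sc v (E * tw v 1 E y)"
      using assms(2) unfolding 2 tw_eqs serre_rel_eqs
      by (simp add: left_diff_distrib right_diff_distrib sc_diff_right vu mult.assoc sc_add_left algebra_simps)
    moreover have "y * E = sc u (E * y) + tw v 1 E y" by (simp add: tw_eqs)
    ultimately show ?thesis
      unfolding top_of_def 2 string_def
      by (intro exI[of _ "\<lambda>k. if k = 0 then y else if k = 1 then tw v 1 E y else 0"])
        (auto simp: powi_simps qnums power2_eq_square u[symmetric])
  next
    case 3
    \<comment> \<open>The factor comes from the leading coefficient \<open>t\<close> of
      \<open>tw\<close>, the inverse of the quantum integer 2, against the coefficient -1 in the
      Serre element.\<close>
    have "tw v 2 E y * E - sc (v * v) (E * tw v 2 E y) = sc (- t) (serre_rel v 2 E y)"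
      unfolding tw_eqs serre_rel_eqs
      by (simp add: expand)
    hence "tw v 2 E y * E = sc (v * v) (E * tw v 2 E y)"
      using assms(2) 3 by simp
    moreover have "y * E = sc (u * u) (E * y) + mid v E y" by (simp add: mid_eq)
    ultimately show ?thesis
      using tw2_mid[of E y]
      unfolding top_of_def 3 string_def
      by (intro exI[of _ "\<lambda>k. if k = 0 then y else if k = 1 then mid v E y else if k = 2 then tw v 2 E y else 0"])
        (auto simp: powi_simps qnums power2_eq_square u[symmetric])
  qed
qed

lemma tw_commutation:
  assumes "m \<le> 2" "serre_rel v m E y = 0"
  shows "tw v m E y * E = sc (v ^ m) (E * tw v m E y)"
proof -
  from top_of_tw[OF assms] obtain f where f: "string v E m f" "f 0 = y" "f m = tw v m E y"
    unfolding top_of_def by (elim exE conjE)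
  have "f m * E = sc (v powi (2 * int m - int m)) (E * f m) + sc (qnum v (Suc m)) (f (Suc m))" "f (Suc m) = 0"
    using f(1) unfolding string_def by blast+
  thus ?thesis by (simp add: f)
qed

text \<open>The recursion of a string can be solved from its first term, so the top is a function of
  the bottom. In \<open>tw_tw\<close> this evaluates a top that was built as a product.\<close>

lemma top_of_eq_tw:
  assumes "m \<le> 2" "top_of v E m x y"
  shows "y = tw v m E x"
proof -
  from assms(2) obtain f where f: "string v E m f" "f 0 = x" "f m = y"
    unfolding top_of_def by (elim exE conjE)
  have f': "f k * E = sc (v powi (2 * int k - int m)) (E * f k) + sc (qnum v (Suc k)) (f (Suc k))" for k
    using f(1) by (simp add: string_def)
  consider "m = 0" | "m = 1" | "m = 2" using assms(1) by linarith
  thus ?thesis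
  proof cases
    case 1
    thus ?thesis using f by (simp add: tw_eqs)
  next
    case 2
    show ?thesis using f'[of 0] f(2,3) unfolding 2 by (simp add: tw_eqs powi_simps qnums u)
  next
    case 3
    have 1: "f (Suc 0) = mid v E x" using f'[of 0] f(2,3) unfolding 3 by (simp add: mid_eq powi_simps qnums)
    have "f (Suc 0) * E = E * f (Suc 0) + sc (v + u) y"
      using f'[of 1] f(2,3) unfolding 3 by (simp add: qnums numeral_2_eq_2)
    hence "sc (v + u) y = sc (v + u) (tw v 2 E x)"
      using tw2_mid[of E x] unfolding 1 by simp
    hence "y = tw v 2 E x"
      by (rule sc_cancel[rotated]) (use qnum_neq_0[OF v, of 2] in \<open>simp add: qnums\<close>)
    thus ?thesis by (simp add: 3)
  qed
qed

end

locale quantum_sl2 = unit_scalar sc v u t for sc :: "'k::field \<Rightarrow> 'r::ring_1 \<Rightarrow> 'r" and v u t +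
  fixes h :: 'k and E F K L :: 'r
  assumes h: "h = inverse (v - u)"
    and KL: "K * L = 1" and LK: "L * K = 1"
    and KE: "K * E = sc (v * v) (E * K)" and KF: "K * F = sc (u * u) (F * K)"
    and EF: "E * F = F * E + sc h K - sc h L"
begin

lemma hv: "h * v = 1 + h * u" "h * (v * c) = c + h * (u * c)" "v * h = 1 + h * u" "v * (h * c) = c + h * (u * c)"
proof -
  have "h * (v - u) = 1" using diff_inverse_neq_0[OF v] by (simp add: h u)
  hence 1: "h * v = 1 + h * u" by (simp add: right_diff_distrib diff_eq_eq)
  thus "h * v = 1 + h * u" "h * (v * c) = c + h * (u * c)"
    by (simp_all add: mult.assoc[symmetric] distrib_right)
  thus "v * h = 1 + h * u" "v * (h * c) = c + h * (u * c)"
    by (simp_all add: mult.commute mult.left_commute)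
qed

lemma huu: "h * (u * u) = h - u" "h * (u * (u * c)) = h * c - u * c"
proof -
  have "u + h * (u * u) = u * (h * v)" by (simp add: hv algebra_simps)
  also have "\<dots> = h" using vu(4)[of h] by (simp add: mult.commute)
  finally show 1: "h * (u * u) = h - u" by (simp add: eq_diff_eq add.commute)
  have "h * (u * (u * c)) = (h * (u * u)) * c" by (simp add: mult.assoc)
  thus "h * (u * (u * c)) = h * c - u * c" by (simp add: 1 left_diff_distrib)
qed

text \<open>From \<open>t * (v + u) = 1\<close> and \<open>h * (v - u) = 1\<close> one gets 2 h t =
  h u + t u. It is stated for repeated summands, the form in which the simplifier meets it.\<close>

lemma ht: "sc (h * t) x + sc (h * t) x = sc (h * u) x + sc (t * u) x"
  "sc (h * t) x + (sc (h * t) x + z) = sc (h * u) x + (sc (t * u) x + z)"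
proof -
  have "t * (v + u) = 1" by (simp add: distrib_left tv)
  moreover have "h * (v - u) = 1" using diff_inverse_neq_0[OF v] by (simp add: h u)
  ultimately have "h * u + t * u = h * u * (t * (v + u)) + t * u * (h * (v - u))" by simp
  also have "\<dots> = h * t * (u * v) + h * t * (u * v)" by (simp add: algebra_simps)
  finally have "h * t + h * t = h * u + t * u" by (simp add: vu)
  thus 1: "sc (h * t) x + sc (h * t) x = sc (h * u) x + sc (t * u) x"
    by (simp add: sc_add_left[symmetric])
  thus "sc (h * t) x + (sc (h * t) x + z) = sc (h * u) x + (sc (t * u) x + z)"
    by (simp add: add.assoc[symmetric])
qed

lemma torus_flip:
  assumes "K * x = sc c (x * K)" "c * e = 1" shows "L * x = sc e (x * L)"
proof -
  have "x = L * (K * x)" by (simp add: LK mult.assoc[symmetric])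
  hence "x * L = sc c (L * (x * (K * L)))" by (metis assms(1) mult.assoc sc_mult_left sc_mult_right)
  hence "sc e (x * L) = L * x" using assms(2) by (simp add: KL mult.commute)
  thus ?thesis by simp
qed

lemma LE: "L * E = sc (u * u) (E * L)"
  by (rule torus_flip[OF KE]) (simp add: vu mult.assoc)

lemma LF: "L * F = sc (v * v) (F * L)"
  by (rule torus_flip[OF KF]) (simp add: vu mult.assoc)

lemmas sl2_rules = KL LK KE KF EF LE LF
  assoc_rule[OF KL] assoc_rule[OF LK] assoc_rule[OF KE] assoc_rule[OF KF] assoc_rule[OF EF]
  assoc_rule[OF LE] assoc_rule[OF LF]

text \<open>The shape of \<open>E j\<close> for an index \<open>j\<close> other than that of
  \<open>E\<close>: weight \<open>- m\<close>, and killed by the adjoint action of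
  \<open>F\<close>.\<close>

definition lowest :: "nat \<Rightarrow> 'r \<Rightarrow> bool" where
  "lowest m y \<longleftrightarrow> K * y = sc (u ^ m) (y * K) \<and> y * F = F * y"

lemma lowest_rules:
  assumes "lowest m y"
  shows "K * y = sc (u ^ m) (y * K)" "L * y = sc (v ^ m) (y * L)" "y * F = F * y"
    "K * (y * x) = sc (u ^ m) (y * (K * x))" "L * (y * x) = sc (v ^ m) (y * (L * x))" "y * (F * x) = F * (y * x)"
proof -
  show 1: "K * y = sc (u ^ m) (y * K)" and 3: "y * F = F * y"
    using assms by (simp_all add: lowest_def)
  have "u ^ m * v ^ m = 1" by (simp add: power_mult_distrib[symmetric] vu)
  with 1 show 2: "L * y = sc (v ^ m) (y * L)" by (rule torus_flip)
  show "K * (y * x) = sc (u ^ m) (y * (K * x))" "L * (y * x) = sc (v ^ m) (y * (L * x))" "y * (F * x) = F * (y * x)"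
    using assoc_rule[OF 1] assoc_rule[OF 2] assoc_rule[OF 3] by (simp_all add: mult.assoc)
qed

text \<open>\<open>G\<close> is Lusztig's image of \<open>E\<close>, and \<open>tw v m E y\<close>
  that of a lowest \<open>y\<close>; the lemmas on \<open>G\<close> are the relations between such
  images.\<close>

abbreviation "G \<equiv> - (L * F)"

lemma tw_G_1:
  assumes "lowest 1 y"
  shows "tw v 1 E y * G = sc v (G * tw v 1 E y) - sc v y"
  unfolding tw_eqs using lowest_rules[OF assms]
  by (simp add: sl2_rules sc_distribs scalars hv huu ht algebra_simps)

lemma tw_G_2:
  assumes "lowest 2 y"
  shows "tw v 2 E y * G = sc (v * v) (G * tw v 2 E y) - sc (v * v) (mid v E y)"
    "mid v E y * G = G * mid v E y - sc (v + u) y"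
    "y * G = sc (u * u) (G * y)"
  unfolding tw_eqs mid_eq using lowest_rules[OF assms]
  by (simp_all add: sl2_rules sc_distribs scalars hv huu ht algebra_simps power2_eq_square)

text \<open>q-commuting with \<open>G\<close> walks the string of \<open>y\<close> backwards, from
  its top to \<open>y\<close>, and \<open>y\<close> itself q-commutes with \<open>G\<close>. Hence
  \<open>m + 1\<close> such steps annihilate the top, which is the Serre relation.\<close>

lemma serre_G:
  assumes "m \<le> 2" "lowest m y"
  shows "serre_rel v m G (tw v m E y) = 0"
proof -
  consider "m = 0" | "m = 1" | "m = 2" using assms(1) by linarith
  thus ?thesis
  proof cases
    case 1
    thus ?thesis using lowest_rules[OF assms(2)]
      by (simp add: tw_eqs serre_rel_eqs sl2_rules mult.assoc)
  next
    case 2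
    define Y where "Y = tw v 1 E y"
    have 1: "Y * G = sc v (G * Y) - sc v y" using tw_G_1 assms(2) unfolding Y_def 2 by blast
    have 2: "y * G = sc u (G * y)" using lowest_rules[OF assms(2)] \<open>m = 1\<close> by (simp add: sl2_rules scalars sc_distribs mult.assoc)
    obtain g where g: "g = G" by simp
    note rules = 1[folded g] 2[folded g]
    show ?thesis unfolding \<open>m = 1\<close> Y_def[symmetric] serre_rel_eqs g[symmetric]
      by (simp add: rules rules[THEN assoc_rule] expand)
  next
    case 3
    define Y where "Y = tw v 2 E y"
    define M where "M = mid v E y"
    obtain g where g: "g = G" by simp
    note rules = tw_G_2[OF assms(2)[unfolded 3], folded Y_def M_def g]
    show ?thesis unfolding 3 Y_def[symmetric] serre_rel_eqs g[symmetric]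
      by (simp add: rules rules[THEN assoc_rule] expand)
  qed
qed

text \<open>The same backward walk, made with all its coefficients, ends at \<open>y\<close>. It
  shows that \<open>twr\<close> gives the inverse of Lusztig's automorphism
  (\<open>TT'_E\<close>).\<close>

lemma twr_G:
  assumes "m \<le> 2" "lowest m y"
  shows "twr v m G (tw v m E y) = y"
proof -
  consider "m = 0" | "m = 1" | "m = 2" using assms(1) by linarith
  thus ?thesis
  proof cases
    case 1
    thus ?thesis by (simp add: tw_eqs twr_eqs)
  next
    case 2
    define Y where "Y = tw v 1 E y"
    obtain g where g: "g = G" by simp
    note rules = tw_G_1[OF assms(2)[unfolded 2], folded Y_def g]
    show ?thesis unfolding 2 Y_def[symmetric] twr_eqs g[symmetric]
      by (simp add: rules expand)
  next
    case 3
    define Y where "Y = tw v 2 E y"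
    define M where "M = mid v E y"
    obtain g where g: "g = G" by simp
    note rules = tw_G_2[OF assms(2)[unfolded 3], folded Y_def M_def g]
    show ?thesis unfolding 3 Y_def[symmetric] twr_eqs g[symmetric]
      by (simp add: rules rules[THEN assoc_rule] expand)
  qed
qed

definition highest :: "nat \<Rightarrow> 'r \<Rightarrow> bool" where
  "highest m z \<longleftrightarrow> K * z = sc (v ^ m) (z * K) \<and> z * E = E * z"

lemma highest_rules:
  assumes "highest m z"
  shows "K * z = sc (v ^ m) (z * K)" "L * z = sc (u ^ m) (z * L)" "E * z = z * E"
    "K * (z * x) = sc (v ^ m) (z * (K * x))" "L * (z * x) = sc (u ^ m) (z * (L * x))" "E * (z * x) = z * (E * x)"
proof -
  show 1: "K * z = sc (v ^ m) (z * K)" and 3: "E * z = z * E"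
    using assms by (simp_all add: highest_def)
  have "v ^ m * u ^ m = 1" by (simp add: power_mult_distrib[symmetric] vu)
  with 1 show 2: "L * z = sc (u ^ m) (z * L)" by (rule torus_flip)
  show "K * (z * x) = sc (v ^ m) (z * (K * x))" "L * (z * x) = sc (u ^ m) (z * (L * x))" "E * (z * x) = z * (E * x)"
    using assoc_rule[OF 1] assoc_rule[OF 2] assoc_rule[OF 3] by (simp_all add: mult.assoc)
qed

text \<open>\<open>Z, Z', Z''\<close> are the terms of the string of some \<open>F k\<close>,
  starting from its top and padded by 0. Moving \<open>E\<close> across \<open>Z\<close> leaves
  terms with \<open>L\<close>, and these cancel in \<open>tw\<close> because of the power of
  \<open>v\<close> by which \<open>L\<close> and \<open>y\<close> commute.\<close>

lemma commute_tw_chain: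
  assumes "m \<le> 2" "lowest m y" and y: "y * Z = Z * y" "y * Z' = Z' * y" "y * Z'' = Z'' * y"
    and E: "E * Z = Z * E + sc c (L * Z')" "E * Z' = Z' * E + sc c' (L * Z'')" "E * Z'' = Z'' * E"
  shows "tw v m E y * Z = Z * tw v m E y"
proof -
  have E': "Z * E = E * Z - sc c (L * Z')" "Z' * E = E * Z' - sc c' (L * Z'')" "Z'' * E = E * Z''"
    by (simp_all add: E)
  note rules = y[symmetric] E' y[symmetric, THEN assoc_rule] E'[THEN assoc_rule] lowest_rules(2,5)[OF assms(2)] LE
    assoc_rule[OF LE]
  consider "m = 0" | "m = 1" | "m = 2" using assms(1) by linarith
  thus ?thesis
  proof cases
    case 1
    thus ?thesis by (simp add: tw_eqs y)
  next
    case 2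
    show ?thesis unfolding 2 tw_eqs
      by (simp add: rules[unfolded 2] expand)
  next
    case 3
    show ?thesis unfolding 3 tw_eqs
      by (simp add: rules[unfolded 3] expand power2_eq_square)
  qed
qed

lemma tw_F:
  "lowest 1 y ==> tw v 1 E y * F = F * tw v 1 E y + sc u (y * K)"
  "lowest 2 y ==> tw v 2 E y * F = F * tw v 2 E y + mid v E y * K"
  "lowest 2 y ==> mid v E y * F = F * mid v E y + sc (u * u * (v + u)) (y * K)"
  unfolding tw_eqs mid_eq
  using lowest_rules[of 1 y] lowest_rules[of 2 y]
  by (simp_all add: sl2_rules sc_distribs scalars hv huu ht algebra_simps power2_eq_square)

text \<open>Meant for \<open>y = E j\<close>, \<open>z = F j\<close>, with \<open>A\<close> and
  \<open>B\<close> the torus elements \<open>K j\<close> and \<open>L j\<close>, so that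
  \<open>A * K ^ m\<close> is Lusztig's image of \<open>K j\<close>.\<close>

lemma commutator_tw_twr:
  assumes "m \<le> 2" "lowest m y" "highest m z"
    and yz: "y * z = z * y + sc g A - sc g B"
    and A: "A * E = sc (u ^ m) (E * A)" "A * F = sc (v ^ m) (F * A)" "A * K = K * A" "A * L = L * A"
    and B: "B * E = sc (v ^ m) (E * B)" "B * F = sc (u ^ m) (F * B)" "B * K = K * B" "B * L = L * B"
  shows "tw v m E y * twr u m F z = twr u m F z * tw v m E y + sc g (A * K ^ m) - sc g (B * L ^ m)"
proof -
  interpret bar: unit_scalar sc u v t
    by unfold_locales (use v not_root_of_unity_inverse in \<open>auto simp: u t add.commute\<close>)
  note rules = A B A[THEN assoc_rule] B[THEN assoc_rule] yz yz[THEN assoc_rule] sl2_rules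
  note rules' = lowest_rules[OF assms(2)] highest_rules[OF assms(3)]
  consider "m = 0" | "m = 1" | "m = 2" using assms(1) by linarith
  thus ?thesis
  proof cases
    case 1
    thus ?thesis by (simp add: tw_eqs bar.twr_eqs yz)
  next
    case 2
    show ?thesis unfolding 2 tw_eqs bar.twr_eqs
      by (simp add: rules[unfolded 2] rules'[unfolded 2] sc_distribs scalars hv huu ht algebra_simps)
  next
    case 3
    \<comment> \<open>Moving \<open>E\<close> across the top \<open>Z\<close> one step at a time,
      through the next term \<open>Zm\<close>, keeps the normal forms small.\<close>
    define Z where "Z = twr u 2 F z"
    define Zm where "Zm = F * z - sc (v * v) (z * F)"
    note r = rules[unfolded 3] rules'[unfolded 3]
    have EZ: "E * Z = Z * E + L * Zm"
      unfolding Z_def Zm_def bar.twr_eqs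
      by (simp add: r sc_distribs scalars hv huu ht algebra_simps power2_eq_square)
    have EZm: "E * Zm = Zm * E + sc (v * v * (v + u)) (L * z)"
      unfolding Zm_def
      by (simp add: r sc_distribs scalars hv huu ht algebra_simps power2_eq_square)
    have yZm: "y * Zm = Zm * y + sc (g * (1 - v * v * (v * v))) (F * A)"
      unfolding Zm_def
      by (simp add: r sc_distribs scalars hv huu ht algebra_simps power2_eq_square)
    have LZm: "L * Zm = Zm * L"
      unfolding Zm_def
      by (simp add: r sc_distribs scalars hv huu ht algebra_simps power2_eq_square)
    have yZ: "y * Z = Z * y + sc (g * (v - v * v * v)) (F * (F * A)) + sc (g * (v * v * (v * v * v) - v * v * v)) (F * (F * A))"
      unfolding Z_def bar.twr_eqs
      by (simp add: r sc_distribs scalars hv huu ht algebra_simps power2_eq_square)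
    note r' = EZ EZm yZm LZm yZ
    show ?thesis unfolding 3 Z_def[symmetric] tw_eqs
      by (simp add: r r' r'[THEN assoc_rule] sc_distribs scalars hv huu ht algebra_simps power2_eq_square)
  qed
qed

end

section \<open>Rank two computations\<close>

context unit_scalar
begin

lemma tw_1_commutation:
  assumes "serre_rel v 1 y x = 0"
  shows "tw v 1 x y * y = sc u (y * tw v 1 x y)"
proof -
  have "tw v 1 x y * y - sc u (y * tw v 1 x y) = sc (- u) (serre_rel v 1 y x)"
    unfolding tw_eqs serre_rel_eqs by (simp add: expand)
  thus ?thesis using assms by simp
qed

text \<open>Type B2 with \<open>x\<close> long and \<open>y\<close> short: \<open>Y\<close> and
  \<open>V\<close> are, up to scalars, the two other root vectors, and the claim is their
  q-commutation. Hypothesis \<open>S\<close> is the Serre relation of \<open>y\<close> on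
  \<open>x\<close>; its parameter is a square root of \<open>v\<close>.\<close>

lemma tw_1_commutator:
  fixes x y
  defines "Y \<equiv> tw v 1 x y" and "V \<equiv> tw v 1 x y * y - y * tw v 1 x y"
  assumes S: "y * (y * (y * x)) - sc (v + 1 + u) (y * (y * (x * y))) + sc (v + 1 + u) (y * (x * (y * y)))
     - x * (y * (y * y)) = 0"
    and S': "serre_rel v 1 x y = 0"
  shows "Y * V = sc u (V * Y)"
proof -
  have yx: "y * x = Y + sc u (x * y)" by (simp add: Y_def tw_eqs)
  have Yx: "Y * x = sc v (x * Y)" using tw_commutation[of 1 x y] S' by (simp add: Y_def)
  have yY: "y * Y = Y * y - V" by (simp add: V_def Y_def)
  have yV: "y * V = sc v (V * y)"
  proof -
    have "y * V - sc v (V * y) = - (y * (y * (y * x)) - sc (v + 1 + u) (y * (y * (x * y))) + sc (v + 1 + u) (y * (x * (y * y)))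
     - x * (y * (y * y)))"
      unfolding V_def tw_eqs by (simp add: expand)
    with S show ?thesis by simp
  qed
  have Vx: "V * x = x * V + sc (1 - v) (Y * Y)"
  proof -
    have "V * x = Y * (y * x) - y * (Y * x)" by (simp add: V_def Y_def algebra_simps)
    thus ?thesis
      by (simp add: yx yx[THEN assoc_rule] Yx Yx[THEN assoc_rule] yY expand)
  qed
  \<comment> \<open>Multiplying the relation of \<open>y\<close> and \<open>V\<close> by
    \<open>x\<close> and straightening \<open>x\<close> to the left turns it into the relation of
    \<open>Y\<close> and \<open>V\<close>.\<close>
  have "y * V * x = sc v (V * y * x)" using yV by simp
  hence "y * (V * x) = sc v (V * (y * x))" by (simp add: mult.assoc)
  hence "sc v (Y * V) = V * Y"
    unfolding Vx yx
    by (simp add: yx[THEN assoc_rule] Yx Vx Yx[THEN assoc_rule] Vx[THEN assoc_rule] yV yV[THEN assoc_rule]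
      yY yY[THEN assoc_rule] expand)
  hence "sc u (sc v (Y * V)) = sc u (V * Y)" by simp
  thus ?thesis by (simp add: scalars)
qed

text \<open>Type B2 with \<open>x\<close> short and \<open>y\<close> long. The second and third
  relation each come from the preceding one by multiplying with \<open>x\<close> on the right and
  moving \<open>x\<close> to the left.\<close>

lemma tw_2_commutation:
  fixes x y
  defines "Y \<equiv> tw v 2 x y" and "M \<equiv> mid v x y"
  assumes S: "y * (y * x) - sc (v * v + u * u) (y * (x * y)) + x * (y * y) = 0"
    and S': "serre_rel v 2 x y = 0"
  shows "y * M = sc (v * v) (M * y)"
    "y * Y = Y * y + sc (t * (v * v - 1)) (M * M)"
    "M * Y = sc (v * v) (Y * M)"
proof -
  have yx: "y * x = M + sc (u * u) (x * y)" by (simp add: M_def mid_eq)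
  have Yx: "Y * x = sc (v * v) (x * Y)" using tw_commutation[of 2 x y] S' by (simp add: Y_def power2_eq_square)
  have Mx: "M * x = x * M + sc (v + u) Y" using tw2_mid by (simp add: M_def Y_def)
  show yM: "y * M = sc (v * v) (M * y)"
  proof -
    have "y * M - sc (v * v) (M * y) = y * (y * x) - sc (v * v + u * u) (y * (x * y)) + x * (y * y)"
      unfolding M_def mid_eq by (simp add: expand)
    with S show ?thesis by simp
  qed
  have tvu: "t * (v + u) = 1" by (simp add: distrib_left tv)
  have "y * M * x = sc (v * v) (M * y * x)" using yM by simp
  hence "y * (M * x) = sc (v * v) (M * (y * x))" by (simp add: mult.assoc)
  hence "sc (v + u) (y * Y) = sc (v + u) (Y * y) + sc (v * v - 1) (M * M)"
    unfolding Mx yx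
    by (simp add: yx[THEN assoc_rule] Mx Mx[THEN assoc_rule] yM yM[THEN assoc_rule] expand)
  hence "sc t (sc (v + u) (y * Y)) = sc t (sc (v + u) (Y * y) + sc (v * v - 1) (M * M))" by simp
  thus yY: "y * Y = Y * y + sc (t * (v * v - 1)) (M * M)"
    by (simp only: sc_add_right sc_sc tvu sc_1)
  have "y * Y * x = Y * y * x + sc (t * (v * v - 1)) (M * M * x)" using yY by (simp add: distrib_right)
  hence "y * (Y * x) = Y * (y * x) + sc (t * (v * v - 1)) (M * (M * x))" by (simp add: mult.assoc)
  moreover have "y * (Y * x) = sc (v * v) (M * Y) + x * (y * Y)"
    unfolding Yx by (simp add: yx[THEN assoc_rule] expand)
  moreover have "Y * (y * x) = Y * M + x * (Y * y)"
    unfolding yx by (simp add: Yx[THEN assoc_rule] expand)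
  moreover have "M * (M * x) = x * (M * M) + sc (v + u) (Y * M + M * Y)"
    unfolding Mx by (simp add: Mx[THEN assoc_rule] expand)
  ultimately have "sc (v * v) (M * Y) = Y * M + sc (t * (v * v - 1) * (v + u)) (Y * M + M * Y)"
    unfolding yY by (simp add: sc_add_right distrib_left)
  also have "t * (v * v - 1) * (v + u) = v * v - 1"
    using tvu by (metis mult.commute mult.left_commute mult.right_neutral)
  finally show "M * Y = sc (v * v) (Y * M)"
    by (simp add: sc_distribs algebra_simps)
qed

text \<open>Since \<open>z\<close> commutes with \<open>x\<close>, it is its own top. Passing to
  tops for \<open>x\<close> therefore turns \<open>tw v n y z\<close> into
  \<open>tw v n (tw v 1 x y) z\<close> factor by factor.\<close>

lemma tw_tw:
  assumes "n \<le> 2" "serre_rel v 1 x y = 0" "x * z = z * x"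
  shows "tw v n (tw v 1 x y) z = tw v n x (tw v n y z)"
proof -
  have y: "top_of v x 1 y (tw v 1 x y)"
    using top_of_tw[of 1 x y] assms(2) by simp
  have z: "top_of v x 0 z z"
    by (rule top_of_tw0) (rule assms(3))
  note zy = top_of_mult[OF v z y, simplified] and yz = top_of_mult[OF v y z, simplified]
  note yy = top_of_mult[OF v y y, simplified]
  consider "n = 0" | "n = 1" | "n = 2" using assms(1) by linarith
  hence "top_of v x n (tw v n y z) (tw v n (tw v 1 x y) z)"
  proof cases
    case 1
    thus ?thesis using z by (simp add: tw_eqs)
  next
    case 2
    show ?thesis unfolding 2 tw_eqs
      using top_of_diff[OF zy top_of_sc[OF yz, of u]] by (simp add: tw_eqs)
  next
    case 3
    note zyy = top_of_mult[OF v z yy, simplified] and yyz = top_of_mult[OF v y yz, simplified]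
      and yzy = top_of_mult[OF v y zy, simplified]
    show ?thesis unfolding 3 tw_eqs
      using top_of_add[OF top_of_diff[OF top_of_sc[OF zyy, of t] top_of_sc[OF yzy, of u]] top_of_sc[OF yyz, of "t * (u * u)"]]
      by (simp add: tw_eqs numeral_2_eq_2)
  qed
  thus ?thesis
    by (rule top_of_eq_tw[OF assms(1)])
qed

end

section \<open>Rank two relations between the images of the generators\<close>

context quantum_sl2
begin

text \<open>Serre relations with \<open>G\<close> as the second argument; the digits are the bond
  from \<open>E\<close> to \<open>y\<close> and the bond back. In contrast to
  \<open>serre_G\<close>, the commutation of the top with lower terms of the string enters, hence
  the Serre relation of \<open>y\<close> on \<open>E\<close>.\<close>

lemma serre_G_rev_11:
  assumes "lowest 1 y" "serre_rel v 1 y E = 0"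
  shows "serre_rel v 1 (tw v 1 E y) G = 0"
proof -
  define Y where "Y = tw v 1 E y"
  obtain g where g: "g = G" by simp
  have 1: "Y * g = sc v (g * Y) - sc v y"
    using tw_G_1[OF assms(1), folded g] by (simp add: Y_def)
  have 2: "Y * y = sc u (y * Y)" using tw_1_commutation[OF assms(2)] by (simp add: Y_def)
  show ?thesis unfolding Y_def[symmetric] serre_rel_eqs g[symmetric]
    by (simp add: 1 2 1[THEN assoc_rule] 2[THEN assoc_rule] expand)
qed

lemma serre_G_rev_21:
  assumes "lowest 2 y" and S: "serre_rel v 2 E y = 0"
    "y * (y * E) - sc (v * v + u * u) (y * (E * y)) + E * (y * y) = 0"
  defines "Y \<equiv> tw v 2 E y"
  shows "Y * (Y * G) - sc (v * v + u * u) (Y * (G * Y)) + G * (Y * Y) = 0"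
proof -
  define M where "M = mid v E y"
  obtain g where g: "g = G" by simp
  note 1 = tw_G_2[OF assms(1), folded Y_def M_def g]
  have "sc (u * u) (M * Y) = Y * M"
    using tw_2_commutation(3)[OF S(2,1), folded Y_def M_def] by (simp add: scalars mult.assoc)
  hence 2: "Y * M = sc (u * u) (M * Y)" by simp
  show ?thesis unfolding g[symmetric]
    by (simp add: 1 2 1[THEN assoc_rule] 2[THEN assoc_rule] expand)
qed

lemma serre_G_rev_12:
  assumes "lowest 1 y" and S: "serre_rel v 1 E y = 0"
    "y * (y * (y * E)) - sc (v + 1 + u) (y * (y * (E * y))) + sc (v + 1 + u) (y * (E * (y * y))) - E * (y * (y * y)) = 0"
  defines "Y \<equiv> tw v 1 E y"
  shows "Y * (Y * (Y * G)) - sc (v + 1 + u) (Y * (Y * (G * Y))) + sc (v + 1 + u) (Y * (G * (Y * Y))) - G * (Y * (Y * Y)) = 0"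
proof -
  obtain g where g: "g = G" by simp
  have 1: "Y * g = sc v (g * Y) - sc v y"
    using tw_G_1[OF assms(1), folded g] by (simp add: Y_def)
  define V where "V = Y * y - y * Y"
  have 2: "Y * V = sc u (V * Y)"
    using tw_1_commutator[OF S(2,1)] by (simp add: Y_def V_def)
  have 3: "y * Y = Y * y - V" by (simp add: V_def)
  have 4: "V * Y = sc v (Y * V)" by (simp add: 2 scalars)
  show ?thesis unfolding g[symmetric]
    by (simp add: 1 3 4 1[THEN assoc_rule] 3[THEN assoc_rule] 4[THEN assoc_rule] expand)
qed

lemma tw_tw_G_1:
  assumes "lowest 1 y" shows "tw v 1 (tw v 1 E y) G = y"
proof -
  define Y where "Y = tw v 1 E y"
  obtain g where g: "g = G" by simp
  have 1: "Y * g = sc v (g * Y) - sc v y"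
    using tw_G_1[OF assms(1), folded g] by (simp add: Y_def)
  show ?thesis unfolding Y_def[symmetric] g[symmetric]
    by (simp add: tw_eqs 1 expand)
qed

lemma tw_tw_G_2:
  assumes "lowest 2 y" shows "G * tw v 2 E y - sc (u * u) (tw v 2 E y * G) = mid v E y"
  unfolding tw_G_2(1)[OF assms] by (simp add: expand)

text \<open>Here \<open>E\<close> is long and \<open>y\<close> is short with parameter
  \<open>v'\<close>. In terms of automorphisms the left side is \<open>T i (T j (E i))\<close> and
  the right side \<open>T' j (E i)\<close>; see \<open>rank2_B\<close>.\<close>

lemma tw_2_tw_1_G:
  assumes "lowest 1 y" and s: "unit_scalar sc v' u' t'" and v: "v = v' * v'" and S: "serre_rel v 1 E y = 0"
  shows "tw v' 2 (tw v 1 E y) G = twr v' 2 y E"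
proof -
  interpret s: unit_scalar sc v' u' t' by (rule s)
  have u: "u = u' * u'" by (simp add: u v s.u)
  define Y where "Y = tw v 1 E y"
  obtain g where g: "g = G" by simp
  have 1: "Y * g = sc v (g * Y) - sc v y"
    using tw_G_1[OF assms(1), folded g] by (simp add: Y_def)
  have Y: "Y = y * E - sc u (E * y)" by (simp add: Y_def tw_eqs)
  show ?thesis unfolding Y_def[symmetric] g[symmetric] s.tw_eqs s.twr_eqs
    by (simp add: 1 1[THEN assoc_rule] sc_distribs u v s.scalars algebra_simps)
      (simp add: Y sc_distribs u v s.scalars algebra_simps)
qed

lemma G_commutator: "G * - (E * K) - - (E * K) * G = sc h (L - K)"
  by (simp add: mult.assoc sl2_rules sc_distribs scalars hv huu algebra_simps)

end

section \<open>Identities with a third index attached to a double bond\<close>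

context unit_scalar
begin

text \<open>With \<open>e\<close>, \<open>x\<close>, \<open>z\<close> the generators for
  \<open>i\<close>, \<open>j\<close>, \<open>k\<close>, where \<open>i\<close> is the short end of
  the double bond and \<open>k\<close> is attached to it, this is the invariance of
  \<open>T i (T j (T i (E k)))\<close> under \<open>T j\<close> that \<open>fix_B\<close>
  needs.\<close>

lemma tw_rank_three_1:
  assumes z: "z * x = x * z" and S: "serre_rel v 1 e z = 0"
  defines "Z \<equiv> x * e - sc (u * u) (e * x)" and "X \<equiv> e * x - sc (u * u) (x * e)"
  shows "tw v 1 Z (tw v 1 e z) = tw v 1 e (tw v 1 X z)"
proof -
  have "t * (v + u) = 1" by (simp add: distrib_left tv)
  have "sc t (e * (e * z) + z * (e * e)) = sc (t * (v + u)) (e * (z * e))"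
    using S unfolding serre_rel_eqs sc_sc[symmetric] by (simp add: algebra_simps)
  \<comment> \<open>Solved for its middle term, the Serre relation becomes the rewriting rule by
    which both sides are compared.\<close>
  hence 1: "e * (z * e) = sc t (e * (e * z)) + sc t (z * (e * e))"
    using \<open>t * (v + u) = 1\<close> by (simp add: sc_add_right)
  have "e * (z * (e * w)) = (e * (z * e)) * w" for w by (simp add: mult.assoc)
  hence "e * (z * (e * w)) = sc t (e * (e * (z * w))) + sc t (z * (e * (e * w)))" for w
    unfolding 1 by (simp add: distrib_right mult.assoc)
  note 1 = 1 this
  show ?thesis
    unfolding Z_def X_def tw_eqs
    by (simp add: 1 z z[THEN assoc_rule] expand)
qed

text \<open>The case of \<open>fix_B\<close> in which \<open>i\<close> is the long end. Multiplying
  the Serre relation of \<open>e\<close> and \<open>z\<close> by \<open>x\<close> and straightening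
  gives a rule for \<open>z * (M * e)\<close>, and once more by \<open>x\<close> a rule for
  \<open>z * (M * M)\<close>; with these both sides reach the same normal form.\<close>

lemma tw_rank_three_2:
  assumes z: "z * x = x * z" and S: "e * (e * z) - sc (v * v + u * u) (e * (z * e)) + z * (e * e) = 0"
    and Sx: "serre_rel v 2 x e = 0" "e * (e * x) - sc (v * v + u * u) (e * (x * e)) + x * (e * e) = 0"
  defines "Z \<equiv> twr v 2 x e" and "X \<equiv> tw v 2 x e"
  assumes that: "Y = z * e - sc (u * u) (e * z)" "U = z * X - sc (u * u) (X * z)"
  shows "Y * Z - sc (u * u) (Z * Y) = U * e - sc (u * u) (e * U)"
proof -
  define M where "M = mid v x e"
  note 2 = tw_2_commutation[OF Sx(2,1), folded X_def M_def]
  have ex: "e * x = M + sc (u * u) (x * e)" by (simp add: M_def mid_eq)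
  have Xx: "X * x = sc (v * v) (x * X)" using tw_commutation[of 2 x e] Sx(1) by (simp add: X_def power2_eq_square)
  have Mx: "M * x = x * M + sc (v + u) X" using tw2_mid by (simp add: M_def X_def)
  note r = 2 ex Xx Mx z
  define c where "c = t * (v * v - 1)"
  have Z: "Z = sc (u * u) X - sc (u * (1 - u * u)) (x * M) + sc (u - u * u * u) (x * (x * e)) + sc (u * u * u * u * u - u * u * u) (x * (x * e))"
     unfolding Z_def twr_eqs
    by (simp add: r r[THEN assoc_rule] expand)
  have zee: "z * (e * e) = sc (v * v + u * u) (e * (z * e)) - e * (e * z)" using S by (simp add: algebra_simps)
  have "z * (e * (e * x)) = sc (v * v + u * u) (e * (z * (e * x))) - e * (e * (z * x))"
    using assoc_rule[OF zee, of x] by (simp add: left_diff_distrib mult.assoc)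
  hence "sc (v * v + u * u) (z * (M * e)) = sc (v * v + u * u) (sc (u * u) (M * (z * e)) + e * (z * M) - M * (e * z))"
    by (simp add: r r[THEN assoc_rule] zee expand)
  \<comment> \<open>This is the quantum integer 2 at the parameter \<open>v * v\<close>.\<close>
  moreover have "v * v + u * u \<noteq> 0"
  proof -
    have "not_root_of_unity (v * v)"
      using not_root_of_unity_power[OF v, of 2] by (simp add: power2_eq_square)
    from qnum_neq_0[OF this, of 2] qnum_2[OF this] show ?thesis
      by (simp add: u)
  qed
  ultimately have zMe: "z * (M * e) = sc (u * u) (M * (z * e)) + e * (z * M) - M * (e * z)"
    by (rule sc_cancel[rotated])
  have "z * (M * (e * x)) = sc (u * u) (M * (z * (e * x))) + e * (z * (M * x)) - M * (e * (z * x))"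
    using arg_cong[OF zMe, of "\<lambda>w. w * x"] by (simp add: left_diff_distrib distrib_right mult.assoc)
  hence zMM: "z * (M * M) = M * (z * M) + sc (u * u) (M * (z * M)) + sc u (e * (z * X)) + sc v (e * (z * X))
      + sc (u * u * u) (X * (z * e)) + sc (u * u * u * u * u) (X * (z * e)) - M * (M * z)
      - sc u (X * (e * z)) - sc u (z * (X * e)) - sc (u * u * u) (X * (e * z)) - sc (u * u * u) (z * (X * e))"
    by (simp add: r r[THEN assoc_rule] zee zMe expand)
  show ?thesis unfolding that Z
    by (simp add: r r[THEN assoc_rule] zee zMe zMM expand)
      (simp only: mult_2_right distrib_left sc_add_left ac_simps)
qed

end

context scaled_ring
begin

text \<open>\<open>tw\<close> and \<open>twr\<close> apply the formula for 2 to every larger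
  \<open>m\<close>, hence the \<open>min\<close>.\<close>

lemma tw_weight:
  assumes "k * x = sc \<alpha> (x * k)" "k * y = sc \<beta> (y * k)"
  shows "k * tw v (nat m) x y = sc (\<beta> * \<alpha> ^ min 2 (nat m)) (tw v (nat m) x y * k)"
    and "k * twr v (nat m) x y = sc (\<beta> * \<alpha> ^ min 2 (nat m)) (twr v (nat m) x y * k)"
proof -
  note r = assms assms[THEN assoc_rule]
  have "min 2 (nat m) = (if nat m = 0 then 0 else if nat m = 1 then 1 else 2)" by auto
  thus "k * tw v (nat m) x y = sc (\<beta> * \<alpha> ^ min 2 (nat m)) (tw v (nat m) x y * k)"
    "k * twr v (nat m) x y = sc (\<beta> * \<alpha> ^ min 2 (nat m)) (twr v (nat m) x y * k)"
    by (simp_all add: tw_def twr_def r sc_distribs power2_eq_square algebra_simps)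
qed

end

lemma (in scaled_ring) serre_rel_opposite:
  "scaled_ring.serre_rel (op_scale sc) (inverse v) m (op x) (op y) =
    (if m = 1 then op (serre_rel v m x y) else - op (serre_rel v m x y))"
proof -
  interpret o: scaled_ring "op_scale sc" by (rule scaled_ring_opposite)
  show ?thesis
    by (simp add: o.serre_rel_def serre_rel_def op_eq_iff mult.assoc algebra_simps)
qed

context scaled_ring
begin

text \<open>All monomials of the Serre element have strings of the same length, so its top is the
  Serre element of the tops, and a top of 0 is 0. This settles, without a computation in three
  generators, that \<open>T i\<close> respects the Serre relations between two other
  indices.\<close>

lemma serre_top:
  assumes v: "not_root_of_unity v" and x: "top_of v E N x X" and y: "top_of v E M y Y"
    and S: "serre_rel w m x y = 0"
  shows "serre_rel w m X Y = 0"
proof -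
  note mult = top_of_mult[OF v]
  note xx = mult[OF x x] and xy = mult[OF x y] and yx = mult[OF y x]
  note xxy = mult[OF xx y] and xyx = mult[OF xy x] and yxx = mult[OF yx x] and xxx = mult[OF xx x]
  consider "m = 0" | "m = 1" | "m \<noteq> 0" "m \<noteq> 1" by blast
  hence "\<exists>n. top_of v E n (serre_rel w m x y) (serre_rel w m X Y)"
  proof cases
    case 1
    have "top_of v E (N + M) (x * y - y * x) (X * Y - Y * X)"
      by (rule top_of_diff) (use xy yx in \<open>simp_all add: add.commute\<close>)
    thus ?thesis unfolding 1 serre_rel_def by auto
  next
    case 2
    have "top_of v E (N + N + M) (x * x * y - sc (w + inverse w) (x * y * x) + y * x * x)
      (X * X * Y - sc (w + inverse w) (X * Y * X) + Y * X * X)"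
      by (intro top_of_add top_of_diff top_of_sc) (use xxy xyx yxx in \<open>simp_all add: ac_simps\<close>)
    thus ?thesis unfolding 2 serre_rel_def by auto
  next
    case 3
    let ?c = "w ^ 2 + 1 + inverse w ^ 2"
    have "top_of v E (N + N + N + M) (x * x * x * y - sc ?c (x * x * y * x) + sc ?c (x * y * x * x) - y * x * x * x)
      (X * X * X * Y - sc ?c (X * X * Y * X) + sc ?c (X * Y * X * X) - Y * X * X * X)"
      by (intro top_of_add top_of_diff top_of_sc)
        (use mult[OF xxx y] mult[OF xxy x] mult[OF xyx x] mult[OF yxx x] in \<open>simp_all add: ac_simps\<close>)
    with 3 show ?thesis unfolding serre_rel_def by auto
  qed
  thus ?thesis
    using top_of_0[OF v] unfolding S by blast
qed

end

section \<open>Quantum relations and the braid automorphisms\<close>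

text \<open>Besides symmetrisability only those consequences of positive definiteness are kept that
  the braid relations use. \<open>no_triangle\<close> and \<open>no_double\<close> restrict how a
  third index can be attached to two given ones.\<close>

locale cartan_type =
  fixes I :: "'i set" and a :: "'i \<Rightarrow> 'i \<Rightarrow> int" and d :: "'i \<Rightarrow> nat"
  assumes fin: "finite I"
    and diag [simp]: "i \<in> I ==> a i i = 2"
    and off: "i \<in> I ==> j \<in> I ==> i \<noteq> j ==> a i j \<in> {0, - 1, - 2}"
    and d_pos: "i \<in> I ==> 0 < d i"
    and sym: "i \<in> I ==> j \<in> I ==> int (d i) * a i j = int (d j) * a j i"
    and single: "i \<in> I ==> j \<in> I ==> i \<noteq> j ==> a i j = - 2 ==> a j i = - 1"
    and no_triangle: "i \<in> I ==> j \<in> I ==> k \<in> I ==> i \<noteq> j ==> j \<noteq> k ==> i \<noteq> k ==>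
        a i j \<noteq> 0 ==> a i k \<noteq> 0 ==> a j k = 0"
    and no_double: "i \<in> I ==> j \<in> I ==> k \<in> I ==> i \<noteq> j ==> j \<noteq> k ==> i \<noteq> k ==>
        a i j * a j i = 2 ==> a i k \<noteq> - 2"
begin

definition bond :: "'i \<Rightarrow> 'i \<Rightarrow> nat" where "bond i j = nat (- a i j)"

lemma bond_le: "i \<in> I ==> j \<in> I ==> i \<noteq> j ==> bond i j \<le> 2"
  using off[of i j] by (auto simp: bond_def)

lemma a_eq: "i \<in> I ==> j \<in> I ==> i \<noteq> j ==> a i j = - int (bond i j)"
  using off[of i j] by (auto simp: bond_def)

lemma a_0_sym: "i \<in> I ==> j \<in> I ==> a i j = 0 ==> a j i = 0"
  using sym[of i j] d_pos[of j] by auto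

lemma bond_cases [consumes 3, case_names zero one left right]:
  assumes "i \<in> I" "j \<in> I" "i \<noteq> j"
  obtains (zero) "bond i j = 0" "bond j i = 0" | (one) "bond i j = 1" "bond j i = 1" "d i = d j"
    | (left) "bond i j = 2" "bond j i = 1" "d j = 2 * d i"
    | (right) "bond i j = 1" "bond j i = 2" "d i = 2 * d j"
proof -
  have "a i j \<in> {0, - 1, - 2}" "a j i \<in> {0, - 1, - 2}"
    using assms off by auto
  then consider "a i j = 0" | "a i j = - 1" "a j i = - 1" | "a i j = - 1" "a j i = - 2" | "a i j = - 2"
    using a_0_sym[of j i] assms by auto
  thus thesis
  proof cases
    case 1
    thus thesis using zero a_0_sym[of i j] assms by (simp add: bond_def)
  next
    case 2
    thus thesis using one sym[of i j] assms by (simp add: bond_def)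
  next
    case 3
    thus thesis using right sym[of i j] assms by (simp add: bond_def)
  next
    case 4
    thus thesis using left single[of i j] sym[of i j] assms by (simp add: bond_def)
  qed
qed

end

text \<open>A family satisfying the relations of the quantized algebra in some ring, with no claim
  that it generates the ring or satisfies no further relations. So the locale can be instantiated
  with the images under \<open>T i\<close>, in the opposite ring, and with \<open>q\<close>
  inverted.\<close>

locale qrel = cartan_type I a d + scaled_ring sc
  for I :: "'i set" and a d and sc :: "'k::field \<Rightarrow> 'r::ring_1 \<Rightarrow> 'r" +
  fixes q :: 'k and E F K L :: "'i \<Rightarrow> 'r"
  assumes q: "not_root_of_unity q"
    and KL: "i \<in> I ==> K i * L i = 1" and LK: "i \<in> I ==> L i * K i = 1"
    and KK: "i \<in> I ==> j \<in> I ==> K i * K j = K j * K i"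
    and KE: "i \<in> I ==> j \<in> I ==> K i * E j = sc ((q ^ d i) powi a i j) (E j * K i)"
    and KF: "i \<in> I ==> j \<in> I ==> K i * F j = sc ((q ^ d i) powi (- a i j)) (F j * K i)"
    and EF: "i \<in> I ==> j \<in> I ==> E i * F j - F j * E i =
      (if i = j then sc (inverse (q ^ d i - inverse (q ^ d i))) (K i - L i) else 0)"
    and serre_E: "i \<in> I ==> j \<in> I ==> i \<noteq> j ==> serre_rel (q ^ d i) (bond i j) (E i) (E j) = 0"
    and serre_F: "i \<in> I ==> j \<in> I ==> i \<noteq> j ==> serre_rel (q ^ d i) (bond i j) (F i) (F j) = 0"
begin

abbreviation "v i \<equiv> q ^ d i"
abbreviation "u i \<equiv> inverse (q ^ d i)"

definition TE :: "'i \<Rightarrow> 'i \<Rightarrow> 'r" where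
  "TE i j = (if j = i then - (L i * F i) else tw (v i) (bond i j) (E i) (E j))"

definition TF :: "'i \<Rightarrow> 'i \<Rightarrow> 'r" where
  "TF i j = (if j = i then - (E i * K i) else twr (u i) (bond i j) (F i) (F j))"

definition TK :: "'i \<Rightarrow> 'i \<Rightarrow> 'r" where
  "TK i j = (if j = i then L i else K j * K i ^ bond i j)"

definition TL :: "'i \<Rightarrow> 'i \<Rightarrow> 'r" where
  "TL i j = (if j = i then K i else L j * L i ^ bond i j)"

lemma v: "i \<in> I ==> not_root_of_unity (v i)"
  using not_root_of_unity_power[OF q d_pos] .

lemma v_neq_0: "i \<in> I ==> v i \<noteq> 0"
  using v[of i] unfolding not_root_of_unity_def by blast

lemma powi_add: "q powi x * q powi y = q powi (x + y)"
  using q by (simp add: not_root_of_unity_def power_int_add)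

lemma v_sym: "i \<in> I ==> j \<in> I ==> v i powi a i j = v j powi a j i"
proof -
  assume ij: "i \<in> I" "j \<in> I"
  have "v i powi a i j = q powi (int (d i) * a i j)" "v j powi a j i = q powi (int (d j) * a j i)"
    by (simp_all add: power_int_mult)
  thus ?thesis using sym[OF ij] by simp
qed

lemma KL_comm: "i \<in> I ==> j \<in> I ==> K i * L j = L j * K i"
proof -
  assume ij: "i \<in> I" "j \<in> I"
  have "K i * L j = L j * (K j * K i) * L j" using LK[OF ij(2)] by (simp add: mult.assoc[symmetric])
  also have "\<dots> = L j * (K i * (K j * L j))" by (simp only: KK[OF ij(2,1)] mult.assoc)
  finally show ?thesis using KL[OF ij(2)] by simp
qed

lemma LL: "i \<in> I ==> j \<in> I ==> L i * L j = L j * L i"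
proof -
  assume ij: "i \<in> I" "j \<in> I"
  have "L i * L j = L j * (K j * L i) * L j" using LK[OF ij(2)] by (simp add: mult.assoc[symmetric])
  also have "\<dots> = L j * (L i * (K j * L j))" by (simp only: KL_comm[OF ij(2,1)] mult.assoc)
  finally show ?thesis using KL[OF ij(2)] by simp
qed

lemma sl2: "i \<in> I ==> quantum_sl2 sc (v i) (u i) (inverse (v i + u i)) (inverse (v i - u i)) (E i) (F i) (K i) (L i)"
proof (unfold_locales, goal_cases)
  case 1 thus ?case by (rule v)
next
  case 7 thus ?case using KE[of i i] by (simp add: power2_eq_square)
next
  case 8 thus ?case using KF[of i i] by (simp add: power2_eq_square power_int_minus)
next
  case 9 thus ?case using EF[of i i] by (simp add: sc_diff_right algebra_simps)
qed (auto simp: KL LK)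

lemma K_pow_comm: "i \<in> I ==> K i * x = sc c (x * K i) ==> K i ^ n * x = sc (c ^ n) (x * K i ^ n)"
proof (induction n)
  case (Suc n)
  thus ?case
    by (simp add: mult.assoc assoc_rule[OF Suc.prems(2)] mult.commute[of c])
qed simp

lemma lowest: "i \<in> I ==> j \<in> I ==> i \<noteq> j ==> quantum_sl2.lowest sc (u i) (F i) (K i) (bond i j) (E j)"
  using KE[of i j] EF[of j i]
  by (simp add: quantum_sl2.lowest_def[OF sl2] a_eq power_int_minus power_inverse)

lemma highest: "i \<in> I ==> j \<in> I ==> i \<noteq> j ==> quantum_sl2.highest sc (v i) (E i) (K i) (bond i j) (F j)"
  using KF[of i j] EF[of i j]
  by (simp add: quantum_sl2.highest_def[OF sl2] a_eq)

lemma K_tw: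
  assumes "i \<in> I" "j \<in> I" "k \<in> I" "k \<noteq> i"
  shows "K j * tw w (bond i k) (E i) (E k) = sc (v j powi (a j k - a i k * a j i)) (tw w (bond i k) (E i) (E k) * K j)"
proof -
  have "min 2 (nat (- a i k)) = bond i k" using bond_le[of i k] assms by (simp add: bond_def)
  moreover have "v j powi a j k * (v j powi a j i) ^ bond i k = v j powi (a j k - a i k * a j i)"
    using a_eq[of i k] assms
    by (simp add: powi_add power_int_mult[symmetric] power_int_of_nat[symmetric] algebra_simps del: power_int_of_nat)
  ultimately show ?thesis
    using tw_weight(1)[OF KE[of j i] KE[of j k], of w "- a i k"] assms by (simp add: bond_def)
qed

lemma KTE:
  assumes "i \<in> I" "j \<in> I" "k \<in> I"
  shows "K j * TE i k = sc (v j powi (a j k - a i k * a j i)) (TE i k * K j)"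
proof (cases "k = i")
  case True
  have "K j * (L i * F i) = L i * (K j * F i)"
    using KL_comm[of j i] assms by (simp add: mult.assoc[symmetric])
  thus ?thesis using assms True KF[of j i]
    by (simp add: TE_def sc_minus_right mult.assoc KL_comm)
next
  case False
  thus ?thesis using K_tw assms by (simp add: TE_def)
qed

lemma inverse_flip:
  assumes "k * l = (1::'r)" "l * k = 1" "k * x = sc c (x * k)" "c \<noteq> 0" shows "l * x = sc (inverse c) (x * l)"
proof -
  have "x * l = l * (k * x) * l" using assms(2) by (simp add: mult.assoc[symmetric])
  also have "\<dots> = sc c (l * x * (k * l))" unfolding assms(3) by (simp add: mult.assoc)
  finally show ?thesis using assms by simp
qed

lemma TKL: "i \<in> I ==> j \<in> I ==> TK i j * TL i j = 1" "i \<in> I ==> j \<in> I ==> TL i j * TK i j = 1"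
proof -
  assume ij: "i \<in> I" "j \<in> I"
  have 1: "K i ^ n * L i ^ n = 1" "L i ^ n * K i ^ n = 1" for n
    using ij by (simp_all add: left_right_inverse_power KL LK)
  have 2: "K i ^ n * L j = L j * K i ^ n" "L i ^ n * K j = K j * L i ^ n" for n
    using KL_comm ij by (auto intro!: power_commuting_commutes)
  have "K j * K i ^ n * (L j * L i ^ n) = K j * (K i ^ n * L j) * L i ^ n"
    "L j * L i ^ n * (K j * K i ^ n) = L j * (L i ^ n * K j) * K i ^ n" for n
    by (simp_all add: mult.assoc)
  hence "K j * K i ^ n * (L j * L i ^ n) = (K j * L j) * (K i ^ n * L i ^ n)"
    "L j * L i ^ n * (K j * K i ^ n) = (L j * K j) * (L i ^ n * K i ^ n)" for n
    unfolding 2 by (simp_all only: mult.assoc)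
  thus "TK i j * TL i j = 1" "TL i j * TK i j = 1"
    using ij by (simp_all add: TK_def TL_def KL LK 1)
qed

lemma opposite: "qrel I a d (op_scale sc) (inverse q) (\<lambda>i. op (F i)) (\<lambda>i. op (E i)) (\<lambda>i. op (L i)) (\<lambda>i. op (K i))"
proof -
  interpret o: scaled_ring "op_scale sc" by (rule scaled_ring_opposite)
  have nz: "i \<in> I ==> v i powi n \<noteq> 0" for i n using v_neq_0[of i] by (simp add: power_int_not_zero)
  show ?thesis
  proof (unfold_locales, goal_cases)
    case 1 thus ?case by (rule not_root_of_unity_inverse[OF q])
  next
    case (2 i) thus ?case by (simp add: op_eq_iff KL)
  next
    case (3 i) thus ?case by (simp add: op_eq_iff LK)
  next
    case (4 i j) thus ?case by (simp add: op_eq_iff LL)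
  next
    case (5 i j)
    thus ?case using inverse_flip[OF KL LK KF[of i j]] v_neq_0[of i] nz
      by (simp add: op_eq_iff power_inverse power_int_inverse power_int_minus)
  next
    case (6 i j)
    thus ?case using inverse_flip[OF KL LK KE[of i j]] v_neq_0[of i] nz
      by (simp add: op_eq_iff power_inverse power_int_inverse power_int_minus)
  next
    case (7 i j)
    have "inverse (u i - v i) = - inverse (v i - u i)" by (metis inverse_minus_eq minus_diff_eq)
    with 7 show ?case using EF[of j i]
      by (auto simp: op_eq_iff power_inverse sc_distribs)
  next
    case (8 i j)
    thus ?case using serre_F[of i j] by (auto simp: power_inverse serre_rel_opposite op_eq_iff)
  next
    case (9 i j)
    thus ?case using serre_E[of i j] by (auto simp: power_inverse serre_rel_opposite op_eq_iff)
  qed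
qed

text \<open>If \<open>j = i\<close> this is \<open>serre_G\<close>; if \<open>k = i\<close> it is
  one of the reversed forms, according to the type of the bond. Otherwise both arguments are tops of
  strings for \<open>E i\<close>, and \<open>serre_top\<close> applies.\<close>

lemma serre_TE:
  assumes "i \<in> I" "j \<in> I" "k \<in> I" "j \<noteq> k"
  shows "serre_rel (v j) (bond j k) (TE i j) (TE i k) = 0"
proof -
  interpret i: quantum_sl2 sc "v i" "u i" "inverse (v i + u i)" "inverse (v i - u i)" "E i" "F i" "K i" "L i"
    by (rule sl2) fact
  consider "j = i" | "k = i" "j \<noteq> i" | "j \<noteq> i" "k \<noteq> i" by blast
  thus ?thesis
  proof cases
    case 1
    thus ?thesis
      using i.serre_G[OF bond_le lowest, of k] assms by (simp add: TE_def)
  next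
    case 2
    have low: "i.lowest (bond i j) (E j)" by (rule lowest) (use 2 assms in auto)
    have S: "serre_rel (v i) (bond i j) (E i) (E j) = 0" "serre_rel (v j) (bond j i) (E j) (E i) = 0"
      using 2 assms serre_E by auto
    have ij: "i \<noteq> j" using 2 by simp
    from assms(1,2) ij show ?thesis
    proof (cases rule: bond_cases)
      case zero
      thus ?thesis using i.serre_G[of 0 "E j"] low 2
        by (simp add: TE_def serre_rel_def)
    next
      case one
      thus ?thesis using i.serre_G_rev_11[of "E j"] low S 2 by (simp add: TE_def)
    next
      case left
      have vj: "v j = v i * v i" "u j = u i * u i" by (simp_all add: left(3) mult_2 power_add)
      have "serre_rel (v j) 1 x y = x * (x * y) - sc (v i * v i + u i * u i) (x * (y * x)) + y * (x * x)" for x y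
        by (simp add: serre_rel_def vj mult.assoc)
      with i.serre_G_rev_21[of "E j"] show ?thesis using low S 2 left by (simp add: TE_def)
    next
      case right
      have vi: "v j ^ 2 = v i" "u j ^ 2 = u i"
        by (simp_all add: right(3) mult_2 power_add power2_eq_square)
      have "serre_rel (v j) 2 x y = x * (x * (x * y)) - sc (v i + 1 + u i) (x * (x * (y * x))) +
          sc (v i + 1 + u i) (x * (y * (x * x))) - y * (x * (x * x))" for x y
        by (simp add: serre_rel_def vi mult.assoc)
      with i.serre_G_rev_12[of "E j"] show ?thesis using low S 2 right by (simp add: TE_def)
    qed
  next
    case 3
    have "top_of (v i) (E i) (bond i l) (E l) (TE i l)" if "l \<in> I" "l \<noteq> i" for l
      using i.top_of_tw[OF bond_le serre_E, of l] that assms by (simp add: TE_def)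
    thus ?thesis
      using serre_top[OF v[OF assms(1)]] serre_E[of j k] 3 assms by blast
  qed
qed

lemma TEF_diag:
  assumes "i \<in> I"
  shows "TE i i * TF i i - TF i i * TE i i = sc (inverse (v i - u i)) (TK i i - TL i i)"
proof -
  interpret i: quantum_sl2 sc "v i" "u i" "inverse (v i + u i)" "inverse (v i - u i)" "E i" "F i" "K i" "L i"
    by (rule sl2) fact
  show ?thesis
    using i.G_commutator by (simp add: TE_def TF_def TK_def TL_def)
qed

lemma op_sl2:
  "i \<in> I ==> quantum_sl2 (op_scale sc) (u i) (v i) (inverse (v i + u i)) (inverse (u i - v i))
     (op (F i)) (op (E i)) (op (L i)) (op (K i))"
  using qrel.sl2[OF opposite] by (simp add: power_inverse add.commute)

text \<open>\<open>F i\<close> and \<open>L i\<close> both commute up to a scalar with the top of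
  the string of \<open>F k\<close>, and the two scalars are inverse to each other.\<close>

lemma TEF_left:
  assumes "i \<in> I" "k \<in> I" "k \<noteq> i"
  shows "TE i i * TF i k = TF i k * TE i i"
proof -
  interpret i: quantum_sl2 sc "v i" "u i" "inverse (v i + u i)" "inverse (v i - u i)" "E i" "F i" "K i" "L i"
    by (rule sl2) fact
  interpret o: quantum_sl2 "op_scale sc" "u i" "v i" "inverse (v i + u i)" "inverse (u i - v i)" "op (F i)" "op (E i)" "op (L i)" "op (K i)"
    by (rule op_sl2) fact
  define n where "n = bond i k"
  have n: "n \<le> 2" using bond_le assms by (simp add: n_def)
  define Z where "Z = twr (u i) n (F i) (F k)"
  have Z: "op Z = o.tw (u i) n (op (F i)) (op (F k))"
    by (simp add: Z_def tw_opposite scaled_ring_axioms)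
  have "o.serre_rel (u i) n (op (F i)) (op (F k)) = 0"
    using serre_F[of i k, folded n_def] assms by (auto simp: serre_rel_opposite op_eq_iff)
  from o.tw_commutation[OF n this] have FZ: "F i * Z = sc (u i ^ n) (Z * F i)"
    unfolding Z[symmetric] by (simp add: op_eq_iff)
  have "K i * Z = sc (v i ^ n * (u i * u i) ^ min 2 n) (Z * K i)"
    using tw_weight(2)[OF i.KF i.highest_rules(1)[OF highest], of k "u i" "int n"] assms by (simp add: Z_def n_def)
  also have "v i ^ n * (u i * u i) ^ min 2 n = u i ^ n"
    using n v_neq_0[OF assms(1)] by (simp add: min_absorb2 power_mult_distrib[symmetric] mult.assoc[symmetric])
  finally have "K i * Z = sc (u i ^ n) (Z * K i)" .
  hence LZ: "L i * Z = sc (v i ^ n) (Z * L i)"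
    by (rule i.torus_flip) (use v_neq_0[OF assms(1)] in \<open>simp add: power_mult_distrib[symmetric]\<close>)
  have "L i * (F i * Z) = Z * (L i * F i)"
    using v_neq_0[OF assms(1)] by (simp add: FZ LZ LZ[THEN assoc_rule] power_mult_distrib[symmetric] mult.assoc)
  thus ?thesis
    using assms by (simp add: TE_def TF_def Z_def n_def mult.assoc)
qed

lemma TEF_off:
  assumes "i \<in> I" "j \<in> I" "k \<in> I" "j \<noteq> i" "k \<noteq> i" "j \<noteq> k"
  shows "TE i j * TF i k = TF i k * TE i j"
proof -
  interpret i: quantum_sl2 sc "v i" "u i" "inverse (v i + u i)" "inverse (v i - u i)" "E i" "F i" "K i" "L i"
    by (rule sl2) fact
  interpret o: quantum_sl2 "op_scale sc" "u i" "v i" "inverse (v i + u i)" "inverse (u i - v i)" "op (F i)" "op (E i)" "op (L i)" "op (K i)"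
    by (rule op_sl2) fact
  define n where "n = bond i k"
  have n: "n \<le> 2" using bond_le assms by (simp add: n_def)
  define Z where "Z = twr (u i) n (F i) (F k)"
  have Z: "op Z = o.tw (u i) n (op (F i)) (op (F k))"
    by (simp add: Z_def tw_opposite scaled_ring_axioms)
  have low: "o.lowest n (op (F k))"
    using qrel.lowest[OF opposite] assms by (simp add: power_inverse n_def)
  have y: "i.lowest (bond i j) (E j)" using lowest assms by simp
  have jF: "E j * F i = F i * E j" "E j * F k = F k * E j" "E i * F k = F k * E i"
    using EF[of j i] EF[of j k] EF[of i k] assms by simp_all
  have "E j * twr w n (F i) (F k) = twr w n (F i) (F k) * E j" for w
    by (simp add: twr_def distrib_left distrib_right right_diff_distrib left_diff_distrib mult.assoc
      jF jF[THEN assoc_rule])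
  hence jZ: "E j * Z = Z * E j" by (simp add: Z_def)
  have "tw (v i) (bond i j) (E i) (E j) * Z = Z * tw (v i) (bond i j) (E i) (E j)"
  proof -
    consider "n = 0" | "n = 1" | "n = 2" using n by linarith
    thus ?thesis
    proof cases
      case 1
      \<comment> \<open>The string of \<open>F k\<close> has \<open>n + 1\<close> terms; the places
        of missing terms are filled with 0.\<close>
      show ?thesis
        by (rule i.commute_tw_chain[of _ _ _ 0 0 0 0])
          (use bond_le y jZ assms 1 jF in \<open>simp_all add: Z_def twr_def\<close>)
    next
      case 2
      have "E i * Z = Z * E i + sc (v i) (L i * F k)"
        using o.tw_F(1)[of "op (F k)"] low unfolding 2 Z[symmetric, unfolded 2] by (simp add: op_eq_iff)
      thus ?thesis
        by (intro i.commute_tw_chain[of _ _ _ "F k" 0 _ 0])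
          (use bond_le y jZ assms jF in simp_all)
    next
      case 3
      define M where "M = unop (o.mid (u i) (op (F i)) (op (F k)))"
      have M: "op M = o.mid (u i) (op (F i)) (op (F k))" by (simp add: M_def)
      have "E i * Z = Z * E i + sc 1 (L i * M)"
        using o.tw_F(2)[of "op (F k)"] low unfolding 3 M[symmetric] Z[symmetric, unfolded 3] by (simp add: op_eq_iff)
      moreover have "E i * M = M * E i + sc (v i * v i * (u i + v i)) (L i * F k)"
        using o.tw_F(3)[of "op (F k)"] low unfolding 3 M[symmetric] Z[symmetric, unfolded 3] by (simp add: op_eq_iff)
      moreover have "E j * M = M * E j"
        unfolding M_def o.mid_def by (simp add: left_diff_distrib right_diff_distrib mult.assoc jF jF[THEN assoc_rule])
      ultimately show ?thesis
        by (intro i.commute_tw_chain[of _ _ _ M "F k" 1 "v i * v i * (u i + v i)"])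
          (use bond_le y jZ assms jF in simp_all)
    qed
  qed
  thus ?thesis using assms by (simp add: TE_def TF_def Z_def n_def)
qed

lemma TEF_same:
  assumes "i \<in> I" "j \<in> I" "j \<noteq> i"
  shows "TE i j * TF i j - TF i j * TE i j = sc (inverse (v j - u j)) (TK i j - TL i j)"
proof -
  interpret i: quantum_sl2 sc "v i" "u i" "inverse (v i + u i)" "inverse (v i - u i)" "E i" "F i" "K i" "L i"
    by (rule sl2) fact
  have vs: "v j powi a j i = u i ^ bond i j" "v j powi (- a j i) = v i ^ bond i j"
  proof -
    show "v j powi a j i = u i ^ bond i j"
      using v_sym[of i j] a_eq[of i j] assms by (simp add: power_int_minus power_inverse)
    thus "v j powi (- a j i) = v i ^ bond i j" by (simp only: power_int_minus power_inverse inverse_inverse_eq)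
  qed
  have 1: "K j * E i = sc (u i ^ bond i j) (E i * K j)" "K j * F i = sc (v i ^ bond i j) (F i * K j)"
    using KE[of j i] KF[of j i] assms unfolding vs by simp_all
  have 2: "L j * E i = sc (v i ^ bond i j) (E i * L j)" "L j * F i = sc (u i ^ bond i j) (F i * L j)"
    using inverse_flip[OF KL LK 1(1)] inverse_flip[OF KL LK 1(2)] assms v_neq_0[of i]
    by (simp_all add: power_inverse)
  have "E j * F j = F j * E j + sc (inverse (v j - u j)) (K j) - sc (inverse (v j - u j)) (L j)"
    using EF[of j j] assms by (simp add: sc_diff_right algebra_simps)
  from i.commutator_tw_twr[OF bond_le lowest highest this 1(1) 1(2) KK _ 2(1) 2(2) _ LL]
  show ?thesis using assms KL_comm
    by (simp add: TE_def TF_def TK_def TL_def sc_diff_right)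
qed

lemma opposite_T:
  assumes "i \<in> I"
  shows "qrel.TE a d (op_scale sc) (inverse q) (\<lambda>i. op (F i)) (\<lambda>i. op (E i)) (\<lambda>i. op (K i)) i j = op (TF i j)"
    and "qrel.TF a d (op_scale sc) (inverse q) (\<lambda>i. op (F i)) (\<lambda>i. op (E i)) (\<lambda>i. op (L i)) i j = op (TE i j)"
proof -
  interpret o: qrel I a d "op_scale sc" "inverse q" "\<lambda>i. op (F i)" "\<lambda>i. op (E i)" "\<lambda>i. op (L i)" "\<lambda>i. op (K i)"
    by (rule opposite)
  show "o.TE i j = op (TF i j)" "o.TF i j = op (TE i j)"
    by (simp_all add: TE_def TF_def o.TE_def o.TF_def power_inverse tw_opposite scaled_ring_axioms)
      (simp_all add: op_eq_iff)
qed

lemma TEF_right: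
  assumes "i \<in> I" "k \<in> I" "k \<noteq> i"
  shows "TE i k * TF i i = TF i i * TE i k"
  using qrel.TEF_left[OF opposite assms] unfolding opposite_T[OF assms(1)] by (simp add: op_eq_iff)

lemma serre_TF:
  assumes "i \<in> I" "j \<in> I" "k \<in> I" "j \<noteq> k"
  shows "serre_rel (v j) (bond j k) (TF i j) (TF i k) = 0"
  using qrel.serre_TE[OF opposite assms] unfolding opposite_T[OF assms(1)]
  by (auto simp: power_inverse serre_rel_opposite op_eq_iff split: if_splits)

lemma TEF:
  assumes "i \<in> I" "j \<in> I" "k \<in> I"
  shows "TE i j * TF i k - TF i k * TE i j = (if j = k then sc (inverse (v j - u j)) (TK i j - TL i j) else 0)"
  using TEF_diag[of i] TEF_left[of i k] TEF_right[of i j] TEF_off[of i j k] TEF_same[of i j] assms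
  by (cases "j = i"; cases "k = i") auto

lemma KTF:
  assumes "i \<in> I" "j \<in> I" "k \<in> I"
  shows "K j * TF i k = sc (v j powi (- (a j k - a i k * a j i))) (TF i k * K j)"
proof -
  obtain w where w: "w = v j powi (a j k - a i k * a j i)" and nz: "w \<noteq> 0"
    using v_neq_0[OF assms(2)] power_int_not_zero by blast
  have "op (L j) * op (TF i k) = op_scale sc (inverse (v j) powi (a j k - a i k * a j i)) (op (TF i k) * op (L j))"
    using qrel.KTE[OF opposite assms] unfolding opposite_T[OF assms(1)] by (simp add: power_inverse)
  hence "TF i k * L j = sc (inverse w) (L j * TF i k)"
    by (simp add: op_eq_iff w power_int_inverse)
  hence "L j * TF i k = sc w (TF i k * L j)"
    using nz by simp
  from inverse_flip[OF LK KL this nz] show ?thesis using assms by (simp only: power_int_minus w)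
qed

text \<open>\<open>s\<close> is 1 for images of \<open>E k\<close> and -1 for images of
  \<open>F k\<close>. The exponent in the hypothesis belongs to the simple root of \<open>k\<close>
  reflected at \<open>i\<close>, and the claim expresses the invariance of the form under that
  reflection.\<close>

lemma TK_comm:
  assumes "i \<in> I" "j \<in> I" "k \<in> I" and x: "\<And>l. l \<in> I ==> K l * x = sc (v l powi (s * (a l k - a i k * a l i))) (x * K l)"
  shows "TK i j * x = sc (v j powi (s * a j k)) (x * TK i j)"
proof (cases "j = i")
  case True
  have "L i * x = sc (inverse (v i powi (s * (a i k - a i k * a i i)))) (x * L i)"
    by (rule inverse_flip[OF KL LK x]) (use assms v_neq_0 in auto)
  moreover have "inverse (v i powi (s * (a i k - a i k * a i i))) = v i powi (s * a i k)"
    using assms by (simp add: power_int_minus[symmetric] algebra_simps)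
  ultimately show ?thesis using True by (simp add: TK_def)
next
  case False
  define m where "m = bond i j"
  have m: "a i j = - int m" using a_eq[of i j] False assms by (simp add: m_def)
  have 1: "K i ^ m * x = sc ((v i powi (s * (a i k - a i k * a i i))) ^ m) (x * K i ^ m)"
    by (rule K_pow_comm) (use assms in auto)
  have "(v i powi (s * (a i k - a i k * a i i))) ^ m = v i powi (a i j * (s * a i k))"
    using assms by (simp add: m power_int_mult[symmetric] power_int_of_nat[symmetric] algebra_simps del: power_int_of_nat)
  also have "\<dots> = v j powi (s * (a i k * a j i))"
  proof -
    have "int (d i) * (a i j * (s * a i k)) = int (d i) * a i j * (s * a i k)" by (simp only: mult.assoc)
    also have "\<dots> = int (d j) * (s * (a i k * a j i))" unfolding sym[OF assms(1,2)] by (simp only: mult_ac)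
    finally have e: "int (d i) * (a i j * (s * a i k)) = int (d j) * (s * (a i k * a j i))" .
    have "v l powi n = q powi (int (d l) * n)" for l n by (simp only: power_int_mult power_int_of_nat)
    thus ?thesis by (simp only: e)
  qed
  finally have 2: "(v i powi (s * (a i k - a i k * a i i))) ^ m = v j powi (s * (a i k * a j i))" .
  have "K j * K i ^ m * x = sc (v j powi (s * (a i k * a j i)) * v j powi (s * (a j k - a i k * a j i))) (x * (K j * K i ^ m))"
    using 1 unfolding 2 by (simp add: mult.assoc x[OF assms(2)] x[OF assms(2), THEN assoc_rule])
  also have "v j powi (s * (a i k * a j i)) * v j powi (s * (a j k - a i k * a j i)) = v j powi (s * a j k)"
    using v_neq_0[OF assms(2)] by (simp add: power_int_add[symmetric] algebra_simps)
  finally show ?thesis using False by (simp add: TK_def m_def)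
qed

text \<open>This is what makes Lusztig's \<open>T i\<close> well defined, since a
  \<open>qrel\<close> family amounts to a homomorphism out of the algebra
  (\<open>qrel_iff\<close>).\<close>

theorem T_qrel:
  assumes "i \<in> I"
  shows "qrel I a d sc q (TE i) (TF i) (TK i) (TL i)"
proof (unfold_locales, goal_cases)
  case 1
  show ?case by (rule q)
next
  case (2 j)
  thus ?case using TKL assms by simp
next
  case (3 j)
  thus ?case using TKL assms by simp
next
  case (4 j k)
  have 1: "K l * K i ^ n = K i ^ n * K l" if "l \<in> I" for l n
    using KK[of i l] assms that by (metis power_commuting_commutes)
  have 2: "L i * (K l * K i ^ n) = K l * K i ^ n * L i" if "l \<in> I" for l n
  proof -
    have "K i ^ n * L i = L i * K i ^ n"
      by (rule power_commuting_commutes) (simp add: assms KL LK)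
    hence "K l * K i ^ n * L i = K l * L i * K i ^ n" by (simp add: mult.assoc)
    thus ?thesis using KL_comm[of l i] that assms by (simp add: mult.assoc)
  qed
  have "K j * K i ^ m * (K k * K i ^ n) = K k * K i ^ n * (K j * K i ^ m)" for m n
  proof -
    have 3: "K i ^ m * K i ^ n = K i ^ n * K i ^ m" by (simp only: power_add[symmetric] add.commute)
    have "K j * K i ^ m * (K k * K i ^ n) = K j * (K i ^ m * K k) * K i ^ n" by (simp only: mult.assoc)
    also have "\<dots> = (K j * K k) * (K i ^ m * K i ^ n)" unfolding 1[OF 4(2), symmetric] by (simp only: mult.assoc)
    also have "\<dots> = K k * (K j * K i ^ n) * K i ^ m" unfolding KK[OF 4] 3 by (simp only: mult.assoc)
    also have "K j * K i ^ n = K i ^ n * K j" by (rule 1[OF 4(1)])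
    also have "K k * (K i ^ n * K j) * K i ^ m = K k * K i ^ n * (K j * K i ^ m)" by (simp only: mult.assoc)
    finally show ?thesis .
  qed
  thus ?case using 2 4 by (simp add: TK_def)
next
  case (5 j k)
  thus ?case using TK_comm[OF assms 5, of "TE i k" 1] KTE assms by simp
next
  case (6 j k)
  thus ?case using TK_comm[OF assms 6, of "TF i k" "- 1"] KTF assms by simp
next
  case (7 j k)
  thus ?case using TEF assms by simp
next
  case (8 j k)
  thus ?case using serre_TE assms by simp
next
  case (9 j k)
  thus ?case using serre_TF assms by simp
qed

end

section \<open>Evaluation of noncommutative polynomials\<close>

abbreviation "keys \<equiv> Poly_Mapping.keys"
abbreviation "lookup \<equiv> Poly_Mapping.lookup"
abbreviation "single \<equiv> Poly_Mapping.single"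

lemma poly_mapping_sum_single:
  "x = (\<Sum>w\<in>keys x. single w (lookup x w))"
  by (rule poly_mapping_eqI) (simp add: lookup_sum lookup_single when_def in_keys_iff sum.delta)

context scaled_ring
begin

definition eval_word :: "('g \<Rightarrow> 'r) \<Rightarrow> 'g word \<Rightarrow> 'r" where
  "eval_word g w = prod_list (map g (letters w))"

definition lift :: "('g \<Rightarrow> 'r) \<Rightarrow> ('g word \<Rightarrow>\<^sub>0 'k) \<Rightarrow> 'r" where
  "lift g x = (\<Sum>w\<in>keys x. sc (lookup x w) (eval_word g w))"

lemma eval_word_0 [simp]: "eval_word g 0 = 1"
  by (simp add: eval_word_def zero_word_def)

lemma eval_word_add: "eval_word g (u + w) = eval_word g u * eval_word g w"
  by (simp add: eval_word_def plus_word_def)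

lemma lift_superset:
  assumes "finite A" "keys x \<subseteq> A"
  shows "lift g x = (\<Sum>w\<in>A. sc (lookup x w) (eval_word g w))"
  unfolding lift_def by (rule sum.mono_neutral_left) (use assms in \<open>auto simp: in_keys_iff\<close>)

lemma lift_add: "lift g (x + y) = lift g x + lift g y"
proof -
  let ?A = "keys x \<union> keys y"
  have "lift g (x + y) = (\<Sum>w\<in>?A. sc (lookup (x + y) w) (eval_word g w))"
    by (rule lift_superset) (auto simp: Poly_Mapping.keys_add)
  also have "\<dots> = (\<Sum>w\<in>?A. sc (lookup x w) (eval_word g w)) + (\<Sum>w\<in>?A. sc (lookup y w) (eval_word g w))"
    by (simp add: lookup_add sc_add_left sum.distrib)
  also have "\<dots> = lift g x + lift g y"
    by (simp add: lift_superset[of ?A])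
  finally show ?thesis .
qed

lemma lift_0 [simp]: "lift g 0 = 0"
  by (simp add: lift_def)

lemma lift_uminus: "lift g (- x) = - lift g x"
  using lift_add[of g x "- x"] by (simp add: eq_neg_iff_add_eq_0 add.commute)

lemma lift_diff: "lift g (x - y) = lift g x - lift g y"
  using lift_add[of g x "- y"] by (simp add: lift_uminus)

lemma lift_sum: "lift g (sum f A) = (\<Sum>a\<in>A. lift g (f a))"
  by (induction A rule: infinite_finite_induct) (auto simp: lift_add)

lemma lift_single: "lift g (single w c) = sc c (eval_word g w)"
  by (cases "c = 0") (simp_all add: lift_def)

lemma lift_1 [simp]: "lift g 1 = 1"
  using lift_single[of g 0 1] by simp

lemma lift_mult: "lift g (x * y) = lift g x * lift g y"
proof -
  note x = poly_mapping_sum_single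
  have "lift g (single w c * y) = sc c (eval_word g w) * lift g y" for w c
  proof -
    have "lift g (single w c * y) = lift g (\<Sum>v\<in>keys y. single (w + v) (c * lookup y v))"
      by (subst x[of y]) (simp add: sum_distrib_left mult_single)
    also have "\<dots> = (\<Sum>v\<in>keys y. sc c (eval_word g w) * sc (lookup y v) (eval_word g v))"
      by (simp add: lift_sum lift_single eval_word_add mult.commute)
    finally show ?thesis by (simp add: lift_def sum_distrib_left)
  qed
  hence "lift g ((\<Sum>w\<in>keys x. single w (lookup x w)) * y) = lift g x * lift g y"
    by (simp add: sum_distrib_right lift_sum lift_def[of g x])
  thus ?thesis by (simp only: poly_mapping_sum_single[symmetric])
qed

lemma lift_power: "lift g (x ^ n) = lift g x ^ n"
  by (induction n) (simp_all add: lift_mult)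

end

section \<open>The algebra as a type\<close>

text \<open>Equalities in \<open>uq C\<close> are proved in a ring whose carrier is a type. Since a type cannot
  depend on \<open>C\<close>, all the quotients are put together into one product ring, and \<open>uq C\<close> is
  embedded into it by the trivial representation \<open>E, F \<mapsto> 0\<close>, \<open>K \<mapsto> 1\<close> on the components
  other than \<open>C\<close>.\<close>

inductive_set rel_ideal :: "'i cartan_datum \<Rightarrow> 'i falg set" for C where
  rel: "x \<in> uq_relators C ==> x \<in> rel_ideal C"
| zero: "0 \<in> rel_ideal C"
| add: "x \<in> rel_ideal C ==> y \<in> rel_ideal C ==> x + y \<in> rel_ideal C"
| left: "x \<in> rel_ideal C ==> y * x \<in> rel_ideal C"
| right: "x \<in> rel_ideal C ==> x * y \<in> rel_ideal C"

lemma rel_ideal_uminus: "x \<in> rel_ideal C ==> - x \<in> rel_ideal C"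
  using rel_ideal.left[of x C "- 1"] by simp

lemma rel_ideal_diff: "x \<in> rel_ideal C ==> y \<in> rel_ideal C ==> x - y \<in> rel_ideal C"
  using rel_ideal.add[OF _ rel_ideal_uminus, of x C y] by simp

quotient_type 'i uqt = "'i cartan_datum \<Rightarrow> 'i falg" / "\<lambda>f g. \<forall>C. f C - g C \<in> rel_ideal C"
proof (rule equivpI)
  show "reflp (\<lambda>f g. \<forall>C :: 'i cartan_datum. f C - g C \<in> rel_ideal C)"
    by (auto simp: reflp_def rel_ideal.zero)
  show "symp (\<lambda>f g. \<forall>C :: 'i cartan_datum. f C - g C \<in> rel_ideal C)"
  proof (intro sympI allI)
    fix f g :: "'i cartan_datum \<Rightarrow> 'i falg" and C assume "\<forall>C. f C - g C \<in> rel_ideal C"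
    hence "- (f C - g C) \<in> rel_ideal C" by (blast intro: rel_ideal_uminus)
    thus "g C - f C \<in> rel_ideal C" by simp
  qed
  show "transp (\<lambda>f g. \<forall>C :: 'i cartan_datum. f C - g C \<in> rel_ideal C)"
  proof (intro transpI allI)
    fix f g h :: "'i cartan_datum \<Rightarrow> 'i falg" and C
    assume "\<forall>C. f C - g C \<in> rel_ideal C" "\<forall>C. g C - h C \<in> rel_ideal C"
    hence "(f C - g C) + (g C - h C) \<in> rel_ideal C" by (blast intro: rel_ideal.add)
    thus "f C - h C \<in> rel_ideal C" by simp
  qed
qed

lemma rel_ideal_cong:
  assumes "x - x' \<in> rel_ideal C"
  shows "y - y' \<in> rel_ideal C ==> x + y - (x' + y') \<in> rel_ideal C"
    and "y - y' \<in> rel_ideal C ==> x - y - (x' - y') \<in> rel_ideal C"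
    and "y - y' \<in> rel_ideal C ==> x * y - x' * y' \<in> rel_ideal C"
    and "- x - - x' \<in> rel_ideal C"
proof -
  show "- x - - x' \<in> rel_ideal C" using rel_ideal_uminus[OF assms] by simp
  assume y: "y - y' \<in> rel_ideal C"
  show "x + y - (x' + y') \<in> rel_ideal C" using rel_ideal.add[OF assms y] by (simp add: algebra_simps)
  show "x - y - (x' - y') \<in> rel_ideal C" using rel_ideal_diff[OF assms y] by (simp add: algebra_simps)
  show "x * y - x' * y' \<in> rel_ideal C"
    using rel_ideal.add[OF rel_ideal.right[OF assms, of y] rel_ideal.left[OF y, of x']] by (simp add: algebra_simps)
qed

lemma rel_ideal_empty: "index C = {} ==> x \<in> rel_ideal C ==> x = 0"
  by (rotate_tac, induction x rule: rel_ideal.induct) (auto simp: uq_relators_def)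

instantiation uqt :: (type) ring_1
begin

lift_definition zero_uqt :: "'a uqt" is "\<lambda>_. 0" .
lift_definition one_uqt :: "'a uqt" is "\<lambda>_. 1" .
lift_definition plus_uqt :: "'a uqt \<Rightarrow> 'a uqt \<Rightarrow> 'a uqt" is "\<lambda>f g C. f C + g C"
  by (simp add: rel_ideal_cong)
lift_definition minus_uqt :: "'a uqt \<Rightarrow> 'a uqt \<Rightarrow> 'a uqt" is "\<lambda>f g C. f C - g C"
  by (simp add: rel_ideal_cong)
lift_definition uminus_uqt :: "'a uqt \<Rightarrow> 'a uqt" is "\<lambda>f C. - f C"
  using rel_ideal_cong(4) by blast
lift_definition times_uqt :: "'a uqt \<Rightarrow> 'a uqt \<Rightarrow> 'a uqt" is "\<lambda>f g C. f C * g C"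
  by (simp add: rel_ideal_cong)

instance
proof
  fix x y z :: "'a uqt"
  show "x + y + z = x + (y + z)" "x + y = y + x" by (transfer, simp add: rel_ideal.zero algebra_simps)+
  show "0 + x = x" "- x + x = 0" "x - y = x + - y" "x * y * z = x * (y * z)" "1 * x = x" "x * 1 = x"
    "(x + y) * z = x * z + y * z" "x * (y + z) = x * y + x * z"
    by (transfer, simp add: rel_ideal.zero mult.assoc distrib_right distrib_left)+
  show "(0 :: 'a uqt) \<noteq> 1"
  proof (transfer, rule notI)
    assume "\<forall>C :: 'a cartan_datum. (0 :: 'a falg) - 1 \<in> rel_ideal C"
    \<comment> \<open>For the empty index set there are no relators, so that component is the free
      algebra itself and is nonzero.\<close>
    hence "(0 :: 'a falg) - 1 \<in> rel_ideal \<lparr>index = {}, cartan = \<lambda>_ _. 0, symm = \<lambda>_. 0\<rparr>" by blast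
    from rel_ideal_empty[OF _ this] show False by simp
  qed
qed

end

lemma rel_ideal_left_diff: "x - x' \<in> rel_ideal C ==> y * x - y * x' \<in> rel_ideal C"
  using rel_ideal.left[of "x - x'" C y] by (simp add: right_diff_distrib)

lemma rel_ideal_trans: "x - y \<in> rel_ideal C ==> y - z \<in> rel_ideal C ==> x - z \<in> rel_ideal C"
  using rel_ideal.add[of "x - y" C "y - z"] by simp

lemma rel_ideal_sym: "x - y \<in> rel_ideal C ==> y - x \<in> rel_ideal C"
  using rel_ideal_uminus[of "x - y" C] by simp

lemma rel_ideal_iff: "x - y \<in> rel_ideal C ==> x - z \<in> rel_ideal C \<longleftrightarrow> y - z \<in> rel_ideal C"
  using rel_ideal_trans[of x y C z] rel_ideal_trans[OF rel_ideal_sym, of x y C z] by blast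

lift_definition uscale :: "qfield \<Rightarrow> 'i uqt \<Rightarrow> 'i uqt" is "\<lambda>c f C. fconst c * f C"
  by (simp add: rel_ideal_left_diff)

text \<open>Relates an element to all representatives of its component at \<open>C\<close>, which
  respects the quotient without any choice.\<close>

lift_definition at_datum :: "'i cartan_datum \<Rightarrow> 'i uqt \<Rightarrow> 'i falg \<Rightarrow> bool" is "\<lambda>C f x. f C - x \<in> rel_ideal C"
  by (rule ext) (simp add: rel_ideal_iff)

lemma fconst_simps [simp]: "fconst 0 = 0" "fconst 1 = 1" "fconst c * fconst e = fconst (c * e)"
  "fconst (c + e) = fconst c + fconst e"
  by (simp_all add: fconst_def mult_single single_add)

lemma fconst_central: "x * fconst c = fconst c * x"
proof -
  have "(\<Sum>w\<in>keys x. single w (lookup x w)) * fconst c =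
    fconst c * (\<Sum>w\<in>keys x. single w (lookup x w))"
    by (simp add: sum_distrib_left sum_distrib_right fconst_def mult_single mult.commute)
  thus ?thesis by (simp only: poly_mapping_sum_single[symmetric])
qed

definition fscale :: "qfield \<Rightarrow> 'i falg \<Rightarrow> 'i falg" where
  "fscale c x = fconst c * x"

interpretation falg: scaled_ring fscale
proof
  fix c e :: qfield and x y :: "'i falg"
  show "fscale c (x + y) = fscale c x + fscale c y" "fscale (c + e) x = fscale c x + fscale e x" "fscale 1 x = x"
    "fscale c x * y = fscale c (x * y)"
    by (simp_all add: fscale_def distrib_left distrib_right mult.assoc)
  show "fscale c (fscale e x) = fscale (c * e) x"
    by (simp add: fscale_def mult.assoc[symmetric])
  show "x * fscale c y = fscale c (x * y)"
    by (simp add: fscale_def mult.assoc[symmetric] fconst_central)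
qed

interpretation uqt: scaled_ring uscale
proof
  fix c e :: qfield and x y :: "'i uqt"
  show "uscale c (x + y) = uscale c x + uscale c y" by transfer (simp add: rel_ideal.zero distrib_left)
  show "uscale (c + e) x = uscale c x + uscale e x" by transfer (simp add: rel_ideal.zero distrib_right)
  show "uscale c (uscale e x) = uscale (c * e) x" by transfer (simp add: rel_ideal.zero flip: mult.assoc)
  show "uscale 1 x = x" by transfer (simp add: rel_ideal.zero)
  show "uscale c x * y = uscale c (x * y)" by transfer (simp add: rel_ideal.zero mult.assoc)
  show "x * uscale c y = uscale c (x * y)"
    by transfer (simp add: rel_ideal.zero fconst_central flip: mult.assoc)
qed

lemma free_hom_eq: "free_hom f = falg.lift f"
  by (simp add: fun_eq_iff free_hom_def falg.lift_def falg.eval_word_def fscale_def)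

lemma uqt_exhaust: obtains f where "r = abs_uqt f"
  by (induct r rule: uqt.abs_induct) blast

lemma at_datum_intros:
  "at_datum C 0 0" "at_datum C 1 1"
  "at_datum C r x ==> at_datum C s y ==> at_datum C (r + s) (x + y)"
  "at_datum C r x ==> at_datum C s y ==> at_datum C (r - s) (x - y)"
  "at_datum C r x ==> at_datum C s y ==> at_datum C (r * s) (x * y)"
  "at_datum C r x ==> at_datum C (uscale c r) (fscale c x)"
  by (rule uqt_exhaust[of r], rule uqt_exhaust[of s],
    simp add: zero_uqt_def one_uqt_def plus_uqt.abs_eq minus_uqt.abs_eq times_uqt.abs_eq uscale.abs_eq at_datum.abs_eq
      rel_ideal.zero rel_ideal_cong rel_ideal_left_diff fscale_def)+

lemma at_datum_unique: "at_datum C r x ==> at_datum C r y \<longleftrightarrow> x - y \<in> rel_ideal C"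
  by (rule uqt_exhaust[of r]) (simp add: at_datum.abs_eq rel_ideal_iff)

lemma at_datum_exists: "\<exists>x. at_datum C r x"
proof (rule uqt_exhaust[of r])
  fix f assume "r = abs_uqt f"
  hence "at_datum C r (f C)" by (simp add: at_datum.abs_eq rel_ideal.zero)
  thus ?thesis ..
qed

lemma uqt_eqI:
  assumes "\<And>C. \<exists>x. at_datum C r x \<and> at_datum C s x" shows "r = s"
proof (rule uqt_exhaust[of r], rule uqt_exhaust[of s])
  fix f g assume r: "r = abs_uqt f" and s: "s = abs_uqt g"
  have "f C - g C \<in> rel_ideal C" for C
  proof -
    obtain x where "f C - x \<in> rel_ideal C" "g C - x \<in> rel_ideal C"
      using assms[of C] unfolding r s at_datum.abs_eq by blast
    thus ?thesis by (rule rel_ideal_trans[OF _ rel_ideal_sym])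
  qed
  thus "r = s" unfolding r s by (simp add: uqt.abs_eq_iff)
qed

lemma at_datum_lift:
  assumes "\<And>g. at_datum C (f g) (f' g)"
  shows "at_datum C (uqt.lift f x) (falg.lift f' x)"
proof -
  have "at_datum C (uqt.eval_word f w) (falg.eval_word f' w)" for w
  proof -
    have "at_datum C (prod_list (map f xs)) (prod_list (map f' xs))" for xs
      by (induction xs) (use assms in \<open>simp_all add: at_datum_intros\<close>)
    thus ?thesis by (simp add: uqt.eval_word_def falg.eval_word_def)
  qed
  hence "at_datum C (\<Sum>w\<in>A. uscale (c w) (uqt.eval_word f w)) (\<Sum>w\<in>A. fscale (c w) (falg.eval_word f' w))" for A c
    by (induction A rule: infinite_finite_induct) (simp_all add: at_datum_intros)
  thus ?thesis by (simp add: uqt.lift_def falg.lift_def)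
qed

lemma falg_eval_word: "falg.eval_word fgen w = single w 1"
proof -
  have "prod_list (map fgen xs) = single (Word xs) 1" for xs :: "'i qgen list"
    by (induction xs) (simp_all add: fgen_def mult_single plus_word_def flip: zero_word_def single_one)
  from this[of "letters w"] show ?thesis by (cases w) (simp add: falg.eval_word_def)
qed

lemma falg_lift_fgen: "falg.lift fgen x = x"
proof (rule poly_mapping_eqI)
  fix w
  show "lookup (falg.lift fgen x) w = lookup x w"
    unfolding falg.lift_def falg_eval_word fscale_def fconst_def
    by (simp add: mult_single lookup_sum lookup_single when_def in_keys_iff sum.delta)
qed

definition trivial_gen :: "'i qgen \<Rightarrow> 'i falg" where
  "trivial_gen g = (case g of Kgen _ \<Rightarrow> 1 | Kinv _ \<Rightarrow> 1 | _ \<Rightarrow> 0)"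

lift_definition ugen :: "'i cartan_datum \<Rightarrow> 'i qgen \<Rightarrow> 'i uqt" is
  "\<lambda>C g C'. if C' = C then fgen g else trivial_gen g" .

definition embed :: "'i cartan_datum \<Rightarrow> 'i falg \<Rightarrow> 'i uqt" where
  "embed C = uqt.lift (ugen C)"

lemma at_datum_embed: "at_datum C (embed C x) x"
proof -
  have "at_datum C (ugen C g) (fgen g)" for g by (simp add: ugen_def at_datum.abs_eq rel_ideal.zero)
  from at_datum_lift[of C "ugen C" fgen x] this show ?thesis by (simp add: embed_def falg_lift_fgen)
qed

locale qscaled_ring = scaled_ring sc for sc :: "qfield \<Rightarrow> 'r::ring_1 \<Rightarrow> 'r"
begin

lemma lift_fgen: "lift g (fgen x) = g x"
  by (simp add: fgen_def lift_single eval_word_def)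

lemma lift_fconst: "lift g (fconst c) = sc c 1"
  by (simp add: fconst_def lift_single)

lemma lift_fscale: "lift g (fscale c x) = sc c (lift g x)"
  by (simp add: fscale_def lift_mult lift_fconst)

lemmas lift_simps = lift_fgen lift_fconst lift_add lift_diff lift_uminus lift_mult lift_power lift_sum

lemma lift_generators: "lift g (fE i) = g (Egen i)" "lift g (fF i) = g (Fgen i)"
  "lift g (fK i) = g (Kgen i)" "lift g (fKinv i) = g (Kinv i)"
  by (simp_all add: fE_def fF_def fK_def fKinv_def lift_fgen)

lemma lift_rel_ideal:
  assumes "\<And>r. r \<in> uq_relators C ==> lift g r = 0" "x \<in> rel_ideal C"
  shows "lift g x = 0"
  using assms(2) by induction (simp_all add: assms(1) lift_add lift_mult)

lemma lift_free_hom: "lift g (free_hom f x) = lift (\<lambda>y. lift g (f y)) x"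
proof -
  have "lift g (falg.eval_word f w) = eval_word (\<lambda>y. lift g (f y)) w" for w
  proof -
    have "lift g (prod_list (map f xs)) = prod_list (map (\<lambda>y. lift g (f y)) xs)" for xs
      by (induction xs) (simp_all add: lift_mult)
    thus ?thesis by (simp add: falg.eval_word_def eval_word_def)
  qed
  thus ?thesis
    by (simp add: free_hom_eq falg.lift_def lift_sum lift_fscale lift_def[of "\<lambda>y. lift g (f y)"])
qed

lemma qint_eq: "qint v n = qnum v n"
  by (simp add: qint_def qnum_def)

lemma qfact_eqs: assumes "not_root_of_unity v"
  shows "qfact v 0 = 1" "qfact v 1 = 1" "qfact v (Suc 0) = 1" "qfact v 2 = v + inverse v" "qfact v 3 = (v + inverse v) * (v ^ 2 + 1 + inverse v ^ 2)"
  using qnum_1[OF assms] qnum_2[OF assms] qnum_3[OF assms]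
  by (simp_all add: qfact_def qint_eq numeral_2_eq_2 numeral_3_eq_3)

lemma lift_serre_eq:
  assumes v: "not_root_of_unity (qi C i)" and m: "nat (- cartan C i j) \<le> 2" "cartan C i j \<le> 0"
    and Y: "lift g (Y i) = x" "lift g (Y j) = y"
  shows "\<exists>c. c \<noteq> 0 \<and> lift g (serre C Y i j) = sc c (serre_rel (qi C i) (nat (- cartan C i j)) x y)"
proof -
  let ?v = "qi C i"
  have 2: "?v + inverse ?v \<noteq> 0" using qnum_neq_0[OF v, of 2] qnum_2[OF v] by simp
  have 3: "?v ^ 2 + 1 + inverse ?v ^ 2 \<noteq> 0" using qnum_neq_0[OF v, of 3] qnum_3[OF v] by simp
  consider "cartan C i j = 0" | "cartan C i j = - 1" | "cartan C i j = - 2" using m by linarith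
  thus ?thesis
  proof cases
    case 1
    have "lift g (serre C Y i j) = - serre_rel ?v 0 x y"
      by (simp add: 1 serre_def divpow_def lift_simps Y qfact_eqs[OF v] serre_rel_def sc_distribs)
    thus ?thesis by (intro exI[of _ "- 1"]) (simp add: 1 sc_minus_left)
  next
    case 2
    obtain c where c: "c = ?v + inverse ?v" by simp
    have f: "qfact ?v (Suc (Suc 0)) = c" "qfact ?v (Suc 0) = 1" "qfact ?v 0 = 1"
      using qfact_eqs[OF v] by (simp_all add: c numeral_2_eq_2)
    have S: "serre_rel ?v 1 x y = x * x * y - sc c (x * y * x) + y * x * x"
      by (simp add: serre_rel_def c)
    have "nat (1 - cartan C i j) = 2" "c \<noteq> 0" using 2 \<open>?v + inverse ?v \<noteq> 0\<close> by (simp_all add: c)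
    hence "lift g (serre C Y i j) = sc (inverse c) (serre_rel ?v 1 x y)"
      unfolding S serre_def divpow_def Let_def
      by (simp add: lift_simps Y numeral_2_eq_2 f sc_distribs mult.assoc)
    thus ?thesis using \<open>c \<noteq> 0\<close> by (intro exI[of _ "inverse c"]) (simp add: 2)
  next
    case 3
    obtain b c where bc: "b = ?v + inverse ?v" "c = ?v ^ 2 + 1 + inverse ?v ^ 2" by simp
    have f: "qfact ?v (Suc (Suc (Suc 0))) = b * c" "qfact ?v (Suc (Suc 0)) = b" "qfact ?v (Suc 0) = 1" "qfact ?v 0 = 1"
      using qfact_eqs[OF v] by (simp_all add: bc numeral_2_eq_2 numeral_3_eq_3)
    have S: "serre_rel ?v 2 x y = x * x * x * y - sc c (x * x * y * x) + sc c (x * y * x * x) - y * x * x * x"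
      by (simp add: serre_rel_def bc)
    have nz: "b \<noteq> 0" "c \<noteq> 0" using \<open>?v + inverse ?v \<noteq> 0\<close> \<open>?v ^ 2 + 1 + inverse ?v ^ 2 \<noteq> 0\<close> by (simp_all add: bc)
    moreover have "nat (1 - cartan C i j) = 3" using 3 by simp
    ultimately have "lift g (serre C Y i j) = sc (inverse (b * c)) (- serre_rel ?v 2 x y)"
      unfolding S serre_def divpow_def Let_def
      by (simp add: lift_simps Y numeral_3_eq_3 f sc_distribs mult.assoc)
    thus ?thesis using nz by (intro exI[of _ "- inverse (b * c)"]) (simp add: 3 sc_minus_left sc_minus_right)
  qed
qed

lemma lift_serre:
  assumes v: "not_root_of_unity (qi C i)" and m: "nat (- cartan C i j) \<le> 2" "cartan C i j \<le> 0"
    and Y: "lift g (Y i) = x" "lift g (Y j) = y"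
  shows "lift g (serre C Y i j) = 0 \<longleftrightarrow> serre_rel (qi C i) (nat (- cartan C i j)) x y = 0"
  using lift_serre_eq[OF assms] sc_eq_0_iff by metis

end

lemma uq_relators_ball:
  "(\<forall>r\<in>uq_relators C. P r) \<longleftrightarrow> (\<forall>i\<in>index C. P (fK i * fKinv i - 1) \<and> P (fKinv i * fK i - 1)) \<and>
    (\<forall>i\<in>index C. \<forall>j\<in>index C. P (fK i * fK j - fK j * fK i) \<and>
      P (fK i * fE j * fKinv i - fconst (qi C i powi cartan C i j) * fE j) \<and>
      P (fK i * fF j * fKinv i - fconst (qi C i powi (- cartan C i j)) * fF j) \<and>
      P (fE i * fF j - fF j * fE i - (if i = j then fconst (inverse (qi C i - inverse (qi C i))) * (fK i - fKinv i) else 0)) \<and>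
      (i \<noteq> j \<longrightarrow> P (serre C fE i j) \<and> P (serre C fF i j)))"
proof -
  have "(\<forall>r\<in>{f i | i. i \<in> A}. P r) \<longleftrightarrow> (\<forall>i\<in>A. P (f i))" for f and A :: "'a set" by blast
  moreover have "(\<forall>r\<in>{f i j | i j. i \<in> A \<and> j \<in> A}. P r) \<longleftrightarrow> (\<forall>i\<in>A. \<forall>j\<in>A. P (f i j))" for f and A :: "'a set" by blast
  moreover have "(\<forall>r\<in>{f i j | i j. i \<in> A \<and> j \<in> A \<and> i \<noteq> j}. P r) \<longleftrightarrow> (\<forall>i\<in>A. \<forall>j\<in>A. i \<noteq> j \<longrightarrow> P (f i j))" for f and A :: "'a set" by blast
  ultimately show ?thesis unfolding uq_relators_def ball_Un by (simp only: ball_conj_distrib imp_conjR conj_assoc)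
qed

lemma qvar_not_root_of_unity: "not_root_of_unity qvar"
proof -
  have pow: "qvar ^ n = Fract ([:0, 1:] ^ n) 1" for n
    by (induction n) (simp_all add: qvar_def One_fract_def)
  have "qvar \<noteq> 0" by (simp add: qvar_def Zero_fract_def eq_fract)
  moreover have "qvar ^ n \<noteq> 1" if "n > 0" for n
  proof
    assume "qvar ^ n = 1"
    hence "[:0, 1:] ^ n = (1 :: complex poly)" by (simp add: pow One_fract_def eq_fract)
    hence "degree ([:0, 1:] ^ n :: complex poly) = 0" by simp
    thus False using that by (simp add: degree_power_eq)
  qed
  ultimately show ?thesis by (simp add: not_root_of_unity_def)
qed

context qscaled_ring
begin

lemma conj_iff: "K * L = 1 ==> L * K = 1 ==> K * x * L - sc c y = 0 \<longleftrightarrow> K * x = sc c (y * K)"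
  for K L x y :: 'r
proof -
  assume KL: "K * L = 1" "L * K = 1"
  have "K * x = sc c (y * K) \<longleftrightarrow> K * x * L = sc c (y * K) * L"
  proof
    assume "K * x * L = sc c (y * K) * L"
    hence "K * x * L * K = sc c (y * K) * L * K" by simp
    thus "K * x = sc c (y * K)" using KL by (simp add: mult.assoc)
  qed simp
  also have "sc c (y * K) * L = sc c y" using KL by (simp add: mult.assoc)
  finally show ?thesis by simp
qed

text \<open>Translates the list of relators into the locale \<open>qrel\<close>. The homomorphisms
  \<open>uT\<close>, \<open>uT'\<close>, \<open>uomega\<close> and the trivial representation are
  all obtained through it.\<close>

lemma qrel_iff:
  assumes C: "cartan_type (index C) (cartan C) (symm C)"
  shows "(\<forall>r\<in>uq_relators C. lift g r = 0) \<longleftrightarrow>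
    qrel (index C) (cartan C) (symm C) sc qvar (\<lambda>i. g (Egen i)) (\<lambda>i. g (Fgen i)) (\<lambda>i. g (Kgen i)) (\<lambda>i. g (Kinv i))"
proof (cases "\<forall>i\<in>index C. g (Kgen i) * g (Kinv i) = 1 \<and> g (Kinv i) * g (Kgen i) = 1")
  case True
  interpret C: cartan_type "index C" "cartan C" "symm C" by (rule C)
  have v: "not_root_of_unity (qi C i)" if "i \<in> index C" for i
    unfolding qi_def by (rule not_root_of_unity_power) (use qvar_not_root_of_unity C.d_pos that in auto)
  have serre: "lift g (serre C fE i j) = 0 \<longleftrightarrow> serre_rel (qvar ^ symm C i) (C.bond i j) (g (Egen i)) (g (Egen j)) = 0"
    "lift g (serre C fF i j) = 0 \<longleftrightarrow> serre_rel (qvar ^ symm C i) (C.bond i j) (g (Fgen i)) (g (Fgen j)) = 0"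
    if "i \<in> index C" "j \<in> index C" "i \<noteq> j" for i j
    using lift_serre[of C i j g _ "g (Egen i)" "g (Egen j)"] lift_serre[of C i j g _ "g (Fgen i)" "g (Fgen j)"]
      v[of i] C.bond_le[of i j] C.off[of i j] that
    by (auto simp: C.bond_def lift_generators qi_def)
  note simps = lift_simps lift_generators
  have K: "lift g (fK i * fKinv i - 1) = 0 \<and> lift g (fKinv i * fK i - 1) = 0" if "i \<in> index C" for i
    using True that by (simp add: simps)
  have conj: "lift g (fK i * x * fKinv i - fconst c * y) = 0 \<longleftrightarrow>
      g (Kgen i) * lift g x = sc c (lift g y * g (Kgen i))" if "i \<in> index C" for i c x y
    using conj_iff[of "g (Kgen i)"] True that by (simp add: simps)
  have KK: "lift g (fK i * fK j - fK j * fK i) = 0 \<longleftrightarrow> g (Kgen i) * g (Kgen j) = g (Kgen j) * g (Kgen i)" for i j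
    by (simp add: simps)
  have EF: "lift g (fE i * fF j - fF j * fE i - (if i = j then fconst (inverse (qi C i - inverse (qi C i))) * (fK i - fKinv i) else 0)) = 0 \<longleftrightarrow>
      g (Egen i) * g (Fgen j) - g (Fgen j) * g (Egen i) = (if i = j then sc (inverse (qvar ^ symm C i - inverse (qvar ^ symm C i))) (g (Kgen i) - g (Kinv i)) else 0)" for i j
    by (simp add: simps qi_def)
  show ?thesis
    unfolding uq_relators_ball qrel_def qrel_axioms_def qi_def
    using True by (simp only: C scaled_ring_axioms qvar_not_root_of_unity K KK EF[unfolded qi_def] conj serre lift_generators simp_thms ball_simps cong: ball_cong imp_cong) blast
next
  case False
  thus ?thesis by (auto simp: uq_relators_ball lift_simps lift_generators qrel_def qrel_axioms_def)
qed

end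

interpretation falg: qscaled_ring fscale
  by (simp add: qscaled_ring_def falg.scaled_ring_axioms)

interpretation uqt: qscaled_ring uscale
  by (simp add: qscaled_ring_def uqt.scaled_ring_axioms)

lemma trivial_relators:
  assumes "cartan_type (index C) (cartan C) (symm C)" "r \<in> uq_relators C"
  shows "falg.lift trivial_gen r = 0"
proof -
  interpret C: cartan_type "index C" "cartan C" "symm C" by fact
  have "qrel (index C) (cartan C) (symm C) fscale qvar (\<lambda>i. trivial_gen (Egen i)) (\<lambda>i. trivial_gen (Fgen i))
     (\<lambda>i. trivial_gen (Kgen i)) (\<lambda>i. trivial_gen (Kinv i))"
    by unfold_locales (simp_all add: qvar_not_root_of_unity trivial_gen_def falg.serre_rel_def)
  thus ?thesis using falg.qrel_iff[OF assms(1)] assms(2) by blast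
qed

lemma embed_relators:
  assumes "cartan_type (index C) (cartan C) (symm C)" "r \<in> uq_relators C"
  shows "embed C r = 0"
proof (rule uqt_eqI)
  fix C'
  show "\<exists>x. at_datum C' (embed C r) x \<and> at_datum C' 0 x"
  proof (cases "C' = C")
    case True
    have "at_datum C (embed C r) 0"
      using at_datum_unique[OF at_datum_embed[of C r]] rel_ideal.rel[OF assms(2)] by simp
    thus ?thesis using True at_datum_intros(1) by blast
  next
    case False
    hence "at_datum C' (ugen C g) (trivial_gen g)" for g
      by (simp add: ugen_def at_datum.abs_eq rel_ideal.zero)
    hence "at_datum C' (embed C r) (falg.lift trivial_gen r)"
      unfolding embed_def by (rule at_datum_lift)
    thus ?thesis using trivial_relators[OF assms] at_datum_intros(1) by auto
  qed
qed

lemma embed_eq_iff: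
  assumes "cartan_type (index C) (cartan C) (symm C)"
  shows "embed C x = embed C y \<longleftrightarrow> x - y \<in> rel_ideal C"
proof
  assume *: "embed C x = embed C y"
  have "at_datum C (embed C x) y" unfolding * by (rule at_datum_embed)
  thus "x - y \<in> rel_ideal C" using at_datum_unique[OF at_datum_embed] by blast
next
  assume "x - y \<in> rel_ideal C"
  hence "embed C (x - y) = 0"
    unfolding embed_def by (rule uqt.lift_rel_ideal[rotated]) (use embed_relators[OF assms] in \<open>simp add: embed_def\<close>)
  thus "embed C x = embed C y" by (simp add: embed_def uqt.lift_diff)
qed

context qscaled_ring
begin

text \<open>The homomorphism out of \<open>uq C\<close> given by images of the generators; it factors through
  the component \<open>C\<close> of the product ring.\<close>

definition extend :: "'i cartan_datum \<Rightarrow> ('i qgen \<Rightarrow> 'r) \<Rightarrow> 'i uqt \<Rightarrow> 'r" where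
  "extend C g r = lift g (SOME x. at_datum C r x)"

lemma extend_eq:
  assumes "\<forall>r\<in>uq_relators C. lift g r = 0" "at_datum C r x"
  shows "extend C g r = lift g x"
proof -
  define y where "y = (SOME x. at_datum C r x)"
  have "at_datum C r y" unfolding y_def by (rule someI[of "at_datum C r" x]) (rule assms(2))
  with at_datum_unique[OF assms(2), of y] have "x - y \<in> rel_ideal C" by blast
  moreover have "lift g z = 0" if "z \<in> rel_ideal C" for z
    by (rule lift_rel_ideal[of C, OF _ that]) (use assms(1) in blast)
  ultimately have "lift g (x - y) = 0" by blast
  thus ?thesis by (simp add: extend_def lift_diff y_def)
qed

lemma extend_hom:
  assumes "\<forall>r\<in>uq_relators C. lift g r = 0"
  shows "extend C g (r + s) = extend C g r + extend C g s" "extend C g (r * s) = extend C g r * extend C g s"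
    "extend C g (uscale c r) = sc c (extend C g r)" "extend C g 1 = 1" "extend C g (embed C x) = lift g x"
proof -
  obtain a b where xy: "at_datum C r a" "at_datum C s b"
    using at_datum_exists[of C r] at_datum_exists[of C s] by (elim exE)
  note e = extend_eq[OF assms]
  show "extend C g (r + s) = extend C g r + extend C g s" "extend C g (r * s) = extend C g r * extend C g s"
    "extend C g (uscale c r) = sc c (extend C g r)" "extend C g 1 = 1" "extend C g (embed C x) = lift g x"
    using e[OF xy(1)] e[OF xy(2)] e[OF at_datum_intros(3)[OF xy]] e[OF at_datum_intros(5)[OF xy]] e[OF at_datum_intros(6)[OF xy(1)]]
      e[OF at_datum_intros(2)] e[OF at_datum_embed]
    by (simp_all add: lift_add lift_mult lift_fscale)
qed

end

section \<open>Subalgebras and homomorphisms\<close>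

context scaled_ring
begin

inductive_set alg :: "'r set \<Rightarrow> 'r set" for S where
  gen: "x \<in> S ==> x \<in> alg S"
| one: "1 \<in> alg S"
| scale: "x \<in> alg S ==> sc c x \<in> alg S"
| add: "x \<in> alg S ==> y \<in> alg S ==> x + y \<in> alg S"
| mult: "x \<in> alg S ==> y \<in> alg S ==> x * y \<in> alg S"

lemma alg_0: "0 \<in> alg S"
  using alg.scale[OF alg.one, of 0] by simp

lemma alg_uminus: "x \<in> alg S ==> - x \<in> alg S"
  using alg.scale[of x S "- 1"] by (simp add: sc_minus_left)

lemma alg_diff: "x \<in> alg S ==> y \<in> alg S ==> x - y \<in> alg S"
  using alg.add[OF _ alg_uminus, of x S y] by simp

lemma alg_power: "x \<in> alg S ==> x ^ n \<in> alg S"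
  by (induction n) (auto intro: alg.one alg.mult)

lemmas alg_intros = alg.one alg.scale alg.add alg.mult alg_0 alg_uminus alg_diff alg_power

lemma alg_subset_iff: "alg S \<subseteq> alg S' \<longleftrightarrow> S \<subseteq> alg S'"
proof
  assume S: "S \<subseteq> alg S'"
  have "x \<in> alg S'" if "x \<in> alg S" for x
    using that by induction (use S in \<open>auto intro: alg_intros\<close>)
  thus "alg S \<subseteq> alg S'" by blast
qed (auto intro: alg.gen)

lemma tw_in_alg: "x \<in> alg S ==> y \<in> alg S ==> tw v m x y \<in> alg S"
  "x \<in> alg S ==> y \<in> alg S ==> twr v m x y \<in> alg S"
  "x \<in> alg S ==> y \<in> alg S ==> mid v x y \<in> alg S"
  by (simp_all add: tw_def twr_def mid_def alg_intros)

definition alg_hom :: "('r \<Rightarrow> 'r) \<Rightarrow> bool" where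
  "alg_hom \<phi> \<longleftrightarrow> \<phi> 1 = 1 \<and> (\<forall>x y. \<phi> (x + y) = \<phi> x + \<phi> y) \<and> (\<forall>x y. \<phi> (x * y) = \<phi> x * \<phi> y) \<and>
     (\<forall>c x. \<phi> (sc c x) = sc c (\<phi> x))"

lemma alg_hom_simps:
  assumes "alg_hom \<phi>"
  shows "\<phi> 1 = 1" "\<phi> 0 = 0" "\<phi> (x + y) = \<phi> x + \<phi> y" "\<phi> (x * y) = \<phi> x * \<phi> y" "\<phi> (sc c x) = sc c (\<phi> x)"
    "\<phi> (- x) = - \<phi> x" "\<phi> (x - y) = \<phi> x - \<phi> y" "\<phi> (x ^ n) = \<phi> x ^ n" "\<phi> (sum f A) = (\<Sum>a\<in>A. \<phi> (f a))"
    "\<phi> (tw v m x y) = tw v m (\<phi> x) (\<phi> y)" "\<phi> (twr v m x y) = twr v m (\<phi> x) (\<phi> y)" "\<phi> (mid v x y) = mid v (\<phi> x) (\<phi> y)"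
proof -
  show 1: "\<phi> 1 = 1" "\<phi> (x + y) = \<phi> x + \<phi> y" "\<phi> (x * y) = \<phi> x * \<phi> y" "\<phi> (sc c x) = sc c (\<phi> x)" for x y c
    using assms by (auto simp: alg_hom_def)
  show 2: "\<phi> 0 = 0" using 1(4)[of 0 0] by simp
  show 3: "\<phi> (- x) = - \<phi> x" for x using 1(4)[of "- 1" x] by (simp add: sc_minus_left)
  show 4: "\<phi> (x - y) = \<phi> x - \<phi> y" for x y using 1(2)[of x "- y"] 3[of y] by simp
  show "\<phi> (x ^ n) = \<phi> x ^ n" by (induction n) (simp_all add: 1)
  show "\<phi> (sum f A) = (\<Sum>a\<in>A. \<phi> (f a))" by (induction A rule: infinite_finite_induct) (simp_all add: 1 2)
  show "\<phi> (tw v m x y) = tw v m (\<phi> x) (\<phi> y)" "\<phi> (twr v m x y) = twr v m (\<phi> x) (\<phi> y)" "\<phi> (mid v x y) = mid v (\<phi> x) (\<phi> y)"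
    by (simp_all add: tw_def twr_def mid_def 1 4)
qed

lemma alg_hom_comp: "alg_hom \<phi> ==> alg_hom \<psi> ==> alg_hom (\<lambda>x. \<phi> (\<psi> x))"
  by (simp add: alg_hom_def)

lemma alg_hom_id: "alg_hom (\<lambda>x. x)"
  by (simp add: alg_hom_def)

lemma alg_hom_eq_on_alg:
  assumes "alg_hom \<phi>" "alg_hom \<psi>" "\<And>x. x \<in> S ==> \<phi> x = \<psi> x" "x \<in> alg S"
  shows "\<phi> x = \<psi> x"
  using assms(4) by induction (simp_all add: assms(3) alg_hom_simps[OF assms(1)] alg_hom_simps[OF assms(2)])

lemma alg_hom_alg:
  assumes "alg_hom \<phi>" shows "\<phi> ` alg S = alg (\<phi> ` S)"
proof -
  note hom = alg_hom_simps(1,3,4,5)[OF assms]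
  show ?thesis
proof (intro equalityI subsetI)
  fix y assume "y \<in> \<phi> ` alg S"
  then obtain x where "x \<in> alg S" "y = \<phi> x" by blast
  moreover have "\<phi> x \<in> alg (\<phi> ` S)" if "x \<in> alg S" for x
    using that by induction (simp_all add: hom alg.intros)
  ultimately show "y \<in> alg (\<phi> ` S)" by simp
next
  fix y assume "y \<in> alg (\<phi> ` S)"
  thus "y \<in> \<phi> ` alg S"
  proof induction
    case one
    have "\<phi> 1 \<in> \<phi> ` alg S" by (rule imageI) (rule alg.one)
    thus ?case by (simp add: hom)
  next
    case (scale x c)
    then obtain z where "z \<in> alg S" "x = \<phi> z" by blast
    hence "\<phi> (sc c z) \<in> \<phi> ` alg S" by (intro imageI alg.scale)
    thus ?case unfolding \<open>x = \<phi> z\<close> by (simp only: hom)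
  next
    case (add x y)
    then obtain z w where "z \<in> alg S" "x = \<phi> z" "w \<in> alg S" "y = \<phi> w" by blast
    hence "\<phi> (z + w) \<in> \<phi> ` alg S" by (intro imageI alg.add)
    thus ?case unfolding \<open>x = \<phi> z\<close> \<open>y = \<phi> w\<close> by (simp only: hom)
  next
    case (mult x y)
    then obtain z w where "z \<in> alg S" "x = \<phi> z" "w \<in> alg S" "y = \<phi> w" by blast
    hence "\<phi> (z * w) \<in> \<phi> ` alg S" by (intro imageI alg.mult)
    thus ?case unfolding \<open>x = \<phi> z\<close> \<open>y = \<phi> w\<close> by (simp only: hom)
  qed (auto intro: alg.gen)
qed
qed

lemma alg_hom_opposite:
  assumes "alg_hom \<phi>"
  shows "scaled_ring.alg_hom (op_scale sc) (\<lambda>x. op (\<phi> (unop x)))"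
  unfolding scaled_ring.alg_hom_def[OF scaled_ring_opposite]
  by (simp add: op_eq_iff alg_hom_simps[OF assms])

lemma serre_rel_inverse: "serre_rel (inverse v) m x y = serre_rel v m x y"
  by (simp add: serre_rel_def algebra_simps)

end

section \<open>Symmetries of the relations; the automorphisms and their inverses\<close>

context qrel
begin

text \<open>Inverting \<open>q\<close> and exchanging \<open>E\<close> with \<open>F\<close>, the
  torus being fixed, turns the formulas for the inverse automorphisms \<open>T'\<close> into those
  for \<open>T\<close>; see \<open>braided_bar\<close>.\<close>

lemma bar: "qrel I a d sc (inverse q) F E K L"
proof (unfold_locales, goal_cases)
  case 1 show ?case by (rule not_root_of_unity_inverse[OF q])
next
  case (5 i j) thus ?case using KF[of i j] by (simp add: power_inverse power_int_inverse power_int_minus)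
next
  case (6 i j) thus ?case using KE[of i j] by (simp add: power_inverse power_int_inverse power_int_minus)
next
  case (7 i j)
  have "inverse (u i - v i) = - inverse (v i - u i)" by (metis inverse_minus_eq minus_diff_eq)
  moreover have "F i * E j - E j * F i = - (E j * F i - F i * E j)" by simp
  ultimately show ?case using EF[of j i] 7 by (auto simp: power_inverse sc_minus_left)
qed (auto simp: KL LK KK power_inverse serre_rel_inverse serre_E serre_F)

text \<open>The Chevalley involution. It is used to exchange the two halves of the triangular
  decomposition.\<close>

lemma omega: "qrel I a d sc q F E L K"
proof -
  have nz: "v i powi n \<noteq> 0" if "i \<in> I" for i n using v_neq_0[OF that] by (rule power_int_not_zero[OF disjI1])
  show ?thesis
  proof (unfold_locales, goal_cases)
    case 1 show ?case by (rule q)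
  next
    case (5 i j) thus ?case using inverse_flip[OF KL LK KF[of i j] nz] by (simp add: power_int_minus)
  next
    case (6 i j) thus ?case using inverse_flip[OF KL LK KE[of i j] nz] by (simp add: power_int_minus)
  next
    case (7 i j)
    have "F i * E j - E j * F i = - (E j * F i - F i * E j)" by simp
    thus ?case using EF[of j i] 7 by (auto simp: sc_diff_right)
  qed (auto simp: KL LK LL serre_E serre_F)
qed

definition gens :: "'r set" where "gens = E ` I \<union> F ` I \<union> K ` I \<union> L ` I"

end

text \<open>\<open>T\<close> and \<open>T'\<close> are shown to be inverse to each other on
  \<open>alg gens\<close> only (\<open>TT'\<close>, \<open>T'T\<close>): in the intended ring, a
  product over all data, \<open>T i\<close> acts through a single component.\<close>

locale braided = qrel I a d sc q E F K L
  for I :: "'i set" and a d and sc :: "'k::field \<Rightarrow> 'r::ring_1 \<Rightarrow> 'r" and q E F K L +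
  fixes T T' :: "'i \<Rightarrow> 'r \<Rightarrow> 'r"
  assumes T_hom: "i \<in> I ==> alg_hom (T i)"
    and T_E: "i \<in> I ==> j \<in> I ==> T i (E j) = TE i j"
    and T_F: "i \<in> I ==> j \<in> I ==> T i (F j) = TF i j"
    and T_K: "i \<in> I ==> j \<in> I ==> T i (K j) = TK i j"
    and T_L: "i \<in> I ==> j \<in> I ==> T i (L j) = TL i j"
    and T'_hom: "i \<in> I ==> alg_hom (T' i)"
    and T'_E: "i \<in> I ==> j \<in> I ==> T' i (E j) = (if j = i then - (F i * K i) else twr (v i) (bond i j) (E i) (E j))"
    and T'_F: "i \<in> I ==> j \<in> I ==> T' i (F j) = (if j = i then - (L i * E i) else tw (u i) (bond i j) (F i) (F j))"
    and T'_K: "i \<in> I ==> j \<in> I ==> T' i (K j) = TK i j"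
    and T'_L: "i \<in> I ==> j \<in> I ==> T' i (L j) = TL i j"
begin

lemma braided_bar: "braided I a d sc (inverse q) F E K L T' T"
proof -
  interpret b: qrel I a d sc "inverse q" F E K L by (rule bar)
  show ?thesis
    by unfold_locales
      (simp_all add: T_hom T'_hom T_E T_F T_K T_L T'_E T'_F T'_K T'_L b.TE_def b.TF_def b.TK_def b.TL_def TE_def TF_def TK_def TL_def power_inverse)
qed

lemma braided_opposite:
  "braided I a d (op_scale sc) (inverse q) (\<lambda>i. op (F i)) (\<lambda>i. op (E i)) (\<lambda>i. op (L i)) (\<lambda>i. op (K i))
     (\<lambda>i x. op (T i (unop x))) (\<lambda>i x. op (T' i (unop x)))"
proof -
  interpret o: qrel I a d "op_scale sc" "inverse q" "\<lambda>i. op (F i)" "\<lambda>i. op (E i)" "\<lambda>i. op (L i)" "\<lambda>i. op (K i)"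
    by (rule opposite)
  have pow: "op x ^ n = op (x ^ n)" for x :: 'r and n
    by (induction n) (simp_all add: op_eq_iff power_commutes)
  have comm: "L j * L i ^ n = L i ^ n * L j" "K j * K i ^ n = K i ^ n * K j" if "i \<in> I" "j \<in> I" for i j n
    using power_commuting_commutes[OF LL[OF that], of n] power_commuting_commutes[OF KK[OF that], of n] by simp_all
  show ?thesis
    by unfold_locales
      (simp_all add: alg_hom_opposite T_hom T'_hom opposite_T T_E T_F T_K T_L T'_E T'_F T'_K T'_L TE_def TF_def TK_def TL_def
        o.TE_def o.TF_def o.TK_def o.TL_def power_inverse pow tw_opposite scaled_ring_axioms comm op_eq_iff)
qed

lemma TT'_E:
  assumes "i \<in> I" "j \<in> I"
  shows "T i (T' i (E j)) = E j"
proof (cases "j = i")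
  case True
  interpret i: quantum_sl2 sc "v i" "u i" "inverse (v i + u i)" "inverse (v i - u i)" "E i" "F i" "K i" "L i"
    by (rule sl2) fact
  show ?thesis using assms True
    by (simp add: T'_E alg_hom_simps[OF T_hom] T_F T_K TF_def TK_def mult.assoc KL)
next
  case False
  interpret i: quantum_sl2 sc "v i" "u i" "inverse (v i + u i)" "inverse (v i - u i)" "E i" "F i" "K i" "L i"
    by (rule sl2) fact
  have "i.lowest (bond i j) (E j)" using lowest assms False by simp
  thus ?thesis
    using assms False i.twr_G[OF bond_le[of i j]]
    by (simp add: T'_E alg_hom_simps[OF T_hom] T_E TE_def)
qed

lemma TT'_K:
  assumes "i \<in> I" "j \<in> I"
  shows "T i (T' i (K j)) = K j" "T i (T' i (L j)) = L j"
  using assms left_right_inverse_power[OF KL[of i], of "bond i j"] left_right_inverse_power[OF LK[of i], of "bond i j"]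
  by (simp_all add: T'_K T'_L TK_def TL_def alg_hom_simps[OF T_hom] T_K T_L mult.assoc)

lemma TT'_F:
  assumes "i \<in> I" "j \<in> I"
  shows "T i (T' i (F j)) = F j"
  using braided.TT'_E[OF braided_opposite assms] by (simp add: op_eq_iff)

lemma TT': assumes "i \<in> I" "x \<in> alg gens" shows "T i (T' i x) = x"
  by (rule alg_hom_eq_on_alg[OF alg_hom_comp[OF T_hom T'_hom] alg_hom_id _ assms(2)])
    (use assms(1) in \<open>auto simp: gens_def TT'_E TT'_F TT'_K\<close>)

lemma T'T: assumes "i \<in> I" "x \<in> alg gens" shows "T' i (T i x) = x"
proof -
  have "qrel.gens I F E K L = gens"
    by (simp add: qrel.gens_def[OF bar] gens_def Un_ac)
  thus ?thesis using braided.TT'[OF braided_bar, of i x] assms by simp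
qed

end

section \<open>Braid relations\<close>

context qrel
begin

definition Kz :: "'i \<Rightarrow> int \<Rightarrow> 'r" where
  "Kz i n = (if 0 \<le> n then K i ^ nat n else L i ^ nat (- n))"

lemma Kz_simps: "Kz i 0 = 1" "Kz i 1 = K i" "Kz i (- 1) = L i"
  by (simp_all add: Kz_def)

lemma Kz_Suc: "i \<in> I ==> Kz i (n + 1) = K i * Kz i n"
proof (cases "0 \<le> n")
  case True
  thus ?thesis by (simp add: Kz_def nat_add_distrib)
next
  case False
  assume "i \<in> I"
  define m where "m = nat (- n - 1)"
  have "n = - int (Suc m)" using False by (simp add: m_def)
  thus ?thesis using \<open>i \<in> I\<close> KL[of i] by (auto simp: Kz_def nat_add_distrib mult.assoc[symmetric])
qed

lemma Kz_add:
  assumes "i \<in> I" shows "Kz i (m + n) = Kz i m * Kz i n"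
proof -
  have "Kz i (m + n) = Kz i m * Kz i n" for m
  proof (induction m rule: int_induct[where k = 0])
    case base show ?case by (simp add: Kz_simps)
  next
    case (step1 m)
    have "Kz i (m + 1 + n) = Kz i ((m + n) + 1)" by (simp add: algebra_simps)
    thus ?case using step1 Kz_Suc[OF assms] by (simp add: mult.assoc)
  next
    case (step2 m)
    have "K i * Kz i (m - 1 + n) = Kz i (m + n)" "K i * Kz i (m - 1) = Kz i m"
      using Kz_Suc[OF assms, of "m - 1 + n"] Kz_Suc[OF assms, of "m - 1"] by (simp_all add: algebra_simps)
    hence "K i * Kz i (m - 1 + n) = K i * (Kz i (m - 1) * Kz i n)" using step2 by (simp add: mult.assoc[symmetric])
    hence "L i * (K i * Kz i (m - 1 + n)) = L i * (K i * (Kz i (m - 1) * Kz i n))" by simp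
    thus ?case using LK[OF assms] by (simp add: mult.assoc[symmetric])
  qed
  thus ?thesis .
qed

lemma Kz_comm: "i \<in> I ==> j \<in> I ==> Kz i m * Kz j n = Kz j n * Kz i m"
proof -
  assume ij: "i \<in> I" "j \<in> I"
  have "x ^ m * y ^ n = y ^ n * x ^ m" if "x * y = y * x" for x y :: 'r and m n
    using power_commuting_commutes[OF power_commuting_commutes[OF that, symmetric], of n m] by simp
  thus ?thesis
    using KK[OF ij] LL[OF ij] KL_comm[OF ij] KL_comm[OF ij(2,1)] by (simp add: Kz_def)
qed

end

context braided
begin

lemma T_Kz:
  assumes "i \<in> I" "j \<in> I" "j \<noteq> i"
  shows "T i (Kz j n) = Kz j n * Kz i (int (bond i j) * n)" "T i (Kz i n) = Kz i (- n)"
proof -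
  have pw: "Kz i (int m) = K i ^ m" "Kz i (- int m) = L i ^ m" for m by (auto simp: Kz_def)
  have "T i (K j ^ n) = Kz j (int n) * Kz i (int (bond i j) * int n) \<and> T i (L j ^ n) = Kz j (- int n) * Kz i (- (int (bond i j) * int n))" for n
  proof (induction n)
    case 0 show ?case by (simp add: alg_hom_simps[OF T_hom] assms Kz_simps)
  next
    case (Suc n)
    have "K j * Kz i (int (bond i j)) * (Kz j (int n) * Kz i (int (bond i j) * int n)) = Kz j (1 + int n) * Kz i (int (bond i j) * (1 + int n))"
      unfolding distrib_left Kz_add[OF assms(1)] Kz_add[OF assms(2)] mult_1_right Kz_simps
      using Kz_comm[OF assms(1,2), of "int (bond i j)" "int n"] by (simp add: mult.assoc) (simp add: mult.assoc[symmetric])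
    moreover have "L j * Kz i (- int (bond i j)) * (Kz j (- int n) * Kz i (- (int (bond i j) * int n))) = Kz j (- 1 + - int n) * Kz i (- int (bond i j) + - (int (bond i j) * int n))"
      unfolding Kz_add[OF assms(1)] Kz_add[OF assms(2)] mult_1_right Kz_simps
      using Kz_comm[OF assms(1,2), of "- int (bond i j)" "- int n"] by (simp add: mult.assoc) (simp add: mult.assoc[symmetric])
    ultimately show ?case using Suc assms
      by (simp add: alg_hom_simps[OF T_hom] T_K T_L TK_def TL_def pw[symmetric] algebra_simps)
  qed
  from this[of "nat n"] this[of "nat (- n)"] show "T i (Kz j n) = Kz j n * Kz i (int (bond i j) * n)"
    by (cases "0 \<le> n") (simp_all add: Kz_def[of j])
  show "T i (Kz i n) = Kz i (- n)"
    using assms by (auto simp: Kz_def alg_hom_simps[OF T_hom] T_K T_L TK_def TL_def)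
qed

lemma rank2_A:
  assumes "i \<in> I" "j \<in> I" "i \<noteq> j" "bond i j = 1" "bond j i = 1"
  shows "T i (T j (E i)) = E j"
proof -
  interpret i: quantum_sl2 sc "v i" "u i" "inverse (v i + u i)" "inverse (v i - u i)" "E i" "F i" "K i" "L i"
    by (rule sl2) fact
  have "d i = d j" using assms sym[of i j] by (simp add: a_eq)
  thus ?thesis
    using assms lowest[of i j] i.tw_tw_G_1[of "E j"] by (simp add: T_E TE_def alg_hom_simps[OF T_hom])
qed

text \<open>Equivalently \<open>T j (T i (T j (E i))) = E i\<close>, in accordance with the fact
  that in type B2 this product of reflections fixes the simple root of \<open>i\<close>.\<close>

lemma rank2_B:
  assumes ij: "i \<in> I" "j \<in> I" "i \<noteq> j" and b: "bond i j * bond j i = 2"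
  shows "T i (T j (E i)) = T' j (E i)"
proof -
  interpret i: quantum_sl2 sc "v i" "u i" "inverse (v i + u i)" "inverse (v i - u i)" "E i" "F i" "K i" "L i"
    by (rule sl2) fact
  interpret j: quantum_sl2 sc "v j" "u j" "inverse (v j + u j)" "inverse (v j - u j)" "E j" "F j" "K j" "L j"
    by (rule sl2) fact
  note low = lowest[OF ij]
  from ij show ?thesis
  proof (cases rule: bond_cases)
    case left
    have uj: "u j = u i * u i" by (simp add: left(3) mult_2 power_add)
    have "T i (T j (E i)) = tw (v j) 1 (tw (v i) 2 (E i) (E j)) i.G"
      using ij left by (simp add: T_E TE_def alg_hom_simps[OF T_hom])
    also have "\<dots> = i.G * tw (v i) 2 (E i) (E j) - sc (u i * u i) (tw (v i) 2 (E i) (E j) * i.G)"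
      unfolding j.tw_eqs uj ..
    also have "\<dots> = mid (v i) (E i) (E j)" using i.tw_tw_G_2 low left by simp
    also have "\<dots> = T' j (E i)" using ij left(1,2) by (simp add: T'_E i.mid_eq j.twr_eqs uj)
    finally show ?thesis .
  next
    case right
    have vi: "v i = v j * v j" by (simp add: right(3) mult_2 power_add)
    have "T i (T j (E i)) = tw (v j) 2 (tw (v i) 1 (E i) (E j)) i.G"
      using ij right by (simp add: T_E TE_def alg_hom_simps[OF T_hom])
    also have "\<dots> = twr (v j) 2 (E j) (E i)"
      using i.tw_2_tw_1_G[of "E j", OF _ j.unit_scalar_axioms vi] low right serre_E[OF ij] by simp
    also have "\<dots> = T' j (E i)" using ij right by (simp add: T'_E)
    finally show ?thesis .
  qed (use b in auto)
qed

lemma E_comm: "i \<in> I ==> j \<in> I ==> i \<noteq> j ==> bond i j = 0 ==> E i * E j = E j * E i"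
  using serre_E[of i j] by (simp add: serre_rel_def)

lemma bond_0_sym: "i \<in> I ==> j \<in> I ==> i \<noteq> j ==> bond i j = 0 ==> bond j i = 0"
  using a_0_sym[of i j] a_eq[of i j] a_eq[of j i] by simp

text \<open>As \<open>T j\<close> fixes \<open>E k\<close>, the braid relation on \<open>E k\<close>
  amounts to \<open>T i\<close> fixing \<open>T j (T i (E k))\<close>. This element is a nested
  twist, and \<open>tw_tw\<close> rewrites it into exactly the form to which \<open>T i\<close>
  takes it.\<close>

lemma fix_A:
  assumes "i \<in> I" "j \<in> I" "k \<in> I" "i \<noteq> j" "k \<noteq> i" "k \<noteq> j" "bond i j = 1" "bond j i = 1" "bond j k = 0"
  shows "T i (T j (T i (E k))) = T j (T i (E k))"
proof -
  interpret i: quantum_sl2 sc "v i" "u i" "inverse (v i + u i)" "inverse (v i - u i)" "E i" "F i" "K i" "L i"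
    by (rule sl2) fact
  have "d i = d j" using assms sym[of i j] by (simp add: a_eq)
  hence S: "serre_rel (v i) 1 (E j) (E i) = 0" using serre_E[of j i] assms by simp
  have jk: "T j (E k) = E k" using assms by (simp add: T_E TE_def tw_def)
  have ik: "T i (E k) = tw (v i) (bond i k) (E i) (E k)" using assms by (simp add: T_E TE_def)
  have "T j (T i (E k)) = tw (v i) (bond i k) (T j (E i)) (E k)"
    unfolding ik alg_hom_simps[OF T_hom[OF assms(2)]] jk ..
  moreover have "T i \<dots> = tw (v i) (bond i k) (E j) (tw (v i) (bond i k) (E i) (E k))"
    unfolding alg_hom_simps[OF T_hom[OF assms(1)]] ik using rank2_A assms by simp
  moreover have "T j (E i) = tw (v i) 1 (E j) (E i)" using assms \<open>d i = d j\<close> by (simp add: T_E TE_def)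
  ultimately show ?thesis
    using i.tw_tw[OF bond_le[of i k] S E_comm[of j k]] assms by simp
qed

text \<open>The analogue of \<open>fix_A\<close> for a double bond. By \<open>rank2_B\<close> both
  sides become explicit twists in the generators of \<open>i\<close>, \<open>j\<close>,
  \<open>k\<close>, which \<open>tw_rank_three_1\<close> and \<open>tw_rank_three_2\<close>
  compare.\<close>

lemma fix_B:
  assumes ijk: "i \<in> I" "j \<in> I" "k \<in> I" "i \<noteq> j" "k \<noteq> i" "k \<noteq> j" and b: "bond i j * bond j i = 2" and jk: "bond j k = 0"
  shows "T j (T i (T j (T i (E k)))) = T i (T j (T i (E k)))"
proof -
  interpret i: quantum_sl2 sc "v i" "u i" "inverse (v i + u i)" "inverse (v i - u i)" "E i" "F i" "K i" "L i"
    by (rule sl2) fact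
  interpret j: quantum_sl2 sc "v j" "u j" "inverse (v j + u j)" "inverse (v j - u j)" "E j" "F j" "K j" "L j"
    by (rule sl2) fact
  have jEk: "T j (E k) = E k" using ijk jk by (simp add: T_E TE_def tw_def)
  have zx: "E k * E j = E j * E k" using E_comm[of j k] ijk jk by simp
  have "a i j * a j i = 2" using b ijk by (simp add: a_eq flip: of_nat_mult)
  \<comment> \<open>\<open>no_double\<close> leaves 0 and 1 as the bond from \<open>i\<close> to
    \<open>k\<close>.\<close>
  hence "bond i k \<noteq> 2" using no_double[of i j k] ijk a_eq[of i k] by auto
  then consider "bond i k = 0" | "bond i k = 1" using bond_le[of i k] ijk by force
  thus ?thesis
  proof cases
    case 1
    hence "T i (E k) = E k" using ijk by (simp add: T_E TE_def tw_def)
    thus ?thesis using jEk by simp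
  next
    case 2
    define U where "U = tw (v i) 1 (T j (E i)) (E k)"
    define Y where "Y = tw (v i) 1 (E i) (E k)"
    have Y: "T i (E k) = Y" using ijk 2 by (simp add: T_E TE_def Y_def)
    have U: "T j Y = U" using ijk by (simp add: Y_def U_def alg_hom_simps[OF T_hom] jEk)
    have iU: "T i U = tw (v i) 1 (T' j (E i)) Y"
      using ijk by (simp add: U_def alg_hom_simps[OF T_hom] Y rank2_B b)
    have jiU: "T j (T i U) = tw (v i) 1 (E i) U"
      unfolding iU using ijk by (simp add: alg_hom_simps[OF T_hom] TT'_E U)
    have Sk: "serre_rel (v i) 1 (E i) (E k) = 0" using serre_E[of i k] ijk 2 by simp
    have "tw (v i) 1 (T' j (E i)) Y = tw (v i) 1 (E i) U"
      using ijk(1,2,4)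
    proof (cases rule: bond_cases)
      case left
      have uj: "u j = u i * u i" by (simp add: left(3) mult_2 power_add)
      show ?thesis
        using i.tw_rank_three_1[OF zx Sk] ijk left(1,2)
        by (simp add: Y_def U_def T'_E T_E TE_def j.tw_eqs j.twr_eqs uj)
    next
      case right
      have ui: "u i = u j * u j" "v i = v j * v j" by (simp_all add: right(3) mult_2 power_add)
      have "serre_rel (v i) 1 x y = x * (x * y) - sc (v j * v j + u j * u j) (x * (y * x)) + y * (x * x)" for x y
        by (simp add: serre_rel_def ui mult.assoc)
      moreover have "tw (v j * v j) (Suc 0) x y = y * x - sc (u j * u j) (x * y)" for x y
        by (simp add: tw_def)
      ultimately show ?thesis
        using j.tw_rank_three_2[OF zx _ _ _ refl refl] Sk serre_E[of j i] serre_E[of i j] ijk right(1,2)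
        by (simp add: Y_def U_def T'_E T_E TE_def ui)
    qed (use b in auto)
    thus ?thesis unfolding Y U jiU unfolding iU by simp
  qed
qed

end

fun alternating :: "nat \<Rightarrow> 'i \<Rightarrow> 'i \<Rightarrow> 'i list" where
  "alternating 0 i j = []"
| "alternating (Suc n) i j = i # alternating n j i"

context cartan_type
begin

definition braid_order :: "'i \<Rightarrow> 'i \<Rightarrow> nat" where
  "braid_order i j = (if bond i j * bond j i = 0 then 2 else if bond i j * bond j i = 1 then 3 else 4)"

lemma braid_order_sym: "braid_order i j = braid_order j i"
  by (simp add: braid_order_def mult.commute)

lemma set_alternating: "set (alternating n i j) \<subseteq> {i, j}"
  by (induction n arbitrary: i j) auto

end

context scaled_ring
begin

lemma tw_tw_commute:
  assumes "x * y = y * x"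
  shows "tw v m x (tw w n y z) = tw w n y (tw v m x z)"
  by (simp add: tw_def assms assms[THEN assoc_rule] sc_distribs algebra_simps)

end

context braided
begin

lemma T_gens_Kz:
  assumes "i \<in> I" "j \<in> I" "i \<noteq> j"
  shows "T i (Kz i y * Kz j z) = Kz i (int (bond i j) * z - y) * Kz j z"
    "T j (Kz i y * Kz j z) = Kz i y * Kz j (int (bond j i) * y - z)"
proof -
  show "T i (Kz i y * Kz j z) = Kz i (int (bond i j) * z - y) * Kz j z"
    using assms Kz_comm[OF assms(1,2), of "int (bond i j) * z" z] Kz_add[OF assms(1), of "-y" "int (bond i j) * z"]
    by (simp add: alg_hom_simps[OF T_hom] T_Kz mult.assoc[symmetric]) (simp add: mult.assoc)
  show "T j (Kz i y * Kz j z) = Kz i y * Kz j (int (bond j i) * y - z)"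
    using assms Kz_add[OF assms(2), of "int (bond j i) * y" "-z"]
    by (simp add: alg_hom_simps[OF T_hom] T_Kz mult.assoc)
qed

lemma T_gens_Kz3:
  assumes "i \<in> I" "j \<in> I" "k \<in> I" "i \<noteq> j" "k \<noteq> i" "k \<noteq> j"
  shows "T i (Kz k x * (Kz i y * Kz j z)) = Kz k x * (Kz i (int (bond i k) * x + int (bond i j) * z - y) * Kz j z)"
    "T j (Kz k x * (Kz i y * Kz j z)) = Kz k x * (Kz i y * Kz j (int (bond j k) * x + int (bond j i) * y - z))"
proof -
  have "T i (Kz k x * (Kz i y * Kz j z)) = T i (Kz k x) * (T i (Kz i y * Kz j z))"
    "T j (Kz k x * (Kz i y * Kz j z)) = T j (Kz k x) * (T j (Kz i y * Kz j z))"
    using assms by (simp_all only: alg_hom_simps[OF T_hom])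
  thus "T i (Kz k x * (Kz i y * Kz j z)) = Kz k x * (Kz i (int (bond i k) * x + int (bond i j) * z - y) * Kz j z)"
    "T j (Kz k x * (Kz i y * Kz j z)) = Kz k x * (Kz i y * Kz j (int (bond j k) * x + int (bond j i) * y - z))"
    using Kz_add[OF assms(1), of "int (bond i k) * x" "int (bond i j) * z - y"]
     Kz_add[OF assms(2), of "int (bond j k) * x" "int (bond j i) * y - z"]
     Kz_comm[OF assms(2,1), of "int (bond j k) * x" y] assms
    by (simp_all add: T_Kz T_gens_Kz mult.assoc add_diff_eq) (simp add: mult.assoc[symmetric])
qed

text \<open>On torus monomials the \<open>T i\<close> act linearly on exponents. Factors with
  exponent 0 are inserted so that two or three exponents can be followed at once.\<close>

lemma braid_Kz:
  assumes ij: "i \<in> I" "j \<in> I" "i \<noteq> j" and k: "k \<in> I"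
  shows "foldr T (alternating (braid_order i j) i j) (Kz k n) = foldr T (alternating (braid_order i j) j i) (Kz k n)"
proof -
  note simps = numeral_2_eq_2 numeral_3_eq_3 numeral_eq_Suc[of "num.Bit0 (num.Bit0 num.One)"]
  consider "k = i" | "k = j" | "k \<noteq> i" "k \<noteq> j" by blast
  thus ?thesis
  proof cases
    case 1
    have "foldr T (alternating (braid_order i j) i j) (Kz i n * Kz j 0) = foldr T (alternating (braid_order i j) j i) (Kz i n * Kz j 0)"
      using ij by (cases rule: bond_cases) (simp_all add: braid_order_def eval_nat_numeral T_gens_Kz[OF ij])
    thus ?thesis using 1 by (simp add: Kz_simps)
  next
    case 2
    have "foldr T (alternating (braid_order i j) i j) (Kz i 0 * Kz j n) = foldr T (alternating (braid_order i j) j i) (Kz i 0 * Kz j n)"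
      using ij by (cases rule: bond_cases) (simp_all add: braid_order_def eval_nat_numeral T_gens_Kz[OF ij])
    thus ?thesis using 2 by (simp add: Kz_simps)
  next
    case 3
    have "foldr T (alternating (braid_order i j) i j) (Kz k n * (Kz i 0 * Kz j 0)) = foldr T (alternating (braid_order i j) j i) (Kz k n * (Kz i 0 * Kz j 0))"
      using ij by (cases rule: bond_cases) (simp_all add: braid_order_def eval_nat_numeral T_gens_Kz3[OF ij(1,2) k ij(3) 3] algebra_simps)
    thus ?thesis by (simp add: Kz_simps)
  qed
qed

lemma rank2_F:
  assumes "i \<in> I" "j \<in> I" "i \<noteq> j"
  shows "bond i j = 1 ==> bond j i = 1 ==> T i (T j (F i)) = F j"
    "bond i j * bond j i = 2 ==> T j (T i (T j (F i))) = F i"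
    "bond i j * bond j i = 2 ==> T j (T i (T j (E i))) = E i"
proof -
  show "bond i j = 1 ==> bond j i = 1 ==> T i (T j (F i)) = F j"
    using braided.rank2_A[OF braided_opposite assms] by (simp add: op_eq_iff)
  show "bond i j * bond j i = 2 ==> T j (T i (T j (F i))) = F i"
    using braided.rank2_B[OF braided_opposite assms] TT'_F[OF assms(2,1)] by (simp add: op_eq_iff)
  show "bond i j * bond j i = 2 ==> T j (T i (T j (E i))) = E i"
    using rank2_B[OF assms] TT'_E[OF assms(2,1)] by simp
qed

lemma rank2_L:
  assumes "i \<in> I" "j \<in> I" "i \<noteq> j"
  shows "bond i j = 1 ==> bond j i = 1 ==> T i (T j (L i)) = L j"
    "bond i j * bond j i = 2 ==> T j (T i (T j (L i))) = L i"
proof -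
  have L: "L i = Kz i (- 1) * Kz j 0" "L j = Kz i 0 * Kz j (- 1)" by (simp_all add: Kz_simps)
  show "bond i j = 1 ==> bond j i = 1 ==> T i (T j (L i)) = L j"
    unfolding L using assms by (simp add: T_gens_Kz)
  show "bond i j * bond j i = 2 ==> T j (T i (T j (L i))) = L i"
    unfolding L using assms by (cases rule: bond_cases) (simp_all add: T_gens_Kz[OF assms])
qed

text \<open>For \<open>k\<close> in \<open>{i, j}\<close> the rank two identities decide. If
  \<open>k\<close> is not bonded to one of the two, that \<open>T\<close> fixes \<open>E k\<close>,
  and \<open>fix_A\<close>, \<open>fix_B\<close> or plain commutation applies. If it is bonded to
  both, then \<open>i\<close> and \<open>j\<close> are not bonded, as there are no triangles, and
  the two twists commute.\<close>

lemma braid_E: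
  assumes ij: "i \<in> I" "j \<in> I" "i \<noteq> j" and k: "k \<in> I"
  shows "foldr T (alternating (braid_order i j) i j) (E k) = foldr T (alternating (braid_order i j) j i) (E k)"
proof -
  have same: "foldr T (alternating (braid_order i j) i j) (E i) = foldr T (alternating (braid_order i j) j i) (E i)"
    if ij: "i \<in> I" "j \<in> I" "i \<noteq> j" for i j
  proof -
    have TEi: "T i (E i) = - (L i * F i)" "T j (E j) = - (L j * F j)" using that by (simp_all add: T_E TE_def)
    consider "bond i j = 0" "bond j i = 0" | "bond i j = 1" "bond j i = 1" | "bond i j * bond j i = 2"
      using ij by (cases rule: bond_cases) auto
    thus ?thesis
    proof cases
      case 1
      hence "T j (E i) = E i" "T j (L i * F i) = L i * F i"
        using ij by (simp_all add: alg_hom_simps[OF T_hom] T_E TE_def T_L TL_def T_F TF_def tw_def twr_def)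
      thus ?thesis using 1 ij
        by (simp add: braid_order_def numeral_2_eq_2 TEi alg_hom_simps[OF T_hom])
    next
      case 2
      have "T i (T j (T i (E i))) = - (T i (T j (L i)) * T i (T j (F i)))"
        unfolding TEi using ij by (simp add: alg_hom_simps[OF T_hom])
      also have "\<dots> = T j (T i (T j (E i)))"
        using rank2_A rank2_F(1) rank2_L(1) 2 ij by (simp add: TEi)
      finally show ?thesis using 2 by (simp add: braid_order_def numeral_3_eq_3)
    next
      case 3
      have "T j (T i (T j (T i (E i)))) = - (T j (T i (T j (L i))) * T j (T i (T j (F i))))"
        unfolding TEi using ij by (simp add: alg_hom_simps[OF T_hom])
      also have "\<dots> = T i (T j (T i (T j (E i))))"
        using rank2_F(2,3)[OF ij] rank2_L(2)[OF ij] 3 ij by (simp add: TEi)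
      finally show ?thesis using 3 by (simp add: braid_order_def eval_nat_numeral)
    qed
  qed
  have other: "foldr T (alternating (braid_order i j) i j) (E k) = foldr T (alternating (braid_order i j) j i) (E k)"
    if ij: "i \<in> I" "j \<in> I" "i \<noteq> j" and k: "k \<in> I" "k \<noteq> i" "k \<noteq> j" and jk: "bond j k = 0" for i j k
  proof -
    have "T j (E k) = E k" using ij k jk by (simp add: T_E TE_def tw_def)
    moreover have "T j (T i (E k)) = T i (E k)" if b: "bond i j = 0" "bond j i = 0"
    proof -
      have "T i (E k) = tw (v i) (bond i k) (E i) (E k)" using ij k by (simp add: T_E TE_def)
      moreover have "T j (E i) = E i" using b ij by (simp add: T_E TE_def tw_def)
      ultimately show ?thesis using \<open>T j (E k) = E k\<close> ij by (simp add: alg_hom_simps[OF T_hom])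
    qed
    moreover have "T i (T j (T i (E k))) = T j (T i (E k))" if "bond i j = 1" "bond j i = 1"
      by (rule fix_A) (use ij k jk that in auto)
    moreover have "T j (T i (T j (T i (E k)))) = T i (T j (T i (E k)))" if "bond i j * bond j i = 2"
      by (rule fix_B) (use ij k jk that in auto)
    ultimately show ?thesis
      by (cases rule: bond_cases[OF ij]) (simp_all add: braid_order_def eval_nat_numeral)
  qed
  consider "k = i" | "k = j" | "k \<noteq> i" "k \<noteq> j" "bond j k = 0" | "k \<noteq> i" "k \<noteq> j" "bond i k = 0"
    | "k \<noteq> i" "k \<noteq> j" "bond i k \<noteq> 0" "bond j k \<noteq> 0" by blast
  thus ?thesis
  proof cases
    case 1 thus ?thesis using same[OF ij] by simp
  next
    case 2 thus ?thesis using same[of j i] ij by (simp add: braid_order_sym)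
  next
    case 3 thus ?thesis using other[OF ij k] by simp
  next
    case 4 thus ?thesis using other[OF ij(2,1) _ k] ij by (simp add: braid_order_sym)
  next
    case 5
    have b: "bond i j = 0"
    proof (rule ccontr)
      assume "bond i j \<noteq> 0"
      hence "a j k = 0" using no_triangle[of i j k] ij k 5 a_eq by auto
      thus False using 5 a_eq[of j k] ij k by simp
    qed
    have b': "bond j i = 0" by (rule bond_0_sym[OF ij b])
    have "T i (E k) = tw (v i) (bond i k) (E i) (E k)" "T j (E k) = tw (v j) (bond j k) (E j) (E k)"
      using ij k 5 by (simp_all add: T_E TE_def)
    moreover have "T j (E i) = E i" "T i (E j) = E j" using b b' ij by (simp_all add: T_E TE_def tw_def)
    ultimately have "T i (T j (E k)) = T j (T i (E k))"
      using ij tw_tw_commute[OF E_comm[OF ij b]] by (simp add: alg_hom_simps[OF T_hom])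
    thus ?thesis by (simp add: braid_order_def b eval_nat_numeral)
  qed
qed

lemma braid_F:
  assumes ij: "i \<in> I" "j \<in> I" "i \<noteq> j" and k: "k \<in> I"
  shows "foldr T (alternating (braid_order i j) i j) (F k) = foldr T (alternating (braid_order i j) j i) (F k)"
proof -
  have "foldr (\<lambda>i x. op (T i (unop x))) xs (op y) = op (foldr T xs y)" for xs y
    by (induction xs) simp_all
  thus ?thesis using braided.braid_E[OF braided_opposite ij k] by (simp add: op_eq_iff)
qed

lemma T_gens: "i \<in> I ==> x \<in> gens ==> T i x \<in> alg gens"
proof -
  assume i: "i \<in> I"
  have g: "E j \<in> alg gens" "F j \<in> alg gens" "K j \<in> alg gens" "L j \<in> alg gens" if "j \<in> I" for j
    using that by (auto simp: gens_def intro: alg.gen)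
  assume "x \<in> gens"
  then consider j where "j \<in> I" "x = E j" | j where "j \<in> I" "x = F j" | j where "j \<in> I" "x = K j" | j where "j \<in> I" "x = L j"
    unfolding gens_def by blast
  thus ?thesis
    by cases (auto simp: i T_E T_F T_K T_L TE_def TF_def TK_def TL_def intro!: g alg_intros tw_in_alg)
qed

lemma T_alg: "i \<in> I ==> x \<in> alg gens ==> T i x \<in> alg gens"
  using alg_hom_alg[OF T_hom, of i gens] T_gens[of i] alg_subset_iff[of "T i ` gens" gens] by blast

lemma alg_hom_foldr: "set xs \<subseteq> I ==> alg_hom (foldr T xs)"
  by (induction xs) (simp_all add: alg_hom_id[unfolded id_def[symmetric]] o_def alg_hom_comp[OF T_hom])

lemma foldr_T_alg: "set xs \<subseteq> I ==> x \<in> alg gens ==> foldr T xs x \<in> alg gens"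
  by (induction xs) (simp_all add: T_alg)

theorem braid_relation:
  assumes ij: "i \<in> I" "j \<in> I" "i \<noteq> j" and x: "x \<in> alg gens"
  shows "foldr T (alternating (braid_order i j) i j) x = foldr T (alternating (braid_order i j) j i) x"
proof (rule alg_hom_eq_on_alg[OF _ _ _ x])
  show "alg_hom (foldr T (alternating (braid_order i j) i j))" "alg_hom (foldr T (alternating (braid_order i j) j i))"
    by (rule alg_hom_foldr, use set_alternating ij in fastforce)+
  show "foldr T (alternating (braid_order i j) i j) x = foldr T (alternating (braid_order i j) j i) x" if "x \<in> gens" for x
    using that braid_E[OF ij] braid_F[OF ij] braid_Kz[OF ij, of _ 1] braid_Kz[OF ij, of _ "- 1"]
    by (auto simp: gens_def Kz_simps)
qed

end

section \<open>Weyl groups\<close>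

lemma length_alternating [simp]: "length (alternating n i j) = n"
  by (induction n arbitrary: i j) auto

lemma alternating_Suc: "alternating (Suc p) i j = alternating p i j @ [if even p then i else j]"
  by (induction p arbitrary: i j) auto

locale weyl =
  fixes C :: "'i cartan_datum" and I and a and d
  defines "I \<equiv> index C" and "a \<equiv> cartan C" and "d \<equiv> symm C"
  assumes ct: "cartan_type I a d"
begin

sublocale cartan_type I a d by (rule ct)

abbreviation "W \<equiv> weyl_word C"
abbreviation "\<alpha> \<equiv> simple_root"

definition pairing :: "('i \<Rightarrow> int) \<Rightarrow> 'i \<Rightarrow> int" where
  "pairing v i = (\<Sum>j\<in>I. a i j * v j)"

definition form :: "('i \<Rightarrow> int) \<Rightarrow> ('i \<Rightarrow> int) \<Rightarrow> int" where
  "form v w = (\<Sum>i\<in>I. \<Sum>j\<in>I. int (d i) * a i j * v i * w j)"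

definition vadd :: "('i \<Rightarrow> int) \<Rightarrow> int \<Rightarrow> ('i \<Rightarrow> int) \<Rightarrow> ('i \<Rightarrow> int)" where
  "vadd v c w = (\<lambda>k. v k + c * w k)"

abbreviation "s \<equiv> reflection C"

lemma s_eq: "s i v = vadd v (- pairing v i) (\<alpha> i)"
  by (simp add: reflection_def pairing_def vadd_def fun_eq_iff a_def I_def)

lemma pairing_vadd: "pairing (vadd v c w) i = pairing v i + c * pairing w i"
  by (simp add: pairing_def vadd_def sum.distrib sum_distrib_left algebra_simps)

lemma form_vadd: "form (vadd v c w) x = form v x + c * form w x" "form x (vadd v c w) = form x v + c * form x w"
  by (simp_all add: form_def vadd_def sum.distrib sum_distrib_left algebra_simps)

lemma pairing_root: "i \<in> I ==> j \<in> I ==> pairing (\<alpha> j) i = a i j"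
  using fin by (simp add: pairing_def simple_root_def sum.delta if_distrib cong: if_cong)

lemma form_sym: "form v w = form w v"
proof -
  have "form v w = (\<Sum>j\<in>I. \<Sum>i\<in>I. int (d i) * a i j * v i * w j)"
    unfolding form_def by (rule sum.swap)
  also have "\<dots> = form w v"
    unfolding form_def by (intro sum.cong refl) (simp add: sym mult.commute mult.left_commute)
  finally show ?thesis .
qed

lemma form_root: "i \<in> I ==> form (\<alpha> i) v = int (d i) * pairing v i"
proof -
  assume i: "i \<in> I"
  have "form (\<alpha> i) v = (\<Sum>k\<in>I. if k = i then \<Sum>j\<in>I. int (d k) * a k j * v j else 0)"
    unfolding form_def by (rule sum.cong) (auto simp: simple_root_def)
  thus ?thesis using i fin by (simp add: pairing_def sum_distrib_left mult.assoc)
qed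

lemma s_vadd: "s i (vadd v c w) = vadd (s i v) c (s i w)"
  by (simp add: s_eq vadd_def pairing_vadd[unfolded vadd_def] fun_eq_iff algebra_simps)

lemma W_Nil: "W [] v = v" and W_Cons: "W (i # ws) v = s i (W ws v)" and W_append: "W (us @ ws) v = W us (W ws v)"
  by (simp_all add: weyl_word_def)

lemma W_vadd: "W ws (vadd v c w) = vadd (W ws v) c (W ws w)"
  by (induction ws) (simp_all add: W_Nil W_Cons s_vadd)

lemma ss: "i \<in> I ==> s i (s i v) = v"
  unfolding s_eq pairing_vadd by (simp add: pairing_root vadd_def fun_eq_iff)

lemma form_s: "i \<in> I ==> form (s i v) (s i w) = form v w"
  using form_sym[of v "\<alpha> i"] by (simp add: s_eq form_vadd form_root pairing_root algebra_simps)

lemma form_W: "set ws \<subseteq> I ==> form (W ws v) (W ws w) = form v w"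
  by (induction ws) (simp_all add: W_Nil W_Cons form_s)

lemma W_rev: "set ws \<subseteq> I ==> W (rev ws) (W ws v) = v" "set ws \<subseteq> I ==> W ws (W (rev ws) v) = v"
proof -
  show 1: "set ws \<subseteq> I ==> W (rev ws) (W ws v) = v" for ws
    by (induction ws) (simp_all add: W_Nil W_Cons W_append ss)
  show "set ws \<subseteq> I ==> W ws (W (rev ws) v) = v" using 1[of "rev ws"] by simp
qed

lemma W_outside: "set ws \<subseteq> I ==> k \<notin> I ==> W ws v k = v k"
  by (induction ws) (auto simp: W_Nil W_Cons s_eq vadd_def simple_root_def)

lemma W_0: "W ws (\<lambda>_. 0) = (\<lambda>_. 0)"
  using W_vadd[of ws "\<lambda>_. 0" "- 1" "\<lambda>_. 0"] by (simp add: vadd_def)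

lemma s_root: "i \<in> I ==> s i (\<alpha> i) = vadd (\<lambda>_. 0) (- 1) (\<alpha> i)"
  "i \<in> I ==> j \<in> I ==> j \<noteq> i ==> s i (\<alpha> j) = vadd (\<alpha> j) (int (bond i j)) (\<alpha> i)"
  using a_eq[of i j] by (simp_all add: s_eq pairing_root vadd_def fun_eq_iff)

definition pos :: "('i \<Rightarrow> int) \<Rightarrow> bool" where "pos v \<longleftrightarrow> (\<forall>k. 0 \<le> v k)"
definition neg :: "('i \<Rightarrow> int) \<Rightarrow> bool" where "neg v \<longleftrightarrow> (\<forall>k. v k \<le> 0)"

lemma neg_vadd: "neg v ==> neg w ==> 0 \<le> c ==> neg (vadd v c w)"
  by (simp add: neg_def vadd_def add_nonpos_nonpos mult_nonneg_nonpos)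

lemma neg_uminus: "neg (vadd (\<lambda>_. 0) (- 1) v) \<longleftrightarrow> pos v" "pos (vadd (\<lambda>_. 0) (- 1) v) \<longleftrightarrow> neg v"
  by (simp_all add: neg_def pos_def vadd_def)

lemma W_root_neq_0: "set ws \<subseteq> I ==> W ws (\<alpha> i) \<noteq> (\<lambda>_. 0)"
proof
  assume ws: "set ws \<subseteq> I" and "W ws (\<alpha> i) = (\<lambda>_. 0)"
  hence "\<alpha> i = (\<lambda>_. 0)" using W_rev(1)[OF ws, of "\<alpha> i"] by (simp add: W_0)
  hence "\<alpha> i i = 0" by simp
  thus False by (simp add: simple_root_def)
qed

lemma not_pos_neg: "set ws \<subseteq> I ==> \<not> (pos (W ws (\<alpha> i)) \<and> neg (W ws (\<alpha> i)))"
  using W_root_neq_0[of ws i] by (auto simp: pos_def neg_def fun_eq_iff intro: antisym)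

text \<open>Invariance of the form gives \<open>d i = d j\<close>, and then equality of the pairings
  that define the two reflections.\<close>

lemma conjugate:
  assumes ws: "set ws \<subseteq> I" and i: "i \<in> I" and j: "j \<in> I" and eq: "W ws (\<alpha> i) = \<alpha> j"
  shows "W ws (s i v) = s j (W ws v)"
proof -
  have "form (\<alpha> j) (\<alpha> j) = form (\<alpha> i) (\<alpha> i)" using form_W[OF ws, of "\<alpha> i" "\<alpha> i"] eq by simp
  hence d: "d i = d j" using i j by (simp add: form_root pairing_root)
  have "form (\<alpha> j) (W ws v) = form (\<alpha> i) v" using form_W[OF ws, of "\<alpha> i" v] eq by simp
  hence "pairing (W ws v) j = pairing v i" using i j d d_pos[OF j] by (simp add: form_root)
  thus ?thesis by (simp add: s_eq W_vadd eq)
qed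

lemma s_rank2:
  assumes ij: "i \<in> I" "j \<in> I" "i \<noteq> j"
  shows "s i (vadd (vadd v x (\<alpha> i)) y (\<alpha> j)) = vadd (vadd v (int (bond i j) * y - pairing v i - x) (\<alpha> i)) y (\<alpha> j)"
    "s j (vadd (vadd v x (\<alpha> i)) y (\<alpha> j)) = vadd (vadd v x (\<alpha> i)) (int (bond j i) * x - pairing v j - y) (\<alpha> j)"
proof -
  have s: "s i (\<alpha> i) = vadd (\<lambda>_. 0) (- 1) (\<alpha> i)" "s j (\<alpha> j) = vadd (\<lambda>_. 0) (- 1) (\<alpha> j)"
    "s i (\<alpha> j) = vadd (\<alpha> j) (int (bond i j)) (\<alpha> i)" "s j (\<alpha> i) = vadd (\<alpha> i) (int (bond j i)) (\<alpha> j)"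
    using ij s_root by auto
  show "s i (vadd (vadd v x (\<alpha> i)) y (\<alpha> j)) = vadd (vadd v (int (bond i j) * y - pairing v i - x) (\<alpha> i)) y (\<alpha> j)"
    unfolding s_vadd s s_eq[of i v] by (simp add: vadd_def fun_eq_iff algebra_simps)
  show "s j (vadd (vadd v x (\<alpha> i)) y (\<alpha> j)) = vadd (vadd v x (\<alpha> i)) (int (bond j i) * x - pairing v j - y) (\<alpha> j)"
    unfolding s_vadd s s_eq[of j v] by (simp add: vadd_def fun_eq_iff algebra_simps)
qed

lemma W_braid:
  assumes ij: "i \<in> I" "j \<in> I" "i \<noteq> j"
  shows "W (alternating (braid_order i j) i j) v = W (alternating (braid_order i j) j i) v"
proof -
  define w where "w x y = vadd (vadd v x (\<alpha> i)) y (\<alpha> j)" for x y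
  define P Q where "P = - pairing v i" and "Q = - pairing v j"
  have "s i (w x y) = w (int (bond i j) * y + P - x) y"
    "s j (w x y) = w x (int (bond j i) * x + Q - y)" for x y
    using s_rank2[OF ij, of v x y] by (simp_all add: w_def P_def Q_def)
  hence "W (alternating (braid_order i j) i j) (w 0 0) = W (alternating (braid_order i j) j i) (w 0 0)"
    by (cases rule: bond_cases[OF ij]) (simp_all add: braid_order_def eval_nat_numeral W_Cons W_Nil algebra_simps)
  thus ?thesis by (simp add: w_def vadd_def)
qed

text \<open>Symmetric although no clause says so, because \<open>i\<close> and \<open>j\<close> can
  be exchanged in \<open>move\<close>.\<close>

inductive braid_equiv :: "'i list \<Rightarrow> 'i list \<Rightarrow> bool" where
  refl: "braid_equiv ws ws"
| move: "i \<in> I ==> j \<in> I ==> i \<noteq> j ==> set us \<subseteq> I ==> set vs \<subseteq> I ==>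
    braid_equiv (us @ alternating (braid_order i j) i j @ vs) (us @ alternating (braid_order i j) j i @ vs)"
| trans: "braid_equiv ws ws' ==> braid_equiv ws' ws'' ==> braid_equiv ws ws''"

lemma braid_equiv_append: "braid_equiv us vs ==> set ws \<subseteq> I ==> braid_equiv (us @ ws) (vs @ ws)"
proof (induction rule: braid_equiv.induct)
  case (move i j us vs)
  thus ?case using braid_equiv.move[of i j us "vs @ ws"] by simp
qed (auto intro: braid_equiv.intros)

text \<open>Alternating words of odd length are palindromes, those of even length are reversed into
  the other alternating word; among the orders 2, 3, 4 only 3 is odd.\<close>

lemma rev_alternating: "rev (alternating (braid_order i j) i j) =
    (if braid_order i j = 3 then alternating (braid_order i j) i j else alternating (braid_order i j) j i)"
  by (simp add: braid_order_def eval_nat_numeral)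

lemma rev_alternating': "rev (alternating (braid_order i j) j i) =
    (if braid_order i j = 3 then alternating (braid_order i j) j i else alternating (braid_order i j) i j)"
  using rev_alternating[of j i] unfolding braid_order_sym[of j i] .

lemma braid_equiv_rev:
  assumes "i \<in> I" "j \<in> I" "i \<noteq> j" "set us \<subseteq> I"
  shows "braid_equiv (us @ rev (alternating (braid_order i j) i j)) (us @ rev (alternating (braid_order i j) j i))"
proof -
  let ?m = "braid_order i j"
  have 1: "braid_equiv (us @ alternating ?m i j) (us @ alternating ?m j i)"
    using braid_equiv.move[of i j us "[]"] assms by simp
  have 2: "braid_equiv (us @ alternating ?m j i) (us @ alternating ?m i j)"
    using braid_equiv.move[of j i us "[]"] assms by (simp add: braid_order_sym[of j i])
  show ?thesis
  proof (cases "?m = 3")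
    case True thus ?thesis unfolding rev_alternating rev_alternating' if_P[OF True] by (intro 1)
  next
    case False thus ?thesis unfolding rev_alternating rev_alternating' if_not_P[OF False] by (intro 2)
  qed
qed

lemma W_rev_alternating:
  assumes "i \<in> I" "j \<in> I" "i \<noteq> j"
  shows "W (rev (alternating (braid_order i j) i j)) v = W (rev (alternating (braid_order i j) j i)) v"
proof (cases "braid_order i j = 3")
  case True show ?thesis unfolding rev_alternating rev_alternating' if_P[OF True] by (rule W_braid[OF assms])
next
  case False show ?thesis unfolding rev_alternating rev_alternating' if_not_P[OF False] by (rule W_braid[OF assms, symmetric])
qed

definition reduced :: "'i list \<Rightarrow> bool" where
  "reduced ws \<longleftrightarrow> set ws \<subseteq> I \<and> (\<forall>vs. set vs \<subseteq> I \<longrightarrow> W vs = W ws \<longrightarrow> length ws \<le> length vs)"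

lemma reduced_set: "reduced ws ==> set ws \<subseteq> I" by (simp add: reduced_def)

lemma reduced_eq: "reduced ws ==> set ws' \<subseteq> I ==> W ws' = W ws ==> length ws' = length ws ==> reduced ws'"
  by (simp add: reduced_def)

lemma reduced_sub: "reduced (us @ ws @ vs) ==> reduced ws"
proof -
  assume r: "reduced (us @ ws @ vs)"
  have "length ws \<le> length xs" if "set xs \<subseteq> I" "W xs = W ws" for xs
  proof -
    have "W (us @ xs @ vs) = W (us @ ws @ vs)" by (rule ext) (simp add: W_append that(2))
    moreover have "set (us @ xs @ vs) \<subseteq> I" using r that by (simp add: reduced_def)
    ultimately have "length (us @ ws @ vs) \<le> length (us @ xs @ vs)" using r unfolding reduced_def by blast
    thus ?thesis by simp
  qed
  thus ?thesis using r by (simp add: reduced_def)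
qed

lemma reduced_decompositionD:
  assumes "reduced_decomposition C rs w" shows "reduced rs" "W rs = w"
proof -
  show "W rs = w" using assms by (simp add: reduced_decomposition_def)
  have "length rs \<le> length vs" if "set vs \<subseteq> I" "W vs = W rs" for vs
  proof -
    have "weyl_length C w \<le> length vs" unfolding weyl_length_def
      by (rule Least_le) (use that \<open>W rs = w\<close> in \<open>auto simp: I_def lists_eq_set\<close>)
    thus ?thesis using assms by (simp add: reduced_decomposition_def)
  qed
  thus "reduced rs" using assms by (auto simp: reduced_def reduced_decomposition_def I_def lists_eq_set)
qed

lemma reduced_iff_length: "set ws \<subseteq> I ==> reduced ws \<longleftrightarrow> weyl_length C (W ws) = length ws"
proof -
  assume ws: "set ws \<subseteq> I"
  show ?thesis
  proof
    assume "reduced ws"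
    thus "weyl_length C (W ws) = length ws" unfolding weyl_length_def
      by (intro Least_equality) (auto simp: reduced_def I_def lists_eq_set)
  next
    assume "weyl_length C (W ws) = length ws"
    thus "reduced ws" using reduced_decompositionD(1)[of ws "W ws"] ws
      by (simp add: reduced_decomposition_def I_def lists_eq_set)
  qed
qed

end

text \<open>That every root has a sign is assumed here because it is proved in two different ways:
  from the positive definite form for the simply laced datum, and by comparison with that datum for
  the folded one.\<close>

locale rooted = weyl +
  assumes sign: "set ws \<subseteq> I ==> i \<in> I ==> pos (W ws (\<alpha> i)) \<or> neg (W ws (\<alpha> i))"
begin

section \<open>Exchange condition, reduced words and Matsumoto's theorem\<close>

lemma neg_iff: "set ws \<subseteq> I ==> i \<in> I ==> neg (W ws (\<alpha> i)) \<longleftrightarrow> \<not> pos (W ws (\<alpha> i))"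
  using sign not_pos_neg by blast

text \<open>Reflection at \<open>j\<close> changes only the coefficient at \<open>j\<close>, so a
  root that changes sign is a multiple of \<open>\<alpha> j\<close>. Applying the inverse word shows
  that the integral factor divides 1.\<close>

lemma simple_permutes:
  assumes ws: "set ws \<subseteq> I" and i: "i \<in> I" and j: "j \<in> I"
    and p: "pos (W ws (\<alpha> i))" and n: "neg (s j (W ws (\<alpha> i)))"
  shows "W ws (\<alpha> i) = \<alpha> j"
proof -
  define \<beta> where "\<beta> = W ws (\<alpha> i)"
  have "\<beta> k = 0" if "k \<noteq> j" for k
  proof -
    have "s j \<beta> k = \<beta> k" using that by (simp add: s_eq vadd_def simple_root_def)
    moreover have "0 \<le> \<beta> k" "s j \<beta> k \<le> 0" using p n by (simp_all add: pos_def neg_def \<beta>_def)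
    ultimately show ?thesis by simp
  qed
  hence \<beta>: "\<beta> = vadd (\<lambda>_. 0) (\<beta> j) (\<alpha> j)" by (auto simp: vadd_def simple_root_def fun_eq_iff)
  have "\<alpha> i = W (rev ws) \<beta>" using W_rev(1)[OF ws] by (simp add: \<beta>_def)
  also have "\<dots> = vadd (\<lambda>_. 0) (\<beta> j) (W (rev ws) (\<alpha> j))" by (subst \<beta>) (simp add: W_vadd W_0)
  finally have "\<alpha> i i = \<beta> j * W (rev ws) (\<alpha> j) i" by (simp add: vadd_def)
  hence "1 = \<beta> j * W (rev ws) (\<alpha> j) i" by (simp add: simple_root_def)
  hence "\<beta> j dvd 1" by (rule dvdI)
  moreover have "0 \<le> \<beta> j" using p by (simp add: pos_def \<beta>_def)
  ultimately have "\<beta> j = 1" by simp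
  thus ?thesis using \<beta> by (simp add: \<beta>_def vadd_def)
qed

text \<open>Reading from the right, at the letter that makes the image of \<open>\<alpha> i\<close>
  negative this image equals the simple root of the letter. \<open>conjugate\<close> then moves
  \<open>s i\<close> to that place, where it cancels.\<close>

lemma exchange:
  assumes "set ws \<subseteq> I" "i \<in> I" "neg (W ws (\<alpha> i))"
  obtains xs j ys where "ws = xs @ j # ys" "\<And>v. W ws (s i v) = W (xs @ ys) v"
  using assms
proof (induction ws arbitrary: thesis)
  case Nil
  thus ?case by (auto simp: W_Nil neg_def simple_root_def dest: spec[of _ i])
next
  case (Cons j ws)
  show ?case
  proof (cases "neg (W ws (\<alpha> i))")
    case True
    have "set ws \<subseteq> I" using Cons.prems(2) by simp
    from Cons.IH[OF _ this Cons.prems(3) True]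
    obtain xs k ys where "ws = xs @ k # ys" "\<And>v. W ws (s i v) = W (xs @ ys) v" by metis
    thus ?thesis using Cons.prems(1)[of "j # xs" k ys] by (simp add: W_Cons)
  next
    case False
    hence "pos (W ws (\<alpha> i))" using neg_iff Cons.prems by auto
    hence "W ws (\<alpha> i) = \<alpha> j" using simple_permutes[of ws i j] Cons.prems by (simp add: W_Cons)
    hence "W ws (s i v) = s j (W ws v)" for v using conjugate[of ws i j] Cons.prems by simp
    thus ?thesis using Cons.prems(1)[of "[]" j ws] Cons.prems(2) by (simp add: W_Cons ss)
  qed
qed

text \<open>Both directions come from \<open>exchange\<close>: applied to \<open>ws\<close> it
  shortens \<open>ws @ [i]\<close>, and applied to any word for \<open>ws @ [i]\<close> it yields a
  shorter word for \<open>ws\<close>.\<close>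

lemma reduced_snoc:
  assumes r: "reduced ws" and i: "i \<in> I" shows "reduced (ws @ [i]) \<longleftrightarrow> pos (W ws (\<alpha> i))"
proof -
  have ws: "set ws \<subseteq> I" using r by (simp add: reduced_def)
  show ?thesis
  proof
    assume R: "reduced (ws @ [i])"
    show "pos (W ws (\<alpha> i))"
    proof (rule ccontr)
      assume "\<not> pos (W ws (\<alpha> i))"
      then obtain xs j ys where "ws = xs @ j # ys" "\<And>v. W ws (s i v) = W (xs @ ys) v"
        using exchange[OF ws i] neg_iff[OF ws i] by metis
      hence "W (xs @ ys) = W (ws @ [i])" "length (xs @ ys) < length (ws @ [i])" "set (xs @ ys) \<subseteq> I"
        using ws by (auto simp: fun_eq_iff W_append W_Cons W_Nil)
      thus False using R unfolding reduced_def by (meson leD)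
    qed
  next
    assume p: "pos (W ws (\<alpha> i))"
    have "length (ws @ [i]) \<le> length vs" if vs: "set vs \<subseteq> I" "W vs = W (ws @ [i])" for vs
    proof -
      have eq: "W vs v = W ws (s i v)" for v using vs(2) by (simp add: W_append W_Cons W_Nil)
      have "W vs (\<alpha> i) = vadd (\<lambda>_. 0) (- 1) (W ws (\<alpha> i))" unfolding eq s_root(1)[OF i] W_vadd W_0 ..
      hence "neg (W vs (\<alpha> i))" using p by (simp add: neg_uminus)
      then obtain xs j ys where x: "vs = xs @ j # ys" "\<And>v. W vs (s i v) = W (xs @ ys) v"
        using exchange[OF vs(1) i] by metis
      have "W (xs @ ys) = W ws" using x(2) eq i by (simp add: fun_eq_iff ss)
      moreover have "set (xs @ ys) \<subseteq> I" using x vs by auto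
      ultimately have "length ws \<le> length (xs @ ys)" using r unfolding reduced_def by blast
      thus ?thesis by (simp add: x(1))
    qed
    thus "reduced (ws @ [i])" using ws i by (auto simp: reduced_def)
  qed
qed

lemma reduced_peel:
  assumes r: "reduced ws" and i: "i \<in> I" and n: "neg (W ws (\<alpha> i))"
  obtains vs where "reduced (vs @ [i])" "reduced vs" "W (vs @ [i]) = W ws" "length ws = Suc (length vs)"
proof -
  have ws: "set ws \<subseteq> I" using r by (simp add: reduced_def)
  obtain xs j ys where x: "ws = xs @ j # ys" "\<And>v. W ws (s i v) = W (xs @ ys) v"
    using exchange[OF ws i n] by metis
  have eq: "W ((xs @ ys) @ [i]) = W ws"
  proof
    fix v
    have "W ((xs @ ys) @ [i]) v = W (xs @ ys) (s i v)" by (simp only: W_append[of "xs @ ys"] W_Cons W_Nil)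
    thus "W ((xs @ ys) @ [i]) v = W ws v" using ss[OF i] by (simp add: x(2)[symmetric])
  qed
  have "reduced ((xs @ ys) @ [i])"
    using r ws i unfolding reduced_def eq by (auto simp: x(1))
  thus thesis using that[of "xs @ ys"] eq reduced_sub[of "[]" "xs @ ys" "[i]"] x(1) by simp
qed

text \<open>Lets \<open>peel_alternating\<close> deduce the sign of the next root from the signs for
  \<open>\<alpha> i\<close> and \<open>\<alpha> j\<close> alone.\<close>

lemma rank2_positive:
  assumes ij: "i \<in> I" "j \<in> I" "i \<noteq> j" and p: "p < braid_order i j"
  obtains x y where "0 \<le> x" "0 \<le> y"
    "W (alternating p i j) (\<alpha> (if even p then i else j)) = vadd (vadd (\<lambda>_. 0) x (\<alpha> i)) y (\<alpha> j)"
proof -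
  define w where "w x y = vadd (vadd (\<lambda>_. 0) x (\<alpha> i)) y (\<alpha> j)" for x y
  have "pairing (\<lambda>_. 0) k = 0" for k by (simp add: pairing_def)
  hence s: "s i (w x y) = w (int (bond i j) * y - x) y"
    "s j (w x y) = w x (int (bond j i) * x - y)" for x y
    using s_rank2[OF ij, of "\<lambda>_. 0" x y] by (simp_all add: w_def)
  have r: "\<alpha> i = w 1 0" "\<alpha> j = w 0 1" by (simp_all add: w_def vadd_def)
  have "p = 0 \<or> p = 1 \<or> p = 2 \<or> p = 3" using p by (auto simp: braid_order_def split: if_splits)
  have ex: "\<exists>x y. A = w x y \<and> 0 \<le> x \<and> 0 \<le> y" if "A = w x y" "0 \<le> x" "0 \<le> y" for A x y
    using that by blast
  from \<open>p = 0 \<or> _\<close> have "\<exists>x y. W (alternating p i j) (if even p then w 1 0 else w 0 1) = w x y \<and> 0 \<le> x \<and> 0 \<le> y"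
  proof (elim disjE)
    assume "p = 0"
    hence "W (alternating p i j) (if even p then w 1 0 else w 0 1) = w 1 0" by (simp add: W_Nil)
    thus ?thesis by (rule ex) simp_all
  next
    assume "p = 1"
    hence "W (alternating p i j) (if even p then w 1 0 else w 0 1) = w (int (bond i j)) 1" by (simp add: W_Nil W_Cons s)
    thus ?thesis by (rule ex) simp_all
  next
    assume 2: "p = 2"
    hence "W (alternating p i j) (if even p then w 1 0 else w 0 1) = w (int (bond i j * bond j i) - 1) (int (bond j i))"
      by (simp add: W_Nil W_Cons s numeral_2_eq_2 mult.commute)
    moreover have "1 \<le> bond i j * bond j i" using 2 p by (simp add: braid_order_def split: if_splits)
    hence "0 \<le> int (bond i j * bond j i) - 1" by linarith
    ultimately show ?thesis using ex of_nat_0_le_iff by blast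
  next
    assume 3: "p = 3"
    hence "bond i j * bond j i = 2"
      using p by (cases rule: bond_cases[OF ij]) (simp_all add: braid_order_def)
    hence "int (bond j i) * int (bond i j) = 2" by (simp add: mult.commute flip: of_nat_mult)
    hence "W (alternating p i j) (if even p then w 1 0 else w 0 1) = w 0 1"
      using 3 by (simp add: W_Nil W_Cons s numeral_3_eq_3 algebra_simps)
    thus ?thesis by (rule ex) simp_all
  qed
  then obtain x y where "0 \<le> x" "0 \<le> y" "W (alternating p i j) (if even p then w 1 0 else w 0 1) = w x y" by blast
  moreover have "(if even p then w 1 0 else w 0 1) = \<alpha> (if even p then i else j)" using r by simp
  ultimately show thesis using that[of x y] unfolding w_def by simp
qed

text \<open>Below the braid order the next root to be peeled is a nonnegative combination of the two
  negative ones, hence negative, and \<open>reduced_peel\<close> removes another letter. So an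
  element that makes both simple roots negative has a reduced word ending in a full alternating
  word.\<close>

lemma peel_alternating:
  assumes ij: "i \<in> I" "j \<in> I" "i \<noteq> j" and r: "reduced ws" and n: "neg (W ws (\<alpha> i))" "neg (W ws (\<alpha> j))"
    and p: "p \<le> braid_order i j"
  shows "\<exists>vs. reduced (vs @ rev (alternating p i j)) \<and> W (vs @ rev (alternating p i j)) = W ws \<and> length ws = length vs + p"
  using p
proof (induction p)
  case 0
  thus ?case using r by auto
next
  case (Suc p)
  have "p \<le> braid_order i j" using Suc.prems by simp
  from Suc.IH[OF this]
  obtain vs where vs: "reduced (vs @ rev (alternating p i j))" "W (vs @ rev (alternating p i j)) = W ws" "length ws = length vs + p"
    by blast
  define k where "k = (if even p then i else j)"
  have k: "k \<in> I" using ij by (simp add: k_def)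
  have alt: "alternating (Suc p) i j = alternating p i j @ [k]"
    unfolding k_def by (rule alternating_Suc)
  have al: "set (alternating p i j) \<subseteq> I" using set_alternating[of p i j] ij by auto
  obtain x y where xy: "0 \<le> x" "0 \<le> y" "W (alternating p i j) (\<alpha> k) = vadd (vadd (\<lambda>_. 0) x (\<alpha> i)) y (\<alpha> j)"
  proof (rule rank2_positive[OF ij, of p])
    show "p < braid_order i j" using Suc.prems by simp
  qed (unfold k_def)
  have "W vs v = W ws (W (alternating p i j) v)" for v
    unfolding vs(2)[symmetric] W_append using W_rev(1)[OF al] by simp
  hence "W vs (\<alpha> k) = vadd (vadd (\<lambda>_. 0) x (W ws (\<alpha> i))) y (W ws (\<alpha> j))"
    by (simp only: xy(3) W_vadd W_0)
  moreover have "neg (vadd (vadd (\<lambda>_. 0) x (W ws (\<alpha> i))) y (W ws (\<alpha> j)))"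
    by (intro neg_vadd n xy(1,2)) (simp add: neg_def)
  ultimately have nk: "neg (W vs (\<alpha> k))" by simp
  have rvs: "reduced vs" using vs(1) reduced_sub[of "[]" vs] by simp
  obtain us where us: "reduced (us @ [k])" "W (us @ [k]) = W vs" "length vs = Suc (length us)"
    by (rule reduced_peel[OF rvs k nk])
  have W: "W (us @ rev (alternating (Suc p) i j)) = W ws"
  proof
    fix v
    have "W (us @ rev (alternating (Suc p) i j)) v = W (us @ [k]) (W (rev (alternating p i j)) v)"
      unfolding alt by (simp add: W_append W_Cons W_Nil)
    also have "\<dots> = W (vs @ rev (alternating p i j)) v" unfolding us(2) by (simp only: W_append)
    finally show "W (us @ rev (alternating (Suc p) i j)) v = W ws v" unfolding vs(2) .
  qed
  have I: "set (us @ rev (alternating (Suc p) i j)) \<subseteq> I"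
    using reduced_set[OF us(1)] al k unfolding alt by simp
  have len: "length ws = length us + Suc p" using us(3) vs(3) by simp
  have "reduced (us @ rev (alternating (Suc p) i j))"
    by (rule reduced_eq[OF r I W]) (simp only: len length_append length_rev length_alternating)
  thus ?case using W len by blast
qed

lemma neg_last:
  assumes "reduced (xs @ [k])" shows "reduced xs" "k \<in> I" "pos (W xs (\<alpha> k))" "neg (W (xs @ [k]) (\<alpha> k))"
proof -
  show 1: "reduced xs" "k \<in> I" using assms reduced_sub[of "[]" xs "[k]"] by (auto simp: reduced_def)
  show "pos (W xs (\<alpha> k))" using reduced_snoc[OF 1] assms by simp
  thus "neg (W (xs @ [k]) (\<alpha> k))" using s_root(1)[OF 1(2)] by (simp add: W_append W_Cons W_Nil W_vadd W_0 neg_uminus)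
qed

text \<open>Induction on the length, comparing last letters. If they differ, both simple roots are
  made negative, so there are reduced words ending in either alternating word of full length. Each
  shares its last letter with one of the given words, and a single braid move connects them.\<close>

theorem matsumoto:
  "reduced ws ==> reduced ws' ==> W ws = W ws' ==> braid_equiv ws ws'"
proof (induction "length ws" arbitrary: ws ws')
  case 0
  have "length ws' \<le> length ([] :: 'i list)"
    using 0(1,4) spec[OF conjunct2[OF 0(3)[unfolded reduced_def]], of "[]"] by simp
  thus ?case using 0 by (simp add: braid_equiv.refl)
next
  case (Suc n)
  note IH = Suc.hyps(1)
  have len: "length ws' = length ws"
    using Suc.prems by (intro antisym) (simp_all add: reduced_def)
  obtain us i where us: "ws = us @ [i]" using Suc.hyps(2) by (cases ws rule: rev_cases) auto
  obtain us' j where us': "ws' = us' @ [j]" using Suc.hyps(2) len by (cases ws' rule: rev_cases) auto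
  have ij: "i \<in> I" "j \<in> I" and I: "set us \<subseteq> I" "set us' \<subseteq> I" using Suc.prems us us' by (auto simp: reduced_def)
  have same: "braid_equiv (xs @ [k]) (ys @ [k])"
    if "length xs = n" "reduced (xs @ [k])" "reduced (ys @ [k])" "W (xs @ [k]) = W (ys @ [k])" for xs ys k
  proof -
    have k: "k \<in> I" using that by (simp add: reduced_def)
    have "W xs v = W ys v" for v
      using fun_cong[OF that(4), of "s k v"] k by (simp add: W_append W_Cons W_Nil ss)
    moreover have "reduced xs" "reduced ys" using that(2,3) reduced_sub[of "[]" xs "[k]"] reduced_sub[of "[]" ys "[k]"] by simp_all
    ultimately have "braid_equiv xs ys" using IH[of xs ys] that(1) by (simp add: fun_eq_iff)
    thus ?thesis using braid_equiv_append k by simp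
  qed
  show ?case
  proof (cases "i = j")
    case True
    thus ?thesis using same[of us i us'] us us' Suc.hyps(2) Suc.prems by simp
  next
    case False
    let ?m = "braid_order i j"
    have n: "neg (W ws (\<alpha> i))" "neg (W ws (\<alpha> j))"
      using neg_last(4)[of us i] neg_last(4)[of us' j] Suc.prems us us' by auto
    obtain vs where vs: "reduced (vs @ rev (alternating ?m i j))" "W (vs @ rev (alternating ?m i j)) = W ws" "length ws = length vs + ?m"
      using peel_alternating[OF ij False Suc.prems(1) n order.refl] by blast
    have v: "set vs \<subseteq> I" using vs(1) by (simp add: reduced_def)
    have W': "W (vs @ rev (alternating ?m j i)) = W ws"
      unfolding vs(2)[symmetric] by (rule ext) (simp only: W_append W_rev_alternating[OF ij False])
    have r': "reduced (vs @ rev (alternating ?m j i))"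
    proof (rule reduced_eq[OF vs(1)])
      show "set (vs @ rev (alternating ?m j i)) \<subseteq> I" using v set_alternating[of ?m j i] ij by auto
      show "W (vs @ rev (alternating ?m j i)) = W (vs @ rev (alternating ?m i j))" using W' vs(2) by simp
    qed simp
    obtain m where m: "?m = Suc m" by (cases ?m) (auto simp: braid_order_def split: if_splits)
    have a1: "vs @ rev (alternating ?m i j) = (vs @ rev (alternating m j i)) @ [i]"
      "vs @ rev (alternating ?m j i) = (vs @ rev (alternating m i j)) @ [j]" by (simp_all add: m)
    have "braid_equiv ws (vs @ rev (alternating ?m i j))"
      unfolding us a1(1)
    proof (rule same)
      show "length us = n" using Suc.hyps(2) us by simp
      show "reduced (us @ [i])" using Suc.prems(1) us by simp
      show "reduced ((vs @ rev (alternating m j i)) @ [i])" using vs(1) a1(1) by simp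
      show "W (us @ [i]) = W ((vs @ rev (alternating m j i)) @ [i])" using vs(2) unfolding a1(1) us by simp
    qed
    moreover have "braid_equiv (vs @ rev (alternating ?m j i)) ws'"
      unfolding us' a1(2)
    proof (rule same)
      show "length (vs @ rev (alternating m i j)) = n" using Suc.hyps(2) vs(3) m by simp
      show "reduced ((vs @ rev (alternating m i j)) @ [j])" using r' a1(2) by simp
      show "reduced (us' @ [j])" using Suc.prems(2) us' by simp
      show "W ((vs @ rev (alternating m i j)) @ [j]) = W (us' @ [j])" using W' Suc.prems(3) unfolding a1(2) us' by simp
    qed
    ultimately show ?thesis
      by (rule braid_equiv.trans[OF _ braid_equiv.trans[OF braid_equiv_rev[OF ij False v]]])
  qed
qed

lemma longest_neg:
  assumes "longest_element C w" "W ws = w" "reduced ws" "j \<in> I"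
  shows "neg (W ws (\<alpha> j))"
proof (rule ccontr)
  assume "\<not> neg (W ws (\<alpha> j))"
  hence "reduced (ws @ [j])" using neg_iff reduced_snoc assms reduced_set by blast
  hence "weyl_length C (W (ws @ [j])) = Suc (length ws)" "weyl_length C w = length ws"
    using reduced_iff_length reduced_set assms by auto
  moreover have "W (ws @ [j]) \<in> weyl_group C"
    using \<open>reduced (ws @ [j])\<close> by (auto simp: weyl_group_def reduced_def I_def lists_eq_set)
  ultimately show False using assms(1) by (auto simp: longest_element_def)
qed

end

section \<open>Positive parts and ordered monomials\<close>

context scaled_ring
begin

inductive_set lspan :: "'r set \<Rightarrow> 'r set" for S where
  zero: "0 \<in> lspan S"
| add: "x \<in> S ==> y \<in> lspan S ==> sc c x + y \<in> lspan S"

lemma lspan_gen: "x \<in> S ==> x \<in> lspan S"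
  using lspan.add[OF _ lspan.zero, of x S 1] by simp

lemma lspan_add: "x \<in> lspan S ==> y \<in> lspan S ==> x + y \<in> lspan S"
  by (induction rule: lspan.induct) (auto simp: add.assoc intro: lspan.add)

lemma lspan_scale: "x \<in> lspan S ==> sc c x \<in> lspan S"
  by (induction rule: lspan.induct) (auto simp: sc_add_right intro: lspan.intros)

lemma lspan_uminus: "x \<in> lspan S ==> - x \<in> lspan S"
  using lspan_scale[of x S "- 1"] by (simp add: sc_minus_left)

lemma lspan_diff: "x \<in> lspan S ==> y \<in> lspan S ==> x - y \<in> lspan S"
  using lspan_add[OF _ lspan_uminus, of x S y] by simp

lemma lspan_image:
  assumes "\<And>x y. f (x + y) = f x + f y" "\<And>c x. f (sc c x) = sc c (f x)" "\<And>x. x \<in> S ==> f x \<in> lspan S'" "x \<in> lspan S"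
  shows "f x \<in> lspan S'"
  using assms(4)
proof induction
  case zero
  show ?case using assms(2)[of 0 0] by (simp add: lspan.zero)
qed (simp add: assms(1-3) lspan_add lspan_scale)

lemma lspan_subset: "S \<subseteq> lspan S' ==> x \<in> lspan S ==> x \<in> lspan S'"
  by (rule lspan_image[of "\<lambda>x. x"]) auto

lemma alg_opposite: "x \<in> scaled_ring.alg (op_scale sc) S ==> unop x \<in> alg (unop ` S)"
proof -
  interpret o: scaled_ring "op_scale sc" by (rule scaled_ring_opposite)
  show "x \<in> o.alg S ==> unop x \<in> alg (unop ` S)"
    by (induction rule: o.alg.induct) (auto intro: alg.intros)
qed

lemma alg_mono: "S \<subseteq> S' ==> alg S \<subseteq> alg S'"
  unfolding alg_subset_iff by (auto intro: alg.gen)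

text \<open>The augmentation in a form that requires no grading: after subtraction of a suitable
  scalar, what remains ends in a generator.\<close>

lemma alg_constant_term:
  assumes "x \<in> alg S"
  obtains c where "x - sc c 1 \<in> lspan {y * z | y z. y \<in> alg S \<and> z \<in> S}"
proof -
  let ?M = "{y * z | y z. y \<in> alg S \<and> z \<in> S}"
  have "\<exists>c. x - sc c 1 \<in> lspan ?M" using assms
  proof induction
    case (gen x)
    have "1 * x \<in> ?M" using gen alg.one by blast
    hence "x - sc 0 1 \<in> lspan ?M" by (simp add: lspan_gen)
    thus ?case ..
  next
    case one
    have "1 - sc 1 1 \<in> lspan ?M" by (simp add: lspan.zero)
    thus ?case ..
  next
    case (scale x c)
    then obtain e where "x - sc e 1 \<in> lspan ?M" by blast
    hence "sc c (x - sc e 1) \<in> lspan ?M" by (rule lspan_scale)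
    thus ?case by (auto simp: sc_diff_right)
  next
    case (add x y)
    then obtain e e' where "x - sc e 1 \<in> lspan ?M" "y - sc e' 1 \<in> lspan ?M" by blast
    hence "(x - sc e 1) + (y - sc e' 1) \<in> lspan ?M" by (rule lspan_add)
    hence "x + y - sc (e + e') 1 \<in> lspan ?M" by (simp add: sc_add_left algebra_simps)
    thus ?case ..
  next
    case (mult x y)
    then obtain e e' where e: "x - sc e 1 \<in> lspan ?M" and e': "y - sc e' 1 \<in> lspan ?M" by blast
    have "x * (y - sc e' 1) \<in> lspan ?M"
    proof (rule lspan_image[of "\<lambda>y. x * y", OF _ _ _ e'])
      fix z assume "z \<in> ?M"
      then obtain y' z' where "z = y' * z'" "y' \<in> alg S" "z' \<in> S" by blast
      hence "x * z = (x * y') * z'" "x * y' \<in> alg S" using mult by (simp_all add: mult.assoc alg.mult)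
      thus "x * z \<in> lspan ?M" using \<open>z' \<in> S\<close> by (intro lspan_gen) blast
    qed (simp_all add: distrib_left)
    hence "x * (y - sc e' 1) + sc e' (x - sc e 1) \<in> lspan ?M" using e by (intro lspan_add lspan_scale)
    hence "x * y - sc (e' * e) 1 \<in> lspan ?M" by (simp add: right_diff_distrib sc_diff_right)
    thus ?case ..
  qed
  thus thesis using that by blast
qed

end

section \<open>Splitting the positive part along one simple generator\<close>

context braided
begin

definition Up :: "'r set" where "Up = alg (E ` I)"

lemma Up_E: "i \<in> I ==> E i \<in> Up" by (auto simp: Up_def intro: alg.gen)

lemmas Up_intros = alg_intros[where S = "E ` I", folded Up_def]

lemma Up_gens: "Up \<subseteq> alg gens"
  unfolding Up_def alg_subset_iff by (auto simp: gens_def intro: alg.gen)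

lemma gens_alg: "i \<in> I ==> E i \<in> alg gens" "i \<in> I ==> F i \<in> alg gens" "i \<in> I ==> K i \<in> alg gens" "i \<in> I ==> L i \<in> alg gens"
  by (auto simp: gens_def intro: alg.gen)

text \<open>All terms of the strings of the \<open>E j\<close> with \<open>j\<close> different from
  \<open>i\<close>. They generate an algebra that the inverse of \<open>T i\<close> maps into
  \<open>Up\<close> (\<open>chain_T\<close>).\<close>

definition chain :: "'i \<Rightarrow> 'r set" where
  "chain i = {E j | j. j \<in> I \<and> j \<noteq> i} \<union> {tw (v i) (bond i j) (E i) (E j) | j. j \<in> I \<and> j \<noteq> i}
     \<union> {mid (v i) (E i) (E j) | j. j \<in> I \<and> j \<noteq> i \<and> bond i j = 2}"

lemma chain_E: "j \<in> I ==> j \<noteq> i ==> E j \<in> alg (chain i)"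
  "j \<in> I ==> j \<noteq> i ==> tw (v i) (bond i j) (E i) (E j) \<in> alg (chain i)"
  "j \<in> I ==> j \<noteq> i ==> bond i j = 2 ==> mid (v i) (E i) (E j) \<in> alg (chain i)"
  unfolding chain_def by (rule alg.gen, blast)+

text \<open>For a generator this is the recursion of its string, and the shape of the right side is
  stable under products.\<close>

lemma chain_straighten:
  assumes i: "i \<in> I" and "p \<in> alg (chain i)"
  shows "\<exists>p1\<in>alg (chain i). \<exists>p2\<in>alg (chain i). p * E i = E i * p1 + p2"
  using assms(2)
proof induction
  interpret i: quantum_sl2 sc "v i" "u i" "inverse (v i + u i)" "inverse (v i - u i)" "E i" "F i" "K i" "L i"
    by (rule sl2) fact
  case (gen x)
  note A = alg.intros alg_intros
  consider j where "j \<in> I" "j \<noteq> i" "x = E j" | j where "j \<in> I" "j \<noteq> i" "x = tw (v i) (bond i j) (E i) (E j)"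
    | j where "j \<in> I" "j \<noteq> i" "bond i j = 2" "x = mid (v i) (E i) (E j)"
    using gen unfolding chain_def by blast
  thus ?case
  proof cases
    case (1 j)
    note c = chain_E[OF 1(1,2)]
    consider "bond i j = 0" | "bond i j = 1" | "bond i j = 2" using bond_le[of i j] i 1 by fastforce
    thus ?thesis
    proof cases
      case 1
      have "x * E i = E i * E j + 0" using E_comm[of i j] i 1 \<open>j \<in> I\<close> \<open>j \<noteq> i\<close> \<open>x = E j\<close> by simp
      thus ?thesis using c alg_0 by blast
    next
      case 2
      have "x * E i = E i * sc (u i) (E j) + tw (v i) (bond i j) (E i) (E j)" using \<open>x = E j\<close> 2 by (simp add: i.tw_eqs)
      thus ?thesis using c A(3) by blast
    next
      case 3
      have "x * E i = E i * sc (u i * u i) (E j) + mid (v i) (E i) (E j)" using \<open>x = E j\<close> by (simp add: i.mid_eq)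
      thus ?thesis using c 3 A(3) by blast
    qed
  next
    case (2 j)
    have "x * E i = E i * sc (v i ^ bond i j) x + 0"
      using i.tw_commutation[of "bond i j" "E i" "E j"] bond_le[of i j] serre_E[of i j] i 2 by simp
    moreover have "sc (v i ^ bond i j) x \<in> alg (chain i)" unfolding 2(3) by (intro A chain_E 2)
    ultimately show ?thesis using alg_0 by blast
  next
    case (3 j)
    have "x * E i = E i * x + sc (v i + u i) (tw (v i) (bond i j) (E i) (E j))"
      using i.tw2_mid[of "E i" "E j"] 3 by simp
    moreover have "sc (v i + u i) (tw (v i) (bond i j) (E i) (E j)) \<in> alg (chain i)" "x \<in> alg (chain i)"
      unfolding 3(4) by (intro A chain_E 3)+
    ultimately show ?thesis by blast
  qed
next
  case one
  have "1 * E i = E i * 1 + 0" by simp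
  thus ?case using alg.one alg_0 by blast
next
  case (scale x c)
  then obtain p1 p2 where "p1 \<in> alg (chain i)" "p2 \<in> alg (chain i)" "x * E i = E i * p1 + p2" by blast
  hence "sc c x * E i = E i * sc c p1 + sc c p2" "sc c p1 \<in> alg (chain i)" "sc c p2 \<in> alg (chain i)"
    by (simp_all add: sc_add_right alg.scale)
  thus ?case by blast
next
  case (add x y)
  then obtain p1 p2 p3 p4 where p: "p1 \<in> alg (chain i)" "p2 \<in> alg (chain i)" "x * E i = E i * p1 + p2"
     "p3 \<in> alg (chain i)" "p4 \<in> alg (chain i)" "y * E i = E i * p3 + p4" by blast
  have "(x + y) * E i = E i * (p1 + p3) + (p2 + p4)" "p1 + p3 \<in> alg (chain i)" "p2 + p4 \<in> alg (chain i)"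
    using p(3,6) alg.add[OF p(1,4)] alg.add[OF p(2,5)] by (simp_all add: algebra_simps)
  thus ?case by blast
next
  case (mult x y)
  then obtain p1 p2 p3 p4 where p: "p1 \<in> alg (chain i)" "p2 \<in> alg (chain i)" "x * E i = E i * p1 + p2"
     "p3 \<in> alg (chain i)" "p4 \<in> alg (chain i)" "y * E i = E i * p3 + p4" by blast
  have "(x * y) * E i = (x * E i) * p3 + x * p4" using p(6) by (simp add: mult.assoc distrib_left)
  also have "\<dots> = E i * (p1 * p3) + (p2 * p3 + x * p4)" unfolding p(3) by (simp add: algebra_simps)
  finally have "(x * y) * E i = E i * (p1 * p3) + (p2 * p3 + x * p4)" .
  moreover have "p1 * p3 \<in> alg (chain i)" "p2 * p3 + x * p4 \<in> alg (chain i)"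
    using p mult.hyps by (auto intro: alg.intros)
  ultimately show ?case by blast
qed

text \<open>The bottoms of the strings are reached as \<open>T i (T' i (E j))\<close>, the tops as
  \<open>T i (E j)\<close>, and the middle terms by one step of the backward walk,
  \<open>tw_tw_G_2\<close>.\<close>

lemma chain_T:
  assumes i: "i \<in> I" shows "alg (chain i) \<subseteq> T i ` Up"
proof -
  interpret i: quantum_sl2 sc "v i" "u i" "inverse (v i + u i)" "inverse (v i - u i)" "E i" "F i" "K i" "L i"
    by (rule sl2) fact
  have "chain i \<subseteq> T i ` Up"
  proof
    fix x assume "x \<in> chain i"
    then consider j where "j \<in> I" "j \<noteq> i" "x = E j" | j where "j \<in> I" "j \<noteq> i" "x = tw (v i) (bond i j) (E i) (E j)"
    | j where "j \<in> I" "j \<noteq> i" "bond i j = 2" "x = mid (v i) (E i) (E j)"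
      unfolding chain_def by blast
    thus "x \<in> T i ` Up"
    proof cases
      case (1 j)
      have "T' i (E j) \<in> Up" using i 1 Up_E by (simp add: T'_E Up_def tw_in_alg)
      thus ?thesis using TT'_E[OF i 1(1)] 1(3) by (metis imageI)
    next
      case (2 j)
      have "x = T i (E j)" using i 2 by (simp add: T_E TE_def)
      thus ?thesis using Up_E 2 by blast
    next
      case (3 j)
      have "i.lowest 2 (E j)" using lowest[of i j] i 3 by simp
      hence "x = T i (E i * E j - sc (u i * u i) (E j * E i))"
        using i 3 i.tw_tw_G_2 by (simp add: T_E TE_def alg_hom_simps[OF T_hom])
      moreover have "E i * E j - sc (u i * u i) (E j * E i) \<in> Up" using Up_E i 3 by (simp add: Up_def alg_intros)
      ultimately show ?thesis by blast
    qed
  qed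
  thus ?thesis unfolding Up_def alg_hom_alg[OF T_hom[OF i]] alg_subset_iff .
qed

lemma Up_decompose:
  assumes i: "i \<in> I" and x: "x \<in> Up"
  shows "x \<in> lspan {E i ^ n * T i y | n y. y \<in> Up}"
proof -
  define S where "S = {E i ^ n * p | n p. p \<in> alg (chain i)}"
  have S: "E i ^ n * p \<in> lspan S" if "p \<in> alg (chain i)" for n p
    by (rule lspan_gen) (use that in \<open>auto simp: S_def\<close>)
  have E: "E i * y \<in> lspan S" if "y \<in> lspan S" for y
  proof (rule lspan_image[OF _ _ _ that])
    fix z assume "z \<in> S"
    then obtain n p where "z = E i ^ n * p" "p \<in> alg (chain i)" by (auto simp: S_def)
    thus "E i * z \<in> lspan S" using S[of p "Suc n"] by (simp add: mult.assoc)
  qed (simp_all add: distrib_left)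
  have p: "p * (E i ^ n * p') \<in> lspan S" if "p \<in> alg (chain i)" "p' \<in> alg (chain i)" for p p' n
    using that(1)
  proof (induction n arbitrary: p)
    case 0
    thus ?case using S[of "p * p'" 0] that(2) alg.mult by simp
  next
    case (Suc n)
    obtain p1 p2 where p12: "p1 \<in> alg (chain i)" "p2 \<in> alg (chain i)" "p * E i = E i * p1 + p2"
      using chain_straighten[OF i Suc.prems] by blast
    have "p * (E i ^ Suc n * p') = (p * E i) * (E i ^ n * p')" by (simp add: mult.assoc)
    also have "\<dots> = E i * (p1 * (E i ^ n * p')) + p2 * (E i ^ n * p')" unfolding p12(3) by (simp add: algebra_simps)
    also have "\<dots> \<in> lspan S" by (intro lspan_add E Suc.IH p12)
    finally show ?case .
  qed
  have c: "p * y \<in> lspan S" if "p \<in> alg (chain i)" "y \<in> lspan S" for p y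
  proof (rule lspan_image[OF _ _ _ that(2)])
    fix z assume "z \<in> S"
    thus "p * z \<in> lspan S" using p that(1) by (auto simp: S_def)
  qed (simp_all add: distrib_left)
  have "y \<in> lspan S ==> x * y \<in> lspan S" for y
    using x unfolding Up_def
  proof (induction arbitrary: y)
    case (gen x)
    then obtain j where "j \<in> I" "x = E j" by blast
    thus ?case using E c gen chain_E by (cases "j = i") auto
  qed (simp_all add: mult.assoc distrib_right lspan_add lspan_scale)
  from this[of 1] have "x \<in> lspan S" using S[of 1 0] alg.one by simp
  thus ?thesis
  proof (rule lspan_subset[rotated])
    show "S \<subseteq> lspan {E i ^ n * T i y | n y. y \<in> Up}"
    proof
      fix z assume "z \<in> S"
      then obtain n p where "z = E i ^ n * p" "p \<in> alg (chain i)" by (auto simp: S_def)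
      moreover then obtain y where "y \<in> Up" "p = T i y" using chain_T[OF i] by blast
      ultimately show "z \<in> lspan {E i ^ n * T i y | n y. y \<in> Up}" by (intro lspan_gen) blast
    qed
  qed
qed

text \<open>The tail \<open>y\<close> has all of \<open>T\<close> along \<open>rs\<close> applied to
  it (\<open>pbw_mult\<close>); with \<open>y = 1\<close> the result is the ordered monomial in the
  root vectors (\<open>pbw_eq_prod\<close>).\<close>

definition pbw :: "'i list \<Rightarrow> nat list \<Rightarrow> 'r \<Rightarrow> 'r" where
  "pbw rs as y = foldr (\<lambda>(r, n) z. E r ^ n * T r z) (zip rs as) y"

lemma pbw_simps: "pbw [] [] y = y" "pbw (r # rs) (n # as) y = E r ^ n * T r (pbw rs as y)"
  by (simp_all add: pbw_def)

lemma pbw_mult: "length rs = length as ==> set rs \<subseteq> I ==> pbw rs as (x * y) = pbw rs as x * foldr T rs y"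
  by (induction rs as rule: list_induct2) (simp_all add: pbw_simps alg_hom_simps[OF T_hom] mult.assoc)

lemma pbw_span:
  assumes "set rs \<subseteq> I" "x \<in> Up"
  shows "x \<in> lspan {pbw rs as y | as y. length as = length rs \<and> y \<in> Up}"
  using assms
proof (induction rs arbitrary: x)
  case Nil
  have "x = pbw [] [] x" by (simp add: pbw_simps)
  hence "x \<in> {pbw [] as y | as y. length as = length ([] :: 'i list) \<and> y \<in> Up}"
    using Nil by (intro CollectI exI[of _ "[]"] exI[of _ x]) simp
  thus ?case by (rule lspan_gen)
next
  case (Cons r rs)
  have r: "r \<in> I" and rs: "set rs \<subseteq> I" using Cons by auto
  let ?S = "{pbw (r # rs) as y | as y. length as = length (r # rs) \<and> y \<in> Up}"
  have "{E r ^ n * T r y | n y. y \<in> Up} \<subseteq> lspan ?S"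
  proof
    fix z assume "z \<in> {E r ^ n * T r y | n y. y \<in> Up}"
    then obtain n y where z: "z = E r ^ n * T r y" "y \<in> Up" by blast
    have "E r ^ n * T r y \<in> lspan ?S"
    proof (rule lspan_image[of "\<lambda>y. E r ^ n * T r y", OF _ _ _ Cons.IH[OF rs z(2)]])
      fix x assume "x \<in> {pbw rs as y | as y. length as = length rs \<and> y \<in> Up}"
      then obtain as y' where x: "x = pbw rs as y'" "length as = length rs" "y' \<in> Up" by blast
      have "E r ^ n * T r x = pbw (r # rs) (n # as) y'" "length (n # as) = length (r # rs)"
        using x by (simp_all add: pbw_simps)
      thus "E r ^ n * T r x \<in> lspan ?S" using x(3) by (intro lspan_gen) blast
    qed (simp_all add: alg_hom_simps[OF T_hom[OF r]] distrib_left)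
    thus "z \<in> lspan ?S" by (simp add: z)
  qed
  thus ?case using Up_decompose[OF r Cons.prems(2)] by (rule lspan_subset)
qed

end

section \<open>Positivity of root vectors along reduced words\<close>

locale braided_weyl = rooted C I a d + braided I a d sc q E F K L T T'
  for C :: "'i cartan_datum" and I a d and sc :: "'k::field \<Rightarrow> 'r::ring_1 \<Rightarrow> 'r" and q E F K L T T'
begin

lemma braid_equiv_set: "braid_equiv ws ws' ==> set ws \<subseteq> I \<longleftrightarrow> set ws' \<subseteq> I"
proof (induction rule: braid_equiv.induct)
  case (move i j us vs)
  thus ?case using set_alternating[of "braid_order i j" i j] set_alternating[of "braid_order i j" j i] by auto
qed auto

lemma braid_equiv_T: "braid_equiv ws ws' ==> set ws \<subseteq> I ==> x \<in> alg gens ==> foldr T ws x = foldr T ws' x"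
proof (induction rule: braid_equiv.induct)
  case (move i j us vs)
  thus ?case using braid_relation[OF move(1-3) foldr_T_alg[OF move(5,7)]] by simp
next
  case (trans ws ws' ws'')
  thus ?case using braid_equiv_set by simp
qed simp

lemma T_reduced: "reduced ws ==> reduced ws' ==> W ws = W ws' ==> x \<in> alg gens ==> foldr T ws x = foldr T ws' x"
  by (rule braid_equiv_T[OF matsumoto reduced_set])

lemma root_rank2:
  assumes "i \<in> I" "j \<in> I" "i \<noteq> j"
  shows "bond j i = 0 ==> s j (\<alpha> i) = \<alpha> i" "bond i j = 1 ==> bond j i = 1 ==> s i (s j (\<alpha> i)) = \<alpha> j"
    "bond i j * bond j i = 2 ==> s j (s i (s j (\<alpha> i))) = \<alpha> i"
proof -
  have r: "\<alpha> i = vadd (vadd (\<lambda>_. 0) 1 (\<alpha> i)) 0 (\<alpha> j)" "\<alpha> j = vadd (vadd (\<lambda>_. 0) 0 (\<alpha> i)) 1 (\<alpha> j)"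
    by (simp_all add: vadd_def)
  have p: "pairing (\<lambda>_. 0) k = 0" for k by (simp add: pairing_def)
  note s = s_rank2[OF assms]
  show "bond j i = 0 ==> s j (\<alpha> i) = \<alpha> i"
    by (subst r(1), subst s(2)) (simp add: p vadd_def)
  show "bond i j = 1 ==> bond j i = 1 ==> s i (s j (\<alpha> i)) = \<alpha> j"
    by (subst r(1), subst s(2), subst s(1)) (simp add: p vadd_def)
  assume b: "bond i j * bond j i = 2"
  hence "int (bond j i) * int (bond i j) = 2" by (simp add: mult.commute flip: of_nat_mult)
  thus "s j (s i (s j (\<alpha> i))) = \<alpha> i"
    by (subst r(1), subst s(2), subst s(1), subst s(2)) (simp add: p vadd_def algebra_simps)
qed

text \<open>With \<open>j\<close> the last letter of \<open>ws\<close>, letters \<open>j\<close> and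
  \<open>i\<close> are stripped from the right until the remaining word keeps
  \<open>\<alpha> i\<close> and \<open>\<alpha> j\<close> positive. By the rank two identities the
  stripped part takes \<open>E i\<close> into the algebra generated by \<open>E i\<close> and
  \<open>E j\<close>, and the induction hypothesis applies to both.\<close>

lemma T_E_positive:
  "reduced ws ==> i \<in> I ==> pos (W ws (\<alpha> i)) ==> foldr T ws (E i) \<in> Up"
proof (induction "length ws" arbitrary: ws i rule: less_induct)
  case less
  show ?case
  proof (cases ws rule: rev_cases)
    case Nil
    thus ?thesis using Up_E less.prems(2) by simp
  next
    case (snoc us j)
    have us: "reduced us" and j: "j \<in> I" and pj: "pos (W us (\<alpha> j))" and nj: "neg (W ws (\<alpha> j))"
      using neg_last[of us j] less.prems(1) snoc by auto
    have i: "i \<in> I" by (rule less.prems(2))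
    have ij: "i \<noteq> j" using nj less.prems(3) not_pos_neg[OF reduced_set[OF less.prems(1)]] by blast
    have step: "foldr T vs x \<in> Up"
      if x: "x \<in> alg {E i, E j}" and v: "reduced vs" "length vs < length ws" "pos (W vs (\<alpha> i))" "pos (W vs (\<alpha> j))" for vs x
    proof -
      have h: "alg_hom (foldr T vs)" by (rule alg_hom_foldr[OF reduced_set[OF v(1)]])
      have "foldr T vs ` {E i, E j} \<subseteq> Up" using less.hyps[OF v(2,1)] i j v(3,4) by simp
      hence "foldr T vs ` alg {E i, E j} \<subseteq> Up"
        unfolding alg_hom_alg[OF h] Up_def alg_subset_iff .
      thus ?thesis using x by blast
    qed
    have E: "E i \<in> alg {E i, E j}" "E j \<in> alg {E i, E j}" by (auto intro: alg.gen)
    have ws_i: "W ws (\<alpha> i) = W us (s j (\<alpha> i))" by (simp add: snoc W_append W_Cons W_Nil)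
    have T_ws: "foldr T ws x = foldr T us (T j x)" for x by (simp add: snoc)
    have TjEi: "T j (E i) \<in> alg {E i, E j}" using i j ij E by (simp add: T_E TE_def tw_in_alg)
    show ?thesis
    proof (cases "pos (W us (\<alpha> i))")
      case True
      show ?thesis unfolding T_ws by (rule step[OF TjEi us _ True pj]) (simp add: snoc)
    next
      case False
      hence n: "neg (W us (\<alpha> i))" using neg_iff[OF reduced_set[OF us] i] by simp
      have b: "bond j i \<noteq> 0"
      proof
        assume "bond j i = 0"
        thus False using root_rank2(1)[OF i j ij] less.prems(3) False ws_i by simp
      qed
      obtain us1 where us1: "reduced (us1 @ [i])" "reduced us1" "W (us1 @ [i]) = W us" "length us = Suc (length us1)"
        by (rule reduced_peel[OF us i n])
      have p1: "pos (W us1 (\<alpha> i))" using neg_last[OF us1(1)] by simp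
      have ws_i1: "W ws (\<alpha> i) = W us1 (s i (s j (\<alpha> i)))" unfolding ws_i us1(3)[symmetric] by (simp add: W_append W_Cons W_Nil)
      have "T j (E i) \<in> alg gens" using T_alg gens_alg i j by simp
      hence T1: "foldr T ws (E i) = foldr T us1 (T i (T j (E i)))"
        unfolding T_ws using T_reduced[OF us us1(1) us1(3)[symmetric]] by simp
      show ?thesis
      proof (cases "bond i j = 1 \<and> bond j i = 1")
        case True
        hence "T i (T j (E i)) = E j" using rank2_A[OF i j ij] by simp
        moreover have "pos (W us1 (\<alpha> j))" using less.prems(3) ws_i1 root_rank2(2)[OF i j ij] True by simp
        ultimately show ?thesis unfolding T1 using step[OF E(2) us1(2) _ p1] us1(4) snoc by simp
      next
        case False
        hence b2: "bond i j * bond j i = 2" using b by (cases rule: bond_cases[OF i j ij]) auto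
        have TT: "T i (T j (E i)) = T' j (E i)" by (rule rank2_B[OF i j ij b2])
        show ?thesis
        proof (cases "pos (W us1 (\<alpha> j))")
          case True
          have "T' j (E i) \<in> alg {E i, E j}" using i j ij E by (simp add: T'_E tw_in_alg)
          thus ?thesis unfolding T1 TT using step us1(2,4) p1 True snoc by simp
        next
          case False
          hence n1: "neg (W us1 (\<alpha> j))" using neg_iff[OF reduced_set[OF us1(2)] j] by simp
          obtain us2 where us2: "reduced (us2 @ [j])" "reduced us2" "W (us2 @ [j]) = W us1" "length us1 = Suc (length us2)"
            by (rule reduced_peel[OF us1(2) j n1])
          have p2: "pos (W us2 (\<alpha> j))" using neg_last[OF us2(1)] by simp
          have "W ws (\<alpha> i) = W us2 (s j (s i (s j (\<alpha> i))))" unfolding ws_i1 us2(3)[symmetric] by (simp add: W_append W_Cons W_Nil)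
          hence p3: "pos (W us2 (\<alpha> i))" using less.prems(3) root_rank2(3)[OF i j ij b2] by simp
          have "T i (T j (E i)) \<in> alg gens" using T_alg gens_alg i j by simp
          hence "foldr T ws (E i) = foldr T us2 (T j (T i (T j (E i))))"
            unfolding T1 using T_reduced[OF us1(2) us2(1) us2(3)[symmetric]] by simp
          also have "T j (T i (T j (E i))) = E i" by (rule rank2_F(3)[OF i j ij b2])
          finally show ?thesis using step[OF E(1) us2(2) _ p3 p2] us2(4) us1(4) snoc by simp
        qed
      qed
    qed
  qed
qed

lemma T_F_positive:
  assumes "reduced ws" "i \<in> I" "pos (W ws (\<alpha> i))"
  shows "foldr T ws (F i) \<in> alg (F ` I)"
proof -
  interpret o: braided I a d "op_scale sc" "inverse q" "\<lambda>i. op (F i)" "\<lambda>i. op (E i)" "\<lambda>i. op (L i)" "\<lambda>i. op (K i)"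
     "\<lambda>i x. op (T i (unop x))" "\<lambda>i x. op (T' i (unop x))"
    by (rule braided_opposite)
  interpret o: braided_weyl C I a d "op_scale sc" "inverse q" "\<lambda>i. op (F i)" "\<lambda>i. op (E i)" "\<lambda>i. op (L i)" "\<lambda>i. op (K i)"
     "\<lambda>i x. op (T i (unop x))" "\<lambda>i x. op (T' i (unop x))"
    by (intro braided_weyl.intro rooted_axioms braided_opposite[unfolded I_def a_def d_def]) (simp_all only: I_def a_def d_def)
  have "foldr (\<lambda>i x. op (T i (unop x))) xs (op y) = op (foldr T xs y)" for xs y
    by (induction xs) simp_all
  hence "op (foldr T ws (F i)) \<in> o.Up" using o.T_E_positive[OF assms] by simp
  hence "unop (op (foldr T ws (F i))) \<in> alg (unop ` (\<lambda>i. op (F i)) ` I)"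
    unfolding o.Up_def by (rule alg_opposite)
  thus ?thesis by (simp add: image_image)
qed

inductive_set torus :: "'r set" where
  one: "1 \<in> torus"
| K: "i \<in> I ==> x \<in> torus ==> K i * x \<in> torus"
| L: "i \<in> I ==> x \<in> torus ==> L i * x \<in> torus"

lemma torus_mult: "x \<in> torus ==> y \<in> torus ==> x * y \<in> torus"
  by (induction rule: torus.induct) (auto simp: mult.assoc intro: torus.intros)

lemma torus_gens: "i \<in> I ==> K i ^ n \<in> torus" "i \<in> I ==> L i ^ n \<in> torus"
  by (induction n) (auto intro: torus.intros)

lemma torus_alg: "x \<in> torus ==> x \<in> alg gens"
  by (induction rule: torus.induct) (auto intro: alg.intros gens_alg)

lemma torus_T:
  assumes "i \<in> I" "x \<in> torus" shows "T i x \<in> torus"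
  using assms(2)
proof induction
  case one
  show ?case by (simp add: alg_hom_simps[OF T_hom[OF assms(1)]] torus.one)
next
  case (K j x)
  have "TK i j \<in> torus" using torus_gens[of i] torus_gens(1)[of j 1] torus_gens(2)[of i 1] assms(1) K by (auto simp: TK_def intro: torus_mult)
  thus ?case using K assms(1) by (simp add: alg_hom_simps[OF T_hom[OF assms(1)]] T_K torus_mult)
next
  case (L j x)
  have "TL i j \<in> torus" using torus_gens[of i] torus_gens(2)[of j 1] torus_gens(1)[of i 1] assms(1) L by (auto simp: TL_def intro: torus_mult)
  thus ?case using L assms(1) by (simp add: alg_hom_simps[OF T_hom[OF assms(1)]] T_L torus_mult)
qed

lemma torus_F:
  assumes "x \<in> torus" "k \<in> I" shows "\<exists>c. F k * x = sc c (x * F k)"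
  using assms(1)
proof induction
  case one
  have "F k * 1 = sc 1 (1 * F k)" by simp
  thus ?case ..
next
  case (K i x)
  then obtain c where c: "F k * x = sc c (x * F k)" by blast
  have nz: "v i powi n \<noteq> 0" for n using v_neq_0[OF K(1)] by (simp add: power_int_not_zero)
  have "F k * K i = sc (v i powi a i k) (K i * F k)"
    using KF[OF K(1) assms(2)] nz by (simp add: power_int_minus)
  hence "(F k * K i) * x = sc (v i powi a i k) (K i * F k) * x" by simp
  hence "F k * (K i * x) = sc (v i powi a i k) (K i * (F k * x))" by (simp only: mult.assoc sc_mult_left)
  hence "F k * (K i * x) = sc (v i powi a i k * c) (K i * x * F k)" using c by (simp add: mult.assoc)
  thus ?case ..
next
  case (L i x)
  then obtain c where c: "F k * x = sc c (x * F k)" by blast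
  have nz: "v i powi n \<noteq> 0" for n using v_neq_0[OF L(1)] by (simp add: power_int_not_zero)
  have "L i * F k = sc (v i powi a i k) (F k * L i)"
    using inverse_flip[OF KL[OF L(1)] LK[OF L(1)] KF[OF L(1) assms(2)] nz] by (simp add: power_int_minus)
  hence "F k * L i = sc (v i powi - a i k) (L i * F k)"
    using nz by (simp add: power_int_minus)
  hence "(F k * L i) * x = sc (v i powi - a i k) (L i * F k) * x" by simp
  hence "F k * (L i * x) = sc (v i powi - a i k) (L i * (F k * x))" by (simp only: mult.assoc sc_mult_left)
  hence "F k * (L i * x) = sc (v i powi - a i k * c) (L i * x * F k)" using c by (simp add: mult.assoc)
  thus ?case ..
qed

definition left_F :: "'r set" where "left_F = lspan {x * F k | x k. x \<in> alg gens \<and> k \<in> I}"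

lemma left_F_gen: "x \<in> alg gens ==> k \<in> I ==> x * F k \<in> left_F"
  unfolding left_F_def by (rule lspan_gen) blast

lemma left_F_left:
  assumes "x \<in> alg gens" "y \<in> left_F" shows "x * y \<in> left_F"
  unfolding left_F_def
proof (rule lspan_image[OF _ _ _ assms(2)[unfolded left_F_def]])
  fix z assume "z \<in> {x * F k | x k. x \<in> alg gens \<and> k \<in> I}"
  thus "x * z \<in> lspan {x * F k | x k. x \<in> alg gens \<and> k \<in> I}"
    using left_F_gen[OF alg.mult[OF assms(1)]] unfolding left_F_def by (auto simp: mult.assoc)
qed (simp_all add: distrib_left)

lemma left_F_torus:
  assumes "x \<in> torus" "y \<in> left_F" shows "y * x \<in> left_F"
  unfolding left_F_def
proof (rule lspan_image[of "\<lambda>y. y * x", OF _ _ _ assms(2)[unfolded left_F_def]])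
  fix z assume "z \<in> {x * F k | x k. x \<in> alg gens \<and> k \<in> I}"
  then obtain y k where z: "z = y * F k" "y \<in> alg gens" "k \<in> I" by blast
  obtain c where "F k * x = sc c (x * F k)" using torus_F[OF assms(1) z(3)] by blast
  hence "z * x = sc c ((y * x) * F k)" by (simp add: z(1) mult.assoc)
  moreover have "(y * x) * F k \<in> left_F" by (intro left_F_gen alg.mult torus_alg assms z)
  ultimately show "z * x \<in> lspan {x * F k | x k. x \<in> alg gens \<and> k \<in> I}"
    using lspan_scale unfolding left_F_def by simp
qed (simp_all add: distrib_right)

end

text \<open>The assumptions are the two consequences of triangular decomposition from which the PBW
  theorem is derived; the induced module provides them.\<close>

locale triangular = braided_weyl C I a d sc q E F K L T T'
  for C :: "'i cartan_datum" and I a d and sc :: "'k::field \<Rightarrow> 'r::ring_1 \<Rightarrow> 'r" and q E F K L T T' +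
  assumes positive_left_F: "x \<in> Up ==> x \<in> left_F ==> x = 0"
    and F_powers_independent: "r \<in> I ==> (\<And>n. y n \<in> Up) ==> (\<Sum>n\<le>N. F r ^ n * y n * K r ^ n) = 0 ==> n \<le> N ==> y n = 0"
begin

text \<open>\<open>rs\<close> may be taken to end in \<open>j\<close>. Then \<open>E j\<close> goes,
  up to sign, to a torus element times the image of \<open>F j\<close>, which is a polynomial in the
  \<open>F k\<close> by \<open>T_F_positive\<close>; what remains to be excluded is a constant
  term.\<close>

lemma T_longest_E:
  assumes r: "reduced rs" and j: "j \<in> I" and n: "neg (W rs (\<alpha> j))"
  shows "foldr T rs (E j) \<in> left_F"
proof -
  obtain us where us: "reduced (us @ [j])" "reduced us" "W (us @ [j]) = W rs" "length rs = Suc (length us)"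
    by (rule reduced_peel[OF r j n])
  have I: "set us \<subseteq> I" by (rule reduced_set[OF us(2)])
  define y where "y = foldr T us (F j)"
  define k where "k = foldr T us (K j)"
  define l where "l = foldr T us (L j)"
  note h = alg_hom_simps[OF alg_hom_foldr[OF I]]
  have torus: "x \<in> torus ==> set us \<subseteq> I ==> foldr T us x \<in> torus" for x us
    by (induction us) (simp_all add: torus_T)
  have kt: "k \<in> torus" "l \<in> torus"
    using torus[OF _ I, of "K j"] torus[OF _ I, of "L j"] torus_gens[OF j, of 1] by (simp_all add: k_def l_def)
  have kl: "k * l = 1" unfolding k_def l_def h(4)[symmetric] KL[OF j] h(1) ..
  have ky: "k * y = sc (v j powi - 2) (y * k)"
    using KF[OF j j] j unfolding k_def y_def h(4)[symmetric] by (simp add: h)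
  have "pos (W us (\<alpha> j))" using neg_last[OF us(1)] by simp
  hence "y \<in> alg (F ` I)" unfolding y_def by (rule T_F_positive[OF us(2) j])
  then obtain c where "y - sc c 1 \<in> lspan {x * z | x z. x \<in> alg (F ` I) \<and> z \<in> F ` I}" by (rule alg_constant_term)
  moreover have "alg (F ` I) \<subseteq> alg gens" unfolding alg_subset_iff by (auto intro: gens_alg)
  hence "{x * z | x z. x \<in> alg (F ` I) \<and> z \<in> F ` I} \<subseteq> left_F" using left_F_gen by blast
  ultimately have y: "y - sc c 1 \<in> left_F" unfolding left_F_def by (rule lspan_subset[rotated])
  \<comment> \<open>Conjugation by \<open>k\<close> multiplies \<open>y\<close> by
    \<open>v j powi - 2\<close> but fixes constants. Comparing the two puts a nonzero multiple of
    \<open>c\<close> into the left ideal, so \<open>c = 0\<close>.\<close>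
  hence "k * (y - sc c 1) * l \<in> left_F" by (intro left_F_torus left_F_left torus_alg kt)
  moreover have "k * (y - sc c 1) * l = sc (v j powi - 2) y - sc c 1"
    using ky kl by (simp add: right_diff_distrib left_diff_distrib mult.assoc)
  ultimately have 1: "sc (v j powi - 2) y - sc c 1 \<in> left_F" by simp
  have "sc (v j powi - 2) (y - sc c 1) \<in> left_F" using y unfolding left_F_def by (rule lspan_scale)
  hence "(sc (v j powi - 2) y - sc c 1) - sc (v j powi - 2) (y - sc c 1) \<in> left_F"
    using lspan_diff[OF 1[unfolded left_F_def]] unfolding left_F_def by blast
  also have "(sc (v j powi - 2) y - sc c 1) - sc (v j powi - 2) (y - sc c 1) = sc ((v j powi - 2 - 1) * c) 1"
    by (simp add: sc_diff_right sc_diff_left left_diff_distrib)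
  finally have z: "sc ((v j powi - 2 - 1) * c) 1 = 0"
    by (intro positive_left_F) (auto simp: Up_def intro: alg.one alg.scale)
  have "v j ^ 2 \<noteq> 1" using v[OF j] unfolding not_root_of_unity_def by simp
  hence "v j powi - 2 \<noteq> 1" by (simp add: power_int_minus)
  hence "c = 0" using sc_eq_0_iff[of "(v j powi - 2 - 1) * c" 1] z by (cases "c = 0") auto
  hence y: "y \<in> left_F" using y by simp
  have "foldr T rs (E j) = foldr T (us @ [j]) (E j)"
    using T_reduced[OF r us(1) us(3)[symmetric]] gens_alg j by simp
  also have "\<dots> = - (l * y)" using j by (simp add: T_E TE_def h l_def y_def)
  also have "\<dots> \<in> left_F" using left_F_left[OF torus_alg[OF kt(2)] y] unfolding left_F_def by (rule lspan_uminus)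
  finally show ?thesis .
qed

section \<open>The PBW theorem: spanning and linear independence\<close>

lemma reduced_Cons: "reduced (r # rs) ==> reduced rs"
  using reduced_sub[of "[r]" rs "[]"] by simp

lemma T_prefix:
  assumes "reduced rs" "k < length rs"
  shows "foldr T (take k rs) (E (rs ! k)) \<in> Up"
proof -
  have "rs = [] @ (take k rs @ [rs ! k]) @ drop (Suc k) rs" using assms(2) by (simp add: id_take_nth_drop[symmetric])
  hence "reduced (take k rs @ [rs ! k])" using assms(1) reduced_sub by metis
  thus ?thesis using neg_last T_E_positive by blast
qed

lemma pbw_eq_prod:
  assumes "set rs \<subseteq> I" "length as = length rs"
  shows "pbw rs as 1 = prod_list (map (\<lambda>k. foldr T (take k rs) (E (rs ! k)) ^ (as ! k)) [0..<length rs])"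
  using assms(2,1)
proof (induction as rs rule: list_induct2)
  case (Cons n as r rs)
  have "T r (prod_list (map f ks)) = prod_list (map (\<lambda>k. T r (f k)) ks)" for f and ks :: "nat list"
    by (induction ks) (use Cons.prems in \<open>simp_all add: alg_hom_simps[OF T_hom]\<close>)
  moreover have "map f [0..<Suc m] = f 0 # map (\<lambda>k. f (Suc k)) [0..<m]" for f :: "nat \<Rightarrow> 'r" and m
    by (simp only: upt_conv_Cons[of 0 "Suc m"] map_Suc_upt[symmetric] map_map list.map) (simp add: o_def)
  ultimately show ?case using Cons by (simp add: pbw_simps alg_hom_simps[OF T_hom] del: upt_Suc)
qed (simp add: pbw_simps)

lemma pbw_Up: "reduced rs ==> length as = length rs ==> pbw rs as 1 \<in> Up"
proof -
  assume r: "reduced rs" "length as = length rs"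
  have pl: "prod_list xs \<in> Up" if "set xs \<subseteq> Up" for xs
    using that by (induction xs) (auto simp: Up_def intro: alg.intros)
  show ?thesis
    unfolding pbw_eq_prod[OF reduced_set[OF r(1)] r(2)]
    by (rule pl) (auto intro!: Up_intros T_prefix[OF r(1)])
qed

theorem pbw_spanning:
  assumes r: "reduced rs" and n: "\<And>j. j \<in> I ==> neg (W rs (\<alpha> j))" and x: "x \<in> Up"
  shows "x \<in> lspan {pbw rs as 1 | as. length as = length rs}"
proof -
  let ?B = "{pbw rs as 1 | as. length as = length rs}"
  have I: "set rs \<subseteq> I" by (rule reduced_set[OF r])
  note h = alg_hom_simps[OF alg_hom_foldr[OF I]]
  have pbw_alg: "pbw rs as 1 \<in> Up" if "length as = length rs" for as by (rule pbw_Up[OF r that])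
  have y: "\<exists>c. foldr T rs y - sc c 1 \<in> left_F" if y: "y \<in> Up" for y
  proof -
    obtain c where "y - sc c 1 \<in> lspan {x * z | x z. x \<in> Up \<and> z \<in> E ` I}"
      using y unfolding Up_def by (rule alg_constant_term)
    hence "foldr T rs (y - sc c 1) \<in> left_F"
      unfolding left_F_def
    proof (rule lspan_image[OF h(3,5), rotated])
      fix z assume "z \<in> {x * z | x z. x \<in> Up \<and> z \<in> E ` I}"
      then obtain x j where "z = x * E j" "x \<in> Up" "j \<in> I" by blast
      moreover have "foldr T rs x \<in> alg gens" using foldr_T_alg[OF I] Up_gens \<open>x \<in> Up\<close> by blast
      ultimately have "foldr T rs z \<in> left_F" using left_F_left[OF _ T_longest_E[OF r _ n]] by (simp add: h)
      thus "foldr T rs z \<in> lspan {x * F k | x k. x \<in> alg gens \<and> k \<in> I}" unfolding left_F_def .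
    qed
    thus ?thesis by (auto simp: h)
  qed
  define S where "S = {pbw rs as y | as y. length as = length rs \<and> y \<in> Up}"
  have S: "\<exists>z\<in>lspan ?B. x - z \<in> left_F" if x: "x \<in> S" for x
  proof -
    obtain as y' where x: "x = pbw rs as y'" "length as = length rs" "y' \<in> Up" using x unfolding S_def by blast
    obtain c where c: "foldr T rs y' - sc c 1 \<in> left_F" using y[OF x(3)] by blast
    have "x = pbw rs as 1 * foldr T rs y'" using pbw_mult[of rs as 1 y'] x(1,2) I by simp
    hence "x - sc c (pbw rs as 1) = pbw rs as 1 * (foldr T rs y' - sc c 1)" by (simp add: right_diff_distrib)
    also have "\<dots> \<in> left_F" using c pbw_alg[OF x(2)] Up_gens by (intro left_F_left) auto
    finally have "x - sc c (pbw rs as 1) \<in> left_F" .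
    moreover have "sc c (pbw rs as 1) \<in> lspan ?B" using x(2) by (intro lspan_scale lspan_gen) blast
    ultimately show ?thesis by blast
  qed
  have "x \<in> lspan S" using pbw_span[OF I x] unfolding S_def .
  hence "\<exists>z\<in>lspan ?B. x - z \<in> left_F"
  proof induction
    case zero
    have "0 - 0 \<in> left_F" unfolding left_F_def by (simp add: lspan.zero)
    thus ?case using lspan.zero by blast
  next
    case (add x y c)
    obtain z1 z2 where z: "z1 \<in> lspan ?B" "x - z1 \<in> left_F" "z2 \<in> lspan ?B" "y - z2 \<in> left_F" using S add by blast
    have "sc c (x - z1) + (y - z2) \<in> left_F" using z unfolding left_F_def by (intro lspan_add lspan_scale)
    moreover have "sc c (x - z1) + (y - z2) = (sc c x + y) - (sc c z1 + z2)" by (simp add: sc_diff_right)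
    moreover have "sc c z1 + z2 \<in> lspan ?B" using z by (intro lspan_add lspan_scale)
    ultimately show ?case by (intro bexI[of _ "sc c z1 + z2"]) simp_all
  qed
  then obtain z where z: "z \<in> lspan ?B" "x - z \<in> left_F" by blast
  have "z \<in> Up" using z(1)
  proof induction
    case (add x y c)
    thus ?case using pbw_alg by (auto simp: Up_def intro: alg.add alg.scale)
  qed (rule Up_intros)
  hence "x - z \<in> Up" using x unfolding Up_def by (intro alg_diff)
  hence "x - z = 0" using z(2) by (rule positive_left_F)
  thus ?thesis using z(1) by simp
qed

lemma FK_power: "r \<in> I ==> \<exists>c. c \<noteq> 0 \<and> (- (F r * K r)) ^ n = sc c (F r ^ n * K r ^ n)"
proof (induction n)
  case 0
  show ?case by (rule exI[of _ 1]) simp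
next
  case (Suc n)
  then obtain c where c: "c \<noteq> 0" "(- (F r * K r)) ^ n = sc c (F r ^ n * K r ^ n)" by blast
  let ?e = "(v r powi - 2) ^ n"
  have "K r ^ n * F r = sc ?e (F r * K r ^ n)" using K_pow_comm[of r "F r" _ n] KF[of r r] Suc.prems by simp
  hence "K r ^ n * (F r * K r) = sc ?e (F r * K r ^ n * K r)" by (simp add: mult.assoc[symmetric])
  hence "(F r ^ n * K r ^ n) * (F r * K r) = sc ?e (F r ^ n * (F r * K r ^ n * K r))" by (simp add: mult.assoc)
  also have "F r ^ n * (F r * K r ^ n * K r) = F r ^ Suc n * K r ^ Suc n"
    by (simp only: power_Suc2 mult.assoc)
  finally have "(F r ^ n * K r ^ n) * (F r * K r) = sc ?e (F r ^ Suc n * K r ^ Suc n)" .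
  hence "(- (F r * K r)) ^ Suc n = sc (- (c * ?e)) (F r ^ Suc n * K r ^ Suc n)"
    by (simp add: c(2) power_Suc2 sc_minus_left del: power_Suc)
  moreover have "?e \<noteq> 0" using v_neq_0[OF Suc.prems] by (simp add: power_int_not_zero)
  ultimately show ?case using c(1) by (intro exI[of _ "- (c * ?e)"]) simp
qed

lemma Up_K:
  assumes "x \<in> Up" "i \<in> I" shows "K i ^ n * x * L i ^ n \<in> Up"
proof -
  have LK: "L i ^ n * K i ^ n = 1" and KL: "K i ^ n * L i ^ n = 1"
    using assms(2) by (simp_all add: left_right_inverse_power KL LK)
  show ?thesis using assms(1) unfolding Up_def
  proof induction
    case (gen x)
    then obtain j where j: "x = E j" "j \<in> I" by blast
    have "K i ^ n * E j * L i ^ n = sc ((v i powi a i j) ^ n) (E j)"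
      using K_pow_comm[OF assms(2) KE[OF assms(2) j(2)], of n] KL by (simp add: mult.assoc)
    thus ?case using j by (simp add: alg.scale alg.gen)
  next
    case (mult x y)
    have "K i ^ n * (x * y) * L i ^ n = (K i ^ n * x * L i ^ n) * (K i ^ n * y * L i ^ n)"
      using LK by (simp add: mult.assoc assoc_rule[OF LK])
    thus ?case using mult alg.mult by metis
  qed (simp_all add: KL alg.intros distrib_left distrib_right)
qed

text \<open>A finite box, so that a sum over it can be split according to the first
  exponent.\<close>

definition exponents :: "nat \<Rightarrow> nat \<Rightarrow> nat list set" where
  "exponents n N = {as. length as = n \<and> set as \<subseteq> {..N}}"

lemma finite_exponents: "finite (exponents n N)"
  using finite_lists_length_eq[of "{..N}" n] by (simp add: exponents_def conj_commute)

lemma sum_exponents_Suc: "(\<Sum>as\<in>exponents (Suc n) N. f as) = (\<Sum>k\<le>N. \<Sum>as\<in>exponents n N. f (k # as))" for f :: "nat list \<Rightarrow> 'r"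
proof -
  have e: "exponents (Suc n) N = (\<lambda>(k, as). k # as) ` ({..N} \<times> exponents n N)"
    by (force simp: exponents_def length_Suc_conv)
  have "inj_on (\<lambda>(k, as). k # as) ({..N} \<times> exponents n N)" by (auto simp: inj_on_def)
  thus ?thesis unfolding e sum.reindex[OF \<open>inj_on _ _\<close>] by (simp add: sum.cartesian_product o_def case_prod_unfold)
qed

theorem pbw_independent:
  assumes "reduced rs" "(\<Sum>as\<in>exponents (length rs) N. sc (c as) (pbw rs as 1)) = 0" "as \<in> exponents (length rs) N"
  shows "c as = 0"
  using assms
proof (induction rs arbitrary: c as)
  case Nil
  have "exponents 0 N = {[]}" by (auto simp: exponents_def)
  hence "sc (c []) 1 = 0" using Nil(2) by (simp add: pbw_simps)
  hence "c [] = 0" using sc_eq_0_iff[of "c []" 1] by auto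
  thus ?case using Nil by (simp add: exponents_def)
next
  case (Cons r rs)
  have rs: "reduced rs" by (rule reduced_Cons[OF Cons.prems(1)])
  have r: "r \<in> I" using reduced_set[OF Cons.prems(1)] by simp
  define Z where "Z k = (\<Sum>as\<in>exponents (length rs) N. sc (c (k # as)) (pbw rs as 1))" for k
  have Z: "Z k \<in> Up" for k
  proof -
    have sum_Up: "sum f A \<in> Up" if "\<And>a. a \<in> A ==> f a \<in> Up" for f and A :: "nat list set"
      using that by (induction A rule: infinite_finite_induct) (auto intro: Up_intros)
    have "sc (c (k # as)) (pbw rs as 1) \<in> Up" if "as \<in> exponents (length rs) N" for as
      using pbw_Up[OF rs, of as] that unfolding exponents_def Up_def by (simp add: alg.scale)
    thus ?thesis unfolding Z_def by (rule sum_Up)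
  qed
  note hT = alg_hom_simps[OF T_hom[OF r]] and hT' = alg_hom_simps[OF T'_hom[OF r]]
  have "(\<Sum>k\<le>N. E r ^ k * T r (Z k)) = (\<Sum>as\<in>exponents (Suc (length rs)) N. sc (c as) (pbw (r # rs) as 1))"
    unfolding sum_exponents_Suc pbw_simps Z_def hT sum_distrib_left sc_mult_right ..
  hence "(\<Sum>k\<le>N. E r ^ k * T r (Z k)) = 0" using Cons.prems(2) by (simp only: list.size add_Suc_right add_0_right)
  moreover have TZ: "T' r (T r (Z k)) = Z k" for k using Up_gens by (intro T'T[OF r]) (rule subsetD[OF _ Z])
  have "T' r (\<Sum>k\<le>N. E r ^ k * T r (Z k)) = (\<Sum>k\<le>N. (T' r (E r)) ^ k * Z k)"
    by (simp only: hT' TZ)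
  moreover have "T' r (E r) = - (F r * K r)" using T'_E[OF r r] by simp
  ultimately have s: "(\<Sum>k\<le>N. (- (F r * K r)) ^ k * Z k) = 0"
    by (simp only: hT'(2))
  have "\<forall>n. \<exists>c. c \<noteq> 0 \<and> (- (F r * K r)) ^ n = sc c (F r ^ n * K r ^ n)" using FK_power[OF r] by (rule allI)
  from choice[OF this] obtain e
    where e': "\<forall>n. e n \<noteq> 0 \<and> (- (F r * K r)) ^ n = sc (e n) (F r ^ n * K r ^ n)" ..
  have e: "e n \<noteq> 0" "(- (F r * K r)) ^ n = sc (e n) (F r ^ n * K r ^ n)" for n
    using spec[OF e', of n] by simp_all
  \<comment> \<open>Conjugation by \<open>K r ^ n\<close>, which preserves \<open>Up\<close> by
    \<open>Up_K\<close>, moves the torus factor to the right of \<open>Z n\<close>, the form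
    required by \<open>F_powers_independent\<close>.\<close>
  define y where "y n = sc (e n) (K r ^ n * Z n * L r ^ n)" for n
  have LK: "L r ^ n * K r ^ n = 1" "K r ^ n * L r ^ n = 1" for n using r by (simp_all add: left_right_inverse_power KL LK)
  have "(- (F r * K r)) ^ n * Z n = F r ^ n * y n * K r ^ n" for n
    using LK by (simp add: e(2) y_def mult.assoc)
  hence "(\<Sum>n\<le>N. F r ^ n * y n * K r ^ n) = 0" using s by simp
  note s0 = this
  have yUp: "y n \<in> Up" for n unfolding y_def using Up_K[OF Z r, of n n] unfolding Up_def by (rule alg.scale)
  have y0: "y n = 0" if "n \<le> N" for n by (rule F_powers_independent[OF r yUp s0 that])
  have Z0: "Z n = 0" if "n \<le> N" for n
  proof -
    have "sc (e n) (K r ^ n * Z n * L r ^ n) = 0" using y0[OF that] by (simp add: y_def)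
    hence 0: "K r ^ n * Z n * L r ^ n = 0" by (simp only: sc_eq_0_iff[OF e(1)])
    have "Z n = (L r ^ n * K r ^ n) * Z n * (L r ^ n * K r ^ n)" by (simp only: LK mult_1_left mult_1_right)
    also have "\<dots> = L r ^ n * (K r ^ n * Z n * L r ^ n) * K r ^ n" by (simp only: mult.assoc)
    finally show ?thesis by (simp only: 0 mult_zero_left mult_zero_right)
  qed
  obtain k bs where as: "as = k # bs" "k \<le> N" "bs \<in> exponents (length rs) N"
    using Cons.prems(3) by (auto simp: exponents_def length_Suc_conv)
  have "(\<Sum>bs\<in>exponents (length rs) N. sc (c (k # bs)) (pbw rs bs 1)) = 0"
    using Z0[OF as(2)] unfolding Z_def .
  from Cons.IH[OF rs this as(3)] show ?case unfolding as(1) .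
qed

end

section \<open>Triangular decomposition\<close>

context unit_scalar
begin

text \<open>Here \<open>f\<close> is paired with the linear variable \<open>y\<close>, as
  \<open>F j\<close> is for the Serre element of \<open>E i\<close> and \<open>E j\<close>. The
  torus terms cancel because the coefficients of the Serre element, weighted by the powers that
  arise from moving the torus element to one side, sum to 0.\<close>

lemma serre_commute_torus:
  assumes "m \<le> 2" "x * f = f * x" "y * f = f * y + sc g (k - l)"
    "k * x = sc (u ^ m) (x * k)" "l * x = sc (v ^ m) (x * l)"
  shows "serre_rel v m x y * f = f * serre_rel v m x y"
proof -
  have y: "y * f = f * y + sc g k - sc g l" using assms(3) by (simp add: sc_diff_right)
  note r = assms(2,4,5) y assms(2,4,5)[THEN assoc_rule] y[THEN assoc_rule]
  have "m = 0 \<or> m = 1 \<or> m = 2" using assms(1) by auto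
  thus ?thesis
  proof (elim disjE)
    assume "m = 0"
    note r = r[unfolded this power_0 sc_1]
    show ?thesis unfolding \<open>m = 0\<close> serre_rel_eqs by (simp add: r sc_distribs algebra_simps)
  next
    assume m: "m = 1"
    note r = r[unfolded m power_one_right]
    show ?thesis unfolding m serre_rel_eqs by (simp add: r expand)
  next
    assume m: "m = 2"
    note r = r[unfolded m power2_eq_square]
    show ?thesis unfolding m serre_rel_eqs by (simp add: r expand)
  qed
qed

end

context quantum_sl2
begin

text \<open>The counterpart of \<open>serre_commute_torus\<close> for the \<open>F\<close> that is
  paired with the repeated variable.\<close>

lemma serre_commute:
  assumes "m \<le> 2" "lowest m y"
  shows "serre_rel v m E y * F = F * serre_rel v m E y"
proof -
  have "m = 0 \<or> m = 1 \<or> m = 2" using assms(1) by auto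
  thus ?thesis
  proof (elim disjE)
    assume m: "m = 0"
    note low = lowest_rules[OF assms(2)[unfolded m], unfolded power_0 sc_1]
    show ?thesis unfolding m serre_rel_eqs by (simp add: low sl2_rules sc_distribs algebra_simps)
  next
    assume m: "m = 1"
    note low = lowest_rules[OF assms(2)[unfolded m], unfolded power_one_right]
    show ?thesis unfolding m serre_rel_eqs
      by (simp add: low sl2_rules sc_distribs scalars hv huu ht algebra_simps)
  next
    assume m: "m = 2"
    note low = lowest_rules[OF assms(2)[unfolded m], unfolded power2_eq_square]
    show ?thesis unfolding m serre_rel_eqs
      by (simp add: low sl2_rules sc_distribs scalars hv huu ht algebra_simps)
  qed
qed

lemma omega: "quantum_sl2 sc v u t h F E L K"
proof
  show "F * E = E * F + sc h L - sc h K" using EF by (simp add: algebra_simps)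
qed (auto simp: h KL LK LE LF)

end

text \<open>Linear endomorphisms as a type, so that they form a \<open>ring_1\<close> and
  \<open>lift\<close> yields a representation of the free algebra.\<close>

typedef 'i lend = "{f :: 'i falg \<Rightarrow> 'i falg. (\<forall>x y. f (x + y) = f x + f y) \<and> (\<forall>c x. f (fscale c x) = fscale c (f x))}"
  morphisms app Lend
  by (rule exI[of _ "\<lambda>x. x"]) simp

lemma app_linear: "app f (x + y) = app f x + app f y" "app f (fscale c x) = fscale c (app f x)"
  using app[of f] by auto

lemma app_0 [simp]: "app f 0 = 0"
  using app_linear(1)[of f 0 0] by simp

lemma app_diff: "app f (x - y) = app f x - app f y"
  using app_linear(1)[of f "x - y" y] by simp

lemma app_sum: "app f (sum g A) = (\<Sum>a\<in>A. app f (g a))"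
  by (induction A rule: infinite_finite_induct) (auto simp: app_linear)

lemma app_Lend:
  "(\<And>x y. f (x + y) = f x + f y) ==> (\<And>c x. f (fscale c x) = fscale c (f x)) ==> app (Lend f) x = f x"
  by (simp add: Lend_inverse)

lemma lend_eqI: "(\<And>x. app f x = app g x) ==> f = g"
  by (simp add: app_inject[symmetric] fun_eq_iff)

instantiation lend :: (type) ring_1
begin
definition "0 = Lend (\<lambda>_. 0)"
definition "1 = Lend (\<lambda>x. x)"
definition "f + g = Lend (\<lambda>x. app f x + app g x)"
definition "f - g = Lend (\<lambda>x. app f x - app g x)"
definition "- f = Lend (\<lambda>x. - app f x)"
definition "f * g = Lend (\<lambda>x. app f (app g x))"

lemma app_ring: "app 0 x = 0" "app 1 x = x" "app (f + g) x = app f x + app g x" "app (f - g) x = app f x - app g x"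
  "app (- f) x = - app f x" "app (f * g) x = app f (app g x)"
  unfolding zero_lend_def one_lend_def plus_lend_def minus_lend_def uminus_lend_def times_lend_def
  by (subst app_Lend; simp add: app_linear falg.sc_distribs)+

instance
proof
  have "app (0 :: 'a lend) 1 \<noteq> app 1 1" by (simp add: app_ring)
  thus "(0 :: 'a lend) \<noteq> 1" by metis
qed (rule lend_eqI, simp add: app_ring app_linear algebra_simps)+

end

definition lscale :: "qfield \<Rightarrow> 'i lend \<Rightarrow> 'i lend" where
  "lscale c f = Lend (\<lambda>x. fscale c (app f x))"

lemma app_lscale: "app (lscale c f) x = fscale c (app f x)"
  unfolding lscale_def by (subst app_Lend) (simp_all add: app_linear falg.sc_distribs mult.commute)

lemmas app_simps = app_ring app_lscale

interpretation lend: qscaled_ring lscale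
  by unfold_locales (rule lend_eqI, simp add: app_simps app_linear falg.sc_distribs)+

section \<open>The induced module on words\<close>

definition wd :: "'i qgen list \<Rightarrow> 'i falg" where "wd gs = single (Word gs) 1"

lemma wd_append: "wd (us @ ws) = wd us * wd ws"
  by (simp add: wd_def mult_single plus_word_def)

lemma wd_simps: "wd [] = 1" "wd (g # gs) = fgen g * wd gs" "wd (us @ ws) = wd us * wd ws"
  using wd_append[of "[g]" gs] by (simp_all add: wd_append) (simp_all add: wd_def fgen_def flip: zero_word_def single_one)

lemma falg_wd_sum: "x = (\<Sum>w\<in>keys x. fscale (lookup x w) (wd (letters w)))"
proof -
  have *: "fscale c (wd (letters w)) = single w c" for c w
    by (cases w) (simp add: fscale_def fconst_def wd_def mult_single)
  show ?thesis unfolding * by (rule poly_mapping_sum_single)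
qed

lemma falg_induct [case_names wd add scale]:
  assumes "\<And>gs. P (wd gs)" "\<And>x y. P x ==> P y ==> P (x + y)" "\<And>c x. P x ==> P (fscale c x)"
  shows "P x"
proof -
  have 0: "P 0" using assms(3)[of "wd []" 0] assms(1) by simp
  have "P (sum f A)" if "\<And>a. P (f a)" for f and A :: "'a qgen word set"
    using that by (induction A rule: infinite_finite_induct) (auto intro: 0 assms(2))
  thus ?thesis by (subst falg_wd_sum) (simp add: assms)
qed

lemma lend_eq_wdI: "(\<And>gs. app f (wd gs) = app g (wd gs)) ==> f = g"
proof (rule lend_eqI)
  assume "\<And>gs. app f (wd gs) = app g (wd gs)"
  thus "app f x = app g x" for x by (induction x rule: falg_induct) (simp_all add: app_linear)
qed

definition linext :: "('i qgen list \<Rightarrow> 'i falg) \<Rightarrow> 'i lend" where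
  "linext \<phi> = Lend (\<lambda>x. \<Sum>w\<in>keys x. fscale (lookup x w) (\<phi> (letters w)))"

lemma app_linext: "app (linext \<phi>) (wd gs) = \<phi> gs"
proof -
  define f where "f x = (\<Sum>w\<in>keys x. fscale (lookup x w) (\<phi> (letters w)))" for x
  have sup: "f x = (\<Sum>w\<in>A. fscale (lookup x w) (\<phi> (letters w)))" if "finite A" "keys x \<subseteq> A" for A x
    unfolding f_def by (rule sum.mono_neutral_left) (use that in \<open>auto simp: in_keys_iff\<close>)
  have "f (x + y) = f x + f y" for x y
  proof -
    let ?A = "keys x \<union> keys y"
    show ?thesis using sup[of ?A x] sup[of ?A y] sup[of ?A "x + y"] Poly_Mapping.keys_add[of x y]
      by (simp add: lookup_add falg.sc_add_left sum.distrib)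
  qed
  moreover have "f (fscale c x) = fscale c (f x)" for c x
  proof -
    have l: "lookup (fscale c x) w = c * lookup x w" for w
      unfolding fscale_def fconst_def mult_map_scale_conv_mult[symmetric] by (simp add: map.rep_eq when_def)
    hence "keys (fscale c x) \<subseteq> keys x" by (auto simp: in_keys_iff)
    hence "f (fscale c x) = (\<Sum>w\<in>keys x. fscale c (fscale (lookup x w) (\<phi> (letters w))))"
      using sup[of "keys x" "fscale c x"] by (simp add: l)
    thus ?thesis by (simp only: f_def falg.sc_sum_right)
  qed
  ultimately have "app (Lend f) (wd gs) = f (wd gs)" by (rule app_Lend)
  thus ?thesis by (simp add: linext_def f_def[abs_def] wd_def)
qed

definition lmult :: "'i falg \<Rightarrow> 'i lend" where "lmult x = Lend (\<lambda>y. x * y)"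

lemma app_lmult: "app (lmult x) y = x * y"
  unfolding lmult_def by (subst app_Lend) (simp_all add: distrib_left)

fun torus_weight :: "'i cartan_datum \<Rightarrow> 'i \<Rightarrow> 'i qgen \<Rightarrow> qfield" where
  "torus_weight C i (Egen j) = qi C i powi cartan C i j"
| "torus_weight C i (Fgen j) = qi C i powi (- cartan C i j)"
| "torus_weight C i _ = 1"

definition word_weight :: "'i cartan_datum \<Rightarrow> 'i \<Rightarrow> 'i qgen list \<Rightarrow> qfield" where
  "word_weight C i gs = prod_list (map (torus_weight C i) gs)"

text \<open>The module induced from the trivial character of the torus is realised, before imposing the
  Serre relations, on words in the \<open>F\<close> and \<open>E\<close> letters: \<open>E j\<close> is moved to the right past leading \<open>F\<close> letters.\<close>

fun raise :: "'i cartan_datum \<Rightarrow> 'i \<Rightarrow> 'i qgen list \<Rightarrow> 'i falg" where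
  "raise C j (Fgen k # gs) = fF k * raise C j gs +
     (if j = k then fscale (inverse (qi C j - inverse (qi C j)) * (word_weight C j gs - inverse (word_weight C j gs))) (wd gs) else 0)"
| "raise C j gs = wd (Egen j # gs)"

fun verma_gen :: "'i cartan_datum \<Rightarrow> 'i qgen \<Rightarrow> 'i lend" where
  "verma_gen C (Egen j) = linext (raise C j)"
| "verma_gen C (Fgen j) = lmult (fF j)"
| "verma_gen C (Kgen i) = linext (\<lambda>gs. fscale (word_weight C i gs) (wd gs))"
| "verma_gen C (Kinv i) = linext (\<lambda>gs. fscale (inverse (word_weight C i gs)) (wd gs))"

declare verma_gen.simps [simp del]

lemma app_verma_gen:
  "app (verma_gen C (Egen j)) (wd gs) = raise C j gs"
  "app (verma_gen C (Fgen j)) x = fF j * x"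
  "app (verma_gen C (Kgen i)) (wd gs) = fscale (word_weight C i gs) (wd gs)"
  "app (verma_gen C (Kinv i)) (wd gs) = fscale (inverse (word_weight C i gs)) (wd gs)"
  by (simp_all add: app_linext app_lmult verma_gen.simps)

lemma word_weight_simps: "word_weight C i [] = 1" "word_weight C i (g # gs) = torus_weight C i g * word_weight C i gs"
  "word_weight C i (us @ ws) = word_weight C i us * word_weight C i ws"
  by (simp_all add: word_weight_def)

lemma fF_wd: "fF j * wd gs = wd (Fgen j # gs)" "fE j * wd gs = wd (Egen j # gs)"
  by (simp_all add: wd_simps fF_def fE_def)

lemma app_raise_F: "app (verma_gen C (Egen j)) (fF k * x) = fF k * app (verma_gen C (Egen j)) x +
  (if j = k then fscale (inverse (qi C j - inverse (qi C j))) (app (verma_gen C (Kgen j)) x - app (verma_gen C (Kinv j)) x) else 0)"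
proof (induction x rule: falg_induct)
  case (wd gs)
  show ?case by (simp add: fF_wd app_verma_gen falg.sc_distribs algebra_simps)
next
  case (add x y)
  thus ?case by (simp add: distrib_left app_linear falg.sc_distribs)
next
  case (scale c x)
  thus ?case by (simp add: app_linear falg.sc_distribs mult.commute[of c])
qed

lemma app_raise_other:
  assumes "\<And>k. g \<noteq> Fgen k"
  shows "app (verma_gen C (Egen j)) (fgen g * x) = fE j * (fgen g * x)"
proof (induction x rule: falg_induct)
  case (wd gs)
  have "raise C j (g # gs) = wd (Egen j # g # gs)" using assms by (cases g) auto
  thus ?case by (simp add: app_verma_gen fF_wd flip: wd_simps(2))
qed (simp_all add: distrib_left app_linear)

lemma app_torus_mult:
  fixes C :: "'i cartan_datum" and x y :: "'i falg"
  shows "app (verma_gen C (Kgen i)) (x * y) = app (verma_gen C (Kgen i)) x * app (verma_gen C (Kgen i)) y"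
  "app (verma_gen C (Kinv i)) (x * y) = app (verma_gen C (Kinv i)) x * app (verma_gen C (Kinv i)) y"
proof -
  have *: "app f (x * y) = app f x * app f y"
    if "\<And>us. app f (wd us) = fscale (h us) (wd us)" "\<And>us ws. h (us @ ws) = h us * h ws" for f :: "'i lend" and h :: "'i qgen list \<Rightarrow> qfield"
  proof (induction x rule: falg_induct)
    case (wd us)
    show ?case
    proof (induction y rule: falg_induct)
      case (wd ws)
      show ?case by (simp add: that mult.commute flip: wd_simps(3))
    qed (simp_all add: distrib_left app_linear mult.commute)
  qed (simp_all add: distrib_right app_linear)
  show "app (verma_gen C (Kgen i)) (x * y) = app (verma_gen C (Kgen i)) x * app (verma_gen C (Kgen i)) y"
    by (rule *[OF app_verma_gen(3) word_weight_simps(3)])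
  show "app (verma_gen C (Kinv i)) (x * y) = app (verma_gen C (Kinv i)) x * app (verma_gen C (Kinv i)) y"
    by (rule *[OF app_verma_gen(4)]) (simp add: word_weight_simps)
qed

section \<open>The operators satisfy the relations modulo the Serre ideal\<close>

locale uq_datum =
  fixes C :: "'i cartan_datum"
  assumes C: "cartan_type (index C) (cartan C) (symm C)"
begin

sublocale C: cartan_type "index C" "cartan C" "symm C" by (rule C)

lemma qi_nonroot: "i \<in> index C ==> not_root_of_unity (qi C i)"
  unfolding qi_def by (rule not_root_of_unity_power) (use qvar_not_root_of_unity C.d_pos in auto)

lemma qi_neq_0: "qi C i \<noteq> 0"
  using qvar_not_root_of_unity by (simp add: qi_def not_root_of_unity_def)

lemma torus_weight_neq_0: "torus_weight C i g \<noteq> 0"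
  by (cases g) (simp_all add: qi_neq_0)

lemma word_weight_neq_0: "word_weight C i gs \<noteq> 0"
  by (induction gs) (simp_all add: word_weight_simps torus_weight_neq_0)

abbreviation "VE i \<equiv> verma_gen C (Egen i)"
abbreviation "VF i \<equiv> verma_gen C (Fgen i)"
abbreviation "VK i \<equiv> verma_gen C (Kgen i)"
abbreviation "VL i \<equiv> verma_gen C (Kinv i)"

lemma VKL: "VK i * VL i = 1" "VL i * VK i = 1"
  by (rule lend_eq_wdI, simp add: app_simps app_verma_gen app_linear word_weight_neq_0)+

lemma VKF: "VK i * VF j = lscale (qi C i powi (- cartan C i j)) (VF j * VK i)"
proof (rule lend_eq_wdI)
  fix gs
  show "app (VK i * VF j) (wd gs) = app (lscale (qi C i powi (- cartan C i j)) (VF j * VK i)) (wd gs)"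
    by (simp add: app_simps app_verma_gen app_linear fF_wd word_weight_simps)
qed

lemma VK_raise: "app (VK i) (raise C j gs) = fscale (qi C i powi cartan C i j * word_weight C i gs) (raise C j gs)"
proof (induction gs)
  case Nil
  show ?case by (simp add: app_verma_gen word_weight_simps)
next
  case (Cons g gs)
  show ?case
  proof (cases g)
    case (Fgen k)
    have K: "app (VK i) (fF k) = fscale (qi C i powi (- cartan C i k)) (fF k)"
      using app_verma_gen(3)[of C i "[Fgen k]"] by (simp add: fF_def wd_simps word_weight_simps)
    obtain p p' where p: "p = qi C i powi cartan C i k" "p' = qi C i powi (- cartan C i k)" by simp
    have pp: "p * (p' * y) = y" "p' * (p * y) = y" "p * (x * (p' * y)) = x * y" for x y
      using qi_neq_0[of i] by (simp_all add: p power_int_minus power_int_not_zero)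
    show ?thesis using Cons
      by (cases "j = k")
        (simp_all add: Fgen K app_linear app_torus_mult app_verma_gen word_weight_simps falg.sc_distribs ac_simps pp p[symmetric])
  qed (simp_all add: app_verma_gen word_weight_simps)
qed

lemma VKE: "VK i * VE j = lscale (qi C i powi cartan C i j) (VE j * VK i)"
  by (rule lend_eq_wdI) (simp add: app_simps app_verma_gen app_linear VK_raise mult.commute)

lemma VEF: "VE i * VF j - VF j * VE i = (if i = j then lscale (inverse (qi C i - inverse (qi C i))) (VK i - VL i) else 0)"
  by (rule lend_eq_wdI) (simp add: app_simps app_verma_gen(2) app_raise_F)

definition serre_E :: "'i \<Rightarrow> 'i \<Rightarrow> 'i falg" where "serre_E i j = falg.serre_rel (qi C i) (C.bond i j) (fE i) (fE j)"
definition serre_F :: "'i \<Rightarrow> 'i \<Rightarrow> 'i falg" where "serre_F i j = falg.serre_rel (qi C i) (C.bond i j) (fF i) (fF j)"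

definition serre_set :: "'i falg set" where
  "serre_set = {serre_E i j | i j. i \<in> index C \<and> j \<in> index C \<and> i \<noteq> j} \<union> {serre_F i j | i j. i \<in> index C \<and> j \<in> index C \<and> i \<noteq> j}"

text \<open>The two-sided ideal of the Serre elements alone; the induced module lives on the free
  algebra modulo it. Spanning by products with words on both sides reduces stability under an
  operator to such products (\<open>serre_ideal_stable\<close>).\<close>

definition serre_ideal :: "'i falg set" where
  "serre_ideal = falg.lspan {wd p * z * wd q | p z q. z \<in> serre_set}"

lemma serre_ideal_gen: "z \<in> serre_set ==> wd p * z * wd q \<in> serre_ideal"
  unfolding serre_ideal_def by (rule falg.lspan_gen) blast

lemma serre_ideal_subspace:
  "0 \<in> serre_ideal" "x \<in> serre_ideal ==> y \<in> serre_ideal ==> x + y \<in> serre_ideal"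
  "x \<in> serre_ideal ==> fscale c x \<in> serre_ideal" "x \<in> serre_ideal ==> y \<in> serre_ideal ==> x - y \<in> serre_ideal"
  unfolding serre_ideal_def by (rule falg.lspan.zero falg.lspan_add falg.lspan_scale falg.lspan_diff; assumption)+

lemma serre_ideal_stable:
  assumes "\<And>p z q. z \<in> serre_set ==> app f (wd p * z * wd q) \<in> serre_ideal" "x \<in> serre_ideal"
  shows "app f x \<in> serre_ideal"
  unfolding serre_ideal_def
proof (rule falg.lspan_image[OF app_linear _ assms(2)[unfolded serre_ideal_def]])
  fix x assume "x \<in> {wd p * z * wd q | p z q. z \<in> serre_set}"
  then obtain p z q where "x = wd p * z * wd q" "z \<in> serre_set" by blast
  thus "app f x \<in> falg.lspan {wd p * z * wd q | p z q. z \<in> serre_set}"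
    using assms(1) unfolding serre_ideal_def by simp
qed

lemma serre_ideal_left: "x \<in> serre_ideal ==> fgen g * x \<in> serre_ideal"
proof -
  assume x: "x \<in> serre_ideal"
  have "app (lmult (fgen g)) x \<in> serre_ideal"
  proof (rule serre_ideal_stable[OF _ x])
    fix p z q assume "z \<in> serre_set"
    from serre_ideal_gen[OF this, of "g # p" q] show "app (lmult (fgen g)) (wd p * z * wd q) \<in> serre_ideal"
      by (simp add: app_lmult wd_simps mult.assoc)
  qed
  thus ?thesis by (simp add: app_lmult)
qed

lemma serre_ideal_right: "z \<in> serre_set ==> z * y \<in> serre_ideal"
proof (induction y rule: falg_induct)
  case (wd gs)
  from serre_ideal_gen[OF this, of "[]" gs] show ?case by (simp add: wd_simps)
qed (simp_all add: distrib_left serre_ideal_subspace)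

lemma serre_ideal_VK: "x \<in> serre_ideal ==> app (VK i) x \<in> serre_ideal" "x \<in> serre_ideal ==> app (VL i) x \<in> serre_ideal"
proof -
  have sr: "falg.serre_rel v m (fscale \<alpha> x) (fscale \<beta> y) = fscale (\<beta> * \<alpha> ^ (if m = 0 then 1 else if m = 1 then 2 else 3)) (falg.serre_rel v m x y)"
    for v m \<alpha> \<beta> and x y :: "'i falg"
    by (simp add: falg.serre_rel_def falg.sc_add_right falg.sc_diff_right falg.sc_minus_right power2_eq_square power3_eq_cube ac_simps)
  have *: "app f x \<in> serre_ideal" if f: "\<And>x y. app f (x * y) = app f x * app f y" and w: "\<And>gs. app f (wd gs) = fscale (h gs) (wd gs)"
    and x: "x \<in> serre_ideal" for f h x
  proof (rule serre_ideal_stable[OF _ x])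
    have g: "app f (fE i) = fscale (h [Egen i]) (fE i)" "app f (fF i) = fscale (h [Fgen i]) (fF i)" for i
      using w[of "[Egen i]"] w[of "[Fgen i]"] by (simp_all add: wd_simps fE_def fF_def)
    have "app f (falg.serre_rel v m x y) = falg.serre_rel v m (app f x) (app f y)" for v m x y
      by (simp add: falg.serre_rel_def app_linear app_diff f)
    hence s: "\<exists>c. app f z = fscale c z" if "z \<in> serre_set" for z
      using that g sr unfolding serre_set_def serre_E_def serre_F_def by auto
    fix p z q assume z: "z \<in> serre_set"
    obtain c where "app f z = fscale c z" using s[OF z] by blast
    hence "app f (wd p * z * wd q) = fscale (h p * c * h q) (wd p * z * wd q)" by (simp add: f w mult.commute mult.left_commute)
    thus "app f (wd p * z * wd q) \<in> serre_ideal" using serre_ideal_gen[OF z] serre_ideal_subspace(3) by simp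
  qed
  show "x \<in> serre_ideal ==> app (VK i) x \<in> serre_ideal" "x \<in> serre_ideal ==> app (VL i) x \<in> serre_ideal"
    by (rule *[OF app_torus_mult(1) app_verma_gen(3)], assumption) (rule *[OF app_torus_mult(2) app_verma_gen(4)], assumption)
qed

lemma VKL_comm: "VL i * VF j = lscale (qi C i powi cartan C i j) (VF j * VL i)"
proof (rule lend_eq_wdI)
  fix gs
  show "app (VL i * VF j) (wd gs) = app (lscale (qi C i powi cartan C i j) (VF j * VL i)) (wd gs)"
    by (simp add: app_simps app_verma_gen app_linear fF_wd word_weight_simps power_int_minus)
qed

lemma verma_sl2:
  assumes "i \<in> index C"
  shows "quantum_sl2 lscale (qi C i) (inverse (qi C i)) (inverse (qi C i + inverse (qi C i))) (inverse (qi C i - inverse (qi C i)))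
     (VE i) (VF i) (VK i) (VL i)"
proof (unfold_locales, goal_cases)
  case 1 show ?case by (rule qi_nonroot[OF assms])
next
  case 7 show ?case using VKE[of i i] assms by (simp add: power2_eq_square)
next
  case 8 show ?case using VKF[of i i] assms by (simp add: power2_eq_square power_int_minus)
next
  case 9 show ?case using VEF[of i i] by (simp add: lend.sc_diff_right algebra_simps)
qed (auto simp: VKL)

lemma qi_sym: "i \<in> index C ==> j \<in> index C ==> qi C i powi cartan C i j = qi C j powi cartan C j i"
proof -
  assume ij: "i \<in> index C" "j \<in> index C"
  have "qi C i powi cartan C i j = qvar powi (int (symm C i) * cartan C i j)"
    "qi C j powi cartan C j i = qvar powi (int (symm C j) * cartan C j i)"
    by (simp_all add: qi_def power_int_mult)
  thus ?thesis using C.sym[OF ij] by simp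
qed

lemma VE_commute_VF: "i \<noteq> j ==> VE i * VF j = VF j * VE i"
  using VEF[of i j] by simp

lemma VL_VE: assumes "i \<in> index C" shows "VL i * VE j = lscale (qi C i powi (- cartan C i j)) (VE j * VL i)"
proof -
  interpret i: quantum_sl2 lscale "qi C i" "inverse (qi C i)" "inverse (qi C i + inverse (qi C i))" "inverse (qi C i - inverse (qi C i))"
     "VE i" "VF i" "VK i" "VL i" by (rule verma_sl2[OF assms])
  show ?thesis using qi_neq_0 by (intro i.torus_flip[OF VKE]) (simp add: power_int_minus power_int_not_zero)
qed

text \<open>Before any quotient is taken the operators satisfy the relations other than the Serre
  relations, and the commutation of Serre elements with the opposite generators rests on those
  only.\<close>

lemma serre_VE_commute:
  assumes ij: "i \<in> index C" "j \<in> index C" "i \<noteq> j"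
  shows "lend.serre_rel (qi C i) (C.bond i j) (VE i) (VE j) * VF k = VF k * lend.serre_rel (qi C i) (C.bond i j) (VE i) (VE j)"
proof -
  interpret i: quantum_sl2 lscale "qi C i" "inverse (qi C i)" "inverse (qi C i + inverse (qi C i))" "inverse (qi C i - inverse (qi C i))"
     "VE i" "VF i" "VK i" "VL i" by (rule verma_sl2[OF ij(1)])
  have a: "cartan C i j = - int (C.bond i j)" using C.a_eq[OF ij] .
  have w: "qi C j powi cartan C j i = inverse (qi C i ^ C.bond i j)"
    using qi_sym[OF ij(1,2)] by (simp add: a power_int_minus)
  have m: "C.bond i j \<le> 2" using C.bond_le[OF ij] .
  consider "k = i" | "k = j" | "k \<noteq> i" "k \<noteq> j" by blast
  thus ?thesis
  proof cases
    case 1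
    have "i.lowest (C.bond i j) (VE j)" using VKE[of i j] VE_commute_VF[of j i] ij(3)
      by (simp add: i.lowest_def a power_int_minus power_inverse)
    thus ?thesis unfolding 1 by (rule i.serre_commute[OF m])
  next
    case 2
    show ?thesis unfolding 2
    proof (rule i.serre_commute_torus[OF m])
      show "VE i * VF j = VF j * VE i" using VE_commute_VF ij(3) by simp
      show "VE j * VF j = VF j * VE j + lscale (inverse (qi C j - inverse (qi C j))) (VK j - VL j)"
        using VEF[of j j] by (simp add: algebra_simps)
      show "VK j * VE i = lscale (inverse (qi C i) ^ C.bond i j) (VE i * VK j)"
        using VKE[of j i] by (simp add: w power_int_minus power_inverse)
      show "VL j * VE i = lscale (qi C i ^ C.bond i j) (VE i * VL j)"
        using VL_VE[OF ij(2), of i] by (simp add: w power_int_minus power_inverse)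
    qed
  next
    case 3
    hence "VE i * VF k = VF k * VE i" "VE j * VF k = VF k * VE j" using VE_commute_VF by simp_all
    note r = this this[THEN assoc_rule]
    show ?thesis by (simp add: lend.serre_rel_def r algebra_simps)
  qed
qed

lemma serre_VF_commute:
  assumes ij: "i \<in> index C" "j \<in> index C" "i \<noteq> j"
  shows "lend.serre_rel (qi C i) (C.bond i j) (VF i) (VF j) * VE k = VE k * lend.serre_rel (qi C i) (C.bond i j) (VF i) (VF j)"
proof -
  interpret i0: quantum_sl2 lscale "qi C i" "inverse (qi C i)" "inverse (qi C i + inverse (qi C i))" "inverse (qi C i - inverse (qi C i))"
     "VE i" "VF i" "VK i" "VL i" by (rule verma_sl2[OF ij(1)])
  interpret i: quantum_sl2 lscale "qi C i" "inverse (qi C i)" "inverse (qi C i + inverse (qi C i))" "inverse (qi C i - inverse (qi C i))"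
     "VF i" "VE i" "VL i" "VK i" by (rule i0.omega)
  have a: "cartan C i j = - int (C.bond i j)" using C.a_eq[OF ij] .
  have w: "qi C j powi cartan C j i = inverse (qi C i ^ C.bond i j)"
    using qi_sym[OF ij(1,2)] by (simp add: a power_int_minus)
  have m: "C.bond i j \<le> 2" using C.bond_le[OF ij] .
  consider "k = i" | "k = j" | "k \<noteq> i" "k \<noteq> j" by blast
  thus ?thesis
  proof cases
    case 1
    have "i.lowest (C.bond i j) (VF j)" using VKL_comm[of i j] VE_commute_VF[of i j] ij(3)
      by (simp add: i.lowest_def a power_int_minus power_inverse)
    thus ?thesis unfolding 1 by (rule i.serre_commute[OF m])
  next
    case 2
    show ?thesis unfolding 2
    proof (rule i0.serre_commute_torus[OF m])
      show "VF i * VE j = VE j * VF i" using VE_commute_VF ij(3) by simp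
      show "VF j * VE j = VE j * VF j + lscale (inverse (qi C j - inverse (qi C j))) (VL j - VK j)"
        using VEF[of j j] by (simp add: algebra_simps lend.sc_distribs)
      show "VL j * VF i = lscale (inverse (qi C i) ^ C.bond i j) (VF i * VL j)"
        using VKL_comm[of j i] by (simp add: w power_int_minus power_inverse)
      show "VK j * VF i = lscale (qi C i ^ C.bond i j) (VF i * VK j)"
        using VKF[of j i] by (simp add: w power_int_minus power_inverse)
    qed
  next
    case 3
    hence "VF i * VE k = VE k * VF i" "VF j * VE k = VE k * VF j" using VE_commute_VF by simp_all
    note r = this this[THEN assoc_rule]
    show ?thesis by (simp add: lend.serre_rel_def r algebra_simps)
  qed
qed

lemma app_serre_F: "app (lend.serre_rel v m (VF i) (VF j)) x = falg.serre_rel v m (fF i) (fF j) * x"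
  by (simp add: lend.serre_rel_def falg.serre_rel_def app_simps app_verma_gen(2) algebra_simps falg.sc_distribs)

lemma app_serre_E:
  assumes "\<And>i. app (VE i) x = fE i * x"
  shows "app (lend.serre_rel v m (VE i) (VE j)) x = falg.serre_rel v m (fE i) (fE j) * x"
proof -
  have "app (VE k) (fE l * y) = fE k * (fE l * y)" for k l y
    using app_raise_other[of "Egen l" C k y] by (simp add: fE_def)
  thus ?thesis
    by (simp add: lend.serre_rel_def falg.serre_rel_def app_simps assms algebra_simps falg.sc_distribs)
qed

text \<open>Leading \<open>F\<close> letters are passed by \<open>app_raise_F\<close> at the cost of
  torus terms that preserve the ideal; in front of any other letter \<open>VE k\<close> is left
  multiplication. At a Serre element of the \<open>F\<close> the operator passes through by
  \<open>serre_VF_commute\<close>.\<close>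

lemma serre_ideal_VE: "x \<in> serre_ideal ==> app (VE k) x \<in> serre_ideal"
proof (rule serre_ideal_stable)
  fix p z q assume z: "z \<in> serre_set"
  show "app (VE k) (wd p * z * wd q) \<in> serre_ideal"
  proof (induction p)
    case Nil
    consider i j where "z = serre_E i j" "i \<in> index C" "j \<in> index C" "i \<noteq> j"
      | i j where "z = serre_F i j" "i \<in> index C" "j \<in> index C" "i \<noteq> j"
      using z unfolding serre_set_def by blast
    thus ?case
    proof cases
      case (1 i j)
      have "app (VE k) (fE l * y) = fE k * (fE l * y)" for l y
        using app_raise_other[of "Egen l" C k y] by (simp add: fE_def)
      hence "app (VE k) (z * wd q) = fE k * (z * wd q)"
        unfolding 1(1) serre_E_def falg.serre_rel_def
        by (simp add: app_diff app_linear distrib_left distrib_right left_diff_distrib right_diff_distrib mult.assoc)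
      thus ?thesis using serre_ideal_left[OF serre_ideal_right[OF z], of "Egen k"] by (simp add: fE_def wd_simps)
    next
      case (2 i j)
      have "app (VE k) (z * wd q) = z * app (VE k) (wd q)"
        unfolding 2(1) serre_F_def using serre_VF_commute[OF 2(2-4), of k]
        by (simp only: app_serre_F[symmetric] app_simps(6)[symmetric])
      thus ?thesis using serre_ideal_right[OF z] by (simp add: wd_simps)
    qed
  next
    case (Cons g p)
    show ?case
    proof (cases "\<exists>l. g = Fgen l")
      case True
      then obtain l where g: "g = Fgen l" by blast
      have "wd (g # p) * z * wd q = fF l * (wd p * z * wd q)" by (simp add: g wd_simps fF_def mult.assoc)
      thus ?thesis
        using serre_ideal_left[OF Cons, of "Fgen l", folded fF_def] serre_ideal_VK[OF serre_ideal_gen[OF z]]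
        by (simp add: app_raise_F serre_ideal_subspace)
    next
      case False
      have "wd (g # p) * z * wd q = fgen g * (wd p * z * wd q)" by (simp add: wd_simps mult.assoc)
      thus ?thesis
        using app_raise_other[of g C k "wd p * z * wd q"] False serre_ideal_left[OF serre_ideal_gen[OF z, of "g # p" q], of "Egen k"]
        by (simp add: fE_def)
    qed
  qed
qed

lemma serre_ideal_verma:
  assumes "x \<in> serre_ideal" shows "app (lend.lift (verma_gen C) y) x \<in> serre_ideal"
proof -
  have g: "app (verma_gen C g) x \<in> serre_ideal" if "x \<in> serre_ideal" for g x
    using that serre_ideal_VE serre_ideal_VK serre_ideal_left[of x] by (cases g) (simp_all add: app_verma_gen(2) fF_def)
  have "app (lend.lift (verma_gen C) (wd gs)) x \<in> serre_ideal" for gs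
  proof (induction gs)
    case Nil
    thus ?case using assms by (simp add: wd_simps app_simps)
  next
    case (Cons h gs)
    thus ?case using g by (simp add: wd_simps lend.lift_mult lend.lift_fgen app_simps)
  qed
  thus ?thesis
    by (induction y rule: falg_induct) (simp_all add: lend.lift_add lend.lift_fscale app_simps serre_ideal_subspace)
qed

text \<open>So the operators define a module of the algebra on the quotient by
  \<open>serre_ideal\<close>. The relators act by 0 except for the Serre elements: those in the
  \<open>F\<close> act by multiplication, and so do those in the \<open>E\<close> once they have
  been moved past the leading \<open>F\<close> letters.\<close>

lemma rel_ideal_verma:
  assumes "y \<in> rel_ideal C" shows "app (lend.lift (verma_gen C) y) x \<in> serre_ideal"
  using assms
proof (induction arbitrary: x)
  case (rel r)
  have nz: "i \<in> index C ==> not_root_of_unity (qi C i)" for i by (rule qi_nonroot)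
  note simps = lend.lift_simps lend.lift_generators
  have serre: "\<exists>c. lend.lift (verma_gen C) (serre C fE i j) = lscale c (lend.serre_rel (qi C i) (C.bond i j) (VE i) (VE j))"
     "\<exists>c. lend.lift (verma_gen C) (serre C fF i j) = lscale c (lend.serre_rel (qi C i) (C.bond i j) (VF i) (VF j))"
    if "i \<in> index C" "j \<in> index C" "i \<noteq> j" for i j
  proof -
    have m: "nat (- cartan C i j) \<le> 2" "cartan C i j \<le> 0"
      using C.bond_le[OF that] C.off[OF that] by (auto simp: C.bond_def)
    show "\<exists>c. lend.lift (verma_gen C) (serre C fE i j) = lscale c (lend.serre_rel (qi C i) (C.bond i j) (VE i) (VE j))"
      using lend.lift_serre_eq[where g = "verma_gen C", OF nz[OF that(1)] m, of fE, OF lend.lift_generators(1) lend.lift_generators(1)] unfolding C.bond_def by blast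
    show "\<exists>c. lend.lift (verma_gen C) (serre C fF i j) = lscale c (lend.serre_rel (qi C i) (C.bond i j) (VF i) (VF j))"
      using lend.lift_serre_eq[where g = "verma_gen C", OF nz[OF that(1)] m, of fF, OF lend.lift_generators(2) lend.lift_generators(2)] unfolding C.bond_def by blast
  qed
  have conj: "k * x * l = lscale c x" if "k * x = lscale c (x * k)" "k * l = 1" for k l x :: "'i lend" and c
    using that by (simp add: mult.assoc)
  have "\<forall>r\<in>uq_relators C. \<forall>x. app (lend.lift (verma_gen C) r) x \<in> serre_ideal"
    unfolding uq_relators_ball
  proof (intro conjI ballI allI impI, goal_cases)
    case (1 i x) thus ?case by (simp add: simps VKL app_simps serre_ideal_subspace)
  next
    case (2 i x) thus ?case by (simp add: simps VKL app_simps serre_ideal_subspace)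
  next
    case (3 i j x)
    have "VK i * VK j = VK j * VK i"
      by (rule lend_eq_wdI) (simp add: app_simps app_verma_gen app_linear mult.commute)
    thus ?case by (simp add: simps app_simps serre_ideal_subspace)
  next
    case (4 i j x) thus ?case using conj[OF VKE VKL(1)] by (simp add: simps app_simps serre_ideal_subspace)
  next
    case (5 i j x) thus ?case using conj[OF VKF VKL(1)] by (simp add: simps app_simps serre_ideal_subspace)
  next
    case (6 i j x) thus ?case using VEF[of i j] by (simp add: simps app_simps serre_ideal_subspace)
  next
    case (7 i j x)
    obtain c where c: "lend.lift (verma_gen C) (serre C fE i j) = lscale c (lend.serre_rel (qi C i) (C.bond i j) (VE i) (VE j))"
      using serre(1)[OF 7] by blast
    let ?S = "lend.serre_rel (qi C i) (C.bond i j) (VE i) (VE j)"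
    have z: "serre_E i j \<in> serre_set" using 7 unfolding serre_set_def by blast
    have "app ?S x \<in> serre_ideal"
    proof (induction x rule: falg_induct)
      case (wd gs)
      show ?case
      proof (induction gs)
        case Nil
        have "app (VE l) (wd []) = fE l * wd []" for l by (simp add: app_verma_gen fF_wd)
        from app_serre_E[OF this] show ?case using serre_ideal_right[OF z] by (simp add: serre_E_def)
      next
        case (Cons g gs)
        show ?case
        proof (cases "\<exists>l. g = Fgen l")
          case True
          then obtain l where g: "g = Fgen l" by blast
          have "app ?S (wd (g # gs)) = app (?S * VF l) (wd gs)" by (simp add: g app_simps app_verma_gen(2) fF_wd)
          also have "\<dots> = fF l * app ?S (wd gs)" unfolding serre_VE_commute[OF 7] by (simp add: app_simps app_verma_gen(2))
          finally show ?thesis using serre_ideal_left[OF Cons, of "Fgen l"] by (simp add: fF_def)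
        next
          case False
          hence "app (VE l) (wd (g # gs)) = fE l * wd (g # gs)" for l
            unfolding wd_simps(2) by (intro app_raise_other) blast
          from app_serre_E[OF this] show ?thesis using serre_ideal_right[OF z] by (simp add: serre_E_def)
        qed
      qed
    qed (simp_all add: app_linear serre_ideal_subspace)
    thus ?case by (simp add: c app_simps serre_ideal_subspace)
  next
    case (8 i j x)
    obtain c where c: "lend.lift (verma_gen C) (serre C fF i j) = lscale c (lend.serre_rel (qi C i) (C.bond i j) (VF i) (VF j))"
      using serre(2)[OF 8] by blast
    have "serre_F i j \<in> serre_set" using 8 unfolding serre_set_def by blast
    thus ?case using serre_ideal_right unfolding c app_simps app_serre_F serre_F_def by (simp add: serre_ideal_subspace)
  qed
  with rel show ?case by blast
qed (simp_all add: lend.lift_add lend.lift_mult app_simps serre_ideal_subspace serre_ideal_verma)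

end

section \<open>Reading off coefficients in the induced module\<close>

definition word_span :: "'i qgen set \<Rightarrow> 'i falg set" where
  "word_span G = falg.lspan {wd gs | gs. set gs \<subseteq> G}"

lemma word_span_wd: "set gs \<subseteq> G ==> wd gs \<in> word_span G"
  unfolding word_span_def by (rule falg.lspan_gen) blast

lemma falg_lspan_mult:
  assumes "x \<in> falg.lspan A" "y \<in> falg.lspan B" "\<And>a b. a \<in> A ==> b \<in> B ==> a * b \<in> falg.lspan D"
  shows "x * y \<in> falg.lspan D"
proof (rule falg.lspan_image[of "\<lambda>x. x * y", OF _ _ _ assms(1)])
  fix a assume "a \<in> A"
  thus "a * y \<in> falg.lspan D"
    by (intro falg.lspan_image[of "\<lambda>y. a * y", OF _ _ _ assms(2)] assms(3)) (simp_all add: distrib_left)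
qed (simp_all add: distrib_right)

lemma word_span_mult: "x \<in> word_span G ==> y \<in> word_span G ==> x * y \<in> word_span G"
  unfolding word_span_def
proof (rule falg_lspan_mult)
  fix a b assume "a \<in> {wd gs | gs. set gs \<subseteq> G}" "b \<in> {wd gs | gs. set gs \<subseteq> G}"
  then obtain us ws where "a * b = wd (us @ ws)" "set (us @ ws) \<subseteq> G" by (auto simp: wd_simps)
  thus "a * b \<in> falg.lspan {wd gs | gs. set gs \<subseteq> G}" by (intro falg.lspan_gen) blast
qed

lemma alg_ugen_lift:
  assumes "x \<in> uqt.alg (ugen C ` G)"
  obtains x' where "x' \<in> word_span G" "embed C x' = x"
proof -
  have "\<exists>x'\<in>word_span G. embed C x' = x" using assms
  proof induction
    case (gen x)
    then obtain g where g: "g \<in> G" "x = ugen C g" by blast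
    have "embed C (wd [g]) = x" by (simp add: g embed_def wd_simps uqt.lift_fgen)
    thus ?case using word_span_wd[of "[g]" G] g by auto
  next
    case one
    have "embed C (wd []) = 1" by (simp add: embed_def wd_simps)
    thus ?case using word_span_wd[of "[]" G] by auto
  next
    case (scale x c)
    then obtain x' where "x' \<in> word_span G" "embed C x' = x" by blast
    hence "fscale c x' \<in> word_span G" "embed C (fscale c x') = uscale c x"
      by (simp_all add: word_span_def falg.lspan_scale embed_def uqt.lift_fscale)
    thus ?case by blast
  next
    case (add x y)
    then obtain x' y' where "x' \<in> word_span G" "embed C x' = x" "y' \<in> word_span G" "embed C y' = y" by blast
    hence "x' + y' \<in> word_span G" "embed C (x' + y') = x + y"
      by (simp_all add: word_span_def falg.lspan_add embed_def uqt.lift_add)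
    thus ?case by blast
  next
    case (mult x y)
    then obtain x' y' where "x' \<in> word_span G" "embed C x' = x" "y' \<in> word_span G" "embed C y' = y" by blast
    hence "x' * y' \<in> word_span G" "embed C (x' * y') = x * y"
      by (simp_all add: word_span_mult embed_def uqt.lift_mult)
    thus ?case by blast
  qed
  thus thesis using that by blast
qed

text \<open>The coefficient of \<open>F\<^sub>r\<^sup>n\<close> among words \<open>F\<^sub>r\<^sup>n w\<close> with \<open>w\<close> a word in the \<open>E\<close> letters.\<close>

definition E_part :: "'i \<Rightarrow> nat \<Rightarrow> 'i lend" where
  "E_part r n = linext (\<lambda>gs. if n \<le> length gs \<and> take n gs = replicate n (Fgen r) \<and> set (drop n gs) \<subseteq> range Egen
     then wd (drop n gs) else 0)"

definition F_part :: "'i lend" where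
  "F_part = linext (\<lambda>gs. if set gs \<subseteq> range Fgen then wd gs else 0)"

text \<open>Whether \<open>p @ w @ q\<close> survives, and how much of \<open>p\<close> is cut off,
  does not depend on the nonempty \<open>E\<close> word \<open>w\<close>. So a multiple of a Serre
  element of the \<open>E\<close> goes to 0 or to another multiple of it.\<close>

lemma E_part_inner:
  "(\<forall>w. w \<noteq> [] \<and> set w \<subseteq> range Egen \<longrightarrow> app (E_part r n) (wd (p @ w @ q)) = 0) \<or>
   (\<exists>p'. \<forall>w. w \<noteq> [] \<and> set w \<subseteq> range Egen \<longrightarrow> app (E_part r n) (wd (p @ w @ q)) = wd (p' @ w @ q))"
proof (cases "n \<le> length p \<and> take n p = replicate n (Fgen r) \<and> set (drop n p) \<subseteq> range Egen \<and> set q \<subseteq> range Egen")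
  case True
  hence "app (E_part r n) (wd (p @ w @ q)) = wd (drop n p @ w @ q)" if "w \<noteq> []" "set w \<subseteq> range Egen" for w
    using that unfolding E_part_def app_linext by auto
  thus ?thesis by blast
next
  case False
  have "app (E_part r n) (wd (p @ w @ q)) = 0" if w: "w \<noteq> []" "set w \<subseteq> range Egen" for w
  proof (rule ccontr)
    assume "app (E_part r n) (wd (p @ w @ q)) \<noteq> 0"
    hence *: "n \<le> length (p @ w @ q)" "take n (p @ w @ q) = replicate n (Fgen r)" "set (drop n (p @ w @ q)) \<subseteq> range Egen"
      unfolding E_part_def app_linext by (auto split: if_splits)
    show False
    proof (cases "n \<le> length p")
      case True
      thus False using * False by auto
    next
      case np: False
      hence "take n (p @ w @ q) ! length p = w ! 0" using w(1) by (simp add: nth_append)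
      moreover have "replicate n (Fgen r) ! length p = Fgen r" using np by simp
      ultimately have "w ! 0 = Fgen r" using *(2) by simp
      moreover have "w ! 0 \<in> range Egen" using w by (meson length_greater_0_conv nth_mem subsetD)
      ultimately show False by auto
    qed
  qed
  thus ?thesis by blast
qed

text \<open>Every word of a Serre element of the \<open>F\<close> contains two different
  \<open>F\<close> letters, whereas \<open>Fgen r\<close> is the only \<open>F\<close> letter in a
  surviving word.\<close>

lemma E_part_F:
  assumes "Fgen i \<in> set w" "Fgen j \<in> set w" "i \<noteq> j"
  shows "app (E_part r n) (wd (p @ w @ q)) = 0"
proof (rule ccontr)
  assume "app (E_part r n) (wd (p @ w @ q)) \<noteq> 0"
  hence *: "take n (p @ w @ q) = replicate n (Fgen r)" "set (drop n (p @ w @ q)) \<subseteq> range Egen"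
    unfolding E_part_def app_linext by (auto split: if_splits)
  have "k = r" if "Fgen k \<in> set w" for k
  proof -
    have "Fgen k \<in> set (take n (p @ w @ q) @ drop n (p @ w @ q))" using that by (simp only: append_take_drop_id) simp
    hence "Fgen k \<in> set (take n (p @ w @ q)) \<or> Fgen k \<in> set (drop n (p @ w @ q))" by (simp only: set_append Un_iff)
    thus ?thesis using *(2) unfolding *(1) by (auto simp del: drop_append split: if_splits)
  qed
  thus False using assms by metis
qed

lemma E_part_power:
  assumes "y \<in> word_span (range Egen)"
  shows "app (E_part r n) (fF r ^ m * y) = (if m = n then y else 0)"
proof -
  have F: "fF r ^ m * wd gs = wd (replicate m (Fgen r) @ gs)" for gs
  proof -
    have "fF r ^ m = wd (replicate m (Fgen r))" by (induction m) (simp_all add: wd_simps fF_def)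
    thus ?thesis by (simp add: wd_simps)
  qed
  have w: "app (E_part r n) (fF r ^ m * wd gs) = (if m = n then wd gs else 0)" if gs: "set gs \<subseteq> range Egen" for gs
  proof (cases "m = n")
    case True
    thus ?thesis using gs unfolding F E_part_def app_linext by simp
  next
    case False
    show ?thesis
    proof (rule ccontr)
      assume "\<not> ?thesis"
      hence "app (E_part r n) (fF r ^ m * wd gs) \<noteq> 0" using False by simp
      hence *: "n \<le> m + length gs" "take n (replicate m (Fgen r) @ gs) = replicate n (Fgen r)"
        "set (drop n (replicate m (Fgen r) @ gs)) \<subseteq> range Egen"
        unfolding F E_part_def app_linext by (auto split: if_splits)
      show False
      proof (cases "n < m")
        case True
        hence "Fgen r \<in> set (drop n (replicate m (Fgen r) @ gs))" by simp
        thus False using *(3) by auto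
      next
        case nm: False
        hence "m < n" using False by simp
        hence "take n (replicate m (Fgen r) @ gs) ! m = gs ! 0" "gs \<noteq> []" using *(1) by (auto simp: nth_append)
        moreover have "replicate n (Fgen r) ! m = Fgen r" using \<open>m < n\<close> by simp
        ultimately have "gs ! 0 = Fgen r" using *(2) by simp
        moreover have "gs ! 0 \<in> range Egen" using gs \<open>gs \<noteq> []\<close> by (meson length_greater_0_conv nth_mem subsetD)
        ultimately show False by auto
      qed
    qed
  qed
  show ?thesis using assms unfolding word_span_def
  proof induction
    case (add x y c)
    then obtain gs where "x = wd gs" "set gs \<subseteq> range Egen" by blast
    hence "app (E_part r n) (fF r ^ m * x) = (if m = n then x else 0)" using w by simp
    thus ?case using add.IH by (simp add: distrib_left app_linear)
  qed simp
qed

text \<open>A stable subspace containing every \<open>E k\<close> applied to 1. It has no nonzero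
  combination of words in the \<open>F\<close> letters, which separates the left ideal of the
  \<open>E\<close> from the negative part.\<close>

definition ends_E :: "'i falg set" where
  "ends_E = falg.lspan {wd (u @ [Egen k]) | u k. True}"

lemma ends_E_wd: "wd (u @ [Egen k]) \<in> ends_E"
  unfolding ends_E_def by (rule falg.lspan_gen) blast

lemma ends_E_image: "(\<And>u k. app f (wd (u @ [Egen k])) \<in> ends_E) ==> x \<in> ends_E ==> app f x \<in> ends_E"
  unfolding ends_E_def by (rule falg.lspan_image[OF app_linear]) auto

lemma ends_E_subspace: "0 \<in> ends_E" "x \<in> ends_E ==> y \<in> ends_E ==> x + y \<in> ends_E" "x \<in> ends_E ==> fscale c x \<in> ends_E"
  unfolding ends_E_def by (rule falg.lspan.zero falg.lspan_add falg.lspan_scale; assumption)+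

context uq_datum
begin

lemma uqt_qrel: "qrel (index C) (cartan C) (symm C) uscale qvar (\<lambda>i. ugen C (Egen i)) (\<lambda>i. ugen C (Fgen i))
    (\<lambda>i. ugen C (Kgen i)) (\<lambda>i. ugen C (Kinv i))"
  using uqt.qrel_iff[OF C, of "ugen C"] embed_relators[OF C] unfolding embed_def by blast

lemma serre_E_words: "serre_E i j \<in> falg.lspan {wd w | w. w \<noteq> [] \<and> set w \<subseteq> range Egen}"
proof -
  have w: "wd w \<in> falg.lspan {wd w | w. w \<noteq> [] \<and> set w \<subseteq> range Egen}" if "w \<noteq> []" "set w \<subseteq> range Egen" for w :: "'i qgen list"
    by (rule falg.lspan_gen) (use that in blast)
  have e: "fE i = wd [Egen i]" for i :: 'i by (simp add: wd_simps fE_def)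
  show ?thesis unfolding serre_E_def falg.serre_rel_def e
    by (auto simp: wd_simps(3)[symmetric] intro!: falg.lspan_add falg.lspan_diff falg.lspan_scale w)
qed

lemma serre_F_words:
  "serre_F i j \<in> falg.lspan {wd w | w. Fgen i \<in> set w \<and> Fgen j \<in> set w \<and> set w \<subseteq> range Fgen}"
proof -
  have w: "wd w \<in> falg.lspan {wd w | w. Fgen i \<in> set w \<and> Fgen j \<in> set w \<and> set w \<subseteq> range Fgen}"
     if "Fgen i \<in> set w" "Fgen j \<in> set w" "set w \<subseteq> range Fgen" for w :: "'i qgen list"
    by (rule falg.lspan_gen) (use that in blast)
  have e: "fF i = wd [Fgen i]" for i :: 'i by (simp add: wd_simps fF_def)
  show ?thesis unfolding serre_F_def falg.serre_rel_def e
    by (auto simp: wd_simps(3)[symmetric] intro!: falg.lspan_add falg.lspan_diff falg.lspan_scale w)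
qed

lemma inner_linear:
  assumes "z \<in> falg.lspan {wd w | w. Q w}"
  shows "(\<And>w. Q w ==> app f (wd (p @ w @ q)) = 0) ==> app f (wd p * z * wd q) = 0"
    "(\<And>w. Q w ==> app f (wd (p @ w @ q)) = wd (p' @ w @ q)) ==> app f (wd p * z * wd q) = wd p' * z * wd q"
proof -
  show "app f (wd p * z * wd q) = 0" if Q: "\<And>w. Q w ==> app f (wd (p @ w @ q)) = 0"
    using assms
  proof induction
    case (add x y c)
    then obtain w where "x = wd w" "Q w" by blast
    hence "app f (wd p * x * wd q) = 0" using Q[of w] by (simp add: wd_simps mult.assoc)
    thus ?case using add.IH by (simp add: distrib_left distrib_right app_linear)
  qed simp
  show "app f (wd p * z * wd q) = wd p' * z * wd q" if Q: "\<And>w. Q w ==> app f (wd (p @ w @ q)) = wd (p' @ w @ q)"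
    using assms
  proof induction
    case (add x y c)
    then obtain w where "x = wd w" "Q w" by blast
    hence "app f (wd p * x * wd q) = wd p' * x * wd q" using Q[of w] by (simp add: wd_simps mult.assoc)
    thus ?case using add.IH by (simp add: distrib_left distrib_right app_linear)
  qed simp
qed

lemma embed_serre: "z \<in> serre_set ==> embed C z = 0"
proof -
  interpret q: qrel "index C" "cartan C" "symm C" uscale qvar "\<lambda>i. ugen C (Egen i)" "\<lambda>i. ugen C (Fgen i)"
    "\<lambda>i. ugen C (Kgen i)" "\<lambda>i. ugen C (Kinv i)" by (rule uqt_qrel)
  have "uqt.lift g (falg.serre_rel v m x y) = uqt.serre_rel v m (uqt.lift g x) (uqt.lift g y)" for g :: "'i qgen \<Rightarrow> 'i uqt" and v m and x y :: "'i falg"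
    by (simp add: falg.serre_rel_def uqt.serre_rel_def uqt.lift_simps uqt.lift_fscale)
  thus "z \<in> serre_set ==> embed C z = 0"
    using q.serre_E q.serre_F
    by (auto simp: serre_set_def serre_E_def serre_F_def embed_def uqt.lift_generators qi_def)
qed

text \<open>The criterion by which a linear map on words passes to the quotient by the Serre
  ideal.\<close>

lemma embed_inner:
  assumes "\<And>p z q. z \<in> serre_set ==> app f (wd p * z * wd q) = 0 \<or> (\<exists>p'. app f (wd p * z * wd q) = wd p' * z * wd q)"
    and "x \<in> serre_ideal"
  shows "embed C (app f x) = 0"
  using assms(2) unfolding serre_ideal_def
proof induction
  case zero
  show ?case by (simp add: embed_def)
next
  case (add x y c)
  then obtain p z q where x: "x = wd p * z * wd q" "z \<in> serre_set" by blast
  have "embed C (app f x) = 0"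
    using assms(1)[OF x(2), of p q] embed_serre[OF x(2)] by (auto simp: x(1) embed_def uqt.lift_mult)
  thus ?case using add.IH by (simp add: app_linear embed_def uqt.lift_add uqt.lift_fscale)
qed

lemma embed_E_part:
  assumes "x \<in> serre_ideal" shows "embed C (app (E_part r n) x) = 0"
proof (rule embed_inner[OF _ assms])
  fix p z q assume "z \<in> serre_set"
  then consider i j where "z = serre_E i j" | i j where "z = serre_F i j" "i \<noteq> j"
    unfolding serre_set_def by blast
  thus "app (E_part r n) (wd p * z * wd q) = 0 \<or> (\<exists>p'. app (E_part r n) (wd p * z * wd q) = wd p' * z * wd q)"
  proof cases
    case (1 i j)
    note z = serre_E_words[of i j, folded 1]
    from E_part_inner[of r n p q] show ?thesis
    proof (elim disjE exE)
      assume "\<forall>w. w \<noteq> [] \<and> set w \<subseteq> range Egen \<longrightarrow> app (E_part r n) (wd (p @ w @ q)) = 0"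
      thus ?thesis by (intro disjI1 inner_linear(1)[OF z]) simp
    next
      fix p' assume "\<forall>w. w \<noteq> [] \<and> set w \<subseteq> range Egen \<longrightarrow> app (E_part r n) (wd (p @ w @ q)) = wd (p' @ w @ q)"
      thus ?thesis by (intro disjI2 exI[of _ p'] inner_linear(2)[OF z]) simp
    qed
  next
    case (2 i j)
    note z = serre_F_words[of i j, folded 2(1)]
    show ?thesis by (intro disjI1 inner_linear(1)[OF z] E_part_F[OF _ _ 2(2)]) simp_all
  qed
qed

lemma embed_F_part:
  assumes "x \<in> serre_ideal" shows "embed C (app F_part x) = 0"
proof (rule embed_inner[OF _ assms])
  fix p z q assume "z \<in> serre_set"
  then consider i j where "z = serre_E i j" | i j where "z = serre_F i j" "i \<noteq> j"
    unfolding serre_set_def by blast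
  thus "app F_part (wd p * z * wd q) = 0 \<or> (\<exists>p'. app F_part (wd p * z * wd q) = wd p' * z * wd q)"
  proof cases
    case (1 i j)
    note z = serre_E_words[of i j, folded 1]
    have "app F_part (wd (p @ w @ q)) = 0" if "w \<noteq> []" "set w \<subseteq> range Egen" for w
    proof -
      have "hd w \<in> range Egen" "hd w \<in> set (p @ w @ q)" using that by auto
      hence "\<not> set (p @ w @ q) \<subseteq> range Fgen" by auto
      thus ?thesis unfolding F_part_def app_linext by (rule if_not_P)
    qed
    thus ?thesis by (intro disjI1 inner_linear(1)[OF z]) simp
  next
    case (2 i j)
    note z = serre_F_words[of i j, folded 2(1)]
    show ?thesis
    proof (cases "set p \<subseteq> range Fgen \<and> set q \<subseteq> range Fgen")
      case True
      have "app F_part (wd (p @ w @ q)) = wd (p @ w @ q)" if "set w \<subseteq> range Fgen" for w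
      proof -
        have "set (p @ w @ q) \<subseteq> range Fgen" using True that by simp
        thus ?thesis unfolding F_part_def app_linext by (rule if_P)
      qed
      thus ?thesis by (intro disjI2 exI[of _ p] inner_linear(2)[OF z]) simp
    next
      case False
      have "app F_part (wd (p @ w @ q)) = 0" for w
      proof -
        have "\<not> set (p @ w @ q) \<subseteq> range Fgen" using False by auto
        thus ?thesis unfolding F_part_def app_linext by (rule if_not_P)
      qed
      thus ?thesis by (intro disjI1 inner_linear(1)[OF z]) simp
    qed
  qed
qed

lemma embed_eq_0: "embed C x = 0 \<longleftrightarrow> x \<in> rel_ideal C"
  using embed_eq_iff[OF C, of x 0] by (simp add: embed_def)

abbreviation "rho \<equiv> lend.lift (verma_gen C)"

lemma rho_E_word: "y \<in> word_span (range Egen) ==> app (rho y) 1 = y"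
  unfolding word_span_def
proof (induction rule: falg.lspan.induct)
  case zero show ?case by (simp add: app_simps)
next
  case (add x y c)
  then obtain gs where gs: "x = wd gs" "set gs \<subseteq> range Egen" by blast
  have "app (rho (wd gs)) 1 = wd gs" using gs(2)
  proof (induction gs)
    case Nil show ?case by (simp add: wd_simps app_simps)
  next
    case (Cons g gs)
    obtain j where g: "g = Egen j" using Cons.prems by auto
    have "raise C j gs = wd (Egen j # gs)" using Cons.prems by (cases gs) auto
    thus ?case using Cons g
      by (simp add: wd_simps(2) lend.lift_mult lend.lift_fgen app_simps app_verma_gen)
  qed
  thus ?case using add.IH gs(1) by (simp add: lend.lift_add lend.lift_fscale app_simps)
qed

lemma rho_F_word: "y \<in> word_span (range Fgen) ==> app (rho y) z = y * z"
  unfolding word_span_def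
proof (induction rule: falg.lspan.induct)
  case zero show ?case by (simp add: app_simps)
next
  case (add x y c)
  then obtain gs where gs: "x = wd gs" "set gs \<subseteq> range Fgen" by blast
  have "app (rho (wd gs)) z = wd gs * z" using gs(2)
  proof (induction gs)
    case Nil show ?case by (simp add: wd_simps app_simps)
  next
    case (Cons g gs)
    obtain j where g: "g = Fgen j" using Cons.prems by auto
    thus ?case using Cons
      by (simp add: wd_simps(2) lend.lift_mult lend.lift_fgen app_simps app_verma_gen fF_def mult.assoc)
  qed
  thus ?case using add.IH gs(1) by (simp add: lend.lift_add lend.lift_fscale app_simps distrib_right)
qed

lemma word_span_mono: "G \<subseteq> G' ==> word_span G \<subseteq> word_span G'"
  unfolding word_span_def by (intro subsetI, erule falg.lspan_subset[rotated]) (auto intro: falg.lspan_gen)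

text \<open>On the empty word the torus factors act trivially and the \<open>y n\<close> act by
  concatenation, so the value is the sum of the \<open>F r ^ n\<close> times lifts of the
  \<open>y n\<close>. \<open>E_part\<close> picks out one summand modulo the Serre
  relations.\<close>

theorem F_powers_independent:
  assumes r: "r \<in> index C" and y: "\<And>n. y n \<in> uqt.alg (ugen C ` Egen ` index C)"
    and s: "(\<Sum>n\<le>N. ugen C (Fgen r) ^ n * y n * ugen C (Kgen r) ^ n) = 0" and n: "n \<le> N"
  shows "y n = 0"
proof -
  have "\<exists>x. x \<in> word_span (range Egen) \<and> embed C x = y n" for n
  proof -
    obtain x where "x \<in> word_span (Egen ` index C)" "embed C x = y n" using y by (rule alg_ugen_lift)
    moreover have "word_span (Egen ` index C) \<subseteq> word_span (range Egen)" by (rule word_span_mono) auto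
    ultimately show ?thesis by blast
  qed
  hence "\<forall>n. \<exists>x. x \<in> word_span (range Egen) \<and> embed C x = y n" by (rule allI)
  from choice[OF this] obtain x where x: "\<And>n. x n \<in> word_span (range Egen)" "\<And>n. embed C (x n) = y n" by blast
  define X where "X = (\<Sum>n\<le>N. fF r ^ n * x n * fK r ^ n)"
  have "embed C X = (\<Sum>n\<le>N. ugen C (Fgen r) ^ n * embed C (x n) * ugen C (Kgen r) ^ n)"
    by (simp add: X_def embed_def uqt.lift_simps uqt.lift_generators)
  hence "X \<in> rel_ideal C" using s x(2) embed_eq_0 by simp
  hence J: "app (rho X) 1 \<in> serre_ideal" by (rule rel_ideal_verma)
  have K: "app (rho (fK r ^ n)) 1 = 1" for n
  proof (induction n)
    case (Suc n)
    have "app (VK r) 1 = 1" using app_verma_gen(3)[of C r "[]"] by (simp add: wd_simps word_weight_simps)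
    thus ?case using Suc by (simp add: lend.lift_mult lend.lift_generators app_simps)
  qed (simp add: app_simps)
  have F: "app (rho (fF r ^ n)) z = fF r ^ n * z" for n z
    by (induction n) (simp_all add: lend.lift_mult lend.lift_generators app_simps app_verma_gen mult.assoc)
  have sum: "app (sum f A) z = (\<Sum>a\<in>A. app (f a) z)" for f :: "nat \<Rightarrow> 'i lend" and A z
    by (induction A rule: infinite_finite_induct) (simp_all add: app_simps)
  have "app (rho X) 1 = (\<Sum>n\<le>N. fF r ^ n * x n)"
    unfolding X_def lend.lift_sum lend.lift_mult sum app_simps K F rho_E_word[OF x(1)] ..
  hence "app (E_part r n) (app (rho X) 1) = (\<Sum>m\<le>N. if m = n then x m else 0)"
    by (simp add: app_sum E_part_power[OF x(1)])
  also have "\<dots> = x n" using n by simp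
  finally show ?thesis using embed_E_part[OF J, of r n] x(2) by simp
qed

lemma raise_ends_E: "raise C j (u @ [Egen k]) \<in> ends_E"
proof (induction u)
  case Nil show ?case using ends_E_wd[of "[Egen j]" k] by simp
next
  case (Cons g u)
  show ?case
  proof (cases "\<exists>l. g = Fgen l")
    case True
    then obtain l where g: "g = Fgen l" by blast
    have "app (lmult (fF l)) (raise C j (u @ [Egen k])) \<in> ends_E"
    proof (rule ends_E_image[OF _ Cons])
      show "app (lmult (fF l)) (wd (u @ [Egen k])) \<in> ends_E" for u k
        using ends_E_wd[of "Fgen l # u" k] by (simp add: app_lmult wd_simps fF_def)
    qed
    thus ?thesis using ends_E_wd[of u k] by (simp add: g app_lmult ends_E_subspace)
  next
    case False
    hence "raise C j (g # u @ [Egen k]) = wd ((Egen j # g # u) @ [Egen k])" by (cases g) auto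
    thus ?thesis using ends_E_wd[of "Egen j # g # u" k] by (simp only: append_Cons)
  qed
qed

lemma rho_ends_E:
  assumes "x \<in> ends_E" shows "app (rho y) x \<in> ends_E"
proof -
  have g: "app (verma_gen C g) x \<in> ends_E" if "x \<in> ends_E" for g x
  proof (rule ends_E_image[OF _ that])
    fix u k
    show "app (verma_gen C g) (wd (u @ [Egen k])) \<in> ends_E"
    proof (cases g)
      case (Egen j) thus ?thesis unfolding Egen app_verma_gen by (intro raise_ends_E)
    next
      case (Fgen j) thus ?thesis using ends_E_wd[of "Fgen j # u" k] unfolding Fgen app_verma_gen fF_wd by simp
    next
      case (Kgen j) thus ?thesis unfolding Kgen app_verma_gen by (intro ends_E_subspace ends_E_wd)
    next
      case (Kinv j) thus ?thesis unfolding Kinv app_verma_gen by (intro ends_E_subspace ends_E_wd)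
    qed
  qed
  have "app (rho (wd gs)) x \<in> ends_E" for gs
  proof (induction gs)
    case Nil
    thus ?case using assms by (simp add: wd_simps app_simps)
  next
    case (Cons h gs)
    thus ?case using g by (simp add: wd_simps lend.lift_mult lend.lift_fgen app_simps)
  qed
  thus ?thesis
    by (induction y rule: falg_induct) (simp_all add: lend.lift_add lend.lift_fscale app_simps ends_E_subspace)
qed

text \<open>On the empty word \<open>y\<close> produces its own lift as a polynomial in the
  \<open>F\<close> and, as an element of the left ideal, an element of \<open>ends_E\<close>.
  \<open>F_part\<close> keeps the former and kills the latter.\<close>

lemma negative_left_E:
  assumes y: "y \<in> uqt.alg (ugen C ` Fgen ` index C)"
    and z: "y \<in> uqt.lspan {x * ugen C (Egen k) | x k. x \<in> uqt.alg (ugen C ` G)}"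
  shows "y = 0"
proof -
  obtain y' where y': "y' \<in> word_span (Fgen ` index C)" "embed C y' = y" using y by (rule alg_ugen_lift)
  have y'F: "y' \<in> word_span (range Fgen)" using y'(1) word_span_mono[of "Fgen ` index C" "range Fgen"] by auto
  have "\<exists>z'. embed C z' = y \<and> app (rho z') 1 \<in> ends_E" using z
  proof induction
    case zero
    have "embed C 0 = 0" "app (rho 0) 1 \<in> ends_E" by (simp_all add: embed_def app_simps ends_E_subspace)
    thus ?case by blast
  next
    case (add x y c)
    then obtain x0 k where x: "x = x0 * ugen C (Egen k)" "x0 \<in> uqt.alg (ugen C ` G)" by blast
    obtain x' where x': "embed C x' = x0" using x(2) by (rule alg_ugen_lift)
    obtain z' where z': "embed C z' = y" "app (rho z') 1 \<in> ends_E" using add.IH by blast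
    have "embed C (fscale c (x' * fE k) + z') = uscale c x + y"
      using x' z'(1) by (simp add: x(1) embed_def uqt.lift_simps uqt.lift_fscale uqt.lift_generators)
    moreover have "app (rho x') (wd [Egen k]) \<in> ends_E" using ends_E_wd[of "[]" k] by (intro rho_ends_E) simp
    hence "app (rho (fscale c (x' * fE k) + z')) 1 \<in> ends_E"
      using z'(2) app_verma_gen(1)[of C k "[]"]
      by (simp add: lend.lift_simps lend.lift_fscale lend.lift_generators app_simps wd_simps(1) ends_E_subspace)
    ultimately show ?case by blast
  qed
  then obtain z' where z': "embed C z' = y" "app (rho z') 1 \<in> ends_E" by blast
  have "embed C (z' - y') = 0" using z'(1) y'(2) by (simp add: embed_def uqt.lift_diff)
  hence "app (rho (z' - y')) 1 \<in> serre_ideal" using embed_eq_0 rel_ideal_verma by blast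
  hence "embed C (app F_part (app (rho z') 1 - y')) = 0"
    using embed_F_part rho_F_word[OF y'F, of 1] by (simp add: lend.lift_diff app_simps)
  moreover have "app F_part (app (rho z') 1) = 0"
    using z'(2) unfolding ends_E_def
  proof induction
    case (add x y c)
    then obtain u k where "x = wd (u @ [Egen k])" by blast
    hence "app F_part x = 0" by (auto simp: F_part_def app_linext)
    thus ?case using add.IH by (simp add: app_linear)
  qed simp
  moreover have "app F_part y' = y'" using y'F unfolding word_span_def
  proof induction
    case (add x y c)
    then obtain gs where "x = wd gs" "set gs \<subseteq> range Fgen" by blast
    hence "app F_part x = x" by (auto simp: F_part_def app_linext)
    thus ?case using add.IH by (simp add: app_linear)
  qed simp
  ultimately have "embed C (- y') = 0" by (simp add: app_diff)
  thus ?thesis using y'(2) by (simp add: embed_def uqt.lift_uminus)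
qed

end

section \<open>The braid action on the quantized enveloping algebra\<close>

context uq_datum
begin

abbreviation "I \<equiv> index C"
abbreviation "uE i \<equiv> ugen C (Egen i)"
abbreviation "uF i \<equiv> ugen C (Fgen i)"
abbreviation "uK i \<equiv> ugen C (Kgen i)"
abbreviation "uL i \<equiv> ugen C (Kinv i)"

sublocale u: qrel I "cartan C" "symm C" uscale qvar uE uF uK uL
  by (rule uqt_qrel)

lemma embed_simps: "embed C (x + y) = embed C x + embed C y" "embed C (x - y) = embed C x - embed C y"
  "embed C (- x) = - embed C x" "embed C (x * y) = embed C x * embed C y" "embed C (x ^ n) = embed C x ^ n"
  "embed C (fconst c) = uscale c 1" "embed C (sum f A) = (\<Sum>a\<in>A. embed C (f a))"
  "embed C 0 = 0" "embed C 1 = 1" "embed C (fscale c x) = uscale c (embed C x)"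
  "embed C (fE i) = uE i" "embed C (fF i) = uF i" "embed C (fK i) = uK i" "embed C (fKinv i) = uL i"
  by (simp_all add: embed_def uqt.lift_simps uqt.lift_generators uqt.lift_fscale)

lemma embed_divpow: "embed C (divpow C i y n) = uscale (inverse (qfact (qi C i) n)) (embed C y ^ n)"
  by (simp add: divpow_def embed_simps)

lemma embed_braid_gen:
  assumes i: "i \<in> I" and j: "j \<in> I"
  shows "embed C (braid_gen C i (Egen j)) = u.TE i j" "embed C (braid_gen C i (Fgen j)) = u.TF i j"
    "embed C (braid_gen C i (Kgen j)) = u.TK i j" "embed C (braid_gen C i (Kinv j)) = u.TL i j"
proof -
  have q: "qi C i = qvar ^ symm C i" by (simp add: qi_def)
  note f = uqt.qfact_eqs[OF qi_nonroot[OF i]]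
  have b: "C.bond i j = 0 \<or> C.bond i j = 1 \<or> C.bond i j = 2" "cartan C i j = - int (C.bond i j)" if "j \<noteq> i"
    using C.bond_le[of i j] C.a_eq[of i j] that i j by auto
  note simps = embed_simps embed_divpow f numeral_2_eq_2
  show "embed C (braid_gen C i (Egen j)) = u.TE i j"
  proof (cases "j = i")
    case False
    from b(1)[OF this] show ?thesis using b(2) False
      by (elim disjE) (simp_all add: braid_gen_def u.TE_def simps uqt.tw_def mult.assoc f[unfolded numeral_2_eq_2] q[symmetric] power2_eq_square uqt.sc_distribs)
  qed (simp add: braid_gen_def u.TE_def embed_simps)
  show "embed C (braid_gen C i (Fgen j)) = u.TF i j"
  proof (cases "j = i")
    case False
    from b(1)[OF this] show ?thesis using b(2) False
      by (elim disjE) (simp_all add: braid_gen_def u.TF_def simps uqt.twr_def mult.assoc f[unfolded numeral_2_eq_2] q[symmetric] power2_eq_square uqt.sc_distribs add.commute[of "inverse (qi C i)"])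
  qed (simp add: braid_gen_def u.TF_def embed_simps)
  have KL: "uK i * (uL i * x) = x" "uL i * (uK i * x) = x" for x
    using u.KL[OF i] u.LK[OF i] by (simp_all add: assoc_rule)
  show "embed C (braid_gen C i (Kgen j)) = u.TK i j"
    using b(2) i j by (cases "j = i") (simp_all add: braid_gen_def u.TK_def embed_simps fKpow_def numeral_2_eq_2 KL)
  show "embed C (braid_gen C i (Kinv j)) = u.TL i j"
    using b(2) i j by (cases "j = i") (simp_all add: braid_gen_def u.TL_def embed_simps fKpow_def numeral_2_eq_2 KL)
qed

definition uT :: "'i \<Rightarrow> 'i uqt \<Rightarrow> 'i uqt" where
  "uT i = uqt.extend C (\<lambda>g. embed C (braid_gen C i g))"

definition uT' :: "'i \<Rightarrow> 'i uqt \<Rightarrow> 'i uqt" where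
  "uT' i = uqt.extend C (\<lambda>g. case g of
     Egen j \<Rightarrow> if j = i then - (uF i * uK i) else uqt.twr (qi C i) (C.bond i j) (uE i) (uE j)
   | Fgen j \<Rightarrow> if j = i then - (uL i * uE i) else uqt.tw (inverse (qi C i)) (C.bond i j) (uF i) (uF j)
   | Kgen j \<Rightarrow> u.TK i j | Kinv j \<Rightarrow> u.TL i j)"

definition uomega :: "'i uqt \<Rightarrow> 'i uqt" where
  "uomega = uqt.extend C (\<lambda>g. case g of Egen j \<Rightarrow> uF j | Fgen j \<Rightarrow> uE j | Kgen j \<Rightarrow> uL j | Kinv j \<Rightarrow> uK j)"

lemma extend_alg_hom:
  assumes "\<forall>r\<in>uq_relators C. uqt.lift g r = 0"
  shows "uqt.alg_hom (uqt.extend C g)" "uqt.extend C g (ugen C x) = g x"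
proof -
  note e = uqt.extend_hom[OF assms]
  show "uqt.alg_hom (uqt.extend C g)" by (simp add: uqt.alg_hom_def e)
  show "uqt.extend C g (ugen C x) = g x"
    using e(5)[of "fgen x"] by (simp add: uqt.lift_fgen embed_def)
qed

lemma qrel_cong:
  assumes "qrel I (cartan C) (symm C) uscale qvar e f k l"
    "\<And>i. i \<in> I ==> e i = e' i" "\<And>i. i \<in> I ==> f i = f' i" "\<And>i. i \<in> I ==> k i = k' i" "\<And>i. i \<in> I ==> l i = l' i"
  shows "qrel I (cartan C) (symm C) uscale qvar e' f' k' l'"
  using assms unfolding qrel_def qrel_axioms_def by simp

lemma uT_gen:
  assumes i: "i \<in> I"
  shows "uqt.alg_hom (uT i)" "uT i (ugen C g) = embed C (braid_gen C i g)" "uT i (embed C x) = embed C (free_hom (braid_gen C i) x)"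
proof -
  have "qrel I (cartan C) (symm C) uscale qvar (\<lambda>j. embed C (braid_gen C i (Egen j))) (\<lambda>j. embed C (braid_gen C i (Fgen j)))
     (\<lambda>j. embed C (braid_gen C i (Kgen j))) (\<lambda>j. embed C (braid_gen C i (Kinv j)))"
    by (rule qrel_cong[OF u.T_qrel[OF i]]) (simp_all add: embed_braid_gen i)
  hence r: "\<forall>r\<in>uq_relators C. uqt.lift (\<lambda>g. embed C (braid_gen C i g)) r = 0"
    using uqt.qrel_iff[OF C] by blast
  show "uqt.alg_hom (uT i)" "uT i (ugen C g) = embed C (braid_gen C i g)"
    unfolding uT_def by (rule extend_alg_hom[OF r])+
  show "uT i (embed C x) = embed C (free_hom (braid_gen C i) x)"
    unfolding uT_def uqt.extend_hom(5)[OF r] by (simp add: embed_def uqt.lift_free_hom)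
qed

text \<open>The relations for the inverse automorphism are those for \<open>T\<close> with
  \<open>q\<close> inverted and \<open>E\<close>, \<open>F\<close> exchanged; inverting
  \<open>q\<close> again returns to the original parameter.\<close>

lemma uT'_gen:
  assumes i: "i \<in> I"
  shows "uqt.alg_hom (uT' i)" "uT' i (uE j) = (if j = i then - (uF i * uK i) else uqt.twr (qi C i) (C.bond i j) (uE i) (uE j))"
    "uT' i (uF j) = (if j = i then - (uL i * uE i) else uqt.tw (inverse (qi C i)) (C.bond i j) (uF i) (uF j))"
    "uT' i (uK j) = u.TK i j" "uT' i (uL j) = u.TL i j"
proof -
  interpret b: qrel I "cartan C" "symm C" uscale "inverse qvar" uF uE uK uL by (rule u.bar)
  interpret b': qrel I "cartan C" "symm C" uscale "inverse (inverse qvar)" "b.TF i" "b.TE i" "b.TK i" "b.TL i"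
    by (rule qrel.bar[OF b.T_qrel[OF i]])
  have "qrel I (cartan C) (symm C) uscale qvar (b.TF i) (b.TE i) (b.TK i) (b.TL i)"
    using b'.qrel_axioms by simp
  hence "qrel I (cartan C) (symm C) uscale qvar (\<lambda>j. if j = i then - (uF i * uK i) else uqt.twr (qi C i) (C.bond i j) (uE i) (uE j))
     (\<lambda>j. if j = i then - (uL i * uE i) else uqt.tw (inverse (qi C i)) (C.bond i j) (uF i) (uF j)) (u.TK i) (u.TL i)"
    by (rule qrel_cong) (simp_all add: b.TF_def b.TE_def b.TK_def b.TL_def u.TK_def u.TL_def qi_def power_inverse)
  hence r: "\<forall>r\<in>uq_relators C. uqt.lift (\<lambda>g. case g of
     Egen j \<Rightarrow> if j = i then - (uF i * uK i) else uqt.twr (qi C i) (C.bond i j) (uE i) (uE j)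
   | Fgen j \<Rightarrow> if j = i then - (uL i * uE i) else uqt.tw (inverse (qi C i)) (C.bond i j) (uF i) (uF j)
   | Kgen j \<Rightarrow> u.TK i j | Kinv j \<Rightarrow> u.TL i j) r = 0"
    by (subst uqt.qrel_iff[OF C]) simp
  show "uqt.alg_hom (uT' i)" "uT' i (uE j) = (if j = i then - (uF i * uK i) else uqt.twr (qi C i) (C.bond i j) (uE i) (uE j))"
    "uT' i (uF j) = (if j = i then - (uL i * uE i) else uqt.tw (inverse (qi C i)) (C.bond i j) (uF i) (uF j))"
    "uT' i (uK j) = u.TK i j" "uT' i (uL j) = u.TL i j"
    unfolding uT'_def by (rule extend_alg_hom[OF r], simp add: extend_alg_hom[OF r])+ (simp_all add: extend_alg_hom[OF r])
qed

lemma uomega_gen: "uqt.alg_hom uomega" "uomega (uE j) = uF j" "uomega (uF j) = uE j" "uomega (uK j) = uL j" "uomega (uL j) = uK j"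
proof -
  have r: "\<forall>r\<in>uq_relators C. uqt.lift (\<lambda>g. case g of Egen j \<Rightarrow> uF j | Fgen j \<Rightarrow> uE j | Kgen j \<Rightarrow> uL j | Kinv j \<Rightarrow> uK j) r = 0"
    by (subst uqt.qrel_iff[OF C]) (use u.omega in simp)
  show "uqt.alg_hom uomega" "uomega (uE j) = uF j" "uomega (uF j) = uE j" "uomega (uK j) = uL j" "uomega (uL j) = uK j"
    unfolding uomega_def by (simp_all add: extend_alg_hom[OF r])
qed

sublocale u: braided I "cartan C" "symm C" uscale qvar uE uF uK uL uT uT'
  by unfold_locales (simp_all add: uT_gen uT'_gen embed_braid_gen qi_def)

lemma gens_eq: "u.gens = ugen C ` (Egen ` I \<union> Fgen ` I \<union> Kgen ` I \<union> Kinv ` I)"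
  by (auto simp: u.gens_def)

end

locale uq_rooted = uq_datum C for C :: "'i cartan_datum" +
  assumes root_sign: "set ws \<subseteq> index C ==> i \<in> index C ==>
     (\<forall>k. 0 \<le> weyl_word C ws (simple_root i) k) \<or> (\<forall>k. weyl_word C ws (simple_root i) k \<le> 0)"
begin

sublocale w: weyl C I "cartan C" "symm C"
  by unfold_locales (auto intro: C)

sublocale w: rooted C I "cartan C" "symm C"
  by unfold_locales (use root_sign in \<open>simp add: w.pos_def w.neg_def\<close>)

sublocale u: braided_weyl C I "cartan C" "symm C" uscale qvar uE uF uK uL uT uT'
  by unfold_locales

text \<open>\<open>negative_left_E\<close> is the first axiom with \<open>E\<close> and
  \<open>F\<close> exchanged, so the involution \<open>uomega\<close> carries one into the other;
  the second axiom is \<open>F_powers_independent\<close>.\<close>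

sublocale u: triangular C I "cartan C" "symm C" uscale qvar uE uF uK uL uT uT'
proof
  fix x assume x: "x \<in> u.Up" and l: "x \<in> u.left_F"
  note h = uqt.alg_hom_simps[OF uomega_gen(1)]
  have "uomega ` uqt.alg u.gens \<subseteq> uqt.alg u.gens"
    unfolding uqt.alg_hom_alg[OF uomega_gen(1)] uqt.alg_subset_iff
    by (auto simp: u.gens_def uomega_gen intro!: uqt.alg.gen)
  hence g: "uomega y \<in> uqt.alg u.gens" if "y \<in> uqt.alg u.gens" for y using that by blast
  have "uomega x = 0"
  proof (rule negative_left_E)
    have "uomega x \<in> uqt.alg (uomega ` uE ` I)" using x unfolding u.Up_def uqt.alg_hom_alg[OF uomega_gen(1), symmetric] by blast
    thus "uomega x \<in> uqt.alg (ugen C ` Fgen ` I)" by (simp add: image_image uomega_gen)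
    show "uomega x \<in> uqt.lspan {y * ugen C (Egen k) | y k. y \<in> uqt.alg (ugen C ` (Egen ` I \<union> Fgen ` I \<union> Kgen ` I \<union> Kinv ` I))}"
      unfolding gens_eq[symmetric]
    proof (rule uqt.lspan_image[OF h(3,5) _ l[unfolded u.left_F_def]])
      fix z assume "z \<in> {x * uF k | x k. x \<in> uqt.alg u.gens \<and> k \<in> I}"
      then obtain y k where "z = y * uF k" "y \<in> uqt.alg u.gens" by blast
      hence "uomega z = uomega y * uE k" "uomega y \<in> uqt.alg u.gens" using g by (simp_all add: h uomega_gen)
      thus "uomega z \<in> uqt.lspan {y * uE k | y k. y \<in> uqt.alg u.gens}" by (intro uqt.lspan_gen) blast
    qed
  qed
  moreover have "uomega (uomega x) = x"
  proof (rule uqt.alg_hom_eq_on_alg[OF uqt.alg_hom_comp[OF uomega_gen(1) uomega_gen(1)] uqt.alg_hom_id])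
    show "x \<in> uqt.alg (uE ` I)" using x by (simp add: u.Up_def)
  qed (auto simp: uomega_gen)
  ultimately show "x = 0" using h(2) by simp
next
  fix r y N n assume "r \<in> I" "\<And>n. y n \<in> u.Up" "(\<Sum>n\<le>N. uF r ^ n * y n * uK r ^ n) = 0" "n \<le> N"
  thus "y n = 0" using F_powers_independent[of r y N n] by (simp add: u.Up_def image_image)
qed

end

section \<open>Transfer to the quotient ring\<close>

context uq_datum
begin

interpretation U: ring "uq C" by (rule ring_uq)

interpretation R: ring "free_alg C" by (rule ring_free_alg)

abbreviation "A \<equiv> carrier (free_alg C)"

lemma free_alg_ops: "x \<oplus>\<^bsub>free_alg C\<^esub> y = x + y" "x \<otimes>\<^bsub>free_alg C\<^esub> y = x * y" "\<one>\<^bsub>free_alg C\<^esub> = 1" "\<zero>\<^bsub>free_alg C\<^esub> = 0"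
  by (simp_all add: free_alg_def)

lemma A_closed: "x \<in> A ==> y \<in> A ==> x + y \<in> A" "x \<in> A ==> y \<in> A ==> x * y \<in> A" "1 \<in> A" "0 \<in> A"
  using R.a_closed[of x y] R.m_closed[of x y] R.one_closed R.zero_closed by (simp_all add: free_alg_ops)

lemma A_uminus: "x \<in> A ==> - x \<in> A"
  by (simp add: free_alg_def)

lemma free_alg_minus: "x \<in> A ==> y \<in> A ==> x \<ominus>\<^bsub>free_alg C\<^esub> y = x - y"
proof -
  assume xy: "x \<in> A" "y \<in> A"
  have "\<ominus>\<^bsub>free_alg C\<^esub> y = - y"
    using R.minus_equality[of "- y" y] xy A_uminus by (simp add: free_alg_ops)
  thus ?thesis by (simp add: a_minus_def free_alg_ops)
qed

lemma A_const: "fconst c \<in> A"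
  by (auto simp: fconst_def free_alg_def zero_word_def)

lemma A_scale: "x \<in> A ==> fscale c x \<in> A"
  unfolding fscale_def by (intro A_closed A_const)

lemma A_gen: "g \<in> qgens C ==> fgen g \<in> A"
  by (auto simp: fgen_def free_alg_def)

lemma A_diff: "x \<in> A ==> y \<in> A ==> x - y \<in> A"
  using A_closed(1)[OF _ A_uminus, of x y] by simp

lemma A_power: "x \<in> A ==> x ^ n \<in> A"
  by (induction n) (auto intro: A_closed)

lemma A_sum: "(\<And>a. a \<in> S ==> f a \<in> A) ==> sum f S \<in> A"
  by (induction S rule: infinite_finite_induct) (auto intro: A_closed)

lemma A_lift:
  assumes "\<And>g. g \<in> qgens C ==> f g \<in> A" "x \<in> A" shows "falg.lift f x \<in> A"
  unfolding falg.lift_def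
proof (intro A_sum A_scale)
  fix w assume "w \<in> keys x"
  hence "set (letters w) \<subseteq> qgens C" using assms(2) by (auto simp: free_alg_def)
  moreover have "prod_list (map f gs) \<in> A" if "set gs \<subseteq> qgens C" for gs
    using that by (induction gs) (auto intro: A_closed assms(1))
  ultimately show "falg.eval_word f w \<in> A" unfolding falg.eval_word_def by blast
qed

text \<open>For the inclusion from right to left, the retraction \<open>\<pi>\<close> kills the
  letters outside \<open>qgens C\<close> and fixes \<open>A\<close>; it maps
  \<open>rel_ideal C\<close> into \<open>uq_ideal C\<close> because the relators already lie in
  \<open>A\<close>.\<close>

lemma uq_ideal_eq: "uq_ideal C = rel_ideal C \<inter> A"
proof
  have "ideal (rel_ideal C \<inter> A) (free_alg C)"
  proof (rule idealI[OF ring_free_alg])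
    show "subgroup (rel_ideal C \<inter> A) (add_monoid (free_alg C))"
    proof (rule R.add.subgroupI)
      show "rel_ideal C \<inter> A \<noteq> {}" using rel_ideal.zero A_closed(4) by blast
      show "\<ominus>\<^bsub>free_alg C\<^esub> a \<in> rel_ideal C \<inter> A" if "a \<in> rel_ideal C \<inter> A" for a
      proof -
        have "\<ominus>\<^bsub>free_alg C\<^esub> a = - a" using free_alg_minus[of 0 a] that A_closed(4) R.minus_eq[of 0 a]
          by (simp add: a_minus_def free_alg_ops)
        thus ?thesis using that rel_ideal_uminus A_uminus by auto
      qed
    qed (auto simp: free_alg_ops intro: rel_ideal.add A_closed)
  qed (auto simp: free_alg_ops intro: rel_ideal.left rel_ideal.right A_closed)
  moreover have "uq_relators C \<subseteq> rel_ideal C \<inter> A" using uq_relators_subset rel_ideal.rel by blast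
  ultimately show "uq_ideal C \<subseteq> rel_ideal C \<inter> A" unfolding uq_ideal_def by (rule R.genideal_minimal)
next
  define \<pi> :: "'i falg \<Rightarrow> 'i falg" where "\<pi> = falg.lift (\<lambda>g. if g \<in> qgens C then fgen g else 0)"
  have \<pi>A: "\<pi> x = x" if "x \<in> A" for x
  proof -
    have m: "map (\<lambda>g. if g \<in> qgens C then fgen g else 0) (letters w) = map fgen (letters w)" if "w \<in> keys x" for w
      by (rule map_cong[OF refl]) (use that \<open>x \<in> A\<close> in \<open>auto simp: free_alg_def\<close>)
    have "\<pi> x = falg.lift fgen x" unfolding \<pi>_def falg.lift_def falg.eval_word_def
      by (rule sum.cong[OF refl]) (simp only: m)
    thus ?thesis by (simp add: falg_lift_fgen)
  qed
  have range: "\<pi> x \<in> A" for x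
  proof -
    have "falg.eval_word (\<lambda>g. if g \<in> qgens C then fgen g else 0) w \<in> A" for w
    proof -
      have "prod_list (map (\<lambda>g. if g \<in> qgens C then fgen g else 0) gs) \<in> A" for gs
        by (induction gs) (auto intro: A_closed A_gen)
      thus ?thesis by (simp add: falg.eval_word_def)
    qed
    thus ?thesis unfolding \<pi>_def falg.lift_def by (intro A_sum A_scale)
  qed
  interpret I: ideal "uq_ideal C" "free_alg C" by (rule ideal_uq_ideal)
  have sub: "additive_subgroup (uq_ideal C) (free_alg C)" for C :: "'i cartan_datum" by (rule ideal.axioms(1)[OF ideal_uq_ideal])
  have "\<pi> x \<in> uq_ideal C" if "x \<in> rel_ideal C" for x
    using that
  proof induction
    case (rel x)
    have "x \<in> A" using uq_relators_subset rel by blast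
    moreover have "x \<in> uq_ideal C" unfolding uq_ideal_def using ring.genideal_self[OF ring_free_alg uq_relators_subset] rel by blast
    ultimately show ?case by (simp add: \<pi>A)
  next
    case zero
    show ?case using additive_subgroup.zero_closed[OF sub[of C]] by (simp add: \<pi>_def free_alg_ops)
  next
    case (add x y)
    thus ?case using additive_subgroup.a_closed[OF sub[of C]] by (simp add: \<pi>_def falg.lift_add free_alg_ops)
  next
    case (left x y)
    thus ?case using I.I_l_closed[OF _ range] by (simp add: \<pi>_def falg.lift_mult free_alg_ops)
  next
    case (right x y)
    thus ?case using I.I_r_closed[OF _ range] by (simp add: \<pi>_def falg.lift_mult free_alg_ops)
  qed
  thus "rel_ideal C \<inter> A \<subseteq> uq_ideal C" using \<pi>A by fastforce
qed

lemma uq_proj_eq_iff: "x \<in> A ==> y \<in> A ==> uq_proj C x = uq_proj C y \<longleftrightarrow> embed C x = embed C y"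
  using ring.quotient_eq_iff_same_a_r_cos[OF ring_free_alg ideal_uq_ideal, of x C y]
  by (auto simp: uq_proj_def free_alg_minus uq_ideal_eq embed_eq_iff[OF C] A_diff)

text \<open>Any representative in \<open>A\<close> gives the same value (\<open>val_proj\<close>).
  By \<open>val_inj\<close>, equality in \<open>uq C\<close> becomes an equation in
  \<open>uqt\<close>.\<close>

definition val :: "'i falg set \<Rightarrow> 'i uqt" where
  "val X = embed C (SOME x. x \<in> A \<and> X = uq_proj C x)"

lemma carrier_uq: "carrier (uq C) = uq_proj C ` A"
  by (auto simp: uq_def FactRing_def A_RCOSETS_def' uq_proj_def)

lemma val_proj: "x \<in> A ==> val (uq_proj C x) = embed C x"
proof -
  assume x: "x \<in> A"
  define y where "y = (SOME y. y \<in> A \<and> uq_proj C x = uq_proj C y)"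
  have "y \<in> A \<and> uq_proj C x = uq_proj C y" unfolding y_def by (rule someI[of _ x]) (simp add: x)
  thus ?thesis using uq_proj_eq_iff x unfolding val_def y_def[symmetric] by blast
qed

lemma val_inj: "X \<in> carrier (uq C) ==> Y \<in> carrier (uq C) ==> val X = val Y \<longleftrightarrow> X = Y"
  unfolding carrier_uq by (elim imageE) (simp add: uq_proj_eq_iff val_proj)

lemma uq_proj_hom: "uq_proj C \<in> ring_hom (free_alg C) (uq C)"
  unfolding uq_def uq_proj_def[abs_def] by (rule ideal.rcos_ring_hom[OF ideal_uq_ideal])

lemma uq_proj_ops:
  assumes "x \<in> A" "y \<in> A"
  shows "uq_proj C x \<oplus>\<^bsub>uq C\<^esub> uq_proj C y = uq_proj C (x + y)" "uq_proj C x \<otimes>\<^bsub>uq C\<^esub> uq_proj C y = uq_proj C (x * y)"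
    "\<one>\<^bsub>uq C\<^esub> = uq_proj C 1"
  using ring_hom_add[OF uq_proj_hom assms] ring_hom_mult[OF uq_proj_hom assms] ring_hom_one[OF uq_proj_hom] by (simp_all add: free_alg_ops)

lemma uq_proj_const: "uq_proj C (fconst c) \<in> carrier (uq C)"
  unfolding carrier_uq by (intro imageI A_const)

lemma uq_E_closed: "i \<in> I ==> uq_E C i \<in> carrier (uq C)"
  unfolding carrier_uq uq_E_def fE_def by (intro imageI A_gen) (auto simp: qgens_def)

lemma uq_scale_closed: "X \<in> carrier (uq C) ==> uq_scale C c X \<in> carrier (uq C)"
  unfolding uq_scale_def using uq_proj_const by auto

lemmas uq_closed = U.a_closed U.m_closed U.one_closed uq_scale_closed uq_E_closed uq_proj_const

lemma val_add_mult:
  assumes "X \<in> carrier (uq C)" "Y \<in> carrier (uq C)"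
  shows "val (X \<oplus>\<^bsub>uq C\<^esub> Y) = val X + val Y" "val (X \<otimes>\<^bsub>uq C\<^esub> Y) = val X * val Y"
  using assms unfolding carrier_uq by (auto simp: uq_proj_ops val_proj A_closed embed_simps)

lemma val_one: "val \<one>\<^bsub>uq C\<^esub> = 1"
  using uq_proj_ops(3)[of 1 1] by (simp add: val_proj A_closed embed_simps)

lemma val_const: "val (uq_proj C (fconst c)) = uscale c 1"
  by (simp add: val_proj A_const embed_simps)

lemma val_scale: "X \<in> carrier (uq C) ==> val (uq_scale C c X) = uscale c (val X)"
  unfolding uq_scale_def using val_add_mult(2)[OF uq_proj_const[of c]] val_const by simp

lemma val_E: "i \<in> I ==> val (uq_E C i) = uE i"
  unfolding uq_E_def fE_def by (subst val_proj, rule A_gen) (auto simp: qgens_def embed_simps fE_def[symmetric])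

lemmas val_ops = val_add_mult val_one val_scale val_E val_const

lemma val_uminus: "X \<in> carrier (uq C) ==> val (\<ominus>\<^bsub>uq C\<^esub> X) = - val X"
proof -
  assume X: "X \<in> carrier (uq C)"
  have z: "val \<zero>\<^bsub>uq C\<^esub> = 0" using val_ops(1)[of "\<zero>\<^bsub>uq C\<^esub>" "\<zero>\<^bsub>uq C\<^esub>"] by simp
  have "val X + val (\<ominus>\<^bsub>uq C\<^esub> X) = 0"
    using val_ops(1)[OF X U.a_inv_closed[OF X]] z X U.r_neg by simp
  thus ?thesis by (simp add: eq_neg_iff_add_eq_0 add.commute)
qed

lemma uq_subalgebra_closed: "S \<subseteq> carrier (uq C) ==> uq_subalgebra C S \<subseteq> carrier (uq C)"
  using ring.generate_ring_in_carrier[OF ring_uq, of "range (\<lambda>c. uq_proj C (fconst c)) \<union> S" C]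
  unfolding uq_subalgebra_def by (auto simp: uq_closed image_subset_iff)

lemma val_subalgebra:
  assumes S: "S \<subseteq> carrier (uq C)"
  shows "val ` uq_subalgebra C S = uqt.alg (val ` S)"
proof (intro equalityI subsetI)
  let ?G = "range (\<lambda>c. uq_proj C (fconst c)) \<union> S"
  have G: "?G \<subseteq> carrier (uq C)" using S by (auto simp: uq_closed)
  have carr: "X \<in> generate_ring (uq C) ?G ==> X \<in> carrier (uq C)" for X
    using U.generate_ring_in_carrier[OF G] by blast
  {
    fix x assume "x \<in> val ` uq_subalgebra C S"
    then obtain X where X: "X \<in> generate_ring (uq C) ?G" "x = val X" unfolding uq_subalgebra_def by blast
    have "val X \<in> uqt.alg (val ` S)" using X(1)
    proof induction
      case one show ?case by (simp add: val_ops uqt.alg.one)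
    next
      case (incl h)
      thus ?case by (auto simp: val_ops intro: uqt.alg.gen uqt.alg.scale[OF uqt.alg.one])
    next
      case (a_inv h) thus ?case by (simp add: val_uminus carr uqt.alg_uminus)
    next
      case (eng_add h1 h2) thus ?case by (simp add: val_ops carr uqt.alg.add)
    next
      case (eng_mult h1 h2) thus ?case by (simp add: val_ops carr uqt.alg.mult)
    qed
    thus "x \<in> uqt.alg (val ` S)" by (simp add: X)
  }
  fix x assume "x \<in> uqt.alg (val ` S)"
  hence "\<exists>X. X \<in> generate_ring (uq C) ?G \<and> val X = x"
  proof induction
    case (gen x)
    then obtain X where "X \<in> S" "x = val X" by blast
    thus ?case by (intro exI[of _ X] conjI generate_ring.incl) auto
  next
    case one
    show ?case by (intro exI conjI, rule generate_ring.one, rule val_ops)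
  next
    case (scale x c)
    then obtain X where X: "X \<in> generate_ring (uq C) ?G" "val X = x" by blast
    have "uq_proj C (fconst c) \<otimes>\<^bsub>uq C\<^esub> X \<in> generate_ring (uq C) ?G"
      by (intro generate_ring.eng_mult X generate_ring.incl) auto
    moreover have "val (uq_proj C (fconst c) \<otimes>\<^bsub>uq C\<^esub> X) = uscale c x"
      using X carr by (simp add: val_ops uq_closed)
    ultimately show ?case by blast
  next
    case (add x y)
    then obtain X Y where X: "X \<in> generate_ring (uq C) ?G" "val X = x" "Y \<in> generate_ring (uq C) ?G" "val Y = y" by blast
    thus ?case by (intro exI[of _ "X \<oplus>\<^bsub>uq C\<^esub> Y"]) (simp add: val_ops carr generate_ring.eng_add)
  next
    case (mult x y)
    then obtain X Y where X: "X \<in> generate_ring (uq C) ?G" "val X = x" "Y \<in> generate_ring (uq C) ?G" "val Y = y" by blast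
    thus ?case by (intro exI[of _ "X \<otimes>\<^bsub>uq C\<^esub> Y"]) (simp add: val_ops carr generate_ring.eng_mult)
  qed
  thus "x \<in> val ` uq_subalgebra C S" unfolding uq_subalgebra_def by blast
qed

lemma uq_plus_carrier: "uq_plus C \<subseteq> carrier (uq C)"
  unfolding uq_plus_def by (rule uq_subalgebra_closed) (auto simp: uq_closed)

lemma val_uq_plus: "val ` uq_plus C = u.Up"
proof -
  have "val ` uq_E C ` I = uE ` I" by (simp add: image_image val_ops)
  thus ?thesis unfolding uq_plus_def u.Up_def by (subst val_subalgebra) (auto simp: uq_closed)
qed

lemma uq_subalgebra_eqI:
  assumes "S \<subseteq> carrier (uq C)" "S' \<subseteq> carrier (uq C)" "uqt.alg (val ` S) = uqt.alg (val ` S')"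
  shows "uq_subalgebra C S = uq_subalgebra C S'"
proof -
  have "inj_on val (carrier (uq C))" by (auto simp: inj_on_def val_inj)
  moreover have "val ` uq_subalgebra C S = val ` uq_subalgebra C S'" using assms val_subalgebra by simp
  ultimately show ?thesis using uq_subalgebra_closed assms(1,2) by (simp add: inj_on_image_eq_iff)
qed

text \<open>Representatives of a coset have the same image under \<open>embed\<close>, and
  \<open>uT\<close> is compatible with the free endomorphism. So the image taken in
  \<open>braid_T\<close> is a singleton and \<open>the_elem\<close> has its intended value.\<close>

lemma braid_T_val:
  assumes i: "i \<in> I" and X: "X \<in> carrier (uq C)"
  shows "braid_T C i X \<in> carrier (uq C)" "val (braid_T C i X) = uT i (val X)"
proof -
  obtain x where x: "x \<in> A" "X = uq_proj C x" using X unfolding carrier_uq by blast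
  interpret Id: ideal "uq_ideal C" "free_alg C" by (rule ideal_uq_ideal)
  let ?T = "free_hom (braid_gen C i)"
  have T: "?T y \<in> A" if "y \<in> A" for y
    unfolding free_hom_eq
  proof (rule A_lift[OF _ that])
    fix g assume g: "g \<in> qgens C"
    have gen: "fE j \<in> A" "fF j \<in> A" "fK j \<in> A" "fKinv j \<in> A" if "j \<in> I" for j
      using that by (auto simp: fE_def fF_def fK_def fKinv_def qgens_def intro!: A_gen)
    have "fKpow i n \<in> A" for n using gen[OF i] by (auto simp: fKpow_def intro!: A_power)
    moreover have "divpow C i y n \<in> A" if "y \<in> A" for y n
      unfolding divpow_def using that by (intro A_closed A_const A_power)
    ultimately show "braid_gen C i g \<in> A"
      using g gen i by (auto simp: braid_gen_def qgens_def Let_def intro!: A_closed A_uminus A_sum A_const)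
  qed
  have mem: "y \<in> A \<and> embed C y = embed C x" if y: "y \<in> X" for y
  proof -
    from y obtain h where h: "h \<in> uq_ideal C" "y = h + x"
      unfolding x(2) uq_proj_def a_r_coset_def' by (auto simp: free_alg_ops)
    hence "h \<in> A" "h \<in> rel_ideal C" using uq_ideal_eq by auto
    thus ?thesis using h x(1) embed_eq_0[of h] A_closed by (simp add: embed_simps)
  qed
  have self: "x \<in> X" unfolding x(2) uq_proj_def by (rule Id.a_rcos_self[OF x(1)])
  have "uq_proj C (?T y) = uq_proj C (?T x)" if "y \<in> X" for y
    using mem[OF that] x(1) T uT_gen(3)[OF i, of y] uT_gen(3)[OF i, of x] by (subst uq_proj_eq_iff) auto
  hence "(\<lambda>x. uq_proj C (?T x)) ` X = {uq_proj C (?T x)}" using self by blast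
  hence b: "braid_T C i X = uq_proj C (?T x)" by (simp add: braid_T_def)
  show "braid_T C i X \<in> carrier (uq C)" unfolding b carrier_uq using T x by blast
  show "val (braid_T C i X) = uT i (val X)" using T x uT_gen(3)[OF i, of x] unfolding b by (simp add: val_proj)
qed

lemma foldr_braid_T_val:
  assumes "set is \<subseteq> I" "X \<in> carrier (uq C)"
  shows "foldr (braid_T C) is X \<in> carrier (uq C) \<and> val (foldr (braid_T C) is X) = foldr uT is (val X)"
  using assms by (induction "is") (auto simp: braid_T_val)

lemma ordered_monomial_val:
  assumes "length Xs = length as" "set Xs \<subseteq> carrier (uq C)"
  shows "ordered_monomial (uq C) Xs as \<in> carrier (uq C) \<and>
     val (ordered_monomial (uq C) Xs as) = prod_list (map (\<lambda>(x, n). val x ^ n) (zip Xs as))"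
proof -
  have pow: "val (X [^]\<^bsub>uq C\<^esub> n) = val X ^ n" if "X \<in> carrier (uq C)" for X and n :: nat
    using that by (induction n) (simp_all add: val_ops power_commutes)
  show ?thesis using assms
    by (induction Xs as rule: list_induct2) (simp_all add: ordered_monomial_def val_ops pow)
qed

end

section \<open>Folding\<close>

text \<open>Off-diagonal terms occur twice by symmetry. For the simply laced form, evenness raises
  positivity to the lower bound 2 on which the sign of roots rests.\<close>

lemma even_quadratic_form:
  fixes a :: "'i \<Rightarrow> 'i \<Rightarrow> int"
  assumes "finite S" "\<And>i. i \<in> S ==> even (a i i)" "\<And>i j. i \<in> S ==> j \<in> S ==> a i j = a j i"
  shows "even (\<Sum>i\<in>S. \<Sum>j\<in>S. a i j * p i * p j)"
  using assms
proof (induction S rule: finite_induct)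
  case (insert k S)
  have "(\<Sum>i\<in>S. a i k * p i * p k) = (\<Sum>i\<in>S. a k i * p k * p i)"
    by (rule sum.cong) (use insert.prems(2) in auto)
  hence "(\<Sum>i\<in>insert k S. \<Sum>j\<in>insert k S. a i j * p i * p j) =
     a k k * p k * p k + 2 * (\<Sum>i\<in>S. a k i * p k * p i) + (\<Sum>i\<in>S. \<Sum>j\<in>S. a i j * p i * p j)"
    using insert.hyps by (simp add: sum.distrib)
  moreover have "even (\<Sum>i\<in>S. \<Sum>j\<in>S. a i j * p i * p j)" using insert by simp
  ultimately show ?case using insert.prems(1) by simp
qed simp

section \<open>The folded Cartan datum\<close>

locale folding =
  fixes I :: "'i set" and a :: "'i \<Rightarrow> 'i \<Rightarrow> int" and \<sigma> :: "'i \<Rightarrow> 'i"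
  assumes ss: "semisimple_cartan_matrix I a" and sl: "simply_laced I a"
    and da: "diagram_automorphism I a \<sigma>" and ad: "admissible_automorphism I a \<sigma>" and ord: "has_order_on I \<sigma> 2"
begin

abbreviation "C \<equiv> simply_laced_datum I a"
abbreviation "D \<equiv> folded_datum I a \<sigma>"
abbreviation "R \<equiv> orbit \<sigma> ` I"
abbreviation "aD \<equiv> cartan D"

lemma C_simps: "index C = I" "cartan C = a" "symm C = (\<lambda>_. 1)"
  by (simp_all add: simply_laced_datum_def)

lemma D_simps: "index D = R" "symm D = card"
  by (simp_all add: folded_datum_def)

lemma finI: "finite I" and a_diag: "i \<in> I ==> a i i = 2"
  using ss by (auto simp: semisimple_cartan_matrix_def)

lemma a_off: "i \<in> I ==> j \<in> I ==> i \<noteq> j ==> a i j = 0 \<or> a i j = - 1"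
  using sl by (auto simp: simply_laced_def)

lemma a_sym: "i \<in> I ==> j \<in> I ==> a i j = a j i"
proof (cases "i = j")
  case False
  assume ij: "i \<in> I" "j \<in> I"
  have "a i j = 0 \<longleftrightarrow> a j i = 0" using ss ij by (auto simp: semisimple_cartan_matrix_def)
  thus ?thesis using a_off[OF ij False] a_off[OF ij(2,1)] False by auto
qed simp

text \<open>The symmetrizers in the hypothesis are arbitrary, but equal on bonded indices since the
  matrix is symmetric. Rescaling the coordinates by their square roots removes them.\<close>

lemma pos_def:
  fixes x :: "'i \<Rightarrow> real"
  assumes "k \<in> I" "x k \<noteq> 0" shows "0 < (\<Sum>i\<in>I. \<Sum>j\<in>I. of_int (a i j) * x i * x j)"
proof -
  obtain d :: "'i \<Rightarrow> nat" where d': "\<forall>i\<in>I. 0 < d i" "\<forall>i\<in>I. \<forall>j\<in>I. int (d i) * a i j = int (d j) * a j i"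
    "\<forall>x :: 'i \<Rightarrow> real. (\<exists>i\<in>I. x i \<noteq> 0) \<longrightarrow> 0 < (\<Sum>i\<in>I. \<Sum>j\<in>I. real (d i) * of_int (a i j) * x i * x j)"
    using ss unfolding semisimple_cartan_matrix_def by (elim conjE exE) (rule that; assumption)
  have d: "i \<in> I ==> 0 < d i" "i \<in> I ==> j \<in> I ==> int (d i) * a i j = int (d j) * a j i" for i j
    using bspec[OF d'(1)] bspec[OF bspec[OF d'(2)]] by auto
  define y where "y i = x i / sqrt (real (d i))" for i
  have "real (d i) * of_int (a i j) * y i * y j = of_int (a i j) * x i * x j" if "i \<in> I" "j \<in> I" for i j
  proof (cases "a i j = 0")
    case False
    hence dd: "d i = d j" using d(2)[OF that] a_sym[OF that] by simp
    have s: "sqrt (real (d j)) * sqrt (real (d j)) = real (d j)" "real (d j) \<noteq> 0" using d(1)[OF that(2)] by auto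
    have "y i * y j = x i * x j / (sqrt (real (d j)) * sqrt (real (d j)))" by (simp add: y_def dd)
    hence "real (d i) * (y i * y j) = x i * x j" using s(2) by (simp only: s(1) dd) simp
    hence "of_int (a i j) * (real (d i) * (y i * y j)) = of_int (a i j) * (x i * x j)" by simp
    thus ?thesis by (simp only: mult.assoc mult.left_commute)
  qed simp
  hence "(\<Sum>i\<in>I. \<Sum>j\<in>I. real (d i) * of_int (a i j) * y i * y j) = (\<Sum>i\<in>I. \<Sum>j\<in>I. of_int (a i j) * x i * x j)"
    by (intro sum.cong refl)
  moreover have "\<exists>i\<in>I. y i \<noteq> 0" using assms d(1)[of k] by (intro bexI[of _ k]) (simp_all add: y_def)
  ultimately show ?thesis using spec[OF d'(3), of y] by simp
qed

lemma \<sigma>_I: "i \<in> I ==> \<sigma> i \<in> I" and \<sigma>_inj: "inj_on \<sigma> I" and \<sigma>_a: "i \<in> I ==> j \<in> I ==> a (\<sigma> i) (\<sigma> j) = a i j"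
  using da by (auto simp: diagram_automorphism_def bij_betw_def)

lemma \<sigma>\<sigma>: "i \<in> I ==> \<sigma> (\<sigma> i) = i"
  using ord by (auto simp: has_order_on_def numeral_2_eq_2)

lemma a_\<sigma>: "i \<in> I ==> \<sigma> i \<noteq> i ==> a i (\<sigma> i) = 0"
proof -
  assume i: "i \<in> I" "\<sigma> i \<noteq> i"
  have "\<forall>k. (\<sigma> ^^ k) i \<noteq> i \<longrightarrow> a i ((\<sigma> ^^ k) i) = 0" using ad i(1) unfolding admissible_automorphism_def by (rule bspec)
  from spec[OF this, of 1] show ?thesis using i(2) by simp
qed

lemma orbit_eq: "i \<in> I ==> orbit \<sigma> i = {i, \<sigma> i}"
proof
  assume i: "i \<in> I"
  show "orbit \<sigma> i \<subseteq> {i, \<sigma> i}"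
  proof
    fix y assume "y \<in> orbit \<sigma> i"
    thus "y \<in> {i, \<sigma> i}" by induction (use \<sigma>\<sigma>[OF i] in auto)
  qed
  have "\<sigma> i \<in> orbit \<sigma> i" by (rule orbit.base)
  moreover from orbit.step[OF this] have "i \<in> orbit \<sigma> i" using \<sigma>\<sigma>[OF i] by simp
  ultimately show "{i, \<sigma> i} \<subseteq> orbit \<sigma> i" by simp
qed

lemma orbit_self: "i \<in> I ==> i \<in> orbit \<sigma> i" by (simp add: orbit_eq)

lemma R_cases [consumes 1]:
  assumes "r \<in> R"
  obtains (single) i where "i \<in> I" "\<sigma> i = i" "r = {i}" | (double) i where "i \<in> I" "\<sigma> i \<noteq> i" "r = {i, \<sigma> i}"
  using assms orbit_eq by fastforce

lemma R_subset: "r \<in> R ==> r \<subseteq> I" and R_finite: "r \<in> R ==> finite r"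
  using orbit_eq \<sigma>_I by auto

lemma R_member: "r \<in> R ==> i \<in> r ==> orbit \<sigma> i = r"
  using orbit_eq \<sigma>_I \<sigma>\<sigma> by (elim R_cases) (auto simp: insert_commute)

lemma R_disjoint: "r \<in> R ==> s \<in> R ==> i \<in> r ==> i \<in> s ==> r = s"
  using R_member by metis

lemma R_card: "r \<in> R ==> card r = 1 \<or> card r = 2"
  by (elim R_cases) auto

lemma R_\<sigma>: "r \<in> R ==> \<sigma> ` r = r" and R_\<sigma>_iff: "r \<in> R ==> i \<in> I ==> \<sigma> i \<in> r \<longleftrightarrow> i \<in> r"
proof -
  show im: "r \<in> R ==> \<sigma> ` r = r" by (elim R_cases) (auto simp: \<sigma>\<sigma>)
  assume r: "r \<in> R" and i: "i \<in> I"
  show "\<sigma> i \<in> r \<longleftrightarrow> i \<in> r"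
  proof
    assume "\<sigma> i \<in> r"
    hence "\<sigma> (\<sigma> i) \<in> \<sigma> ` r" by (rule imageI)
    thus "i \<in> r" by (simp add: im[OF r] \<sigma>\<sigma>[OF i])
  next
    assume "i \<in> r"
    hence "\<sigma> i \<in> \<sigma> ` r" by (rule imageI)
    thus "\<sigma> i \<in> r" by (simp add: im[OF r])
  qed
qed

lemma R_orthogonal: "r \<in> R ==> i \<in> r ==> j \<in> r ==> i \<noteq> j ==> a i j = 0"
  by (elim R_cases) (auto simp: a_\<sigma> \<sigma>\<sigma> \<sigma>_I a_sym[of "\<sigma> _"])

lemma sum_orbit: "r \<in> R ==> (\<Sum>j\<in>r. f (\<sigma> j)) = (\<Sum>j\<in>r. f j)"
  using sum.reindex[of \<sigma> r f] R_\<sigma>[of r] inj_on_subset[OF \<sigma>_inj R_subset[of r]] by (simp add: o_def)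

lemma sum_I: "(\<Sum>s\<in>R. \<Sum>j\<in>s. f j) = (\<Sum>j\<in>I. f j)" for f :: "'i \<Rightarrow> 'b::comm_monoid_add"
proof -
  have "I = \<Union>R" using orbit_self R_subset by blast
  hence "(\<Sum>j\<in>I. f j) = (\<Sum>j\<in>\<Union>R. f j)" by simp
  also have "\<dots> = (\<Sum>s\<in>R. \<Sum>j\<in>s. f j)"
    by (rule sum.Union_disjoint[unfolded o_def]) (use R_finite R_disjoint in blast)+
  finally show ?thesis by simp
qed

text \<open>The sums over the rows of an orbit agree because \<open>\<sigma>\<close> permutes
  \<open>s\<close> and preserves the matrix, so the integer division in \<open>folded_datum\<close>
  is exact.\<close>

lemma aD_eq: assumes r: "r \<in> R" and i: "i \<in> r" and s: "s \<in> R" shows "aD r s = (\<Sum>j\<in>s. a i j)"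
proof -
  have iI: "i \<in> I" using R_subset r i by blast
  have b: "(\<Sum>j\<in>s. a (\<sigma> i) j) = (\<Sum>j\<in>s. a i j)" if "i \<in> I" for i
  proof -
    have "(\<Sum>j\<in>s. a (\<sigma> i) j) = (\<Sum>j\<in>s. a (\<sigma> i) (\<sigma> j))" using sum_orbit[OF s, of "a (\<sigma> i)"] by simp
    also have "\<dots> = (\<Sum>j\<in>s. a i j)" by (rule sum.cong) (use R_subset[OF s] \<sigma>_a that in auto)
    finally show ?thesis .
  qed
  have "r = {i, \<sigma> i}" using R_member[OF r i] orbit_eq[OF iI] by simp
  hence "(\<Sum>k\<in>r. \<Sum>j\<in>s. a k j) = int (card r) * (\<Sum>j\<in>s. a i j)"
    using b[OF iI] by (cases "\<sigma> i = i") simp_all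
  moreover have "card r > 0" using R_card[OF r] by auto
  ultimately show ?thesis by (simp add: folded_datum_def)
qed

lemma aD_diag: "r \<in> R ==> aD r r = 2"
proof -
  assume r: "r \<in> R"
  then obtain i where i: "i \<in> I" "r = orbit \<sigma> i" by blast
  have e: "aD r r = (\<Sum>j\<in>r. a i j)" by (rule aD_eq[OF r _ r]) (simp add: i orbit_self)
  have "(\<Sum>j\<in>r. a i j) = 2" unfolding i(2) orbit_eq[OF i(1)]
    using i(1) by (cases "\<sigma> i = i") (simp_all add: a_diag a_\<sigma>)
  thus ?thesis using e by simp
qed

lemma aD_card_eq: "r \<in> R ==> s \<in> R ==> int (card r) * aD r s = (\<Sum>i\<in>r. \<Sum>j\<in>s. a i j)"
  using aD_eq[of r _ s] by (simp flip: sum_constant)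

lemma aD_sym: assumes "r \<in> R" "s \<in> R" shows "int (card r) * aD r s = int (card s) * aD s r"
proof -
  have "(\<Sum>i\<in>r. \<Sum>j\<in>s. a i j) = (\<Sum>j\<in>s. \<Sum>i\<in>r. a j i)"
    by (subst sum.swap) (use a_sym R_subset assms in \<open>auto intro!: sum.cong\<close>)
  thus ?thesis using aD_card_eq assms by simp
qed

lemma aD_off: assumes rs: "r \<in> R" "s \<in> R" "r \<noteq> s"
  shows "aD r s \<in> {0, - 1, - 2}" "aD r s = - 2 ==> card s = 2" "aD r s = 0 ==> i \<in> r ==> j \<in> s ==> a i j = 0"
proof -
  have e: "aD r s = (\<Sum>j\<in>s. a i j)" "\<forall>j\<in>s. a i j = 0 \<or> a i j = - 1" if i: "i \<in> r" for i
  proof -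
    show "aD r s = (\<Sum>j\<in>s. a i j)" by (rule aD_eq[OF rs(1) i rs(2)])
    show "\<forall>j\<in>s. a i j = 0 \<or> a i j = - 1"
    proof
      fix j assume j: "j \<in> s"
      have "i \<noteq> j" using R_disjoint rs i j by blast
      thus "a i j = 0 \<or> a i j = - 1" using a_off R_subset rs i j by blast
    qed
  qed
  obtain i where i: "i \<in> r" using rs(1) orbit_self by blast
  from rs(2) show "aD r s \<in> {0, - 1, - 2}" by (cases rule: R_cases) (use e[OF i] in auto)
  from rs(2) show "card s = 2" if "aD r s = - 2" by (cases rule: R_cases) (use e[OF i] that in auto)
  show "a i j = 0" if "aD r s = 0" "i \<in> r" "j \<in> s" for i j
    using rs(2) by (cases rule: R_cases) (use e[OF that(2)] that in auto)
qed

text \<open>The symmetrised folded form is the restriction of the original form to vectors that are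
  constant on orbits.\<close>

lemma pos_def_D:
  fixes v :: "'i set \<Rightarrow> int"
  assumes "r \<in> R" "v r \<noteq> 0" shows "0 < (\<Sum>r\<in>R. \<Sum>s\<in>R. int (card r) * aD r s * v r * v s)"
proof -
  define g where "g i j = a i j * v (orbit \<sigma> i) * v (orbit \<sigma> j)" for i j
  have "(\<Sum>s\<in>R. int (card r) * aD r s * v r * v s) = (\<Sum>i\<in>r. \<Sum>j\<in>I. g i j)" if r: "r \<in> R" for r
  proof -
    have "int (card r) * aD r s * v r * v s = (\<Sum>i\<in>r. \<Sum>j\<in>s. g i j)" if s: "s \<in> R" for s
    proof -
      have "(\<Sum>i\<in>r. \<Sum>j\<in>s. g i j) = (\<Sum>i\<in>r. \<Sum>j\<in>s. a i j * (v r * v s))"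
        by (rule sum.cong[OF refl], rule sum.cong[OF refl]) (simp add: g_def R_member[OF r] R_member[OF s])
      thus ?thesis by (simp only: sum_distrib_right[symmetric] aD_card_eq[OF r s, symmetric] mult.assoc)
    qed
    hence "(\<Sum>s\<in>R. int (card r) * aD r s * v r * v s) = (\<Sum>s\<in>R. \<Sum>i\<in>r. \<Sum>j\<in>s. g i j)" by (rule sum.cong[OF refl])
    also have "\<dots> = (\<Sum>i\<in>r. \<Sum>s\<in>R. \<Sum>j\<in>s. g i j)" by (rule sum.swap)
    finally show ?thesis unfolding sum_I .
  qed
  hence "(\<Sum>r\<in>R. \<Sum>s\<in>R. int (card r) * aD r s * v r * v s) = (\<Sum>r\<in>R. \<Sum>i\<in>r. \<Sum>j\<in>I. g i j)" by (rule sum.cong[OF refl])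
  hence "(\<Sum>r\<in>R. \<Sum>s\<in>R. int (card r) * aD r s * v r * v s) = (\<Sum>i\<in>I. \<Sum>j\<in>I. g i j)" unfolding sum_I .
  hence "real_of_int (\<Sum>r\<in>R. \<Sum>s\<in>R. int (card r) * aD r s * v r * v s) =
    real_of_int (\<Sum>i\<in>I. \<Sum>j\<in>I. a i j * v (orbit \<sigma> i) * v (orbit \<sigma> j))" unfolding g_def by (rule arg_cong)
  also have "\<dots> = (\<Sum>i\<in>I. \<Sum>j\<in>I. of_int (a i j) * of_int (v (orbit \<sigma> i)) * of_int (v (orbit \<sigma> j)))" by simp
  also have "\<dots> > 0"
  proof -
    obtain i where "i \<in> I" "r = orbit \<sigma> i" using assms(1) by blast
    thus ?thesis using assms(2) by (intro pos_def[of i]) simp_all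
  qed
  finally show ?thesis by linarith
qed

lemma pos_def_support:
  assumes S: "S \<subseteq> R" "r \<in> S" "v r \<noteq> 0"
  shows "0 < (\<Sum>r\<in>S. \<Sum>s\<in>S. int (card r) * aD r s * v r * v s)"
proof -
  define w where "w r = (if r \<in> S then v r else 0)" for r
  have fin: "finite R" using finI by simp
  have i: "(\<Sum>s\<in>R. int (card r) * aD r s * w r * w s) = (\<Sum>s\<in>S. int (card r) * aD r s * w r * w s)" for r
    by (rule sum.mono_neutral_right) (use fin S(1) in \<open>auto simp: w_def\<close>)
  have "0 < (\<Sum>r\<in>R. \<Sum>s\<in>R. int (card r) * aD r s * w r * w s)"
    by (rule pos_def_D[of r]) (use S in \<open>auto simp: w_def\<close>)
  also have "\<dots> = (\<Sum>r\<in>S. \<Sum>s\<in>S. int (card r) * aD r s * w r * w s)"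
    unfolding i by (rule sum.mono_neutral_right) (use fin S(1) in \<open>auto simp: w_def\<close>)
  also have "\<dots> = (\<Sum>r\<in>S. \<Sum>s\<in>S. int (card r) * aD r s * v r * v s)"
    by (intro sum.cong) (auto simp: w_def)
  finally show ?thesis .
qed

lemma pos_def_C_support:
  assumes S: "S \<subseteq> I" "S \<noteq> {}"
  shows "0 < (\<Sum>i\<in>S. \<Sum>j\<in>S. a i j)"
proof -
  define x :: "'i \<Rightarrow> real" where "x i = (if i \<in> S then 1 else 0)" for i
  obtain k where k: "k \<in> S" using S by blast
  have i: "(\<Sum>j\<in>I. of_int (a i j) * x i * x j) = (\<Sum>j\<in>S. of_int (a i j) * x i * x j)" for i
    by (rule sum.mono_neutral_right) (use finI S(1) in \<open>auto simp: x_def\<close>)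
  have "0 < (\<Sum>i\<in>I. \<Sum>j\<in>I. of_int (a i j) * x i * x j)"
    by (rule pos_def[of k]) (use S k in \<open>auto simp: x_def\<close>)
  also have "\<dots> = (\<Sum>i\<in>S. \<Sum>j\<in>S. of_int (a i j) * x i * x j)"
    unfolding i by (rule sum.mono_neutral_right) (use finI S(1) in \<open>auto simp: x_def\<close>)
  also have "\<dots> = of_int (\<Sum>i\<in>S. \<Sum>j\<in>S. a i j)" by (simp add: x_def)
  finally show ?thesis by linarith
qed

lemma cartan_type_C: "cartan_type (index C) (cartan C) (symm C)"
  unfolding C_simps
proof (unfold_locales, goal_cases)
  case (7 i j k)
  show ?case
  proof (rule ccontr)
    assume "a j k \<noteq> 0"
    with 7 have "a i j = - 1" "a j i = - 1" "a i k = - 1" "a k i = - 1" "a j k = - 1" "a k j = - 1"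
      using a_off[of i j] a_off[of i k] a_off[of j k] a_sym[of i j] a_sym[of i k] a_sym[of j k] by auto
    \<comment> \<open>A triangle would make the sum of its three simple roots isotropic: 6 - 6 =
      0.\<close>
    moreover have "0 < (\<Sum>x\<in>{i, j, k}. \<Sum>y\<in>{i, j, k}. a x y)" by (rule pos_def_C_support) (use 7 in auto)
    ultimately show False using 7 by (simp add: a_diag)
  qed
next
  case (3 i j) thus ?case using a_off[of i j] by auto
next
  case (6 i j) thus ?case using a_off[of i j] by auto
next
  case (8 i j k) thus ?case using a_off[of i j] a_off[of j i] by auto
qed (use finI a_diag a_sym in auto)

lemma cartan_type_D: "cartan_type (index D) (cartan D) (symm D)"
proof -
  have single: "aD s r = - 1" if rs: "r \<in> R" "s \<in> R" "r \<noteq> s" "aD r s = - 2" for r s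
  proof -
    have s2: "card s = 2" using aD_off(2)[OF rs(1-3)] rs(4) by simp
    show ?thesis
    proof (cases "card r = 1")
      case True
      thus ?thesis using aD_sym[OF rs(1,2)] s2 rs(4) by simp
    next
      case False
      hence r2: "card r = 2" using R_card rs(1) by blast
      hence "aD s r = - 2" using aD_sym[OF rs(1,2)] s2 rs(4) by simp
      \<comment> \<open>Two completely joined orbits of size two form a cycle of length four, for
        which the all-one vector has norm 4 + 4 - 8 = 0.\<close>
      moreover have "0 < (\<Sum>x\<in>{r, s}. \<Sum>y\<in>{r, s}. int (card x) * aD x y * 1 * 1)"
        using pos_def_support[of "{r, s}" r "\<lambda>_. 1"] rs by simp
      ultimately show ?thesis using rs r2 s2 aD_diag by simp
    qed
  qed
  show ?thesis unfolding D_simps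
  proof (unfold_locales, goal_cases)
    case 1 show ?case using finI by simp
  next
    case 2 thus ?case by (rule aD_diag)
  next
    case 3 thus ?case by (rule aD_off)
  next
    case (4 r) thus ?case using R_card[of r] by auto
  next
    case 5 thus ?case by (rule aD_sym)
  next
    case 6 thus ?case by (rule single)
  next
    case (7 r s t)
    show ?case
    proof (rule ccontr)
      assume st: "aD s t \<noteq> 0"
      have m: "int (card x) * aD x y \<le> - int (card x)" "int (card x) * aD x y \<le> - int (card y)"
        if "x \<in> R" "y \<in> R" "x \<noteq> y" "aD x y \<noteq> 0" for x y
      proof -
        have "aD y x \<noteq> 0" using aD_sym[OF that(1,2)] that(4) R_card[OF that(1)] by auto
        hence "aD x y \<le> - 1" "aD y x \<le> - 1" using aD_off(1)[of x y] aD_off(1)[of y x] that by auto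
        hence "int (card x) * aD x y \<le> int (card x) * - 1" "int (card y) * aD y x \<le> int (card y) * - 1"
          by (intro mult_left_mono; simp)+
        thus "int (card x) * aD x y \<le> - int (card x)" "int (card x) * aD x y \<le> - int (card y)"
          using aD_sym[OF that(1,2)] by simp_all
      qed
      \<comment> \<open>By \<open>m\<close> each off-diagonal product is at most minus either
        cardinality, so the three pairs at least cancel the diagonal contributions.\<close>
      have "0 < (\<Sum>x\<in>{r, s, t}. \<Sum>y\<in>{r, s, t}. int (card x) * aD x y * 1 * 1)"
        using pos_def_support[of "{r, s, t}" r "\<lambda>_. 1"] 7 by simp
      thus False
        using 7 st m[of r s] m[of r t] m[of s t] aD_sym[of r s] aD_sym[of r t] aD_sym[of s t] by (simp add: aD_diag)
    qed
  next
    case (8 r s t)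
    show ?case
    proof
      assume rt: "aD r t = - 2"
      have tr: "aD t r = - 1" using single[of r t] 8 rt by simp
      have t2: "card t = 2" using aD_off(2)[of r t] 8 rt by simp
      have r1: "card r = 1" using aD_sym[of r t] 8 rt tr t2 by simp
      have "aD r s = - 2 \<and> aD s r = - 1 \<or> aD r s = - 1 \<and> aD s r = - 2"
        using aD_off(1)[of r s] aD_off(1)[of s r] 8 by auto
      hence rs: "aD r s = - 2" "aD s r = - 1" "card s = 2"
        using aD_sym[of r s] 8 r1 R_card[of s] by auto
      \<comment> \<open>With weight 2 at the one-point orbit \<open>r\<close> the diagonal
        contributes 8 + 4 + 4, and each of the two double bonds contributes -8.\<close>
      have "0 < (\<Sum>x\<in>{r, s, t}. \<Sum>y\<in>{r, s, t}. int (card x) * aD x y * (if x = r then 2 else 1) * (if y = r then 2 else 1))"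
        using pos_def_support[of "{r, s, t}" r "\<lambda>x. if x = r then 2 else 1"] 8 by simp
      moreover have "aD s t \<le> 0" "aD t s \<le> 0" using aD_off(1)[of s t] aD_off(1)[of t s] 8 by auto
      ultimately show False using 8 rt tr t2 r1 rs by (simp add: aD_diag)
    qed
  qed
qed

end

text \<open>A root is written as \<open>p - n\<close> with disjoint supports. The mixed term is at
  most 0, and each nonzero part has norm at least 2 by evenness, so a root of norm 2 cannot have
  both parts nonzero.\<close>

sublocale folding \<subseteq> C: uq_rooted "simply_laced_datum I a"
proof (intro uq_rooted.intro uq_datum.intro uq_rooted_axioms.intro)
  show "cartan_type (index C) (cartan C) (symm C)" by (rule cartan_type_C)
next
  interpret cartan_type "index C" "cartan C" "symm C" by (rule cartan_type_C)
  interpret w: weyl C "index C" "cartan C" "symm C" by unfold_locales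
  fix ws i assume ws: "set ws \<subseteq> index C" and i: "i \<in> index C"
  define \<beta> where "\<beta> = weyl_word C ws (simple_root i)"
  define p where "p k = max 0 (\<beta> k)" for k
  define n where "n k = max 0 (- \<beta> k)" for k
  have f: "w.form x y = (\<Sum>i\<in>I. \<Sum>j\<in>I. a i j * x i * y j)" for x y by (simp add: w.form_def C_simps)
  have \<beta>: "\<beta> = w.vadd p (- 1) n" by (auto simp: w.vadd_def p_def n_def)
  have "w.form \<beta> \<beta> = 2" using w.form_W[OF ws] i by (simp add: \<beta>_def w.form_root w.pairing_root C_simps a_diag)
  hence sum: "w.form p p + w.form n n - 2 * w.form p n = 2"
    unfolding \<beta> w.form_vadd using w.form_sym[of n p] by simp
  have "a i j * p i * n j \<le> 0" if "i \<in> I" "j \<in> I" for i j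
  proof (cases "i = j")
    case False
    have "0 \<le> p i * n j" by (simp add: p_def n_def)
    moreover have "a i j \<le> 0" using a_off that False by force
    ultimately show ?thesis by (simp add: mult.assoc mult_nonpos_nonneg)
  qed (auto simp: p_def n_def max_def)
  hence pn: "w.form p n \<le> 0" unfolding f by (intro sum_nonpos) auto
  have two: "2 \<le> w.form x x" if "k \<in> I" "x k \<noteq> 0" for x k
  proof -
    have "0 < (\<Sum>i\<in>I. \<Sum>j\<in>I. of_int (a i j) * real_of_int (x i) * real_of_int (x j))" by (rule pos_def[of k]) (use that in auto)
    also have "\<dots> = real_of_int (w.form x x)" by (simp add: f)
    finally have "0 < w.form x x" by linarith
    moreover have "even (w.form x x)" unfolding f by (rule even_quadratic_form[OF finI]) (use a_diag a_sym in auto)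
    ultimately show ?thesis by presburger
  qed
  have out: "\<beta> k = 0" if "k \<notin> I" for k
    using w.W_outside[OF ws, of k] that i by (auto simp: \<beta>_def simple_root_def C_simps)
  show "(\<forall>k. 0 \<le> weyl_word C ws (simple_root i) k) \<or> (\<forall>k. weyl_word C ws (simple_root i) k \<le> 0)"
  proof (rule ccontr)
    assume "\<not> ?thesis"
    then obtain k l where kl: "\<beta> k < 0" "0 < \<beta> l" unfolding \<beta>_def[symmetric] by (auto simp: not_le)
    have "k \<in> I" "l \<in> I" using kl out by force+
    moreover have "n k \<noteq> 0" "p l \<noteq> 0" using kl by (auto simp: n_def p_def)
    ultimately have "2 \<le> w.form n n" "2 \<le> w.form p p" using two by auto
    thus False using sum pn by linarith
  qed
qed

sublocale folding \<subseteq> D: uq_datum "folded_datum I a \<sigma>"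
  by (rule uq_datum.intro) (rule cartan_type_D)

lemma foldr_concat_map: "foldr f (concat (map g xs)) = foldr (\<lambda>x. foldr f (g x)) xs"
  by (induction xs) simp_all

lemma orbit_list: "finite r ==> distinct (orbit_list r)" "finite r ==> set (orbit_list r) = r"
proof -
  have "distinct (orbit_list r) \<and> set (orbit_list r) = r" if fr: "finite r"
  proof -
    obtain xs where "set xs = r" "distinct xs" using finite_distinct_list[OF fr] by blast
    hence "\<exists>xs. distinct xs \<and> set xs = r" by (intro exI[of _ xs]) simp
    thus ?thesis unfolding orbit_list_def by (rule someI_ex)
  qed
  thus "finite r ==> distinct (orbit_list r)" "finite r ==> set (orbit_list r) = r" by auto
qed

section \<open>Words and roots under unfolding\<close>

context folding
begin

lemma orbit_list_R: "r \<in> R ==> distinct (orbit_list r)" "r \<in> R ==> set (orbit_list r) = r"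
  using orbit_list[OF R_finite] by blast+

definition unfolded :: "'i set list \<Rightarrow> 'i list" where
  "unfolded rs = concat (map orbit_list rs)"

lemma unfolded_simps: "unfolded [] = []" "unfolded (r # rs) = orbit_list r @ unfolded rs"
  "unfolded (rs @ rs') = unfolded rs @ unfolded rs'"
  by (simp_all add: unfolded_def)

lemma set_unfolded: "set rs \<subseteq> R ==> set (unfolded rs) \<subseteq> I"
proof (induction rs)
  case (Cons r rs)
  thus ?case using R_subset[of r] orbit_list_R(2)[of r] by (simp add: unfolded_def)
qed (simp add: unfolded_def)

abbreviation "pair v i \<equiv> (\<Sum>j\<in>I. a i j * v j)"

lemma reflection_C: "reflection C i v k = (if k = i then v k - pair v k else v k)"
  by (simp add: reflection_def simple_root_def C_simps)

text \<open>Pairwise orthogonal reflections act simultaneously: none of them changes a pairing that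
  another one reads.\<close>

lemma reflections_orthogonal:
  assumes "distinct xs" "set xs \<subseteq> I" "\<And>i j. i \<in> set xs ==> j \<in> set xs ==> i \<noteq> j ==> a i j = 0"
  shows "foldr (reflection C) xs v k = (if k \<in> set xs then v k - pair v k else v k)"
  using assms
proof (induction xs arbitrary: k)
  case (Cons i xs)
  define w where "w = foldr (reflection C) xs v"
  have w: "w k = (if k \<in> set xs then v k - pair v k else v k)" for k
    unfolding w_def by (rule Cons.IH) (use Cons.prems in auto)
  have "pair w i = pair v i"
  proof (rule sum.cong[OF refl])
    fix j
    show "a i j * w j = a i j * v j" using Cons.prems by (cases "j \<in> set xs") (auto simp: w)
  qed
  moreover have "foldr (reflection C) (i # xs) v k = (if k = i then w k - pair w k else w k)"
    using reflection_C[of i w k] by (simp add: w_def)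
  ultimately show ?case using Cons.prems(1) w[of k] by auto
qed simp

lemma hat_reflection_eq:
  assumes "r \<in> R" shows "hat_reflection C r v k = (if k \<in> r then v k - pair v k else v k)"
  unfolding hat_reflection_def
  using reflections_orthogonal[of "orbit_list r" v k] orbit_list_R[OF assms] R_subset[OF assms] R_orthogonal[OF assms] by simp

lemma weyl_word_unfolded: "weyl_word C (unfolded rs) = foldr (hat_reflection C) rs"
  by (simp add: weyl_word_def unfolded_def foldr_concat_map hat_reflection_def[abs_def])

text \<open>The folded root lattice as \<sigma>-invariant vectors: the simple root of an orbit
  becomes the sum of the simple roots of its points (\<open>emb_root\<close>), and folded
  reflections become products over orbits (\<open>emb_reflection\<close>).\<close>

definition emb :: "('i set \<Rightarrow> int) \<Rightarrow> 'i \<Rightarrow> int" where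
  "emb v k = (if k \<in> I then v (orbit \<sigma> k) else 0)"

definition shift :: "('i \<Rightarrow> int) \<Rightarrow> 'i \<Rightarrow> int" where
  "shift v k = (if k \<in> I then v (\<sigma> k) else v k)"

lemma emb_reflection:
  assumes r: "r \<in> R" shows "emb (reflection D r v) = hat_reflection C r (emb v)"
proof
  fix k
  show "emb (reflection D r v) k = hat_reflection C r (emb v) k"
  proof (cases "k \<in> r")
    case True
    hence k: "k \<in> I" "orbit \<sigma> k = r" using R_subset R_member r by blast+
    have "pair (emb v) k = (\<Sum>s\<in>R. \<Sum>j\<in>s. a k j * emb v j)" by (simp add: sum_I)
    also have "\<dots> = (\<Sum>s\<in>R. aD r s * v s)"
    proof (rule sum.cong[OF refl])
      fix s assume s: "s \<in> R"
      have "(\<Sum>j\<in>s. a k j * emb v j) = (\<Sum>j\<in>s. a k j * v s)"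
        by (rule sum.cong) (use s R_subset[OF s] R_member[OF s] in \<open>auto simp: emb_def\<close>)
      thus "(\<Sum>j\<in>s. a k j * emb v j) = aD r s * v s" by (simp add: aD_eq[OF r True s] sum_distrib_right)
    qed
    finally show ?thesis using True k by (simp add: hat_reflection_eq[OF r] emb_def reflection_def simple_root_def D_simps)
  next
    case False
    hence "k \<in> I ==> orbit \<sigma> k \<noteq> r" using orbit_self by blast
    thus ?thesis using False by (simp add: hat_reflection_eq[OF r] emb_def reflection_def simple_root_def)
  qed
qed

lemma emb_word: "set rs \<subseteq> R ==> emb (weyl_word D rs v) = weyl_word C (unfolded rs) (emb v)"
  unfolding weyl_word_unfolded by (induction rs) (simp_all add: weyl_word_def emb_reflection)

lemma shift_reflection:
  assumes r: "r \<in> R" shows "hat_reflection C r (shift v) = shift (hat_reflection C r v)"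
proof
  fix k
  show "hat_reflection C r (shift v) k = shift (hat_reflection C r v) k"
  proof (cases "k \<in> I")
    case True
    have "pair (shift v) k = (\<Sum>j\<in>I. a (\<sigma> k) (\<sigma> j) * v (\<sigma> j))"
      by (rule sum.cong) (use \<sigma>_a[OF True] in \<open>auto simp: shift_def\<close>)
    also have "\<dots> = pair v (\<sigma> k)"
      using sum.reindex[OF \<sigma>_inj, of "\<lambda>j. a (\<sigma> k) j * v j"] da by (simp add: o_def diagram_automorphism_def bij_betw_def)
    finally have "pair (shift v) k = pair v (\<sigma> k)" .
    thus ?thesis using True \<sigma>_I[OF True] R_\<sigma>_iff[OF r True] by (simp add: hat_reflection_eq[OF r] shift_def)
  next
    case False
    hence "k \<notin> r" using R_subset[OF r] by blast
    thus ?thesis using False by (simp add: hat_reflection_eq[OF r] shift_def)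
  qed
qed

lemma shift_word: "set rs \<subseteq> R ==> weyl_word C (unfolded rs) (shift v) = shift (weyl_word C (unfolded rs) v)"
  unfolding weyl_word_unfolded by (induction rs) (simp_all add: shift_reflection)

lemma shift_root: "i \<in> I ==> shift (simple_root i) = simple_root (\<sigma> i)"
proof
  fix k assume i: "i \<in> I"
  have "k \<in> I ==> \<sigma> k = i \<longleftrightarrow> k = \<sigma> i" using \<sigma>\<sigma> i by auto
  thus "shift (simple_root i) k = simple_root (\<sigma> i) k" using i \<sigma>_I by (auto simp: shift_def simple_root_def)
qed

lemma emb_root:
  assumes "r \<in> R" "i \<in> r"
  shows "emb (simple_root r) = (if \<sigma> i = i then simple_root i else C.w.vadd (simple_root i) 1 (simple_root (\<sigma> i)))"
proof
  fix k
  have iI: "i \<in> I" using R_subset[OF assms(1)] assms(2) by blast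
  have i: "i \<in> I" "r = {i, \<sigma> i}" using R_member[OF assms] orbit_eq[OF iI] iI by simp_all
  have "k \<in> I ==> orbit \<sigma> k = r \<longleftrightarrow> k \<in> r" using R_member[OF assms(1)] orbit_self by blast
  thus "emb (simple_root r) k = (if \<sigma> i = i then simple_root i else C.w.vadd (simple_root i) 1 (simple_root (\<sigma> i))) k"
    using i \<sigma>_I by (auto simp: emb_def simple_root_def C.w.vadd_def)
qed

text \<open>A folded root unfolds to \<open>\<beta>\<close> or to
  \<open>\<beta> + shift \<beta>\<close>, according to the size of the orbit, and the two summands
  have the same sign.\<close>

lemma sign_transfer:
  assumes rs: "set rs \<subseteq> R" and r: "r \<in> R" and i: "i \<in> r"
  shows "C.w.pos (weyl_word C (unfolded rs) (simple_root i)) ==> 0 \<le> weyl_word D rs (simple_root r) s"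
    "C.w.neg (weyl_word C (unfolded rs) (simple_root i)) ==> weyl_word D rs (simple_root r) s \<le> 0"
proof -
  interpret wD: weyl D "index D" "cartan D" "symm D" by unfold_locales
  define \<beta> where "\<beta> = weyl_word C (unfolded rs) (simple_root i)"
  have iI: "i \<in> I" using R_subset r i by blast
  have "weyl_word C (unfolded rs) (emb (simple_root r)) = (if \<sigma> i = i then \<beta> else C.w.vadd \<beta> 1 (shift \<beta>))"
    unfolding emb_root[OF r i] \<beta>_def using shift_word[OF rs, of "simple_root i"] shift_root[OF iI] by (simp add: C.w.W_vadd)
  hence e: "emb (weyl_word D rs (simple_root r)) k = (if \<sigma> i = i then \<beta> k else \<beta> k + shift \<beta> k)" for k
    using emb_word[OF rs, of "simple_root r"] by (simp add: C.w.vadd_def)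
  have out: "weyl_word D rs (simple_root r) s = 0" if "s \<notin> R"
    using wD.W_outside[of rs s "simple_root r"] rs r that by (auto simp: D_simps simple_root_def)
  have inn: "\<exists>k. weyl_word D rs (simple_root r) s = (if \<sigma> i = i then \<beta> k else \<beta> k + shift \<beta> k)" if s: "s \<in> R"
  proof -
    obtain k where "k \<in> I" "s = orbit \<sigma> k" using s by blast
    thus ?thesis using e[of k] by (intro exI[of _ k]) (simp add: emb_def)
  qed
  {
    assume "C.w.pos (weyl_word C (unfolded rs) (simple_root i))"
    hence p: "0 \<le> \<beta> k" "0 \<le> shift \<beta> k" for k by (auto simp: C.w.pos_def \<beta>_def[symmetric] shift_def)
    show "0 \<le> weyl_word D rs (simple_root r) s"
    proof (cases "s \<in> R")
      case True
      from inn[OF this] obtain k where "weyl_word D rs (simple_root r) s = (if \<sigma> i = i then \<beta> k else \<beta> k + shift \<beta> k)" by (rule exE)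
      thus ?thesis using p[of k] by simp
    qed (simp add: out)
  }
  assume "C.w.neg (weyl_word C (unfolded rs) (simple_root i))"
  hence p: "\<beta> k \<le> 0" "shift \<beta> k \<le> 0" for k by (auto simp: C.w.neg_def \<beta>_def[symmetric] shift_def)
  show "weyl_word D rs (simple_root r) s \<le> 0"
  proof (cases "s \<in> R")
    case True
    from inn[OF this] obtain k where "weyl_word D rs (simple_root r) s = (if \<sigma> i = i then \<beta> k else \<beta> k + shift \<beta> k)" by (rule exE)
    thus ?thesis using p[of k] by simp
  qed (simp add: out)
qed

end

sublocale folding \<subseteq> D: uq_rooted "folded_datum I a \<sigma>"
proof (intro uq_rooted.intro D.uq_datum_axioms uq_rooted_axioms.intro)
  fix rs r assume rs: "set rs \<subseteq> index D" and r: "r \<in> index D"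
  hence rs': "set rs \<subseteq> R" "r \<in> R" by (simp_all add: D_simps)
  then obtain i where i: "i \<in> r" "i \<in> I" using orbit_self by blast
  have "C.w.pos (weyl_word C (unfolded rs) (simple_root i)) \<or> C.w.neg (weyl_word C (unfolded rs) (simple_root i))"
    by (rule C.w.sign) (use set_unfolded[OF rs'(1)] i in \<open>simp_all add: C_simps\<close>)
  thus "(\<forall>k. 0 \<le> weyl_word D rs (simple_root r) k) \<or> (\<forall>k. weyl_word D rs (simple_root r) k \<le> 0)"
  proof
    assume "C.w.pos (weyl_word C (unfolded rs) (simple_root i))"
    thus ?thesis by (intro disjI1 allI sign_transfer(1)[OF rs' i(1)])
  next
    assume "C.w.neg (weyl_word C (unfolded rs) (simple_root i))"
    thus ?thesis by (intro disjI2 allI sign_transfer(2)[OF rs' i(1)])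
  qed
qed

context folding
begin

lemma positive_unfolded:
  assumes rs: "set rs \<subseteq> R" and r: "r \<in> R" and i: "i \<in> r" and p: "D.w.pos (weyl_word D rs (simple_root r))"
  shows "C.w.pos (weyl_word C (unfolded rs) (simple_root i))"
proof (rule ccontr)
  assume n: "\<not> ?thesis"
  have "i \<in> I" using R_subset r i by blast
  hence "C.w.neg (weyl_word C (unfolded rs) (simple_root i))"
    using n C.w.neg_iff[of "unfolded rs" i] set_unfolded[OF rs] by (simp add: C_simps)
  hence "D.w.neg (weyl_word D rs (simple_root r))"
    unfolding D.w.neg_def by (intro allI sign_transfer(2)[OF rs r i])
  thus False using p D.w.not_pos_neg[of rs r] rs by (simp add: D_simps)
qed

lemma reduced_orthogonal:
  assumes "C.w.reduced us" "distinct xs" "set xs \<subseteq> I" "\<And>i j. i \<in> set xs ==> j \<in> set xs ==> i \<noteq> j ==> a i j = 0"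
    "\<And>i. i \<in> set xs ==> C.w.pos (weyl_word C us (simple_root i))"
  shows "C.w.reduced (us @ xs)"
  using assms(2-5)
proof (induction xs rule: rev_induct)
  case Nil
  show ?case using assms(1) by simp
next
  case (snoc i xs)
  have r: "C.w.reduced (us @ xs)" by (rule snoc.IH) (use snoc.prems in auto)
  have "weyl_word C xs (simple_root i) = simple_root i"
  proof
    fix k
    have "pair (simple_root i) k = a k i" using snoc.prems(2) finI by (simp add: simple_root_def sum.delta if_distrib cong: if_cong)
    moreover have "k \<in> set xs ==> a k i = 0" using snoc.prems(1,3) by auto
    ultimately show "weyl_word C xs (simple_root i) k = simple_root i k"
      using reflections_orthogonal[of xs "simple_root i" k] snoc.prems by (simp add: weyl_word_def)
  qed
  hence "C.w.pos (weyl_word C (us @ xs) (simple_root i))" using snoc.prems(4) by (simp add: C.w.W_append)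
  thus ?case using C.w.reduced_snoc[OF r, of i] snoc.prems(2) by (simp add: C_simps)
qed

text \<open>If the folded root of the new letter is positive, then so are the roots at all points of
  the orbit (\<open>positive_unfolded\<close>). As these points are orthogonal, appending them one
  by one increases the length each time.\<close>

lemma reduced_unfolded:
  "D.w.reduced rs ==> C.w.reduced (unfolded rs)"
proof (induction rs rule: rev_induct)
  case Nil
  show ?case by (simp add: unfolded_simps C.w.reduced_def)
next
  case (snoc r rs)
  note l = D.w.neg_last[OF snoc.prems]
  have rs: "set rs \<subseteq> R" and r: "r \<in> R" using D.w.reduced_set[OF snoc.prems] by (auto simp: D_simps)
  have "C.w.reduced (unfolded rs @ orbit_list r)"
  proof (rule reduced_orthogonal[OF snoc.IH[OF l(1)]])
    show "C.w.pos (weyl_word C (unfolded rs) (simple_root i))" if "i \<in> set (orbit_list r)" for i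
      by (rule positive_unfolded[OF rs r _ l(3)]) (use that orbit_list_R[OF r] in simp)
  qed (use orbit_list_R[OF r] R_subset[OF r] R_orthogonal[OF r] in auto)
  thus ?case by (simp add: unfolded_simps)
qed

definition hatE :: "'i set \<Rightarrow> 'i uqt" where "hatE r = prod_list (map C.uE (orbit_list r))"

abbreviation "hatT r \<equiv> foldr C.uT (orbit_list r)"

lemma hatT_unfolded: "foldr C.uT (unfolded rs) = foldr hatT rs"
  by (simp add: unfolded_def foldr_concat_map)

lemma hatX_positive:
  assumes "D.w.reduced (rs @ [r])" shows "foldr hatT rs (hatE r) \<in> C.u.Up"
proof -
  note l = D.w.neg_last[OF assms]
  have rs: "set rs \<subseteq> R" and r: "r \<in> R" using D.w.reduced_set[OF assms] by (auto simp: D_simps)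
  have red: "C.w.reduced (unfolded rs)" by (rule reduced_unfolded[OF l(1)])
  have "foldr C.uT (unfolded rs) (C.uE i) \<in> C.u.Up" if "i \<in> r" for i
    by (rule C.u.T_E_positive[OF red _ positive_unfolded[OF rs r that l(3)]]) (use R_subset[OF r] that in \<open>auto simp: C_simps\<close>)
  moreover have "C.w.reduced (unfolded rs) ==> uqt.alg_hom (foldr C.uT (unfolded rs))"
    by (rule C.u.alg_hom_foldr) (rule C.w.reduced_set)
  note h = uqt.alg_hom_simps[OF this[OF red]]
  have "foldr C.uT (unfolded rs) (prod_list (map C.uE xs)) \<in> C.u.Up" if "set xs \<subseteq> r" for xs
    using that
  proof (induction xs)
    case Nil
    show ?case by (simp add: h C.u.Up_def uqt.alg.one)
  next
    case (Cons x xs)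
    thus ?case using calculation[of x] by (simp add: h C.u.Up_def uqt.alg.mult)
  qed
  thus ?thesis using orbit_list_R(2)[OF r] by (simp add: hatT_unfolded[symmetric] hatE_def)
qed

end

section \<open>Braid moves of folded root vectors\<close>

context scaled_ring
begin

lemma alg_insert_eq:
  assumes "x \<in> alg S" shows "alg (insert x S) = alg S"
proof
  have "insert x S \<subseteq> alg S" using assms alg.gen by blast
  thus "alg (insert x S) \<subseteq> alg S" unfolding alg_subset_iff .
  show "alg S \<subseteq> alg (insert x S)" by (rule alg_mono) blast
qed

lemma alg_insert_exchange:
  assumes "x - y \<in> alg S" shows "alg (insert x S) = alg (insert y S)"
proof -
  have sub: "alg (insert x S) \<subseteq> alg (insert y S)" if xy: "x - y \<in> alg S" for x y
  proof -
    have "x - y \<in> alg (insert y S)" using xy alg_mono[of S "insert y S"] by blast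
    moreover have "y \<in> alg (insert y S)" by (rule alg.gen) simp
    ultimately have "(x - y) + y \<in> alg (insert y S)" by (rule alg.add)
    thus ?thesis unfolding alg_subset_iff using alg.gen[of _ "insert y S"] by auto
  qed
  have "- (x - y) \<in> alg S" using assms by (rule alg_uminus)
  thus ?thesis using sub[OF assms] sub[of y x] by simp
qed

lemma alg_half: "x + x \<in> alg S ==> (1 + 1 :: 'k) \<noteq> 0 ==> x \<in> alg S"
proof -
  assume "x + x \<in> alg S" and nz: "(1 + 1 :: 'k) \<noteq> 0"
  hence "sc (inverse (1 + 1)) (x + x) \<in> alg S" by (intro alg.scale)
  moreover have "x + x = sc (1 + 1) x" by (simp only: sc_add_left sc_1)
  ultimately show ?thesis using nz by (simp only: sc_sc) simp
qed

end

context unit_scalar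
begin

text \<open>Two commuting copies of type A2. After multiplying out, the terms with a single factor
  \<open>u\<close> are the same in both products and cancel; the others are polynomials in
  \<open>x * x'\<close> and \<open>y * y'\<close>.\<close>

lemma rank_two_squared:
  assumes c: "x * x' = x' * x" "x * y' = y' * x" "y * x' = x' * y" "y * y' = y' * y"
  shows "(y * x - sc u (x * y)) * (y' * x' - sc u (x' * y')) - (x * y - sc u (y * x)) * (x' * y' - sc u (y' * x')) \<in> alg {x * x', y * y'}"
proof -
  note r = c[symmetric] c[symmetric, THEN assoc_rule]
  have "(y * x - sc u (x * y)) * (y' * x' - sc u (x' * y')) - (x * y - sc u (y * x)) * (x' * y' - sc u (y' * x'))
     = (y * y') * (x * x') + sc (u * u) ((x * x') * (y * y')) - (x * x') * (y * y') - sc (u * u) ((y * y') * (x * x'))"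
    by (simp add: r sc_distribs algebra_simps)
  moreover have "x * x' \<in> alg {x * x', y * y'}" "y * y' \<in> alg {x * x', y * y'}" by (auto intro: alg.gen)
  ultimately show ?thesis by (simp add: alg.add alg_diff alg.scale alg.mult)
qed

context
  fixes x y z
  assumes xz: "x * z = z * x" and Sx: "serre_rel v 1 y x = 0" and Sz: "serre_rel v 1 y z = 0"
    and two: "(1 + 1 :: 'k) \<noteq> 0"
begin

lemma serre_rules:
  "x * (y * y) = sc v (y * (x * y)) + sc u (y * (x * y)) - y * (y * x)"
  "z * (y * y) = sc v (y * (z * y)) + sc u (y * (z * y)) - y * (y * z)"
  "z * x = x * z"
proof -
  have *: "w * (y * y) = sc v (y * (w * y)) + sc u (y * (w * y)) - y * (y * w)" if "serre_rel v 1 y w = 0" for w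
  proof -
    have "w * (y * y) = (y * (y * w) - sc (v + u) (y * (w * y)) + w * (y * y)) + sc (v + u) (y * (w * y)) - y * (y * w)" by simp
    also have "\<dots> = sc (v + u) (y * (w * y)) - y * (y * w)" using that by (simp add: serre_rel_eqs)
    finally show ?thesis by (simp add: sc_add_left)
  qed
  show "x * (y * y) = sc v (y * (x * y)) + sc u (y * (x * y)) - y * (y * x)"
    "z * (y * y) = sc v (y * (z * y)) + sc u (y * (z * y)) - y * (y * z)" by (rule * Sx Sz)+
  show "z * x = x * z" using xz by simp
qed

text \<open>For orbits of sizes one and two, \<open>A, P\<close> are the two middle root vectors for one of the two words and
  \<open>B, Q\<close> those for the other one.\<close>

lemma folded_AB:
  assumes A: "A = (y * x - sc u (x * y)) * z - sc u (z * (y * x - sc u (x * y)))"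
    and B: "B = x * (z * y - sc u (y * z)) - sc u ((z * y - sc u (y * z)) * x)"
  shows "A - B \<in> alg {x * z, y}"
proof -
  have "A - B = y * (x * z) + sc (u * u) ((x * z) * y) - (x * z) * y - sc (u * u) (y * (x * z))"
    by (simp add: A B serre_rules(3) serre_rules(3)[THEN assoc_rule] sc_distribs algebra_simps)
  moreover have "x * z \<in> alg {x * z, y}" "y \<in> alg {x * z, y}" by (auto intro: alg.gen)
  ultimately show ?thesis by (simp only: alg.add alg_diff alg.scale alg.mult)
qed

text \<open>The factors of \<open>?P\<close> commute, so \<open>?P + ?P'\<close> is twice
  \<open>?P\<close>. This sum is symmetric in \<open>x\<close> and \<open>z\<close>, and for such an
  expression the generators \<open>A\<close>, \<open>x * z\<close>, \<open>y\<close>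
  suffice.\<close>

lemma folded_P:
  assumes A: "A = (y * x - sc u (x * y)) * z - sc u (z * (y * x - sc u (x * y)))"
    and comm: "(y * z - sc u (z * y)) * (y * x - sc u (x * y)) = (y * x - sc u (x * y)) * (y * z - sc u (z * y))" (is "?P = ?P'")
  shows "?P \<in> alg {A, x * z, y}"
proof -
  \<comment> \<open>This is \<open>u\<close> times the symmetric element x y z + z y x, which is
    what \<open>A\<close> contributes beyond \<open>x * z\<close> and \<open>y\<close>.\<close>
  define w where "w = y * (x * z) + sc (u * u) ((x * z) * y) - A"
  let ?e = "x * z"
  note r = serre_rules serre_rules[THEN assoc_rule, unfolded mult.assoc]
  have "?P + ?P' = sc u (w * y) - sc u (y * w) + sc u (y * y * ?e - y * ?e * y) + sc u (y * y * ?e - y * ?e * y)"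
    by (simp add: w_def A r expand)
  moreover have g: "?e \<in> alg {A, ?e, y}" "y \<in> alg {A, ?e, y}" "A \<in> alg {A, ?e, y}" by (auto intro: alg.gen)
  hence "w \<in> alg {A, ?e, y}" unfolding w_def by (simp only: alg.add alg_diff alg.scale alg.mult)
  ultimately have "?P + ?P' \<in> alg {A, ?e, y}" using g by (simp only: alg.add alg_diff alg.scale alg.mult)
  thus ?thesis unfolding comm by (rule alg_half[OF _ two])
qed

lemma folded_Q:
  assumes B: "B = x * (z * y - sc u (y * z)) - sc u ((z * y - sc u (y * z)) * x)"
    and comm: "(x * y - sc u (y * x)) * (z * y - sc u (y * z)) = (z * y - sc u (y * z)) * (x * y - sc u (y * x))" (is "?Q = ?Q'")
  shows "?Q \<in> alg {B, x * z, y}"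
proof -
  \<comment> \<open>Again \<open>u\<close> times x y z + z y x, recovered this time from
    \<open>B\<close>.\<close>
  define w where "w = (x * z) * y + sc (u * u) (y * (x * z)) - B"
  let ?e = "x * z"
  note r = serre_rules serre_rules[THEN assoc_rule, unfolded mult.assoc]
  have "?Q + ?Q' = sc v (w * y) - sc v (y * w) + sc u (y * y * ?e - y * ?e * y) + sc u (y * y * ?e - y * ?e * y)"
    by (simp add: w_def B r expand)
  moreover have g: "?e \<in> alg {B, ?e, y}" "y \<in> alg {B, ?e, y}" "B \<in> alg {B, ?e, y}" by (auto intro: alg.gen)
  hence "w \<in> alg {B, ?e, y}" unfolding w_def by (simp only: alg.add alg_diff alg.scale alg.mult)
  ultimately have "?Q + ?Q' \<in> alg {B, ?e, y}" using g by (simp only: alg.add alg_diff alg.scale alg.mult)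
  thus ?thesis unfolding comm by (rule alg_half[OF _ two])
qed

end

end

lemma qfield_two: "(1 + 1 :: qfield) \<noteq> 0"
  by (simp add: One_fract_def Zero_fract_def eq_fract)

section \<open>Braid moves according to the type of the two orbits\<close>

context folding
begin

abbreviation "UC \<equiv> uqt.alg C.u.gens"
abbreviation "T \<equiv> C.uT"
abbreviation "E \<equiv> C.uE"
abbreviation "ui \<equiv> inverse qvar"

lemma T_hom: "i \<in> I ==> uqt.alg_hom (T i)"
  using C.u.T_hom[of i] by (simp add: C_simps)

lemma T_UC: "i \<in> I ==> x \<in> UC ==> T i x \<in> UC"
  using C.u.T_alg[of i x] by (simp add: C_simps)

lemma E_UC: "i \<in> I ==> E i \<in> UC"
  using C.u.gens_alg(1)[of i] by (simp add: C_simps)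

lemma bond_C: "cartan_type.bond a i j = nat (- a i j)"
  "cartan_type.braid_order a i j = (if nat (- a i j) * nat (- a j i) = 0 then 2 else if nat (- a i j) * nat (- a j i) = 1 then 3 else 4)"
  using C.C.bond_def[of i j] C.C.bond_def[of j i] C.C.braid_order_def[of i j] unfolding C_simps by presburger+

lemma T_comm: "i \<in> I ==> j \<in> I ==> i \<noteq> j ==> a i j = 0 ==> x \<in> UC ==> T i (T j x) = T j (T i x)"
  using C.u.braid_relation[of i j x] by (simp add: C_simps bond_C numeral_2_eq_2)

lemma T_braid: "i \<in> I ==> j \<in> I ==> a i j = - 1 ==> x \<in> UC ==> T i (T j (T i x)) = T j (T i (T j x))"
  using C.u.braid_relation[of i j x] a_sym[of i j] a_diag[of i]
  by (cases "i = j") (simp_all add: C_simps bond_C numeral_3_eq_3)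

lemma T_E: "i \<in> I ==> j \<in> I ==> i \<noteq> j ==> a i j = 0 ==> T i (E j) = E j"
  "i \<in> I ==> j \<in> I ==> a i j = - 1 ==> T i (E j) = E j * E i - uscale ui (E i * E j)"
  using C.u.T_E[of i j, unfolded C.u.TE_def] a_diag[of i]
  by (auto simp: C_simps bond_C uqt.tw_def)

lemma T_T_E: "i \<in> I ==> j \<in> I ==> a i j = - 1 ==> T i (T j (E i)) = E j"
  using C.u.rank2_A[of i j] a_diag[of i] a_sym[of i j] by (cases "i = j") (simp_all add: C_simps bond_C)

lemma E_comm: "i \<in> I ==> j \<in> I ==> i \<noteq> j ==> a i j = 0 ==> E i * E j = E j * E i"
  using C.u.E_comm[of i j] by (simp add: C_simps bond_C)

lemma E_serre: "i \<in> I ==> j \<in> I ==> a i j = - 1 ==> uqt.serre_rel qvar 1 (E i) (E j) = 0"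
  using C.u.serre_E[of i j] a_diag[of i] by (cases "i = j") (simp_all add: C_simps bond_C)

lemma hat_single: "{i} \<in> R ==> hatE {i} = E i" "{i} \<in> R ==> hatT {i} = T i"
proof -
  assume r: "{i} \<in> R"
  have "length (orbit_list {i}) = 1" using distinct_card[OF orbit_list_R(1)[OF r]] orbit_list_R(2)[OF r] by simp
  then obtain j where "orbit_list {i} = [j]" by (cases "orbit_list {i}") auto
  hence "orbit_list {i} = [i]" using orbit_list_R(2)[OF r] by simp
  thus "hatE {i} = E i" "hatT {i} = T i" by (simp_all add: hatE_def fun_eq_iff)
qed

lemma hat_double:
  assumes r: "{i, j} \<in> R" "i \<noteq> j"
  shows "hatE {i, j} = E i * E j" "x \<in> UC ==> hatT {i, j} x = T i (T j x)"
proof -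
  have ij: "i \<in> I" "j \<in> I" "a i j = 0" using R_subset[OF r(1)] R_orthogonal[OF r(1)] r(2) by auto
  have len: "length (orbit_list {i, j}) = 2" using distinct_card[OF orbit_list_R(1)[OF r(1)]] orbit_list_R(2)[OF r(1)] r(2) by simp
  then obtain k l where kl: "orbit_list {i, j} = [k, l]" by (auto simp: length_Suc_conv numeral_2_eq_2)
  hence "{k, l} = {i, j}" using orbit_list_R(2)[OF r(1)] by simp
  hence "k = i \<and> l = j \<or> k = j \<and> l = i" using r(2) by (auto simp: doubleton_eq_iff)
  thus "hatE {i, j} = E i * E j" "x \<in> UC ==> hatT {i, j} x = T i (T j x)"
    using E_comm[OF ij(1,2) r(2) ij(3)] T_comm[OF ij(1,2) r(2) ij(3)] by (auto simp: hatE_def kl)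
qed

lemma hatT_UC: "r \<in> R ==> x \<in> UC ==> hatT r x \<in> UC"
  using C.u.foldr_T_alg[of "orbit_list r" x] orbit_list_R(2) R_subset by (simp add: C_simps)

lemma hatE_UC: "r \<in> R ==> hatE r \<in> UC"
proof -
  have "set xs \<subseteq> I ==> prod_list (map E xs) \<in> UC" for xs
    by (induction xs) (auto intro: uqt.alg.one uqt.alg.mult E_UC)
  thus "r \<in> R ==> hatE r \<in> UC" using orbit_list_R(2) R_subset by (simp add: hatE_def)
qed

fun hatX :: "'i set list \<Rightarrow> 'i uqt set" where
  "hatX [] = {}"
| "hatX (r # rs) = insert (hatE r) (hatT r ` hatX rs)"

lemma hatX_append: "hatX (rs @ rs') = hatX rs \<union> foldr hatT rs ` hatX rs'"
  by (induction rs) (auto simp: image_image)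

lemma hatX_nth: "hatX rs = (\<lambda>k. foldr hatT (take k rs) (hatE (rs ! k))) ` {..<length rs}"
  by (induction rs) (simp_all add: lessThan_Suc_eq_insert_0 image_image)

lemma hatX_UC: "set rs \<subseteq> R ==> hatX rs \<subseteq> UC"
  by (induction rs) (auto simp: hatE_UC hatT_UC)

lemma foldr_hatT: "set rs \<subseteq> R ==> uqt.alg_hom (foldr hatT rs)" "set rs \<subseteq> R ==> x \<in> UC ==> foldr hatT rs x \<in> UC"
  using C.u.alg_hom_foldr[of "unfolded rs"] C.u.foldr_T_alg[of "unfolded rs" x] set_unfolded[of rs]
  by (simp_all add: hatT_unfolded C_simps)

lemma hatT_commute:
  assumes rs: "r \<in> R" "s \<in> R" "r \<noteq> s" "aD r s = 0"
  shows "x \<in> UC ==> hatT r (hatT s x) = hatT s (hatT r x)" "hatT r (hatE s) = hatE s"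
proof -
  have a0: "i \<noteq> j \<and> a i j = 0 \<and> i \<in> I \<and> j \<in> I" if "i \<in> r" "j \<in> s" for i j
    using aD_off(3)[OF rs(1-3) rs(4) that] R_disjoint[OF rs(1,2)] rs(3) R_subset rs(1,2) that by blast
  have sw: "T i (foldr T ys x) = foldr T ys (T i x)" if "i \<in> r" "set ys \<subseteq> s" "x \<in> UC" for i ys x
    using that(2)
  proof (induction ys)
    case (Cons j ys)
    have "set ys \<subseteq> I" using Cons.prems R_subset[OF rs(2)] by auto
    hence "foldr T ys x \<in> UC" using C.u.foldr_T_alg[of ys x] that(3) by (simp add: C_simps)
    thus ?case using Cons T_comm[of i j] a0[OF that(1), of j] by simp
  qed simp
  have swf: "foldr T xs (foldr T ys x) = foldr T ys (foldr T xs x)" if "set xs \<subseteq> r" "set ys \<subseteq> s" "x \<in> UC" for xs ys x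
    using that(1)
  proof (induction xs)
    case (Cons i xs)
    have "set xs \<subseteq> I" using Cons.prems R_subset[OF rs(1)] by auto
    hence "foldr T xs x \<in> UC" using C.u.foldr_T_alg[of xs x] that(3) by (simp add: C_simps)
    thus ?case using Cons sw[of i ys "foldr T xs x"] that(2) by simp
  qed simp
  show "x \<in> UC ==> hatT r (hatT s x) = hatT s (hatT r x)"
    using swf[of "orbit_list r" "orbit_list s" x] orbit_list_R(2) rs(1,2) by simp
  have "T i (prod_list (map E ys)) = prod_list (map E ys)" if "i \<in> r" "set ys \<subseteq> s" for i ys
    using that(2)
  proof (induction ys)
    case Nil
    have "i \<in> I" using that R_subset rs by blast
    thus ?case by (simp add: uqt.alg_hom_simps[OF T_hom])
  next
    case (Cons j ys)
    thus ?case using T_E(1)[of i j] a0[OF that(1), of j] by (simp add: uqt.alg_hom_simps[OF T_hom])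
  qed
  hence "foldr T xs (prod_list (map E ys)) = prod_list (map E ys)" if "set xs \<subseteq> r" "set ys \<subseteq> s" for xs ys
    using that by (induction xs) simp_all
  thus "hatT r (hatE s) = hatE s" using orbit_list_R(2) rs(1,2) by (simp add: hatE_def)
qed

lemma moves_zero:
  assumes rs: "r \<in> R" "s \<in> R" "r \<noteq> s" "aD r s = 0"
  shows "x \<in> UC ==> foldr hatT [r, s] x = foldr hatT [s, r] x" "hatX [r, s] = hatX [s, r]"
proof -
  have "aD s r = 0" using aD_sym[OF rs(1,2)] rs(4) R_card[OF rs(2)] by auto
  thus "x \<in> UC ==> foldr hatT [r, s] x = foldr hatT [s, r] x" "hatX [r, s] = hatX [s, r]"
    using hatT_commute[OF rs] hatT_commute(2)[OF rs(2,1)] rs(3) by (auto simp: insert_commute)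
qed

lemma unit_qvar: "unit_scalar uscale qvar ui (inverse (qvar + ui))"
  by unfold_locales (simp_all add: qvar_not_root_of_unity)

lemma moves_single:
  assumes r: "{i} \<in> R" "{j} \<in> R" "a i j = - 1"
  shows "x \<in> UC ==> foldr hatT [{i}, {j}, {i}] x = foldr hatT [{j}, {i}, {j}] x"
    "uqt.alg (hatX [{i}, {j}, {i}]) = uqt.alg (hatX [{j}, {i}, {j}])"
proof -
  have ij: "i \<in> I" "j \<in> I" using R_subset[OF r(1)] R_subset[OF r(2)] by auto
  have ji: "a j i = - 1" using a_sym[OF ij] r(3) by simp
  show "x \<in> UC ==> foldr hatT [{i}, {j}, {i}] x = foldr hatT [{j}, {i}, {j}] x"
    using T_braid[OF ij r(3)] by (simp add: hat_single r)
  have *: "uqt.alg (hatX [{i}, {j}, {i}]) = uqt.alg {E i, E j}" if "a i j = - 1" "{i} \<in> R" "{j} \<in> R" "i \<in> I" "j \<in> I" for i j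
  proof -
    have "hatX [{i}, {j}, {i}] = insert (T i (E j)) {E i, E j}"
      using T_T_E[OF that(4,5,1)] that by (simp only: hatX.simps hat_single image_insert image_empty) auto
    moreover have "T i (E j) \<in> uqt.alg {E i, E j}"
      unfolding T_E(2)[OF that(4,5,1)] by (intro uqt.alg_diff uqt.alg.scale uqt.alg.mult uqt.alg.gen) auto
    ultimately show ?thesis using uqt.alg_insert_eq by simp
  qed
  show "uqt.alg (hatX [{i}, {j}, {i}]) = uqt.alg (hatX [{j}, {i}, {j}])"
    using *[OF r(3,1,2) ij] *[OF ji r(2,1) ij(2,1)] by (simp add: insert_commute)
qed

text \<open>Two disjoint bonds of type A2. Both words give \<open>E i * E i'\<close> and
  \<open>E j * E j'\<close>, and the middle elements are compared by
  \<open>rank_two_squared\<close>.\<close>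

lemma moves_pair:
  assumes r: "{i, i'} \<in> R" "{j, j'} \<in> R" "i \<noteq> i'" "j \<noteq> j'" "{i, i'} \<noteq> {j, j'}"
    and a: "a i j = - 1" "a i' j' = - 1" "a i j' = 0" "a i' j = 0"
  shows "x \<in> UC ==> foldr hatT [{i, i'}, {j, j'}, {i, i'}] x = foldr hatT [{j, j'}, {i, i'}, {j, j'}] x"
    "uqt.alg (hatX [{i, i'}, {j, j'}, {i, i'}]) = uqt.alg (hatX [{j, j'}, {i, i'}, {j, j'}])"
proof -
  interpret u: unit_scalar uscale qvar ui "inverse (qvar + ui)" by (rule unit_qvar)
  have I: "i \<in> I" "i' \<in> I" "j \<in> I" "j' \<in> I" using R_subset[OF r(1)] R_subset[OF r(2)] by auto
  have ne: "i \<noteq> j" "i \<noteq> j'" "i' \<noteq> j" "i' \<noteq> j'" using R_disjoint[OF r(1,2)] r(5) by auto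
  have a0: "a i i' = 0" "a j j' = 0" using R_orthogonal r by auto
  have as: "a j i = - 1" "a j' i' = - 1" "a j' i = 0" "a j i' = 0" "a i' i = 0" "a j' j = 0" using a a0 a_sym I by metis+
  note c = T_comm[OF I(1,2) r(3) a0(1)] T_comm[OF I(3,4) r(4) a0(2)] T_comm[OF I(1,4) ne(2) a(3)] T_comm[OF I(2,3) ne(3) a(4)]
  note uc = T_UC[OF I(1)] T_UC[OF I(2)] T_UC[OF I(3)] T_UC[OF I(4)]
  note hat = hat_double[OF r(1,3)] hat_double[OF r(2,4)]
  {
    fix x assume x: "x \<in> UC"
    have "T i (T i' (T j (T j' (T i (T i' x))))) = T i (T j (T i' (T i (T j' (T i' x)))))"
      using c(3)[of "T i' x"] c(4)[of "T j' (T i (T i' x))"] uc x by simp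
    also have "\<dots> = T i (T j (T i (T i' (T j' (T i' x)))))" using c(1)[of "T j' (T i' x)"] uc x by simp
    also have "\<dots> = T j (T i (T j (T j' (T i' (T j' x)))))"
      using T_braid[OF I(1,3) a(1), of "T i' (T j' (T i' x))"] T_braid[OF I(2,4) a(2) x] uc x by simp
    also have "\<dots> = T j (T j' (T i (T i' (T j (T j' x)))))"
      using c(2)[of "T i' (T j' x)"] c(3)[of "T j (T i' (T j' x))"] c(4)[of "T j' x"] uc x by simp
    finally show "foldr hatT [{i, i'}, {j, j'}, {i, i'}] x = foldr hatT [{j, j'}, {i, i'}, {j, j'}] x"
      using uc x by (simp add: hat)
  }
  have h: "hatX [{i, i'}, {j, j'}, {i, i'}] = {T i (E j) * T i' (E j'), E i * E i', E j * E j'}"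
    if r: "{i, i'} \<in> R" "{j, j'} \<in> R" "i \<noteq> i'" "j \<noteq> j'" and I: "i \<in> I" "i' \<in> I" "j \<in> I" "j' \<in> I"
      and ne: "i \<noteq> j" "i \<noteq> j'" "i' \<noteq> j" "i' \<noteq> j'"
      and a: "a i j = - 1" "a i' j' = - 1" "a i j' = 0" "a i' j = 0" "a j i' = 0" "a j' i = 0" "a i i' = 0" "a i' i = 0" for i i' j j'
  proof -
    note hat = hat_double[OF r(1,3)] hat_double[OF r(2,4)]
    note uc = T_UC[OF I(1)] T_UC[OF I(2)] T_UC[OF I(3)] T_UC[OF I(4)] E_UC I
    note hm = uqt.alg_hom_simps(4)[OF T_hom[OF I(1)]] uqt.alg_hom_simps(4)[OF T_hom[OF I(2)]] uqt.alg_hom_simps(4)[OF T_hom[OF I(3)]] uqt.alg_hom_simps(4)[OF T_hom[OF I(4)]]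
    have m: "E i * E i' \<in> UC" "E j * E j' \<in> UC" using uc by (auto intro: uqt.alg.mult)
    have 1: "hatT {i, i'} (hatE {j, j'}) = T i (E j) * T i' (E j')"
      using m T_E(1)[OF I(2,3) ne(3) a(4)] T_E(1)[OF I(1,4) ne(2) a(3)] T_comm[OF I(1,2) r(3) a(7), of "E j'"] uc by (simp add: hat hm)
    have "T j (T j' (E i)) = T j (E i)" "T j (T j' (E i')) = T j' (E i')"
      using T_E(1)[OF I(4,1) ne(2)[symmetric] a(6)] T_E(1)[OF I(3,2) ne(3)[symmetric] a(5)]
        T_comm[of j j' "E i'"] R_orthogonal[OF r(2), of j j'] r(4) uc by simp_all
    moreover have "T i (T i' (T j (E i))) = E j"
      using T_comm[OF I(1,2) r(3) a(7), of "T j (E i)"] T_T_E[OF I(1,3) a(1)] T_E(1)[OF I(2,3) ne(3) a(4)] uc by simp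
    moreover have "T i (T i' (T j' (E i'))) = E j'"
      using T_T_E[OF I(2,4) a(2)] T_E(1)[OF I(1,4) ne(2) a(3)] uc by simp
    ultimately have 2: "hatT {i, i'} (hatT {j, j'} (hatE {i, i'})) = E j * E j'"
      using m uc by (simp add: hat hm uqt.alg.mult)
    show ?thesis using 1 2 by (simp only: hatX.simps image_insert image_empty) (auto simp: hat(1) hat(3))
  qed
  have e: "T i (E j) * T i' (E j') - T j (E i) * T j' (E i') \<in> uqt.alg {E i * E i', E j * E j'}"
    unfolding T_E(2)[OF I(1,3) a(1)] T_E(2)[OF I(2,4) a(2)] T_E(2)[OF I(3,1) as(1)] T_E(2)[OF I(4,2) as(2)]
    by (rule u.rank_two_squared) (use E_comm I r ne a a0 as in auto)
  show "uqt.alg (hatX [{i, i'}, {j, j'}, {i, i'}]) = uqt.alg (hatX [{j, j'}, {i, i'}, {j, j'}])"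
    unfolding h[OF r(1-4) I ne a as(4,3) a0(1) as(5)] h[OF r(2,1,4,3) I(3,4,1,2) ne(1)[symmetric] ne(3)[symmetric] ne(2)[symmetric] ne(4)[symmetric] as(1,2) as(4,3) a(3,4) a0(2) as(6)]
    using uqt.alg_insert_exchange[OF e] by (simp add: insert_commute)
qed

text \<open>Type A3 with middle node \<open>j\<close>, folded to B2. Both words give
  \<open>y\<close> and \<open>x * z\<close>; besides them the first word gives \<open>B\<close> and
  \<open>Q\<close> and the second one \<open>A\<close> and \<open>P\<close>, in the notation of the
  proof.\<close>

lemma moves_three:
  assumes r: "{j} \<in> R" "{i, k} \<in> R" "i \<noteq> k" and a: "a j i = - 1" "a j k = - 1"
  shows "x \<in> UC ==> foldr hatT [{j}, {i, k}, {j}, {i, k}] x = foldr hatT [{i, k}, {j}, {i, k}, {j}] x"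
    "uqt.alg (hatX [{j}, {i, k}, {j}, {i, k}]) = uqt.alg (hatX [{i, k}, {j}, {i, k}, {j}])"
proof -
  interpret u: unit_scalar uscale qvar ui "inverse (qvar + ui)" by (rule unit_qvar)
  have I: "i \<in> I" "j \<in> I" "k \<in> I" using R_subset[OF r(1)] R_subset[OF r(2)] by auto
  have a0: "a i k = 0" using R_orthogonal r by auto
  have as: "a i j = - 1" "a k j = - 1" "a k i = 0" using a a0 a_sym I by metis+
  note uc = T_UC[OF I(1)] T_UC[OF I(2)] T_UC[OF I(3)]
  note hat = hat_single[OF r(1)] hat_double[OF r(2,3)]
  note c = T_comm[OF I(1,3) r(3) a0]
  note bi = T_braid[OF I(1,2) as(1)] and bk = T_braid[OF I(3,2) as(2)]
  {
    fix x assume x: "x \<in> UC"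
    \<comment> \<open>The chain passes between two reduced words of the longest element of type A3,
      by braid moves between neighbours and commutations of the two ends.\<close>
    have "T j (T i (T k (T j (T i (T k x))))) = T j (T i (T k (T j (T k (T i x)))))" using c[of x] uc x by simp
    also have "\<dots> = T j (T i (T j (T k (T j (T i x)))))" using bk[of "T i x"] uc x by simp
    also have "\<dots> = T i (T j (T i (T k (T j (T i x)))))" using bi[of "T k (T j (T i x))"] uc x by simp
    also have "\<dots> = T i (T j (T k (T i (T j (T i x)))))" using c[of "T j (T i x)"] uc x by simp
    also have "\<dots> = T i (T j (T k (T j (T i (T j x)))))" using bi[of x] uc x by simp
    also have "\<dots> = T i (T k (T j (T k (T i (T j x)))))" using bk[of "T i (T j x)"] uc x by simp
    also have "\<dots> = T i (T k (T j (T i (T k (T j x)))))" using c[of "T j x"] uc x by simp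
    finally show "foldr hatT [{j}, {i, k}, {j}, {i, k}] x = foldr hatT [{i, k}, {j}, {i, k}, {j}] x"
      using uc x by (simp add: hat)
  }
  define x y z where "x = E i" and "y = E j" and "z = E k"
  note hm = uqt.alg_hom_simps(3-7)[OF T_hom[OF I(1)]] uqt.alg_hom_simps(3-7)[OF T_hom[OF I(2)]] uqt.alg_hom_simps(3-7)[OF T_hom[OF I(3)]]
  have UC: "E i \<in> UC" "E j \<in> UC" "E k \<in> UC" using E_UC I by auto
  have m: "E i * E k \<in> UC" using UC by (intro uqt.alg.mult)
  have xz: "x * z = z * x" unfolding x_def z_def by (rule E_comm[OF I(1,3) r(3) a0])
  have S: "uqt.serre_rel qvar 1 y x = 0" "uqt.serre_rel qvar 1 y z = 0"
    unfolding x_def y_def z_def using E_serre[OF I(2,1) a(1)] E_serre[OF I(2,3) a(2)] by simp_all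
  have t: "T i z = z" "T k x = x" "T i y = y * x - uscale ui (x * y)" "T k y = y * z - uscale ui (z * y)"
    "T j x = x * y - uscale ui (y * x)" "T j z = z * y - uscale ui (y * z)"
    unfolding x_def y_def z_def using T_E(1)[OF I(1,3) r(3) a0] T_E(1)[OF I(3,1) r(3)[symmetric] as(3)]
      T_E(2)[OF I(1,2) as(1)] T_E(2)[OF I(3,2) as(2)] T_E(2)[OF I(2,1) a(1)] T_E(2)[OF I(2,3) a(2)] by auto
  have tt: "T i (T j x) = y" "T k (T j z) = y" "T j (T i y) = x" "T j (T k y) = z"
    unfolding x_def y_def z_def using T_T_E[OF I(1,2) as(1)] T_T_E[OF I(3,2) as(2)] T_T_E[OF I(2,1) a(1)] T_T_E[OF I(2,3) a(2)] by auto
  have UCx: "x \<in> UC" "y \<in> UC" "z \<in> UC" using UC by (simp_all add: x_def y_def z_def)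
  define A where "A = (y * x - uscale ui (x * y)) * z - uscale ui (z * (y * x - uscale ui (x * y)))"
  define B where "B = x * (z * y - uscale ui (y * z)) - uscale ui ((z * y - uscale ui (y * z)) * x)"
  define P where "P = (y * z - uscale ui (z * y)) * (y * x - uscale ui (x * y))"
  define Q where "Q = (x * y - uscale ui (y * x)) * (z * y - uscale ui (y * z))"
  have TA: "T i (T k y) = A" unfolding t(4) hm t(1) t(3) A_def ..
  have TB: "T j A = B" unfolding A_def t(3)[symmetric] hm tt(3) t(6) B_def ..
  have Txz: "T j (x * z) = Q" unfolding hm t Q_def ..
  have Tjx: "T i (T k (T j x)) = T k y" "T i (T k (T j z)) = T i y"
    using c[of "T j x"] uc UCx by (simp_all add: tt)
  have TP: "T i (T k (T j (x * z))) = P" unfolding hm Tjx t(3,4) P_def ..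
  have TjP: "T j P = x * z" unfolding P_def t(3,4)[symmetric] hm tt(3,4) xz ..
  have "T i (T k (T j (T i (T k y)))) = T i (T k (T j (T k (T i y))))" using c[of y] UCx by simp
  also have "\<dots> = T i (T j (T k (T j (T i y))))" using bk[of "T i y"] uc UCx by simp
  also have "\<dots> = y" by (simp only: tt(1,3) t(2))
  finally have Ty: "T i (T k (T j (T i (T k y)))) = y" .
  have mem: "x * z \<in> UC" "A \<in> UC" "B \<in> UC" "Q \<in> UC"
    unfolding TA[symmetric] TB[symmetric] Txz[symmetric] using UCx uc by (auto intro: uqt.alg.mult)
  have e: "hatE {j} = y" "hatE {i, k} = x * z" by (simp_all add: hat x_def y_def z_def)
  have 1: "hatX [{j}, {i, k}, {j}, {i, k}] = {Q, B, x * z, y}"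
    unfolding hatX.simps image_insert image_empty e hat(2)
    using mem uc UCx TA TB Txz TP TjP by (auto simp: hat(4))
  have 2: "hatX [{i, k}, {j}, {i, k}, {j}] = {P, A, x * z, y}"
    unfolding hatX.simps image_insert image_empty e hat(2)
    using mem uc UCx TA TB Txz TP Ty by (auto simp: hat(4))
  have "T j (z * x) = (z * y - uscale ui (y * z)) * (x * y - uscale ui (y * x))" unfolding hm t ..
  hence "Q \<in> uqt.alg {B, x * z, y}"
    unfolding Q_def by (intro u.folded_Q[OF xz S qfield_two B_def]) (use Txz xz in \<open>simp add: Q_def\<close>)
  hence q: "uqt.alg {Q, B, x * z, y} = uqt.alg {B, x * z, y}" by (rule uqt.alg_insert_eq)
  have "T i (T k (T j (z * x))) = (y * x - uscale ui (x * y)) * (y * z - uscale ui (z * y))" unfolding hm Tjx t(3,4) ..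
  hence "P \<in> uqt.alg {A, x * z, y}"
    unfolding P_def by (intro u.folded_P[OF xz S qfield_two A_def]) (use TP xz in \<open>simp add: P_def\<close>)
  hence p: "uqt.alg {P, A, x * z, y} = uqt.alg {A, x * z, y}" by (rule uqt.alg_insert_eq)
  have "uqt.alg {A, x * z, y} = uqt.alg {B, x * z, y}"
    by (rule uqt.alg_insert_exchange[OF u.folded_AB[OF xz S qfield_two A_def B_def]])
  thus "uqt.alg (hatX [{j}, {i, k}, {j}, {i, k}]) = uqt.alg (hatX [{i, k}, {j}, {i, k}, {j}])"
    unfolding 1 2 p q by simp
qed

lemma moves:
  assumes rs: "r \<in> R" "s \<in> R" "r \<noteq> s"
  shows "x \<in> UC ==> foldr hatT (alternating (D.C.braid_order r s) r s) x = foldr hatT (alternating (D.C.braid_order r s) s r) x"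
    "uqt.alg (hatX (alternating (D.C.braid_order r s) r s)) = uqt.alg (hatX (alternating (D.C.braid_order r s) s r))"
proof -
  have b: "D.C.bond r s = nat (- aD r s)" for r s by (simp add: D.C.bond_def)
  have two: "(x \<in> UC \<longrightarrow> foldr hatT [r, s, r, s] x = foldr hatT [s, r, s, r] x) \<and>
     uqt.alg (hatX [r, s, r, s]) = uqt.alg (hatX [s, r, s, r])"
    if rs: "r \<in> R" "s \<in> R" "r \<noteq> s" and bond: "aD r s = - 2" "card s = 2 * card r" for r s
  proof -
    have "card r = 1" "card s = 2" using bond R_card[OF rs(1)] R_card[OF rs(2)] by auto
    then obtain j where j: "r = {j}" by (auto simp: card_1_singleton_iff)
    obtain i where i: "i \<in> I" "\<sigma> i \<noteq> i" "s = {i, \<sigma> i}" using rs(2) \<open>card s = 2\<close> by (cases rule: R_cases) auto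
    have "a j i + a j (\<sigma> i) = - 2" using aD_eq[OF rs(1) _ rs(2), of j] j i bond(1) by simp
    moreover have "j \<in> I" "j \<noteq> i" "j \<noteq> \<sigma> i" using R_subset[OF rs(1)] R_disjoint[OF rs(1,2)] rs(3) j i by auto
    ultimately have "a j i = - 1" "a j (\<sigma> i) = - 1" using a_off[of j i] a_off[of j "\<sigma> i"] i(1) \<sigma>_I by auto
    thus ?thesis using moves_three[of j i "\<sigma> i"] rs(1,2) i(2) unfolding j i(3) by auto
  qed
  have three: "(x \<in> UC \<longrightarrow> foldr hatT [r, s, r] x = foldr hatT [s, r, s] x) \<and> uqt.alg (hatX [r, s, r]) = uqt.alg (hatX [s, r, s])"
    if bond: "aD r s = - 1" "aD s r = - 1" "card r = card s"
  proof (cases "card r = 1")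
    case True
    then obtain i j where ij: "r = {i}" "s = {j}" using bond(3) by (auto simp: card_1_singleton_iff)
    have "a i j = - 1" using aD_eq[OF rs(1) _ rs(2), of i] ij bond(1) by simp
    thus ?thesis using moves_single[of i j] rs unfolding ij by auto
  next
    case False
    hence "card r = 2" "card s = 2" using R_card[OF rs(1)] bond(3) by auto
    obtain i where i: "i \<in> I" "\<sigma> i \<noteq> i" "r = {i, \<sigma> i}" using rs(1) \<open>card r = 2\<close> by (cases rule: R_cases) auto
    obtain k where k: "k \<in> I" "\<sigma> k \<noteq> k" "s = {k, \<sigma> k}" using rs(2) \<open>card s = 2\<close> by (cases rule: R_cases) auto
    have ne: "x \<noteq> y" if "x \<in> r" "y \<in> s" for x y using R_disjoint[OF rs(1,2)] rs(3) that by blast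
    have off: "a x y = 0 \<or> a x y = - 1" if "x \<in> r" "y \<in> s" for x y
      using a_off[of x y] ne[OF that] R_subset[OF rs(1)] R_subset[OF rs(2)] that by blast
    have "a i k + a i (\<sigma> k) = - 1" using aD_eq[OF rs(1) _ rs(2), of i] i k bond(1) by simp
    hence "a i k = - 1 \<or> a i (\<sigma> k) = - 1" using off[of i k] off[of i "\<sigma> k"] i k by auto
    \<comment> \<open>Replacing \<open>k\<close> by \<open>\<sigma> k\<close> if necessary, the
      representative of \<open>s\<close> is chosen to be bonded to \<open>i\<close>.\<close>
    then obtain j where j: "j \<in> I" "\<sigma> j \<noteq> j" "s = {j, \<sigma> j}" "a i j = - 1"
      using k \<sigma>\<sigma>[OF k(1)] \<sigma>_I[OF k(1)] by (elim disjE) (auto simp: insert_commute)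
    have "a i j + a i (\<sigma> j) = - 1" using aD_eq[OF rs(1) _ rs(2), of i] i j bond(1) by simp
    hence 1: "a i (\<sigma> j) = 0" using j(4) by simp
    have "a (\<sigma> i) (\<sigma> j) = - 1" "a (\<sigma> i) j = 0"
      using \<sigma>_a[OF i(1) j(1)] \<sigma>_a[OF i(1) \<sigma>_I[OF j(1)]] \<sigma>\<sigma>[OF j(1)] j(4) 1 by simp_all
    thus ?thesis using moves_pair[of i "\<sigma> i" j "\<sigma> j"] rs i j 1 by auto
  qed
  have RD: "r \<in> index D" "s \<in> index D" using rs by (simp_all add: D_simps)
  have "(x \<in> UC \<longrightarrow> foldr hatT (alternating (D.C.braid_order r s) r s) x = foldr hatT (alternating (D.C.braid_order r s) s r) x) \<and>
    uqt.alg (hatX (alternating (D.C.braid_order r s) r s)) = uqt.alg (hatX (alternating (D.C.braid_order r s) s r))"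
    using RD rs(3)
  proof (cases rule: D.C.bond_cases)
    case zero
    hence "aD r s = 0" using aD_off(1)[OF rs] by (auto simp: b)
    thus ?thesis using moves_zero[OF rs] zero by (simp add: D.C.braid_order_def numeral_2_eq_2)
  next
    case one
    hence "aD r s = - 1" "aD s r = - 1" by (auto simp: b)
    thus ?thesis using three one by (simp add: D.C.braid_order_def numeral_3_eq_3 D_simps)
  next
    case left
    hence "aD r s = - 2" by (auto simp: b)
    thus ?thesis using two[OF rs] left by (simp add: D.C.braid_order_def eval_nat_numeral D_simps)
  next
    case right
    hence "aD s r = - 2" by (auto simp: b)
    thus ?thesis using two[OF rs(2,1) rs(3)[symmetric]] right by (simp add: D.C.braid_order_def eval_nat_numeral D_simps)
  qed
  thus "x \<in> UC ==> foldr hatT (alternating (D.C.braid_order r s) r s) x = foldr hatT (alternating (D.C.braid_order r s) s r) x"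
    "uqt.alg (hatX (alternating (D.C.braid_order r s) r s)) = uqt.alg (hatX (alternating (D.C.braid_order r s) s r))" by auto
qed

lemma alg_hatX_braid_equiv:
  "D.w.braid_equiv rs rs' ==> uqt.alg (hatX rs) = uqt.alg (hatX rs')"
proof (induction rule: D.w.braid_equiv.induct)
  case (move r s us vs)
  hence rs: "r \<in> R" "s \<in> R" "r \<noteq> s" and us: "set us \<subseteq> R" and vs: "set vs \<subseteq> R" by (simp_all add: D_simps)
  let ?b = "alternating (D.C.braid_order r s) r s" and ?b' = "alternating (D.C.braid_order r s) s r"
  have "foldr hatT ?b ` hatX vs = foldr hatT ?b' ` hatX vs"
    by (rule image_cong[OF refl], rule moves(1)[OF rs], rule subsetD[OF hatX_UC[OF vs]])
  hence z: "foldr hatT us ` foldr hatT ?b ` hatX vs = foldr hatT us ` foldr hatT ?b' ` hatX vs" by simp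
  have m: "uqt.alg (foldr hatT us ` hatX ?b) = uqt.alg (foldr hatT us ` hatX ?b')"
    unfolding uqt.alg_hom_alg[OF foldr_hatT(1)[OF us], symmetric] moves(2)[OF rs] ..
  have u: "uqt.alg (X \<union> (Y \<union> Z)) \<subseteq> uqt.alg (X \<union> (Y' \<union> Z))" if "uqt.alg Y \<subseteq> uqt.alg Y'" for X Y Y' Z :: "'i uqt set"
  proof -
    have "Y \<subseteq> uqt.alg Y'" using that uqt.alg_subset_iff by blast
    also have "\<dots> \<subseteq> uqt.alg (X \<union> (Y' \<union> Z))" by (rule uqt.alg_mono) blast
    finally show ?thesis unfolding uqt.alg_subset_iff by (auto intro: uqt.alg.gen)
  qed
  show ?case unfolding hatX_append foldr_append o_def image_Un image_image[symmetric] z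
    by (intro equalityI u) (simp_all only: m order.refl)
qed simp_all

end

section \<open>Quantum foldings\<close>

context scaled_ring
begin

lemma sc_power: "sc c x ^ n = sc (c ^ n) (x ^ n)"
  by (induction n) (simp_all add: mult_ac)

lemma prod_list_sc:
  "prod_list (map (\<lambda>k. sc (c k) (y k)) ks) = sc (prod_list (map c ks)) (prod_list (map y ks))"
  by (induction ks) (simp_all add: mult_ac)

lemma prod_list_powers_alg:
  "(\<And>k. k \<in> set ks ==> y k \<in> alg S) ==> prod_list (map (\<lambda>k. y k ^ n k) ks) \<in> alg S"
proof (induction ks)
  case (Cons k ks)
  have "x ^ m \<in> alg S" if "x \<in> alg S" for x m
    using that by (induction m) (auto intro: alg.one alg.mult)
  thus ?case using Cons by (auto intro: alg.mult)
qed (simp add: alg.one)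

lemma lspan_linear_image:
  fixes sc' :: "'k \<Rightarrow> 's::ring_1 \<Rightarrow> 's"
  assumes sc': "scaled_ring sc'"
    and g: "\<And>x y. g (x + y) = g x + g y" "\<And>c x. g (sc c x) = sc' c (g x)" "\<And>x. x \<in> S ==> g x \<in> scaled_ring.alg sc' S'"
    and x: "x \<in> lspan S"
  shows "g x \<in> scaled_ring.alg sc' S'"
proof -
  interpret s': scaled_ring sc' by (rule sc')
  show ?thesis using x
  proof induction
    case zero
    show ?case using g(2)[of 0 0] s'.alg.scale[OF s'.alg.one, of 0 S'] by simp
  next
    case (add x y c)
    thus ?case by (simp add: g s'.alg.add s'.alg.scale)
  qed
qed

lemma vector_space: "vector_space sc"
  by unfold_locales (simp_all add: sc_distribs)

text \<open>The \<open>b x\<close> are completed to a basis of the whole ring as a vector space;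
  outside their span nothing is said about \<open>g\<close>.\<close>

lemma linear_extension:
  fixes sc' :: "'k \<Rightarrow> 's::ring_1 \<Rightarrow> 's" and b :: "'x \<Rightarrow> 'r" and t :: "'x \<Rightarrow> 's"
  assumes sc': "scaled_ring sc'"
    and ind: "\<And>S c x. finite S ==> S \<subseteq> X ==> (\<Sum>x\<in>S. sc (c x) (b x)) = 0 ==> x \<in> S ==> c x = 0"
  obtains g where "\<And>x y. g (x + y) = g x + g y" "\<And>c x. g (sc c x) = sc' c (g x)" "\<And>x. x \<in> X ==> g (b x) = t x"
proof -
  interpret s': scaled_ring sc' by (rule sc')
  interpret p: vector_space_pair sc sc'
    by (intro vector_space_pair.intro vector_space s'.vector_space)
  have inj: "inj_on b X"
  proof (rule inj_onI, rule ccontr)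
    fix x y assume xy: "x \<in> X" "y \<in> X" "b x = b y" "x \<noteq> y"
    hence "(\<Sum>z\<in>{x, y}. sc (if z = x then 1 else - 1) (b z)) = 0" by (simp add: sc_minus_left)
    from ind[OF _ _ this, of x] xy show False by simp
  qed
  have "p.vs1.independent (b ` X)"
    unfolding p.vs1.independent_explicit_module
  proof (intro allI impI)
    fix S u v assume S: "finite S" "S \<subseteq> b ` X" "(\<Sum>v\<in>S. sc (u v) v) = 0" "v \<in> S"
    obtain S' where S': "S' \<subseteq> X" "finite S'" "S = b ` S'" using finite_subset_image[OF S(1,2)] by blast
    obtain x where x: "x \<in> S'" "v = b x" using S(4) S'(3) by blast
    have "(\<Sum>x\<in>S'. sc (u (b x)) (b x)) = 0"
      using S(3) sum.reindex[OF inj_on_subset[OF inj S'(1)], of "\<lambda>v. sc (u v) v"] by (simp add: S'(3))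
    from ind[OF S'(2,1) this x(1)] show "u v = 0" by (simp add: x(2))
  qed
  from p.linear_independent_extend[OF this, of "\<lambda>v. t (inv_into X b v)"]
  obtain g where g: "Vector_Spaces.linear sc sc' g" "\<forall>v\<in>b ` X. g v = t (inv_into X b v)" by blast
  interpret g: Vector_Spaces.linear sc sc' g by (rule g(1))
  show ?thesis by (rule that[of g]) (use g(2) inj in \<open>simp_all add: g.add g.scale inv_into_f_f\<close>)
qed

end

lemma prod_list_nonzero: "(\<And>k. k \<in> set ks ==> f k \<noteq> 0) ==> prod_list (map f ks) \<noteq> (0 :: 'k :: field)"
  by (induction ks) auto

lemma prod_list_unit_exponent:
  fixes y :: "nat \<Rightarrow> 'r :: monoid_mult"
  assumes "k < n" shows "prod_list (map (\<lambda>j. y j ^ ((replicate n 0)[k := 1] ! j)) [0..<n]) = y k"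
proof -
  have 1: "prod_list (map (\<lambda>j. y j ^ (if j = k then 1 else 0)) js) = 1" if "k \<notin> set js" for js
    using that by (induction js) auto
  have "[0..<n] = [0..<k] @ k # [Suc k..<n]" using assms upt_add_eq_append[of 0 k "n - k"] upt_conv_Cons[of k n] by simp
  moreover have "map (\<lambda>j. y j ^ ((replicate n 0)[k := 1] ! j)) [0..<n] = map (\<lambda>j. y j ^ (if j = k then 1 else 0)) [0..<n]"
    by (rule map_cong[OF refl]) (use assms in \<open>auto simp: nth_list_update\<close>)
  ultimately show ?thesis using 1[of "[0..<k]"] 1[of "[Suc k..<n]"] by (simp only: map_append list.map prod_list.append prod_list.Cons) simp
qed

section \<open>Values of the PBW generators and monomials\<close>

context uq_datum
begin

lemma gamma_neq_0: "gamma C v \<noteq> 0"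
proof -
  have "qi C i - inverse (qi C i) \<noteq> 0" if "i \<in> I" for i
  proof
    assume "qi C i - inverse (qi C i) = 0"
    hence "qi C i * qi C i = qi C i * inverse (qi C i)" by simp
    hence "qi C i ^ 2 = 1" using qi_neq_0[of i] by (simp add: power2_eq_square)
    thus False using qi_nonroot[OF that] unfolding not_root_of_unity_def by (metis zero_less_numeral)
  qed
  thus ?thesis unfolding gamma_def by (cases "finite I") simp_all
qed

lemma scaled_monomial_val:
  assumes X: "\<And>k. k < n ==> X k \<in> carrier (uq C) \<and> val (X k) = uscale (c k) (y k)" and n: "length as = n"
  shows "ordered_monomial (uq C) (map X [0..<n]) as \<in> carrier (uq C) \<and>
    val (ordered_monomial (uq C) (map X [0..<n]) as) =
      uscale (prod_list (map (\<lambda>k. c k ^ (as ! k)) [0..<n])) (prod_list (map (\<lambda>k. y k ^ (as ! k)) [0..<n]))"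
proof -
  have "zip (map X [0..<n]) as = zip (map X [0..<n]) (map ((!) as) [0..<n])" using n map_nth[of as] by simp
  also have "\<dots> = map (\<lambda>k. (X k, as ! k)) [0..<n]" by (simp add: zip_map_map zip_same_conv_map)
  finally have "map (\<lambda>(x, n). val x ^ n) (zip (map X [0..<n]) as) = map (\<lambda>k. val (X k) ^ (as ! k)) [0..<n]" by simp
  also have "\<dots> = map (\<lambda>k. uscale (c k ^ (as ! k)) (y k ^ (as ! k))) [0..<n]"
    by (rule map_cong[OF refl]) (simp add: X uqt.sc_power)
  finally have "prod_list (map (\<lambda>(x, n). val x ^ n) (zip (map X [0..<n]) as)) =
      uscale (prod_list (map (\<lambda>k. c k ^ (as ! k)) [0..<n])) (prod_list (map (\<lambda>k. y k ^ (as ! k)) [0..<n]))"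
    by (simp only: uqt.prod_list_sc)
  moreover have "set (map X [0..<n]) \<subseteq> carrier (uq C)" using X by auto
  moreover have "length (map X [0..<n]) = length as" using n by simp
  ultimately show ?thesis using ordered_monomial_val[of "map X [0..<n]" as] by simp
qed

lemma pbw_gen_val:
  assumes "set rs \<subseteq> I" "k < length rs"
  shows "pbw_gen C rs k \<in> carrier (uq C) \<and> val (pbw_gen C rs k) =
    uscale (inverse (gamma C (weyl_word C (take k rs) (simple_root (rs ! k)) - simple_root (rs ! k))))
      (foldr uT (take k rs) (uE (rs ! k)))"
proof -
  have "rs ! k \<in> I" "set (take k rs) \<subseteq> I" using assms set_take_subset[of k rs] by auto
  thus ?thesis unfolding pbw_gen_def
    using foldr_braid_T_val[of "take k rs" "uq_E C (rs ! k)"] by (simp add: uq_closed val_ops)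
qed

end

context folding
begin

lemma hat_E_val: "r \<in> R ==> hat_E C r \<in> carrier (uq C) \<and> C.val (hat_E C r) = hatE r"
proof -
  have "foldr (\<lambda>i y. uq_E C i \<otimes>\<^bsub>uq C\<^esub> y) xs \<one>\<^bsub>uq C\<^esub> \<in> carrier (uq C) \<and>
     C.val (foldr (\<lambda>i y. uq_E C i \<otimes>\<^bsub>uq C\<^esub> y) xs \<one>\<^bsub>uq C\<^esub>) = prod_list (map E xs)" if "set xs \<subseteq> C.I" for xs
    using that by (induction xs) (simp_all add: C.uq_closed C.val_ops)
  thus "r \<in> R ==> ?thesis" unfolding hat_E_def hatE_def
    using orbit_list_R(2)[of r] R_subset[of r] by (simp add: C_simps)
qed

abbreviation "root_vector rs k \<equiv> foldr hatT (take k rs) (hatE (rs ! k))"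

lemma hat_pbw_gen_val:
  assumes "set rs \<subseteq> R" "k < length rs"
  shows "hat_pbw_gen C rs k \<in> carrier (uq C) \<and> C.val (hat_pbw_gen C rs k) =
    uscale (inverse (\<Prod>i\<in>rs ! k. gamma C (foldr (hat_reflection C) (take k rs) (simple_root i) - simple_root i)))
      (root_vector rs k)"
proof -
  have rs: "rs ! k \<in> R" "set (take k rs) \<subseteq> R" using assms set_take_subset[of k rs] by auto
  have "foldr (hat_T C) us = foldr (braid_T C) (unfolded us)" for us
    by (simp add: unfolded_def foldr_concat_map hat_T_def[abs_def])
  thus ?thesis unfolding hat_pbw_gen_def
    using C.foldr_braid_T_val[of "unfolded (take k rs)" "hat_E C (rs ! k)"] hat_E_val[OF rs(1)] set_unfolded[OF rs(2)]
    by (simp add: C.uq_closed C.val_ops hatT_unfolded C_simps)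
qed

section \<open>The folding attached to one reduced word of the longest element\<close>

context
  fixes rs
  assumes red: "D.w.reduced rs" and neg: "\<And>j. j \<in> index D ==> D.w.neg (weyl_word D rs (simple_root j))"
begin

abbreviation "folded_monomial as \<equiv> ordered_monomial (uq D) (map (pbw_gen D rs) [0..<length rs]) as"
abbreviation "hat_monomial as \<equiv> ordered_monomial (uq C) (map (hat_pbw_gen C rs) [0..<length rs]) as"

lemma folded_monomial:
  assumes "length as = length rs"
  shows "folded_monomial as \<in> carrier (uq D)" "\<exists>c. c \<noteq> 0 \<and> D.val (folded_monomial as) = uscale c (D.u.pbw rs as 1)"
proof -
  have rs: "set rs \<subseteq> index D" by (rule D.w.reduced_set[OF red])
  note m = D.scaled_monomial_val[where X = "pbw_gen D rs", OF D.pbw_gen_val[OF rs] assms]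
  show "folded_monomial as \<in> carrier (uq D)" using m by blast
  have "prod_list (map (\<lambda>k. inverse (gamma D (weyl_word D (take k rs) (simple_root (rs ! k)) - simple_root (rs ! k))) ^ as ! k) [0..<length rs]) \<noteq> 0"
    by (rule prod_list_nonzero) (simp add: D.gamma_neq_0)
  thus "\<exists>c. c \<noteq> 0 \<and> D.val (folded_monomial as) = uscale c (D.u.pbw rs as 1)"
    using m D.u.pbw_eq_prod[OF rs assms] by auto
qed

lemma hat_monomial:
  assumes "length as = length rs"
  shows "hat_monomial as \<in> carrier (uq C)"
    "\<exists>c. c \<noteq> 0 \<and> C.val (hat_monomial as) = uscale c (prod_list (map (\<lambda>k. root_vector rs k ^ as ! k) [0..<length rs]))"
proof -
  have rs: "set rs \<subseteq> R" using D.w.reduced_set[OF red] by (simp add: D_simps)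
  note m = C.scaled_monomial_val[where X = "hat_pbw_gen C rs", OF hat_pbw_gen_val[OF rs] assms]
  show "hat_monomial as \<in> carrier (uq C)" using m by blast
  have "prod_list (map (\<lambda>k. inverse (\<Prod>i\<in>rs ! k. gamma C (foldr (hat_reflection C) (take k rs) (simple_root i) - simple_root i)) ^ as ! k) [0..<length rs]) \<noteq> 0"
  proof (rule prod_list_nonzero)
    fix k assume "k \<in> set [0..<length rs]"
    hence "rs ! k \<in> R" using rs nth_mem[of k rs] by (auto simp del: nth_mem)
    hence "finite (rs ! k)" by (rule R_finite)
    thus "inverse (\<Prod>i\<in>rs ! k. gamma C (foldr (hat_reflection C) (take k rs) (simple_root i) - simple_root i)) ^ as ! k \<noteq> 0"
      by (simp add: C.gamma_neq_0)
  qed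
  thus "\<exists>c. c \<noteq> 0 \<and> C.val (hat_monomial as) = uscale c (prod_list (map (\<lambda>k. root_vector rs k ^ as ! k) [0..<length rs]))"
    using m by auto
qed

lemma root_vector_Up: "k < length rs ==> root_vector rs k \<in> C.u.Up"
proof -
  assume k: "k < length rs"
  have "D.w.reduced (take n rs)" for n
  proof (induction "length rs - n" arbitrary: n)
    case 0 thus ?case using red by simp
  next
    case (Suc d)
    hence n: "n < length rs" by simp
    have "D.w.reduced (take (Suc n) rs)" using Suc by simp
    thus ?case using D.w.neg_last(1)[of "take n rs" "rs ! n"] by (simp add: take_Suc_conv_app_nth[OF n])
  qed
  from this[of "Suc k"] show ?thesis using hatX_positive[of "take k rs" "rs ! k"] by (simp add: take_Suc_conv_app_nth[OF k])
qed

lemma hat_monomial_plus: "length as = length rs ==> C.val (hat_monomial as) \<in> C.u.Up"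
  using hat_monomial(2)[of as] uqt.prod_list_powers_alg[of "[0..<length rs]" "root_vector rs" "E ` index C" "(!) as"] root_vector_Up
  unfolding C.u.Up_def by (auto intro: uqt.alg.scale)

lemma folded_monomial_independent:
  assumes "finite S" "S \<subseteq> {as. length as = length rs}" "(\<Sum>as\<in>S. uscale (c as) (D.val (folded_monomial as))) = 0" "as \<in> S"
  shows "c as = 0"
proof -
  have "\<exists>e. \<forall>as\<in>{as. length as = length rs}. e as \<noteq> 0 \<and> D.val (folded_monomial as) = uscale (e as) (D.u.pbw rs as 1)"
    by (rule bchoice) (use folded_monomial(2) in blast)
  then obtain e where e: "length as = length rs ==> e as \<noteq> 0 \<and> D.val (folded_monomial as) = uscale (e as) (D.u.pbw rs as 1)" for as
    by blast
  \<comment> \<open>A bound on all exponents in \<open>S\<close>, since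
    \<open>pbw_independent\<close> is stated for a box of exponents; 0 is inserted for the case that
    there are none.\<close>
  define N where "N = Max (insert 0 (\<Union>as\<in>S. set as))"
  have N: "S \<subseteq> D.u.exponents (length rs) N"
  proof
    fix as assume "as \<in> S"
    hence "length as = length rs" "set as \<subseteq> {..N}" using assms(1,2) by (auto simp: N_def intro!: Max_ge)
    thus "as \<in> D.u.exponents (length rs) N" by (simp add: D.u.exponents_def)
  qed
  have "(\<Sum>as\<in>D.u.exponents (length rs) N. uscale (if as \<in> S then c as * e as else 0) (D.u.pbw rs as 1)) =
     (\<Sum>as\<in>S. uscale (if as \<in> S then c as * e as else 0) (D.u.pbw rs as 1))"
    by (rule sum.mono_neutral_right[OF D.u.finite_exponents N]) simp
  also have "\<dots> = (\<Sum>as\<in>S. uscale (c as) (D.val (folded_monomial as)))"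
    by (rule sum.cong[OF refl]) (use e assms(2) in auto)
  finally have "(if as \<in> S then c as * e as else 0) = 0"
    unfolding assms(3) by (rule D.u.pbw_independent[OF red]) (use N assms(4) in blast)
  thus ?thesis using assms(2,4) e by auto
qed

lemma folded_monomial_spanning:
  assumes "x \<in> D.u.Up" shows "x \<in> uqt.lspan (D.val ` folded_monomial ` {as. length as = length rs})"
proof (rule uqt.lspan_subset[OF _ D.u.pbw_spanning[OF red neg assms]])
  show "{D.u.pbw rs as 1 | as. length as = length rs} \<subseteq> uqt.lspan (D.val ` folded_monomial ` {as. length as = length rs})"
  proof
    fix y assume "y \<in> {D.u.pbw rs as 1 | as. length as = length rs}"
    then obtain as where as: "length as = length rs" "y = D.u.pbw rs as 1" by blast
    obtain c where c: "c \<noteq> 0" "D.val (folded_monomial as) = uscale c y" using folded_monomial(2)[OF as(1)] as(2) by blast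
    have "uscale (inverse c) (D.val (folded_monomial as)) \<in> uqt.lspan (D.val ` folded_monomial ` {as. length as = length rs})"
      by (intro uqt.lspan_scale uqt.lspan_gen imageI) (simp add: as)
    thus "y \<in> uqt.lspan (D.val ` folded_monomial ` {as. length as = length rs})" using c by simp
  qed
qed auto

lemma folded_monomial_plus: "length as = length rs ==> folded_monomial as \<in> uq_plus D"
proof -
  assume as: "length as = length rs"
  obtain c where "D.val (folded_monomial as) = uscale c (D.u.pbw rs as 1)" using folded_monomial(2)[OF as] by blast
  hence "D.val (folded_monomial as) \<in> D.u.Up"
    using D.u.pbw_Up[OF red as] by (simp add: D.u.Up_def uqt.alg.scale)
  then obtain X where "X \<in> uq_plus D" "D.val X = D.val (folded_monomial as)" unfolding D.val_uq_plus[symmetric] by auto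
  thus ?thesis using D.val_inj[of X "folded_monomial as"] D.uq_plus_carrier folded_monomial(1)[OF as] by auto
qed

text \<open>Each root vector is, up to a nonzero scalar, the monomial with a single exponent 1, and
  conversely the monomials are products of root vectors.\<close>

lemma alg_hat_monomials:
  "uqt.alg (C.val ` hat_monomial ` {as. length as = length rs}) = uqt.alg (hatX rs)"
proof (intro equalityI, unfold uqt.alg_subset_iff)
  show "C.val ` hat_monomial ` {as. length as = length rs} \<subseteq> uqt.alg (hatX rs)"
  proof (intro subsetI, elim imageE, clarify)
    fix as :: "nat list" assume as: "length as = length rs"
    obtain c where c: "C.val (hat_monomial as) = uscale c (prod_list (map (\<lambda>k. root_vector rs k ^ as ! k) [0..<length rs]))"
      using hat_monomial(2)[OF as] by blast
    show "C.val (hat_monomial as) \<in> uqt.alg (hatX rs)"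
      unfolding c by (intro uqt.alg.scale uqt.prod_list_powers_alg uqt.alg.gen) (simp add: hatX_nth)
  qed
  show "hatX rs \<subseteq> uqt.alg (C.val ` hat_monomial ` {as. length as = length rs})"
    unfolding hatX_nth
  proof
    fix y assume "y \<in> root_vector rs ` {..<length rs}"
    then obtain k where k: "k < length rs" "y = root_vector rs k" by auto
    define as :: "nat list" where "as = (replicate (length rs) 0)[k := 1]"
    have as: "length as = length rs" by (simp add: as_def)
    obtain c where c: "c \<noteq> 0" "C.val (hat_monomial as) = uscale c (prod_list (map (\<lambda>k. root_vector rs k ^ as ! k) [0..<length rs]))"
      using hat_monomial(2)[OF as] by blast
    hence "C.val (hat_monomial as) = uscale c y" using prod_list_unit_exponent[OF k(1), of "root_vector rs"] k(2) by (simp add: as_def)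
    moreover have "uscale (inverse c) (C.val (hat_monomial as)) \<in> uqt.alg (C.val ` hat_monomial ` {as. length as = length rs})"
      by (intro uqt.alg.scale uqt.alg.gen imageI) (simp add: as)
    ultimately show "y \<in> uqt.alg (C.val ` hat_monomial ` {as. length as = length rs})" using c(1) by simp
  qed
qed

lemma plus_val_eqI: "X \<in> uq_plus C ==> Y \<in> carrier (uq C) ==> C.val X = C.val Y ==> X = Y"
  using C.val_inj[of X Y] C.uq_plus_carrier by auto

text \<open>Evaluates the description in \<open>quantum_folding\<close>. Independence of the folded
  monomials gives a linear \<open>g\<close>, from which a map with the required properties is built;
  as the monomials span \<open>uq_plus D\<close>, every such map agrees with
  \<open>g\<close>.\<close>

lemma quantum_folding_val:
  obtains g where "\<And>x y. g (x + y) = g x + g y" "\<And>c x. g (uscale c x) = uscale c (g x)"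
    "\<And>as. length as = length rs ==> g (D.val (folded_monomial as)) = C.val (hat_monomial as)"
    "\<And>X. X \<in> uq_plus D ==> quantum_folding C D rs X \<in> uq_plus C \<and> C.val (quantum_folding C D rs X) = g (D.val X)"
proof -
  let ?M = "{as :: nat list. length as = length rs}"
  obtain g where g: "\<And>x y. g (x + y) = g x + g y" "\<And>c x. g (uscale c x) = uscale c (g x)"
    "\<And>as. as \<in> ?M ==> g (D.val (folded_monomial as)) = C.val (hat_monomial as)"
    by (rule uqt.linear_extension[OF uqt.scaled_ring_axioms, of ?M "\<lambda>as. D.val (folded_monomial as)" "\<lambda>as. C.val (hat_monomial as)"])
      (use folded_monomial_independent in blast)+
  have Up: "g x \<in> C.u.Up" if "x \<in> D.u.Up" for x
    unfolding C.u.Up_def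
    by (rule uqt.lspan_linear_image[OF uqt.scaled_ring_axioms g(1,2) _ folded_monomial_spanning[OF that]])
      (use hat_monomial_plus g(3) in \<open>auto simp: C.u.Up_def\<close>)
  have "\<forall>X\<in>uq_plus D. \<exists>Y. Y \<in> uq_plus C \<and> C.val Y = g (D.val X)"
  proof
    fix X assume "X \<in> uq_plus D"
    hence "g (D.val X) \<in> C.val ` uq_plus C" using Up[of "D.val X"] D.val_uq_plus C.val_uq_plus by auto
    thus "\<exists>Y. Y \<in> uq_plus C \<and> C.val Y = g (D.val X)" by auto
  qed
  from bchoice[OF this] obtain f0 where f0: "\<forall>X\<in>uq_plus D. f0 X \<in> uq_plus C \<and> C.val (f0 X) = g (D.val X)" by blast
  define f where "f = restrict f0 (uq_plus D)"
  have f: "X \<in> uq_plus D ==> f X \<in> uq_plus C" "X \<in> uq_plus D ==> C.val (f X) = g (D.val X)" for X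
    using f0 by (auto simp: f_def)
  have Dp: "X \<oplus>\<^bsub>uq D\<^esub> Y \<in> uq_plus D" "uq_scale D c X \<in> uq_plus D" if "X \<in> uq_plus D" "Y \<in> uq_plus D" for X Y c
  proof -
    have XY: "X \<in> carrier (uq D)" "Y \<in> carrier (uq D)" "D.val X \<in> D.u.Up" "D.val Y \<in> D.u.Up"
      using that D.uq_plus_carrier D.val_uq_plus by auto
    have mem: "Z \<in> uq_plus D" if Z: "Z \<in> carrier (uq D)" "D.val Z \<in> D.u.Up" for Z
    proof -
      obtain Z' where "Z' \<in> uq_plus D" "D.val Z' = D.val Z" using Z(2) unfolding D.val_uq_plus[symmetric] by auto
      thus ?thesis using D.val_inj[of Z' Z] Z(1) D.uq_plus_carrier by auto
    qed
    show "X \<oplus>\<^bsub>uq D\<^esub> Y \<in> uq_plus D" "uq_scale D c X \<in> uq_plus D"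
      by (rule mem; use XY in \<open>simp add: D.uq_closed D.val_ops D.u.Up_def uqt.alg.add uqt.alg.scale\<close>)+
  qed
  have carr: "X \<in> uq_plus D ==> X \<in> carrier (uq D)" "Y \<in> uq_plus C ==> Y \<in> carrier (uq C)" for X Y
    using D.uq_plus_carrier C.uq_plus_carrier by auto
  let ?P = "\<lambda>f. f \<in> uq_plus D \<rightarrow>\<^sub>E uq_plus C \<and> uq_linear_on D C (uq_plus D) f \<and>
        (\<forall>as. length as = length rs \<longrightarrow> f (folded_monomial as) = hat_monomial as)"
  have Pf: "?P f"
  proof (intro conjI)
    show "f \<in> uq_plus D \<rightarrow>\<^sub>E uq_plus C" using f0 by (auto simp: f_def)
    show "uq_linear_on D C (uq_plus D) f" unfolding uq_linear_on_def
    proof (intro conjI ballI allI)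
      fix X Y assume XY: "X \<in> uq_plus D" "Y \<in> uq_plus D"
      show "f (X \<oplus>\<^bsub>uq D\<^esub> Y) = f X \<oplus>\<^bsub>uq C\<^esub> f Y"
        by (rule plus_val_eqI) (use XY in \<open>simp_all add: f Dp carr C.uq_closed C.val_ops D.val_ops g(1)\<close>)
    next
      fix c X assume X: "X \<in> uq_plus D"
      show "f (uq_scale D c X) = uq_scale C c (f X)"
        by (rule plus_val_eqI) (use X in \<open>simp_all add: f Dp carr C.uq_closed C.val_ops D.val_ops g(2)\<close>)
    qed
    show "\<forall>as. length as = length rs \<longrightarrow> f (folded_monomial as) = hat_monomial as"
      by (intro allI impI plus_val_eqI) (simp_all add: f folded_monomial_plus hat_monomial(1) g(3))
  qed
  have val: "C.val (f' X) = g (D.val X)" if f': "?P f'" and X: "X \<in> uq_plus D" for f' X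
  proof -
    have C': "Y \<in> uq_plus D ==> f' Y \<in> carrier (uq C)" for Y using f' carr(2) by auto
    have lin: "f' (Y \<oplus>\<^bsub>uq D\<^esub> Z) = f' Y \<oplus>\<^bsub>uq C\<^esub> f' Z" "f' (uq_scale D c Y) = uq_scale C c (f' Y)"
      if "Y \<in> uq_plus D" "Z \<in> uq_plus D" for Y Z c
      using f' that by (simp_all add: uq_linear_on_def)
    have "\<exists>X\<in>uq_plus D. D.val X = x \<and> C.val (f' X) = g x" if "x \<in> uqt.lspan (D.val ` folded_monomial ` ?M)" for x
      using that
    proof induction
      case zero
      \<comment> \<open>The zero of \<open>uq_plus D\<close> is written as 0 times a monomial, so
        that linearity of \<open>f'\<close> applies to it.\<close>
      let ?Z = "uq_scale D 0 (folded_monomial (replicate (length rs) 0))"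
      have m: "folded_monomial (replicate (length rs) 0) \<in> uq_plus D" by (rule folded_monomial_plus) simp
      show ?case by (rule bexI[of _ ?Z]) (use m g(2)[of 0 0] in \<open>simp_all add: Dp carr C' D.val_ops C.val_ops lin\<close>)
    next
      case (add x y c)
      then obtain as X where as: "length as = length rs" "x = D.val (folded_monomial as)"
        and X: "X \<in> uq_plus D" "D.val X = y" "C.val (f' X) = g y" by blast
      let ?m = "folded_monomial as"
      have m: "?m \<in> uq_plus D" "f' ?m = hat_monomial as" using folded_monomial_plus[OF as(1)] f' as(1) by auto
      have "C.val (f' (uq_scale D c ?m \<oplus>\<^bsub>uq D\<^esub> X)) = g (uscale c x + y)"
        using m X C'[OF m(1)] by (simp add: lin Dp C' C.uq_closed C.val_ops g(1,2) g(3) as)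
      moreover have "D.val (uq_scale D c ?m \<oplus>\<^bsub>uq D\<^esub> X) = uscale c x + y"
        using m X by (simp add: carr D.uq_closed D.val_ops as)
      ultimately show ?case using Dp(1)[OF Dp(2)[OF m(1) m(1)] X(1)] by blast
    qed
    moreover have "D.val X \<in> D.u.Up" using X D.val_uq_plus by auto
    ultimately obtain X' where "X' \<in> uq_plus D" "D.val X' = D.val X" "C.val (f' X') = g (D.val X)"
      using folded_monomial_spanning by blast
    thus ?thesis using D.val_inj[of X' X] X carr(1) by auto
  qed
  have "quantum_folding C D rs = f" unfolding quantum_folding_def
  proof (rule the_equality[where P = ?P])
    show "?P f" by (rule Pf)
    fix f' assume f': "?P f'"
    show "f' = f"
    proof (rule PiE_ext)
      show "f' \<in> uq_plus D \<rightarrow>\<^sub>E uq_plus C" "f \<in> uq_plus D \<rightarrow>\<^sub>E uq_plus C" using f' Pf by blast+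
      fix X assume X: "X \<in> uq_plus D"
      hence "f' X \<in> uq_plus C" using f' by blast
      thus "f' X = f X" by (rule plus_val_eqI) (use X f carr val[OF f'] in auto)
    qed
  qed
  thus ?thesis using f g(3) by (intro that[of g] g(1,2)) auto
qed

lemma quantum_folding_image:
  "quantum_folding C D rs ` uq_plus D \<subseteq> carrier (uq C)"
  "uqt.alg (C.val ` quantum_folding C D rs ` uq_plus D) = uqt.alg (hatX rs)"
proof -
  let ?H = "C.val ` hat_monomial ` {as. length as = length rs}"
  obtain g where g: "\<And>x y. g (x + y) = g x + g y" "\<And>c x. g (uscale c x) = uscale c (g x)"
    "\<And>as. length as = length rs ==> g (D.val (folded_monomial as)) = C.val (hat_monomial as)"
    "\<And>X. X \<in> uq_plus D ==> quantum_folding C D rs X \<in> uq_plus C \<and> C.val (quantum_folding C D rs X) = g (D.val X)"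
    using that by (rule quantum_folding_val)
  show "quantum_folding C D rs ` uq_plus D \<subseteq> carrier (uq C)" using g(4) C.uq_plus_carrier by blast
  have "uqt.alg (C.val ` quantum_folding C D rs ` uq_plus D) = uqt.alg ?H"
  proof (intro equalityI, unfold uqt.alg_subset_iff)
    show "C.val ` quantum_folding C D rs ` uq_plus D \<subseteq> uqt.alg ?H"
    proof (intro subsetI, elim imageE, clarify)
      fix X assume X: "X \<in> uq_plus D"
      hence "D.val X \<in> uqt.lspan (D.val ` folded_monomial ` {as. length as = length rs})"
        using D.val_uq_plus folded_monomial_spanning by blast
      hence "g (D.val X) \<in> uqt.alg ?H"
        by (rule uqt.lspan_linear_image[OF uqt.scaled_ring_axioms g(1,2), rotated]) (auto simp: g(3) intro: uqt.alg.gen)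
      thus "C.val (quantum_folding C D rs X) \<in> uqt.alg ?H" using g(4)[OF X] by simp
    qed
    show "?H \<subseteq> uqt.alg (C.val ` quantum_folding C D rs ` uq_plus D)"
    proof (intro subsetI, elim imageE, clarify)
      fix as :: "nat list" assume as: "length as = length rs"
      have "C.val (hat_monomial as) = C.val (quantum_folding C D rs (folded_monomial as))"
        using g(3)[OF as] g(4)[OF folded_monomial_plus[OF as]] by simp
      thus "C.val (hat_monomial as) \<in> uqt.alg (C.val ` quantum_folding C D rs ` uq_plus D)"
        using folded_monomial_plus[OF as] by (simp add: uqt.alg.gen)
    qed
  qed
  thus "uqt.alg (C.val ` quantum_folding C D rs ` uq_plus D) = uqt.alg (hatX rs)"
    by (simp only: alg_hat_monomials)
qed

end

lemma folding_subalgebras_eq: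
  assumes "longest_element D w" "reduced_decomposition D rs w" "reduced_decomposition D rs' w"
  shows "uq_subalgebra C (quantum_folding C D rs ` uq_plus D) = uq_subalgebra C (quantum_folding C D rs' ` uq_plus D)"
proof -
  note r = D.w.reduced_decompositionD[OF assms(2)] and r' = D.w.reduced_decompositionD[OF assms(3)]
  note i = quantum_folding_image[OF r(1) D.w.longest_neg[OF assms(1) r(2,1)]]
  note i' = quantum_folding_image[OF r'(1) D.w.longest_neg[OF assms(1) r'(2,1)]]
  have "D.w.braid_equiv rs rs'" by (rule D.w.matsumoto) (simp_all add: r r')
  hence "uqt.alg (hatX rs) = uqt.alg (hatX rs')" by (rule alg_hatX_braid_equiv)
  thus ?thesis using i i' by (intro C.uq_subalgebra_eqI) simp_all
qed

end

lemma uq_subalgebras_iso_refl: "uq_subalgebras_iso C A A"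
  unfolding uq_subalgebras_iso_def
  by (rule bexI[of _ "\<lambda>x. x"]) (auto simp: uq_linear_on_def ring_iso_def ring_hom_def bij_betw_def)

theorem theorem1p20:
  fixes I :: "'i set" and a :: "'i \<Rightarrow> 'i \<Rightarrow> int" and \<sigma> :: "'i \<Rightarrow> 'i"
    and w\<^sub>0 :: "('i set \<Rightarrow> int) \<Rightarrow> ('i set \<Rightarrow> int)"
    and rs rs' :: "'i set list"
  assumes "semisimple_cartan_matrix I a" and "simply_laced I a"
    and "diagram_automorphism I a \<sigma>" and "admissible_automorphism I a \<sigma>" and "has_order_on I \<sigma> 2"
    and "longest_element (folded_datum I a \<sigma>) w\<^sub>0"
    and "reduced_decomposition (folded_datum I a \<sigma>) rs w\<^sub>0"
    and "reduced_decomposition (folded_datum I a \<sigma>) rs' w\<^sub>0"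
  defines "C \<equiv> simply_laced_datum I a" and "D \<equiv> folded_datum I a \<sigma>"
  shows "uq_subalgebras_iso C
           (uq_subalgebra C (quantum_folding C D rs ` uq_plus D))
           (uq_subalgebra C (quantum_folding C D rs' ` uq_plus D))"
proof -
  interpret folding I a \<sigma> by unfold_locales (fact assms)+
  show ?thesis unfolding C_def D_def folding_subalgebras_eq[OF assms(6-8)] by (rule uq_subalgebras_iso_refl)
qed

end
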